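(* Let $\nu$ be a partition and $n$ a positive integer. Then \[ \omega\Big(\Delta'_{s_{\nu}}e_n\Big|_{t=0}\Big)[X(1-q)] = q^{|\nu| } \sum_{\mu\vdash n} s_\nu\Big[\tfrac{1-q^{\ell(\mu)-1}}{1-q}\Big]\, q^{-n(\mu)}\, (q;q)_{\ell(\mu) }\, P_\mu[X;q^{-1}]. \]
   Context: Plethystic notation is used: for a symmetric function $F$ and a formal expression $A$, $F[A]$ is the plethystic substitution of $A$ into $F$; in particular $s_\nu\big[\frac{1-q^{r}}{1-q}\big]=s_\nu(1,q,\dots,q^{r-1})$. For a partition $\mu$, $\ell(\mu)$ is its number of parts, $n(\mu)=\sum_i (i-1)\mu_i$, and $(q;q)_a=\prod_{i=1}^a(1-q^i)$. $\tilde H_\mu[X;q,t]$ denotes the modified Macdonald polynomial, and $B_\mu(q,t)=\sum_{c\in\mu}q^{a'(c)}t^{l'(c)}$ where for a cell $c$ of the Young diagram of $\mu$, $a'(c)$ and $l'(c)$ are the numbers of cells strictly to its left in its row and strictly below it in its column. For a symmetric function $F$, $\Delta'_F$ is the linear operator on symmetric functions (over $\mathbb{Q}(q,t)$) defined by $\Delta'_F\tilde H_\mu[X;q,t]=F[B_\mu(q,t)-1]\,\tilde H_\mu[X;q,t]$ for all $\mu$. $e_n$ is the elementary symmetric function, $s_\nu$ the Schur function, and $\omega$ the involution with $\omega(s_\lambda)=s_{\lambda'}$; $\omega(G)[X(1-q)]$ means apply $\omega$ and then substitute $X\mapsto X(1-q)$ plethystically. $P_\mu[X;q]$ is the Hall–Littlewood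 polynomial (Macdonald's $P_\mu(x;t)$ with $t$ replaced by $q$), and $P_\mu[X;q^{-1}]$ is the same with $q$ replaced by $q^{-1}$. *)

theory Defs
  imports
    "HOL-Library.Poly_Mapping"
    "HOL-Library.Multiset"
    "HOL-Combinatorics.Permutations"
    "HOL-Computational_Algebra.Fraction_Field"
    "HOL-Computational_Algebra.Polynomial"
    "Jordan_Normal_Form.Determinant"
begin

subsection \<open>Partitions\<close>

definition is_partition :: "nat list \<Rightarrow> bool" where
  "is_partition \<mu> \<longleftrightarrow> sorted_wrt (\<ge>) \<mu> \<and> (\<forall>k\<in>set \<mu>. 0 < k)"

definition partitions_of :: "nat \<Rightarrow> nat list set" where
  "partitions_of n = {\<mu>. is_partition \<mu> \<and> sum_list \<mu> = n}"

definition part :: "nat list \<Rightarrow> nat \<Rightarrow> nat" where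
  "part \<mu> i = (if i < length \<mu> then \<mu> ! i else 0)"

definition conj_partition :: "nat list \<Rightarrow> nat list" where
  "conj_partition \<mu> = map (\<lambda>j. length (filter (\<lambda>k. j < k) \<mu>)) [0..<part \<mu> 0]"

text \<open>The cell \<open>(i, j)\<close> lies in row \<open>i\<close> and column \<open>j\<close>, both counted from \<open>0\<close>, with row \<open>0\<close>
  (the longest) at the bottom; so its coarm is \<open>j\<close> and its coleg is \<open>i\<close>.\<close>

definition cells :: "nat list \<Rightarrow> (nat \<times> nat) set" where
  "cells \<mu> = {(i, j). i < length \<mu> \<and> j < \<mu> ! i}"

definition arm :: "nat list \<Rightarrow> nat \<times> nat \<Rightarrow> nat" where
  "arm \<mu> c = part \<mu> (fst c) - snd c - 1"

definition leg :: "nat list \<Rightarrow> nat \<times> nat \<Rightarrow> nat" where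
  "leg \<mu> c = part (conj_partition \<mu>) (snd c) - fst c - 1"

definition n_stat :: "nat list \<Rightarrow> nat" where
  "n_stat \<mu> = (\<Sum>i<length \<mu>. i * \<mu> ! i)"

definition dominated :: "nat list \<Rightarrow> nat list \<Rightarrow> bool" where
  "dominated \<mu> \<rho> \<longleftrightarrow> is_partition \<mu> \<and> is_partition \<rho> \<and> sum_list \<mu> = sum_list \<rho> \<and>
     (\<forall>k. sum_list (take k \<mu>) \<le> sum_list (take k \<rho>))"

definition strictly_below :: "nat list \<Rightarrow> nat list set" where
  "strictly_below \<rho> = {\<mu>. dominated \<mu> \<rho> \<and> \<mu> \<noteq> \<rho>}"


subsection \<open>Symmetric functions\<close>

text \<open>The ring of symmetric functions over a field \<open>'k\<close> of characteristic \<open>0\<close> is the polynomial ring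
  \<open>'k[p\<^sub>1, p\<^sub>2, \<dots>]\<close>. To exclude a variable \<open>p\<^sub>0\<close> the indices are shifted: the multiset
  \<open>{#i\<^sub>1, \<dots>, i\<^sub>r#}\<close> stands for the monomial \<open>p\<^bsub>i\<^sub>1+1\<^esub> \<cdots> p\<^bsub>i\<^sub>r+1\<^esub>\<close>.\<close>

type_synonym 'k symf = "nat multiset \<Rightarrow>\<^sub>0 'k"

type_synonym 'k xpoly = "(nat \<Rightarrow>\<^sub>0 nat) \<Rightarrow>\<^sub>0 'k"

definition const :: "'k \<Rightarrow> 'm::zero \<Rightarrow>\<^sub>0 'k::zero" where
  "const c = Poly_Mapping.single 0 c"

definition smul :: "'k::comm_ring_1 \<Rightarrow> 'k symf \<Rightarrow> 'k symf" where
  "smul c F = const c * F"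

definition psum :: "nat \<Rightarrow> 'k::comm_ring_1 symf" where
  "psum k = Poly_Mapping.single {#k - 1#} 1"

text \<open>Plethystic substitution \<open>F[A]\<close>: the ring homomorphism given by \<open>\<iota>\<close> on scalars and by
  \<open>p\<^sub>k \<mapsto> a k\<close> for \<open>k \<ge> 1\<close>. The formal expression \<open>A\<close> enters through its power sums \<open>a k = p\<^sub>k[A]\<close>,
  obtained by raising all indeterminates of \<open>A\<close> to the \<open>k\<close>-th power.\<close>

definition pleth :: "('k::zero \<Rightarrow> 'r) \<Rightarrow> (nat \<Rightarrow> 'r::comm_ring_1) \<Rightarrow> 'k symf \<Rightarrow> 'r" where
  "pleth \<iota> a F =
     (\<Sum>M\<in>Poly_Mapping.keys F. \<iota> (Poly_Mapping.lookup F M) * (\<Prod>i\<in>#M. a (Suc i)))"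

definition xvar :: "nat \<Rightarrow> 'k::comm_ring_1 xpoly" where
  "xvar i = Poly_Mapping.single (Poly_Mapping.single i 1) 1"

text \<open>\<open>F(x\<^sub>0, \<dots>, x\<^bsub>N-1\<^esub>)\<close>.\<close>

definition in_vars :: "nat \<Rightarrow> 'k::comm_ring_1 symf \<Rightarrow> 'k xpoly" where
  "in_vars N F = pleth const (\<lambda>k. \<Sum>i<N. xvar i ^ k) F"

text \<open>The images in \<open>N\<close> variables, for all \<open>N\<close>, determine a symmetric function.\<close>

definition mono_symf :: "nat list \<Rightarrow> 'k::field_char_0 symf" where
  "mono_symf \<rho> = (THE F. \<forall>N. in_vars N F =
     (\<Sum>\<alpha> | Poly_Mapping.keys \<alpha> \<subseteq> {..<N} \<and>
        image_mset (Poly_Mapping.lookup \<alpha>) (mset_set (Poly_Mapping.keys \<alpha>)) = mset \<rho>.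
      Poly_Mapping.single \<alpha> 1))"

definition elem_symf :: "nat \<Rightarrow> 'k::field_char_0 symf" where
  "elem_symf n = mono_symf (replicate n 1)"

definition complete_symf :: "int \<Rightarrow> 'k::field_char_0 symf" where
  "complete_symf r = (if r < 0 then 0 else \<Sum>\<mu>\<in>partitions_of (nat r). mono_symf \<mu>)"

definition schur :: "nat list \<Rightarrow> 'k::field_char_0 symf" where
  "schur \<rho> = det (mat (length \<rho>) (length \<rho>)
     (\<lambda>(i, j). complete_symf (int (\<rho> ! i) - int i + int j)))"

definition omega :: "'k::field_char_0 symf \<Rightarrow> 'k symf" where
  "omega = (THE f. Vector_Spaces.linear smul smul f \<and>
     (\<forall>\<rho>. is_partition \<rho> \<longrightarrow> f (schur \<rho>) = schur (conj_partition \<rho>)))"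


subsection \<open>Hall--Littlewood polynomials\<close>

definition hl_v :: "'k::field \<Rightarrow> nat \<Rightarrow> 'k" where
  "hl_v t m = (\<Prod>i = 1..m. (1 - t ^ i) / (1 - t))"

text \<open>\<open>v\<^sub>\<rho>(t)\<close> for \<open>\<rho>\<close> regarded as a sequence of length \<open>N\<close>, zeros included.\<close>

definition hl_v_part :: "'k::field \<Rightarrow> nat \<Rightarrow> nat list \<Rightarrow> 'k" where
  "hl_v_part t N \<rho> = hl_v t (N - length \<rho>) * (\<Prod>k\<in>set \<rho>. hl_v t (count (mset \<rho>) k))"

text \<open>In \<open>N \<ge> \<ell>(\<rho>)\<close> variables,
  \<open>P\<^sub>\<rho>(x; t) = v\<^sub>\<rho>(t)\<^sup>-\<^sup>1 \<Sum>\<^sub>w w(x\<^sup>\<rho> \<Prod>\<^bsub>i<j\<^esub> (x\<^sub>i - t x\<^sub>j) / (x\<^sub>i - x\<^sub>j))\<close>, the sum being over the symmetric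
  group. Denominators are cleared: \<open>w\<close> multiplies \<open>\<Prod>\<^bsub>i<j\<^esub> (x\<^sub>i - x\<^sub>j)\<close> by its sign.\<close>

definition hall_littlewood :: "'k::field_char_0 \<Rightarrow> nat list \<Rightarrow> 'k symf" where
  "hall_littlewood t \<rho> = (THE F. \<forall>N\<ge>length \<rho>.
     const (hl_v_part t N \<rho>) * (\<Prod>(i, j)\<in>{(i, j). i < j \<and> j < N}. xvar i - xvar j) * in_vars N F =
     (\<Sum>w | w permutes {..<N}. of_int (sign w) * (\<Prod>i<N. xvar (w i) ^ part \<rho> i) *
        (\<Prod>(i, j)\<in>{(i, j). i < j \<and> j < N}. xvar (w i) - const t * xvar (w j))))"


subsection \<open>Macdonald polynomials\<close>

text \<open>\<open>z\<^sub>\<rho>\<close>, with the index shift of \<open>symf\<close>.\<close>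

definition z_coeff :: "nat multiset \<Rightarrow> nat" where
  "z_coeff M = (\<Prod>i\<in>set_mset M. Suc i ^ count M i * fact (count M i))"

text \<open>\<open>\<langle>p\<^sub>\<rho>, p\<^sub>\<mu>\<rangle> = \<delta>\<^bsub>\<rho>\<mu>\<^esub> z\<^sub>\<rho> \<Prod>\<^sub>i (1 - q\<^bsup>\<rho>\<^sub>i\<^esup>) / (1 - t\<^bsup>\<rho>\<^sub>i\<^esup>)\<close>\<close>

definition qt_form :: "'k::field_char_0 \<Rightarrow> 'k \<Rightarrow> 'k symf \<Rightarrow> 'k symf \<Rightarrow> 'k" where
  "qt_form q t F G = (\<Sum>M\<in>Poly_Mapping.keys F.
     Poly_Mapping.lookup F M * Poly_Mapping.lookup G M *
     of_nat (z_coeff M) * (\<Prod>i\<in>#M. (1 - q ^ Suc i) / (1 - t ^ Suc i)))"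

text \<open>\<open>P\<^sub>\<rho>(q, t) = m\<^sub>\<rho> +\<close> (terms strictly lower in dominance order), orthogonal to all \<open>m\<^sub>\<mu>\<close> with
  \<open>\<mu> < \<rho>\<close>. This determines \<open>P\<^sub>\<rho>\<close>; that \<open>P\<^sub>\<rho>\<close> and \<open>P\<^sub>\<mu>\<close> are orthogonal also for incomparable \<open>\<rho>\<close>
  and \<open>\<mu>\<close> is Macdonald's theorem.\<close>

definition macdonald_P :: "'k::field_char_0 \<Rightarrow> 'k \<Rightarrow> nat list \<Rightarrow> 'k symf" where
  "macdonald_P q t \<rho> = (THE F.
     F - mono_symf \<rho> \<in> module.span smul (mono_symf ` strictly_below \<rho>) \<and>
     (\<forall>\<mu>\<in>strictly_below \<rho>. qt_form q t F (mono_symf \<mu>) = 0))"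

definition macdonald_J :: "'k::field_char_0 \<Rightarrow> 'k \<Rightarrow> nat list \<Rightarrow> 'k symf" where
  "macdonald_J q t \<rho> =
     smul (\<Prod>c\<in>cells \<rho>. 1 - q ^ arm \<rho> c * t ^ Suc (leg \<rho> c)) (macdonald_P q t \<rho>)"

text \<open>\<open>H\<^sub>\<mu>[X; q, t] = t\<^bsup>n(\<mu>)\<^esup> J\<^sub>\<mu>[X / (1 - t\<^sup>-\<^sup>1); q, t\<^sup>-\<^sup>1]\<close>\<close>

definition modified_macdonald :: "'k::field_char_0 \<Rightarrow> 'k \<Rightarrow> nat list \<Rightarrow> 'k symf" where
  "modified_macdonald q t \<mu> = smul (t ^ n_stat \<mu>)
     (pleth const (\<lambda>k. smul (1 / (1 - inverse t ^ k)) (psum k)) (macdonald_J q (inverse t) \<mu>))"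


subsection \<open>The fields \<open>\<rat>(q)\<close> and \<open>\<rat>(q,t) = \<rat>(q)(t)\<close>, and delta operators\<close>

type_synonym Qq = "rat poly fract"
type_synonym Qqt = "Qq poly fract"

definition q1 :: Qq where "q1 = Fract [:0, 1:] 1"
definition q2 :: Qqt where "q2 = Fract [:q1:] 1"
definition t2 :: Qqt where "t2 = Fract [:0, 1:] 1"

text \<open>Evaluation at \<open>t = 0\<close>; unspecified on rational functions with a pole there.\<close>

definition at_t0 :: "Qqt \<Rightarrow> Qq" where
  "at_t0 x = (THE y. \<exists>a b. poly b 0 \<noteq> 0 \<and> x = Fract a b \<and> y = poly a 0 / poly b 0)"

definition symf_at_t0 :: "Qqt symf \<Rightarrow> Qq symf" where
  "symf_at_t0 F = Poly_Mapping.map at_t0 F"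

text \<open>\<open>p\<^sub>k[B\<^sub>\<mu>(q, t)]\<close>\<close>

definition B_psum :: "nat list \<Rightarrow> nat \<Rightarrow> Qqt" where
  "B_psum \<mu> k = (\<Sum>(i, j)\<in>cells \<mu>. (q2 ^ j * t2 ^ i) ^ k)"

definition Delta' :: "Qqt symf \<Rightarrow> Qqt symf \<Rightarrow> Qqt symf" where
  "Delta' F = (THE D. Vector_Spaces.linear smul smul D \<and>
     (\<forall>\<mu>. is_partition \<mu> \<longrightarrow> D (modified_macdonald q2 t2 \<mu>) =
        smul (pleth (\<lambda>c. c) (\<lambda>k. B_psum \<mu> k - 1) F) (modified_macdonald q2 t2 \<mu>)))"

text \<open>\<open>G[X(1 - q)]\<close>\<close>

definition X_times_1_minus_q :: "Qq symf \<Rightarrow> Qq symf" where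
  "X_times_1_minus_q G = pleth const (\<lambda>k. smul (1 - q1 ^ k) (psum k)) G"

text \<open>\<open>F[(1 - q\<^sup>r) / (1 - q)]\<close>\<close>

definition at_q_bracket :: "nat \<Rightarrow> Qq symf \<Rightarrow> Qq" where
  "at_q_bracket r F = pleth (\<lambda>c. c) (\<lambda>k. (1 - (q1 ^ k) ^ r) / (1 - q1 ^ k)) F"

definition q_pochhammer :: "nat \<Rightarrow> Qq" where
  "q_pochhammer a = (\<Prod>i = 1..a. 1 - q1 ^ i)"

end

theory Submission
  imports Defs
    "HOL-Computational_Algebra.Polynomial_FPS"
    "HOL-Combinatorics.Multiset_Permutations"
    "Jordan_Normal_Form.Char_Poly"
begin

text \<open>
  After clearing scalars, the modified Macdonald polynomials are \<open>P\<^sub>\<mu>(q, t\<^sup>-\<^sup>1)[-X / (1 - t)]\<close>, and they are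
  regular at \<open>t = 0\<close> with a basis as their value there: up to scalars the form defining \<open>P\<^sub>\<mu>\<close> is
  the one with parameters \<open>(q\<^sup>-\<^sup>1, t)\<close>, for which at \<open>t = 0\<close> the functions
  \<open>W\<^sub>\<mu> = \<omega> Q\<^bsub>\<mu>'\<^esub>[X / (1 - q\<^sup>-\<^sup>1); q\<^sup>-\<^sup>1]\<close> are already orthogonal and unitriangular in the monomial basis,
  so that Gram--Schmidt changes \<open>W\<^sub>\<mu>\<close> only by terms vanishing at \<open>t = 0\<close>. Hence
  \<open>\<Delta>'\<^sub>F e\<^sub>n\<close> at \<open>t = 0\<close> is obtained from the expansion of \<open>e\<^sub>n\<close> in the \<open>W\<^sub>\<mu>[-X]\<close> by
  multiplying the coefficient of \<open>W\<^sub>\<mu>[-X]\<close> with \<open>F[q + \<dots> + q\<^bsup>\<mu>\<^sub>1 - 1\<^esup>]\<close>. Applying \<open>\<omega>\<close> and \<open>X \<mapsto> X(1 - q)\<close>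
  turns \<open>W\<^sub>\<mu>[-X]\<close> into a multiple of \<open>P\<^bsub>\<mu>'\<^esub>[X; q\<^sup>-\<^sup>1]\<close>, and \<open>e\<^sub>n\<close> into \<open>h\<^sub>n[X(1 - q)]\<close>,
  whose Hall--Littlewood expansion is given by principal specialization.

  The triangularity and the duality of the Hall--Littlewood functions come from comparing two descriptions:
  vertex operators show that they are upper triangular in products of complete functions, and the
  antisymmetrized sum shows, by degree considerations, that they are lower triangular in monomials.
\<close>

section \<open>Symmetric functions in power sums: plethysm, the Hall form and dual bases\<close>

section \<open>Evaluation homomorphisms of monoid algebras\<close>

text \<open>The monomial, Hall-Littlewood and Macdonald functions, omega and the delta operators are
  given by definite descriptions, so each has first to be shown to exist and to be unique. Power
  sums are the working basis because every plethysm of the argument is diagonal in them. The form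
  with parameters (q, 1/t) vanishes at t = 0 in positive degree; in degree n it is (q t)^n times the
  form with parameters (1/q, t), which has the same orthogonal vectors and a useful limit. Since
  \<open>macdonald_P\<close> is specified by orthogonality to lower monomial functions only, the
  coefficients of e_n are not read off by pairing with the P_mu. They come from inverting a
  triangular matrix that is the identity at t = 0, and are therefore regular there. At t = 0 only
  the bottom row of mu is left in B_mu; its length is the number of parts of the conjugate, whence
  the bracket in the formula. The normalization of W_mu and the coefficient of e_n enter only
  through a product, which is found by comparison with the expansion of h_n[X(1-q)].\<close>

lemma poly_mapping_additive_induct [case_names single add]:
  fixes f :: "'m \<Rightarrow>\<^sub>0 'k::comm_monoid_add"
  assumes single: "\<And>k c. P (Poly_Mapping.single k c)"
    and add: "\<And>f g. P f \<Longrightarrow> P g \<Longrightarrow> P (f + g)"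
  shows "P f"
proof (induction f rule: update_induct)
  case const
  show ?case using single[of undefined 0] by simp
next
  case (update f a b)
  have "Poly_Mapping.update a b f = f + Poly_Mapping.single a b"
    using update(1) by (intro poly_mapping_eqI)
      (auto simp: lookup_update lookup_add lookup_single when_def in_keys_iff)
  then show ?case using add[OF update(3) single] by simp
qed

text \<open>Common shape of three later maps: \<open>pleth\<close> and \<open>grade\<close> are ring
  homomorphisms of this kind, whereas \<open>pperp\<close> is merely additive, so multiplicativity
  of \<open>\<phi>\<close> is left to the lemmas.\<close>

definition pm_eval :: "('k::zero \<Rightarrow> 'r) \<Rightarrow> ('m \<Rightarrow> 'r) \<Rightarrow> ('m \<Rightarrow>\<^sub>0 'k) \<Rightarrow> 'r::comm_ring_1" where
  "pm_eval \<iota> \<phi> f = (\<Sum>k\<in>Poly_Mapping.keys f. \<iota> (Poly_Mapping.lookup f k) * \<phi> k)"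

lemma pm_eval_superset:
  assumes "finite S" "Poly_Mapping.keys f \<subseteq> S" "\<iota> 0 = 0"
  shows "pm_eval \<iota> \<phi> f = (\<Sum>k\<in>S. \<iota> (Poly_Mapping.lookup f k) * \<phi> k)"
  unfolding pm_eval_def by (rule sum.mono_neutral_left) (use assms in \<open>auto simp: in_keys_iff\<close>)

lemma pm_eval_single: "\<iota> 0 = 0 \<Longrightarrow> pm_eval \<iota> \<phi> (Poly_Mapping.single k c) = \<iota> c * \<phi> k"
  by (subst pm_eval_superset[of "{k}"]) auto

lemma pm_eval_add:
  fixes f g :: "'m \<Rightarrow>\<^sub>0 'k::comm_monoid_add"
  assumes "\<iota> 0 = 0" "\<And>a b. \<iota> (a + b) = \<iota> a + \<iota> b"
  shows "pm_eval \<iota> \<phi> (f + g) = pm_eval \<iota> \<phi> f + pm_eval \<iota> \<phi> g"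
proof -
  \<comment> \<open>Terms of \<open>f + g\<close> may cancel, so the three sums are first spread
    over one common finite index set.\<close>
  let ?S = "Poly_Mapping.keys f \<union> Poly_Mapping.keys g"
  have "pm_eval \<iota> \<phi> h = (\<Sum>k\<in>?S. \<iota> (Poly_Mapping.lookup h k) * \<phi> k)" if "h \<in> {f, g, f + g}" for h
    by (rule pm_eval_superset) (use that assms(1) keys_add[of f g] in auto)
  then show ?thesis
    by (simp add: lookup_add assms(2) distrib_right sum.distrib)
qed

lemma comm_ring_hom_pm_eval:
  fixes \<iota> :: "'k::comm_ring_1 \<Rightarrow> 'r::comm_ring_1" and \<phi> :: "'m::comm_monoid_add \<Rightarrow> 'r"
  assumes "comm_ring_hom \<iota>" "\<phi> 0 = 1" "\<And>a b. \<phi> (a + b) = \<phi> a * \<phi> b"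
  shows "comm_ring_hom (pm_eval \<iota> \<phi>)"
proof -
  interpret \<iota>: comm_ring_hom \<iota> by fact
  note add = pm_eval_add[where \<iota> = \<iota>, OF \<iota>.hom_zero \<iota>.hom_add]
  note single = pm_eval_single[where \<iota> = \<iota>, OF \<iota>.hom_zero]
  have mult_single: "pm_eval \<iota> \<phi> (Poly_Mapping.single a c * g) = \<iota> c * \<phi> a * pm_eval \<iota> \<phi> g" for a c g
    by (induction g rule: poly_mapping_additive_induct)
      (simp_all add: mult_single single add assms(3) \<iota>.hom_mult algebra_simps)
  have mult: "pm_eval \<iota> \<phi> (f * g) = pm_eval \<iota> \<phi> f * pm_eval \<iota> \<phi> g" for f g
    by (induction f rule: poly_mapping_additive_induct)
      (simp_all add: mult_single single add distrib_right)
  show ?thesis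
  proof
    show "pm_eval \<iota> \<phi> 1 = 1"
      using single[of \<phi> 0 1] by (simp add: assms(2))
    show "pm_eval \<iota> \<phi> 0 = 0" by (simp add: pm_eval_def)
  qed (simp_all add: add mult)
qed

lemma pleth_conv_pm_eval: "pleth \<iota> a = pm_eval \<iota> (\<lambda>M. \<Prod>i\<in>#M. a (Suc i))"
  by (rule ext) (simp add: pleth_def pm_eval_def)

lemma comm_ring_hom_pleth: "comm_ring_hom \<iota> \<Longrightarrow> comm_ring_hom (pleth \<iota> a)"
  unfolding pleth_conv_pm_eval by (rule comm_ring_hom_pm_eval) auto

lemma const_one [simp]: "const 1 = 1"
  by (simp add: const_def)

lemma const_zero [simp]: "const 0 = 0"
  by (simp add: const_def)

lemma comm_ring_hom_const: "comm_ring_hom (const :: 'k::comm_ring_1 \<Rightarrow> 'm::comm_monoid_add \<Rightarrow>\<^sub>0 'k)"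
  by unfold_locales (simp_all add: const_def single_add mult_single)

lemma comm_ring_homD:
  assumes "comm_ring_hom f"
  shows "f 0 = 0" "f 1 = 1" "f (a + b) = f a + f b" "f (a * b) = f a * f b" "f (- a) = - f a"
    "f (a - b) = f a - f b" "f (a ^ n) = f a ^ n" "f (of_nat n) = of_nat n" "f (of_int i) = of_int i"
    "f (sum g A) = (\<Sum>x\<in>A. f (g x))" "f (prod g A) = (\<Prod>x\<in>A. f (g x))"
    "f (prod_list xs) = prod_list (map f xs)" "f (prod_mset X) = prod_mset (image_mset f X)"
proof -
  interpret comm_ring_hom f by fact
  show "f 0 = 0" "f 1 = 1" "f (a + b) = f a + f b" "f (a * b) = f a * f b" "f (- a) = - f a"
    "f (a - b) = f a - f b" "f (a ^ n) = f a ^ n" "f (of_nat n) = of_nat n" "f (of_int i) = of_int i"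
    "f (sum g A) = (\<Sum>x\<in>A. f (g x))" "f (prod g A) = (\<Prod>x\<in>A. f (g x))"
    by (simp_all add: hom_distribs)
  show "f (prod_list xs) = prod_list (map f xs)" by (induction xs) (simp_all add: hom_distribs)
  show "f (prod_mset X) = prod_mset (image_mset f X)" by (induction X) (simp_all add: hom_distribs)
qed

lemma comm_ring_homI:
  "f 0 = 0 \<Longrightarrow> f 1 = 1 \<Longrightarrow> (\<And>a b. f (a + b) = f a + f b) \<Longrightarrow> (\<And>a b. f (a * b) = f a * f b) \<Longrightarrow>
    comm_ring_hom f"
  by unfold_locales auto

lemma comm_ring_hom_id: "comm_ring_hom (\<lambda>x. x)"
  by (rule comm_ring_homI) auto

lemma comm_ring_hom_compose:
  "comm_ring_hom f \<Longrightarrow> comm_ring_hom g \<Longrightarrow> comm_ring_hom (\<lambda>x. f (g x))"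
  by (rule comm_ring_homI) (simp_all add: comm_ring_homD)

lemma single_multiset_eq:
  "Poly_Mapping.single M c = const c * (\<Prod>i\<in>#M. psum (Suc i))"
proof (induction M)
  case (add i M)
  have "Poly_Mapping.single (add_mset i M) c = Poly_Mapping.single {#i#} 1 * Poly_Mapping.single M c"
    by (simp add: mult_single)
  then show ?case using add by (simp add: psum_def mult_ac)
qed (simp add: const_def)

lemma pleth_const [simp]: "comm_ring_hom \<iota> \<Longrightarrow> pleth \<iota> a (const c) = \<iota> c"
  unfolding pleth_conv_pm_eval const_def
  by (subst pm_eval_single) (auto simp: comm_ring_homD)

lemma pleth_psum: "comm_ring_hom \<iota> \<Longrightarrow> k > 0 \<Longrightarrow> pleth \<iota> a (psum k) = a k"
  unfolding pleth_conv_pm_eval psum_def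
  by (subst pm_eval_single) (auto simp: comm_ring_homD)

text \<open>Universal property of the polynomial ring in the power sums: a homomorphism is fixed by
  its values on scalars and on the \<open>psum k\<close>. Compositions of plethysms are compared in
  this way.\<close>

lemma pleth_unique:
  assumes "comm_ring_hom f" "\<And>c. f (const c) = \<iota> c" "\<And>k. k > 0 \<Longrightarrow> f (psum k) = a k"
    and \<iota>: "comm_ring_hom \<iota>"
  shows "f F = pleth \<iota> a F"
proof -
  interpret f: comm_ring_hom f by fact
  interpret \<iota>: comm_ring_hom \<iota> by fact
  show ?thesis
  proof (induction F rule: poly_mapping_additive_induct)
    case (single M c)
    have "f (Poly_Mapping.single M c) = \<iota> c * (\<Prod>i\<in>#M. a (Suc i))"
      by (simp add: single_multiset_eq comm_ring_homD[OF assms(1)] assms(2,3) image_mset.compositionality comp_def)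
    also have "\<dots> = pleth \<iota> a (Poly_Mapping.single M c)"
      unfolding pleth_conv_pm_eval by (simp add: pm_eval_single)
    finally show ?case .
  next
    case (add F G)
    interpret p: comm_ring_hom "pleth \<iota> a" by (rule comm_ring_hom_pleth[OF \<iota>])
    show ?case using add by (simp add: f.hom_add p.hom_add)
  qed
qed

lemma pleth_compose:
  assumes "comm_ring_hom f" "comm_ring_hom \<iota>"
  shows "f (pleth \<iota> a F) = pleth (\<lambda>c. f (\<iota> c)) (\<lambda>k. f (a k)) F"
  by (rule pleth_unique[where f = "\<lambda>x. f (pleth \<iota> a x)"])
    (use assms in \<open>auto intro: comm_ring_hom_compose comm_ring_hom_pleth simp: pleth_psum\<close>)

lemma pleth_cong:
  "(\<And>c. \<iota> c = \<iota>' c) \<Longrightarrow> (\<And>k. k > 0 \<Longrightarrow> a k = b k) \<Longrightarrow> pleth \<iota> a F = pleth \<iota>' b F"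
  unfolding pleth_def by (intro sum.cong) (auto intro!: arg_cong[where f = prod_mset] image_mset_cong)

lemma lookup_const_times:
  "Poly_Mapping.lookup (const c * F) M = (c::'k::comm_ring_1) * Poly_Mapping.lookup F M"
  by (induction F rule: poly_mapping_additive_induct)
    (auto simp: const_def mult_single lookup_single when_def lookup_add distrib_left)

lemma lookup_smul: "Poly_Mapping.lookup (smul c F) M = c * Poly_Mapping.lookup F M"
  by (simp add: smul_def lookup_const_times)

global_interpretation symf: vector_space "smul :: 'k::field \<Rightarrow> 'k symf \<Rightarrow> 'k symf"
  by unfold_locales (auto intro!: poly_mapping_eqI simp: lookup_smul lookup_add algebra_simps)

global_interpretation symf_pair: vector_space_pair "smul :: 'k::field \<Rightarrow> 'k symf \<Rightarrow> 'k symf" smul ..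

lemma pleth_smul: "comm_ring_hom \<iota> \<Longrightarrow> pleth \<iota> a (smul c F) = \<iota> c * pleth \<iota> a F"
  by (simp add: smul_def comm_ring_homD[OF comm_ring_hom_pleth])

lemma smul_mult_left: "smul c F * G = smul c (F * G)"
  by (simp add: smul_def mult_ac)

lemma smul_mult_right: "F * smul c G = smul c (F * G)"
  by (simp add: smul_def mult_ac)

lemma smul_smul: "smul c (smul d F) = smul (c * d) F"
  by (rule poly_mapping_eqI) (simp add: lookup_smul mult_ac)

section \<open>Complete symmetric functions by Newton's recursion\<close>

text \<open>Newton's identity solved for \<open>h_n\<close>. \<open>complete_symf\<close> is a sum
  of monomial functions and so rests on a definite description; the two are identified in
  \<open>complete_symf_eq\<close>, once the monomial functions are known to exist.\<close>

fun hsym :: "nat \<Rightarrow> 'k::field_char_0 symf" where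
  "hsym n = (if n = 0 then 1
     else smul (1 / of_nat n) (\<Sum>k<n. psum (Suc k) * hsym (n - Suc k)))"

declare hsym.simps [simp del]

lemma hsym_0 [simp]: "hsym 0 = 1"
  by (simp add: hsym.simps)

lemma of_nat_eq_const: "of_nat n = (const (of_nat n) :: 'm::comm_monoid_add \<Rightarrow>\<^sub>0 'k::comm_ring_1)"
proof -
  interpret comm_ring_hom "const :: 'k \<Rightarrow> 'm \<Rightarrow>\<^sub>0 'k" by (rule comm_ring_hom_const)
  show ?thesis by (simp add: hom_of_nat)
qed

lemma hsym_newton:
  "of_nat n * hsym n = (\<Sum>k<n. psum (Suc k) * hsym (n - Suc k) :: 'k::field_char_0 symf)"
proof (cases "n = 0")
  case False
  then show ?thesis
    by (subst hsym.simps) (simp add: of_nat_eq_const smul_def[symmetric] smul_smul)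
qed simp

text \<open>The generating function \<open>f\<close> of the complete symmetric functions is characterised by
  \<open>f' = A f\<close>, where \<open>A\<close> is the generating function of the power sums \<open>a 1, a 2, \<dots>\<close>.\<close>

definition newton :: "(nat \<Rightarrow> 'r) \<Rightarrow> 'r::comm_ring_1 fps \<Rightarrow> bool" where
  "newton a f \<longleftrightarrow> fps_nth f 0 = 1 \<and> fps_deriv f = Abs_fps (\<lambda>k. a (Suc k)) * f"

lemma newtonD:
  "newton a f \<Longrightarrow> of_nat (Suc n) * fps_nth f (Suc n) = (\<Sum>k\<le>n. a (Suc k) * fps_nth f (n - k))"
  unfolding newton_def
  by (drule conjunct2, drule arg_cong[where f = "\<lambda>g. fps_nth g n"])
    (simp add: fps_mult_nth atLeast0AtMost)

lemma newtonI:
  assumes "fps_nth f 0 = 1"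
    "\<And>n. of_nat (Suc n) * fps_nth f (Suc n) = (\<Sum>k\<le>n. a (Suc k) * fps_nth f (n - k))"
  shows "newton a f"
  unfolding newton_def using assms
  by (auto intro!: fps_ext simp: fps_mult_nth atLeast0AtMost)

text \<open>Logarithmic derivatives add when series are multiplied.\<close>

lemma newton_mult:
  assumes "newton a f" "newton b g"
  shows "newton (\<lambda>k. a k + b k) (f * g)"
proof -
  have "Abs_fps (\<lambda>k. a (Suc k) + b (Suc k)) = Abs_fps (\<lambda>k. a (Suc k)) + Abs_fps (\<lambda>k. b (Suc k))"
    by (simp add: fps_eq_iff)
  with assms show ?thesis by (simp add: newton_def algebra_simps)
qed

lemma newton_one: "newton (\<lambda>_. 0) 1"
  by (auto simp: newton_def fps_eq_iff fps_mult_nth)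

lemma newton_geometric: "newton (\<lambda>k. z ^ k) (Abs_fps (\<lambda>n. z ^ n))"
  by (rule newtonI) (simp_all add: power_add[symmetric] flip: power_Suc)

lemma newton_linear: "newton (\<lambda>k. - (z ^ k)) (1 - fps_const z * fps_X)"
proof (rule newtonI)
  fix n
  let ?f = "1 - fps_const z * fps_X"
  show "of_nat (Suc n) * fps_nth ?f (Suc n) = (\<Sum>k\<le>n. - (z ^ Suc k) * fps_nth ?f (n - k))"
  proof (cases n)
    case (Suc m)
    \<comment> \<open>A linear polynomial has only the coefficients 0 and 1, so just
      \<open>k = m\<close> and \<open>k = n\<close> survive, and these two terms cancel.\<close>
    have "(\<Sum>k\<le>n. - (z ^ Suc k) * fps_nth ?f (n - k))
      = (\<Sum>k\<in>{m, n}. - (z ^ Suc k) * fps_nth ?f (n - k))"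
      by (rule sum.mono_neutral_right) (auto simp: Suc)
    then show ?thesis by (simp add: Suc)
  qed simp
qed simp

lemma newton_scale:
  assumes "newton a f"
  shows "newton (\<lambda>k. z ^ k * a k) (Abs_fps (\<lambda>n. z ^ n * fps_nth f n))"
proof (rule newtonI)
  fix n
  have "of_nat (Suc n) * (z ^ Suc n * fps_nth f (Suc n)) = z ^ Suc n * (\<Sum>k\<le>n. a (Suc k) * fps_nth f (n - k))"
    unfolding newtonD[OF assms, symmetric] by (simp add: mult_ac)
  also have "\<dots> = (\<Sum>k\<le>n. (z ^ Suc k * z ^ (n - k)) * (a (Suc k) * fps_nth f (n - k)))"
    by (simp add: sum_distrib_left power_add[symmetric] flip: power_Suc)
  finally show "of_nat (Suc n) * fps_nth (Abs_fps (\<lambda>n. z ^ n * fps_nth f n)) (Suc n)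
    = (\<Sum>k\<le>n. z ^ Suc k * a (Suc k) * fps_nth (Abs_fps (\<lambda>n. z ^ n * fps_nth f n)) (n - k))"
    by (simp add: mult_ac)
qed (use assms in \<open>simp add: newton_def\<close>)

text \<open>Generating function of the values \<open>h_n[A]\<close>, where \<open>A\<close> has
  power sums \<open>a k\<close>. It turns sums of alphabets into products of series
  (\<open>hser_add\<close>).\<close>

definition hser :: "('k::field_char_0 \<Rightarrow> 'r) \<Rightarrow> (nat \<Rightarrow> 'r) \<Rightarrow> 'r::comm_ring_1 fps" where
  "hser \<iota> a = Abs_fps (\<lambda>n. pleth \<iota> a (hsym n))"

lemma hser_nth [simp]: "fps_nth (hser \<iota> a) n = pleth \<iota> a (hsym n)"
  by (simp add: hser_def)

lemma newton_hser:
  assumes "comm_ring_hom \<iota>"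
  shows "newton a (hser \<iota> a)"
proof (rule newtonI)
  interpret p: comm_ring_hom "pleth \<iota> a" by (rule comm_ring_hom_pleth[OF assms])
  show "fps_nth (hser \<iota> a) 0 = 1" by (simp add: p.hom_one)
  fix n
  have "pleth \<iota> a (of_nat (Suc n) * hsym (Suc n)) =
    pleth \<iota> a (\<Sum>k<Suc n. psum (Suc k) * hsym (Suc n - Suc k))"
    by (simp only: hsym_newton)
  then show "of_nat (Suc n) * fps_nth (hser \<iota> a) (Suc n) = (\<Sum>k\<le>n. a (Suc k) * fps_nth (hser \<iota> a) (n - k))"
    unfolding p.hom_mult p.hom_sum p.hom_of_nat lessThan_Suc_atMost
    by (simp add: pleth_psum[OF assms])
qed

text \<open>The target rings, such as polynomials over \<open>symf\<close>, need not be fields;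
  positive integers can be cancelled in them because \<open>\<iota>\<close> carries their inverses
  over from a field of characteristic 0.\<close>

lemma of_nat_cancel_algebra:
  fixes \<iota> :: "'k::field_char_0 \<Rightarrow> 'r::comm_ring_1"
  assumes "comm_ring_hom \<iota>" "of_nat (Suc n) * x = of_nat (Suc n) * (y::'r)"
  shows "x = y"
proof -
  interpret comm_ring_hom \<iota> by fact
  have 1: "\<iota> (1 / of_nat (Suc n)) * of_nat (Suc n) = 1"
    unfolding hom_of_nat[symmetric] hom_mult[symmetric] by (simp del: of_nat_Suc add: hom_one)
  have "x = \<iota> (1 / of_nat (Suc n)) * of_nat (Suc n) * x" by (simp only: 1 mult_1_left)
  also have "\<dots> = \<iota> (1 / of_nat (Suc n)) * of_nat (Suc n) * y"
    using assms(2) by (simp only: mult.assoc)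
  finally show ?thesis by (simp only: 1 mult_1_left)
qed

text \<open>The differential equation with constant term 1 determines the coefficients one after the
  other, as soon as positive integers can be cancelled.\<close>

lemma newton_unique:
  fixes \<iota> :: "'k::field_char_0 \<Rightarrow> 'r::comm_ring_1"
  assumes \<iota>: "comm_ring_hom \<iota>" and fg: "newton a f" "newton b (g :: 'r fps)"
    and ab: "\<And>k. k > 0 \<Longrightarrow> a k = b k"
  shows "f = g"
proof (rule fps_ext)
  fix n show "fps_nth f n = fps_nth g n"
  proof (induction n rule: less_induct)
    case (less n)
    show ?case
    proof (cases n)
      case 0
      then show ?thesis using fg by (simp add: newton_def)
    next
      case (Suc m)
      have "of_nat (Suc m) * fps_nth f (Suc m) = of_nat (Suc m) * fps_nth g (Suc m)"
        unfolding newtonD[OF fg(1)] newtonD[OF fg(2)]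
        by (intro sum.cong) (auto simp: less Suc ab)
      then show ?thesis using of_nat_cancel_algebra[OF \<iota>] Suc by metis
    qed
  qed
qed

lemma hser_eqI:
  "comm_ring_hom \<iota> \<Longrightarrow> newton b g \<Longrightarrow> (\<And>k. k > 0 \<Longrightarrow> a k = b k) \<Longrightarrow> hser \<iota> a = g"
  using newton_unique newton_hser by blast

lemma hser_add:
  "comm_ring_hom \<iota> \<Longrightarrow> hser \<iota> (\<lambda>k. a k + b k) = hser \<iota> a * hser \<iota> b"
  by (rule hser_eqI) (auto intro: newton_mult newton_hser)

lemma pleth_hsym_add:
  "comm_ring_hom \<iota> \<Longrightarrow> pleth \<iota> (\<lambda>k. a k + b k) (hsym n) =
    (\<Sum>i\<le>n. pleth \<iota> a (hsym i) * pleth \<iota> b (hsym (n - i)))"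
  using arg_cong[OF hser_add[of \<iota> a b], of "\<lambda>f. fps_nth f n"]
  by (simp add: fps_mult_nth atLeast0AtMost)

lemma hser_zero: "comm_ring_hom \<iota> \<Longrightarrow> hser \<iota> (\<lambda>_. 0) = 1"
  by (rule hser_eqI) (auto intro: newton_one)

lemma hser_sum:
  "comm_ring_hom \<iota> \<Longrightarrow> hser \<iota> (\<lambda>k. \<Sum>i\<in>A. a i k) = (\<Prod>i\<in>A. hser \<iota> (a i))"
  by (induction A rule: infinite_finite_induct) (simp_all add: hser_zero hser_add)

lemma hser_geometric: "comm_ring_hom \<iota> \<Longrightarrow> hser \<iota> (\<lambda>k. z ^ k) = Abs_fps (\<lambda>n. z ^ n)"
  by (rule hser_eqI) (auto intro: newton_geometric)

lemma hser_linear: "comm_ring_hom \<iota> \<Longrightarrow> hser \<iota> (\<lambda>k. - (z ^ k)) = 1 - fps_const z * fps_X"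
  by (rule hser_eqI) (auto intro: newton_linear)

lemma pleth_hsym_scale:
  "comm_ring_hom \<iota> \<Longrightarrow> pleth \<iota> (\<lambda>k. z ^ k * a k) (hsym n) = z ^ n * pleth \<iota> a (hsym n)"
  using arg_cong[OF hser_eqI[OF _ newton_scale[OF newton_hser[of \<iota> a], of z]], of \<iota> "\<lambda>k. z ^ k * a k" "\<lambda>f. fps_nth f n"]
  by simp

section \<open>The Hall form\<close>

text \<open>Power sum monomials are orthogonal with norm \<open>z_coeff\<close>. The forms with
  parameters arise from this one by inserting a \<open>scale\<close>.\<close>

definition hall :: "'k::field_char_0 symf \<Rightarrow> 'k symf \<Rightarrow> 'k" where
  "hall F G = (\<Sum>M\<in>Poly_Mapping.keys F.
     Poly_Mapping.lookup F M * Poly_Mapping.lookup G M * of_nat (z_coeff M))"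

lemma hall_superset:
  assumes "finite S" "Poly_Mapping.keys F \<subseteq> S"
  shows "hall F G = (\<Sum>M\<in>S. Poly_Mapping.lookup F M * Poly_Mapping.lookup G M * of_nat (z_coeff M))"
  unfolding hall_def by (rule sum.mono_neutral_left) (use assms in \<open>auto simp: in_keys_iff\<close>)

lemma hall_commute: "hall F G = hall G F"
proof -
  let ?S = "Poly_Mapping.keys F \<union> Poly_Mapping.keys G"
  show ?thesis
    by (subst (1 2) hall_superset[of ?S]) (auto simp: mult_ac)
qed

lemma hall_add_left: "hall (F + G) E = hall F E + hall G E"
proof -
  let ?S = "Poly_Mapping.keys F \<union> Poly_Mapping.keys G"
  have "hall H E = (\<Sum>M\<in>?S. Poly_Mapping.lookup H M * Poly_Mapping.lookup E M * of_nat (z_coeff M))"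
    if "H \<in> {F, G, F + G}" for H
    by (rule hall_superset) (use that keys_add[of F G] in auto)
  then show ?thesis by (simp add: lookup_add distrib_right sum.distrib)
qed

lemma hall_add_right: "hall E (F + G) = hall E F + hall E G"
  by (simp add: hall_def lookup_add distrib_left distrib_right sum.distrib)

lemma hall_smul_right: "hall F (smul c G) = c * hall F G"
  by (simp add: hall_def lookup_smul sum_distrib_left mult_ac)

lemma hall_smul_left: "hall (smul c F) G = c * hall F G"
  by (metis hall_commute hall_smul_right)

lemma hall_zero [simp]: "hall 0 G = 0" "hall G 0 = 0"
  by (simp_all add: hall_def)

lemma hall_diff_left: "hall (F - G) E = hall F E - hall G E"
  using hall_add_left[of "F - G" G E] by simp

lemma hall_sum_left: "hall (\<Sum>i\<in>A. F i) G = (\<Sum>i\<in>A. hall (F i) G)"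
  by (induction A rule: infinite_finite_induct) (simp_all add: hall_add_left)

lemma hall_sum_right: "hall G (\<Sum>i\<in>A. F i) = (\<Sum>i\<in>A. hall G (F i))"
  by (induction A rule: infinite_finite_induct) (simp_all add: hall_add_right)

lemma hall_single_left:
  "hall (Poly_Mapping.single M c) G = c * Poly_Mapping.lookup G M * of_nat (z_coeff M)"
  by (subst hall_superset[of "{M}"]) auto

lemma subspace_hall_right: "symf.subspace {G. hall F G = 0}"
  by (auto simp: symf.subspace_def hall_add_right hall_smul_right)

definition mdeg :: "nat multiset \<Rightarrow> nat" where
  "mdeg M = (\<Sum>i\<in>#M. Suc i)"

lemma mdeg_add_mset [simp]: "mdeg (add_mset i M) = Suc i + mdeg M"
  by (simp add: mdeg_def)

lemma mdeg_empty [simp]: "mdeg {#} = 0"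
  by (simp add: mdeg_def)

lemma mdeg_plus [simp]: "mdeg (M + L) = mdeg M + mdeg L"
  by (simp add: mdeg_def)

definition homog :: "nat \<Rightarrow> 'k::zero symf \<Rightarrow> bool" where
  "homog n F \<longleftrightarrow> (\<forall>M. mdeg M \<noteq> n \<longrightarrow> Poly_Mapping.lookup F M = 0)"

lemma hall_homog_neq: "homog m F \<Longrightarrow> homog n G \<Longrightarrow> m \<noteq> n \<Longrightarrow> hall F G = 0"
  unfolding hall_def homog_def by (intro sum.neutral) auto

lemma homog_add: "homog n F \<Longrightarrow> homog n G \<Longrightarrow> homog n (F + G)"
  for F G :: "'k::comm_monoid_add symf"
  by (simp add: homog_def lookup_add)

lemma homog_smul: "homog n F \<Longrightarrow> homog n (smul c F)"
  by (simp add: homog_def lookup_smul)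

lemma homog_zero [simp]: "homog n 0"
  by (simp add: homog_def)

lemma homog_sum: "(\<And>i. i \<in> A \<Longrightarrow> homog n (F i)) \<Longrightarrow> homog n (\<Sum>i\<in>A. F i)"
  for F :: "'i \<Rightarrow> 'k::comm_monoid_add symf"
  by (induction A rule: infinite_finite_induct) (auto intro: homog_add)

lemma subspace_homog: "symf.subspace {F. homog n F}"
  by (auto simp: symf.subspace_def homog_add homog_smul)

lemma homog_single: "mdeg M = n \<Longrightarrow> homog n (Poly_Mapping.single M c)"
  by (auto simp: homog_def lookup_single when_def)

lemma homog_mult:
  fixes F G :: "'k::comm_ring_1 symf"
  assumes "homog m F" "homog n G"
  shows "homog (m + n) (F * G)"
  unfolding homog_def
proof (intro allI impI, rule ccontr)
  fix M assume M: "mdeg M \<noteq> m + n" "Poly_Mapping.lookup (F * G) M \<noteq> 0"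
  then have "M \<in> Poly_Mapping.keys (F * G)" by (simp add: in_keys_iff)
  then obtain A B where "M = A + B" "A \<in> Poly_Mapping.keys F" "B \<in> Poly_Mapping.keys G"
    using keys_mult[of F G] by blast
  then show False using assms M by (auto simp: homog_def in_keys_iff)
qed

lemma homog_psum: "k > 0 \<Longrightarrow> homog k (psum k)"
  unfolding psum_def by (rule homog_single) simp

lemma homog_one: "homog 0 (1 :: 'k::comm_ring_1 symf)"
  using homog_single[of "{#}" 0 "1 :: 'k"] by simp

lemma homog_hsym: "homog n (hsym n :: 'k::field_char_0 symf)"
proof (induction n rule: less_induct)
  case (less n)
  show ?case
  proof (cases "n = 0")
    case False
    have "homog n (psum (Suc k) * hsym (n - Suc k) :: 'k symf)" if "k < n" for k
      using homog_mult[OF homog_psum[of "Suc k"] less[of "n - Suc k"]] that by simp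
    then show ?thesis using False
      by (subst hsym.simps) (auto intro!: homog_smul homog_sum)
  qed (simp add: homog_one)
qed

lemma homog_prod_list_hsym: "homog (sum_list \<sigma>) (prod_list (map hsym \<sigma>))"
  by (induction \<sigma>) (auto intro: homog_one homog_mult homog_hsym)

text \<open>The adjoint of multiplication by \<open>p\<^bsub>i+1\<^esub>\<close>, that is \<open>(i+1) \<partial>/\<partial>p\<^bsub>i+1\<^esub>\<close>.\<close>

definition pperp :: "nat \<Rightarrow> 'k::comm_ring_1 symf \<Rightarrow> 'k symf" where
  "pperp i = pm_eval const (\<lambda>M. Poly_Mapping.single (M - {#i#}) (of_nat (Suc i * count M i)))"

lemma pperp_add: "pperp i (F + G) = pperp i F + pperp i G"
  unfolding pperp_def by (rule pm_eval_add) (simp_all add: comm_ring_homD[OF comm_ring_hom_const])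

lemma pperp_zero [simp]: "pperp i 0 = 0"
  by (simp add: pperp_def pm_eval_def)

lemma pperp_sum: "pperp i (\<Sum>j\<in>A. F j) = (\<Sum>j\<in>A. pperp i (F j))"
  by (induction A rule: infinite_finite_induct) (simp_all add: pperp_add)

lemma pperp_single:
  "pperp i (Poly_Mapping.single M c) = Poly_Mapping.single (M - {#i#}) (c * of_nat (Suc i * count M i))"
  unfolding pperp_def by (subst pm_eval_single) (simp_all add: const_def mult_single)

lemma pperp_const [simp]: "pperp i (const c) = 0"
  by (simp add: const_def pperp_single)

lemma pperp_mult: "pperp i (F * G) = pperp i F * G + F * pperp i G"
proof (induction F rule: poly_mapping_additive_induct)
  case (single M c)
  show ?case
  proof (induction G rule: poly_mapping_additive_induct)
    case (single L d)
    \<comment> \<open>If \<open>i\<close> does not occur in \<open>M\<close>, the multiset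
      difference is truncated, but then the coefficient \<open>count M i\<close> is 0.\<close>
    have 1: "Poly_Mapping.single (M + L - {#i#}) (c * d * of_nat (Suc i * count M i)) =
      Poly_Mapping.single (M - {#i#} + L) (c * d * of_nat (Suc i * count M i))"
      by (cases "i \<in># M") (auto simp: not_in_iff dest!: multi_member_split)
    have 2: "Poly_Mapping.single (M + L - {#i#}) (c * d * of_nat (Suc i * count L i)) =
      Poly_Mapping.single (M + (L - {#i#})) (c * d * of_nat (Suc i * count L i))"
      by (cases "i \<in># L") (auto simp: not_in_iff dest!: multi_member_split)
    have "pperp i (Poly_Mapping.single M c * Poly_Mapping.single L d) =
      Poly_Mapping.single (M + L - {#i#}) (c * d * of_nat (Suc i * count M i)) +
      Poly_Mapping.single (M + L - {#i#}) (c * d * of_nat (Suc i * count L i))"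
      unfolding mult_single pperp_single single_add[symmetric]
      by (simp add: algebra_simps)
    then show ?case unfolding 1 2 pperp_single mult_single by (simp add: mult_ac)
  qed (simp add: distrib_left pperp_add)
qed (simp add: distrib_right pperp_add)

lemma pperp_prod:
  "finite A \<Longrightarrow> pperp i (\<Prod>j\<in>A. g j) = (\<Sum>j\<in>A. pperp i (g j) * (\<Prod>l\<in>A - {j}. g l))"
proof (induction A rule: finite_induct)
  case empty
  show ?case using pperp_const[of i 1] by simp
next
  case (insert x A)
  have "(\<Sum>j\<in>A. pperp i (g j) * (\<Prod>l\<in>insert x A - {j}. g l)) =
    (\<Sum>j\<in>A. g x * (pperp i (g j) * (\<Prod>l\<in>A - {j}. g l)))"
  proof (rule sum.cong)
    fix j assume "j \<in> A"
    then have "insert x A - {j} = insert x (A - {j})" using insert by auto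
    then show "pperp i (g j) * (\<Prod>l\<in>insert x A - {j}. g l) =
      g x * (pperp i (g j) * (\<Prod>l\<in>A - {j}. g l))"
      using insert by (simp add: mult_ac)
  qed simp
  then show ?case using insert by (simp add: pperp_mult sum_distrib_left)
qed

lemma z_coeff_superset:
  "finite S \<Longrightarrow> set_mset M \<subseteq> S \<Longrightarrow> z_coeff M = (\<Prod>i\<in>S. Suc i ^ count M i * fact (count M i))"
  unfolding z_coeff_def by (rule prod.mono_neutral_left) (auto simp: not_in_iff)

text \<open>The growth of \<open>z_coeff\<close> under a new part is exactly the factor produced by
  \<open>pperp\<close>, whence the adjointness in \<open>hall_psum_times\<close>.\<close>

lemma z_coeff_add_mset: "z_coeff (add_mset i M) = Suc i * Suc (count M i) * z_coeff M"
proof -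
  let ?S = "insert i (set_mset M)"
  let ?f = "\<lambda>M i. Suc i ^ count M i * fact (count M i)"
  have "z_coeff (add_mset i M) = ?f (add_mset i M) i * (\<Prod>j\<in>?S - {i}. ?f (add_mset i M) j)"
    by (subst z_coeff_superset[of ?S], simp, simp, rule prod.remove) auto
  also have "(\<Prod>j\<in>?S - {i}. ?f (add_mset i M) j) = (\<Prod>j\<in>?S - {i}. ?f M j)"
    by (rule prod.cong) auto
  also have "?f (add_mset i M) i = Suc i * Suc (count M i) * ?f M i"
    by (simp add: algebra_simps)
  also have "\<dots> * (\<Prod>j\<in>?S - {i}. ?f M j) = Suc i * Suc (count M i) * (\<Prod>j\<in>?S. ?f M j)"
    by (subst prod.remove[of ?S i]) (auto simp: algebra_simps)
  finally show ?thesis by (subst (2) z_coeff_superset[of ?S]) auto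
qed

lemma z_coeff_pos: "z_coeff M > 0"
  by (simp add: z_coeff_def)

lemma z_coeff_empty [simp]: "z_coeff {#} = 1"
  by (simp add: z_coeff_def)

lemma psum_times_single: "psum (Suc i) * Poly_Mapping.single M c = Poly_Mapping.single (add_mset i M) c"
  by (simp add: psum_def mult_single)

lemma hall_psum_times: "hall (psum (Suc i) * F) G = hall F (pperp i G)"
proof (induction F rule: poly_mapping_additive_induct)
  case (single M c)
  show ?case
  proof (induction G rule: poly_mapping_additive_induct)
    case (single L d)
    show ?case
    proof (cases "i \<in># L")
      case True
      then obtain L' where "L = add_mset i L'" by (meson multi_member_split)
      then show ?thesis
        by (auto simp: psum_times_single hall_single_left pperp_single lookup_single when_def z_coeff_add_mset algebra_simps)
    next
      case False
      then have "L \<noteq> add_mset i M" by auto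
      then show ?thesis using False
        by (auto simp: psum_times_single hall_single_left pperp_single lookup_single when_def not_in_iff)
    qed
  qed (simp add: pperp_add hall_add_right)
qed (simp add: distrib_left hall_add_left)

lemma pperp_psum: "pperp i (psum (Suc k)) = (if i = k then of_nat (Suc i) else 0)"
proof -
  have "Poly_Mapping.single {#} (1 + of_nat i) = (1 + of_nat i :: 'a symf)"
    using of_nat_eq_const[of "Suc i", where 'm = "nat multiset" and 'k = 'a] by (simp add: const_def)
  then show ?thesis by (auto simp: psum_def pperp_single)
qed

text \<open>The derivation is applied to Newton's identity. Differentiating the power sums gives
  \<open>(i+1) h_{n-i-1}\<close>; differentiating the complete functions gives, by induction,
  Newton's identity again, with value \<open>(n-i-1) h_{n-i-1}\<close>. The factor \<open>n\<close>
  cancels.\<close>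

lemma pperp_hsym: "pperp i (hsym n) = (if Suc i \<le> n then hsym (n - Suc i) else 0)"
proof (induction n rule: less_induct)
  case (less n)
  show ?case
  proof (cases n)
    case 0
    then show ?thesis using pperp_const[of i 1] by simp
  next
    case (Suc m)
    let ?h = "\<lambda>n. hsym n :: 'a symf"
    have IH: "psum (Suc k) * pperp i (?h (n - Suc k)) =
      (if Suc i + Suc k \<le> n then psum (Suc k) * hsym (n - Suc i - Suc k) else 0)" if "k < n" for k
      using that less[of "n - Suc k"] by (auto simp: add.commute)
    have "of_nat n * pperp i (?h n) = pperp i (of_nat n * ?h n)"
      by (simp add: pperp_mult of_nat_eq_const)
    also have "\<dots> = (\<Sum>k<n. pperp i (psum (Suc k)) * ?h (n - Suc k)) +
        (\<Sum>k<n. psum (Suc k) * pperp i (?h (n - Suc k)))"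
      unfolding hsym_newton by (simp add: pperp_sum pperp_mult sum.distrib)
    also have "(\<Sum>k<n. psum (Suc k) * pperp i (?h (n - Suc k))) =
        (\<Sum>k<n. if Suc i + Suc k \<le> n then psum (Suc k) * hsym (n - Suc i - Suc k) else 0)"
      by (rule sum.cong) (auto simp: IH)
    also have "\<dots> = (\<Sum>k<n - Suc i. psum (Suc k) * hsym (n - Suc i - Suc k))"
      by (rule sum.mono_neutral_cong_right) auto
    also have "\<dots> = of_nat (n - Suc i) * ?h (n - Suc i)"
      by (rule hsym_newton[symmetric])
    also have "(\<Sum>k<n. pperp i (psum (Suc k)) * ?h (n - Suc k)) =
      (\<Sum>k<n. if k = i then of_nat (Suc i) * ?h (n - Suc i) else 0)"
      by (rule sum.cong) (auto simp: pperp_psum)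
    also have "\<dots> = (if i < n then of_nat (Suc i) * ?h (n - Suc i) else 0)"
      by simp
    also have "\<dots> + of_nat (n - Suc i) * ?h (n - Suc i) = of_nat n * (if Suc i \<le> n then ?h (n - Suc i) else 0)"
      by (auto simp: distrib_right[symmetric] of_nat_add[symmetric] simp del: of_nat_Suc of_nat_add)
    finally show ?thesis
      unfolding Suc by (rule of_nat_cancel_algebra[OF comm_ring_hom_const])
  qed
qed

section \<open>Coefficients of monomials as Hall pairings\<close>

lemma in_vars_hom: "comm_ring_hom (in_vars N)"
  using comm_ring_hom_pleth[OF comm_ring_hom_const]
  by (simp add: in_vars_def[abs_def])

lemma in_vars_const [simp]: "in_vars N (const c) = const c"
  by (simp add: in_vars_def comm_ring_hom_const)

lemma in_vars_smul: "in_vars N (smul c F) = const c * in_vars N F"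
  by (simp add: smul_def comm_ring_homD[OF in_vars_hom])

lemma in_vars_psum: "k > 0 \<Longrightarrow> in_vars N (psum k) = (\<Sum>i<N. xvar i ^ k)"
  by (simp add: in_vars_def pleth_psum comm_ring_hom_const)

lemma xvar_power: "xvar i ^ k = Poly_Mapping.single (Poly_Mapping.single i k) 1"
  by (induction k) (simp_all add: xvar_def mult_single single_add[symmetric])

lemma lookup_monomial_times:
  fixes f :: "'k::comm_ring_1 xpoly"
  shows "Poly_Mapping.lookup (Poly_Mapping.single (Poly_Mapping.single j k) 1 * f) \<alpha> =
    (if k \<le> Poly_Mapping.lookup \<alpha> j then Poly_Mapping.lookup f (\<alpha> - Poly_Mapping.single j k) else 0)"
proof (induction f rule: poly_mapping_additive_induct)
  case (single \<gamma> c)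
  have "(Poly_Mapping.single j k + \<gamma> = \<alpha>) \<longleftrightarrow>
    k \<le> Poly_Mapping.lookup \<alpha> j \<and> \<gamma> = \<alpha> - Poly_Mapping.single j k"
    by (auto simp: lookup_add poly_mapping_eq_iff fun_eq_iff lookup_minus lookup_single when_def
        le_add_diff_inverse)
  then show ?case
    by (auto simp: mult_single lookup_single when_def)
qed (simp add: distrib_left lookup_add)

lemma lookup_empty_eq_pleth: "Poly_Mapping.lookup F {#} = pleth (\<lambda>c. c) (\<lambda>_. 0) F"
proof (induction F rule: poly_mapping_additive_induct)
  case (single M c)
  show ?case by (cases M) (simp_all add: pleth_conv_pm_eval pm_eval_single lookup_single when_def)
qed (simp add: lookup_add comm_ring_homD[OF comm_ring_hom_pleth[OF comm_ring_hom_id]])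

lemma pleth_zero_hsym: "comm_ring_hom \<iota> \<Longrightarrow> pleth \<iota> (\<lambda>_. 0) (hsym n) = (if n = 0 then 1 else 0)"
  using arg_cong[OF hser_zero[of \<iota>], of "\<lambda>f. fps_nth f n"] by simp

text \<open>Monomial and complete functions are dual. For a monomial in power sums this is an
  induction: a factor \<open>p_{i+1}\<close>, the sum of the \<open>x_j^{i+1}\<close>, lowers the
  exponent of one variable in the coefficient to be read, while its adjoint derivation lowers, by
  the Leibniz rule, the index of one factor \<open>h\<close>.\<close>

theorem lookup_in_vars:
  assumes "Poly_Mapping.keys \<alpha> \<subseteq> {..<N}"
  shows "Poly_Mapping.lookup (in_vars N F) \<alpha> = hall F (\<Prod>i<N. hsym (Poly_Mapping.lookup \<alpha> i))"
proof (induction F rule: poly_mapping_additive_induct)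
  case (single M c)
  show ?case using assms
  proof (induction M arbitrary: \<alpha>)
    case empty
    have "hall (Poly_Mapping.single {#} c) (\<Prod>i<N. hsym (Poly_Mapping.lookup \<alpha> i)) =
      c * (\<Prod>i<N. if Poly_Mapping.lookup \<alpha> i = 0 then 1 else 0)"
      by (simp add: hall_single_left lookup_empty_eq_pleth
          comm_ring_homD[OF comm_ring_hom_pleth[OF comm_ring_hom_id]] pleth_zero_hsym comm_ring_hom_id)
    moreover have "(\<Prod>i<N. if Poly_Mapping.lookup \<alpha> i = 0 then 1 else 0) = (if \<alpha> = 0 then 1 else 0 :: 'a)"
    proof (cases "\<alpha> = 0")
      case False
      then obtain i where "i \<in> Poly_Mapping.keys \<alpha>" by (meson all_not_in_conv keys_eq_empty)
      then have "i < N" "Poly_Mapping.lookup \<alpha> i \<noteq> 0" using empty by (blast, simp add: in_keys_iff)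
      then show ?thesis using False by auto
    qed simp
    moreover have "in_vars N (Poly_Mapping.single {#} c) = const c"
      using in_vars_const[of N c] by (simp add: const_def)
    ultimately show ?case
      by (simp add: const_def lookup_single when_def)
  next
    case (add i M)
    let ?s = "\<lambda>M. Poly_Mapping.single M c"
    have "Poly_Mapping.lookup (in_vars N (?s (add_mset i M))) \<alpha> =
      (\<Sum>j<N. Poly_Mapping.lookup (xvar j ^ Suc i * in_vars N (?s M)) \<alpha>)"
      unfolding psum_times_single[symmetric] comm_ring_homD(4)[OF in_vars_hom]
      by (simp add: in_vars_psum sum_distrib_right lookup_sum del: power_Suc)
    also have "\<dots> = (\<Sum>j<N. if Suc i \<le> Poly_Mapping.lookup \<alpha> j then
        hall (?s M) (\<Prod>l<N. hsym (Poly_Mapping.lookup (\<alpha> - Poly_Mapping.single j (Suc i)) l)) else 0)"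
    proof (rule sum.cong)
      fix j assume "j \<in> {..<N}"
      have "Poly_Mapping.keys (\<alpha> - Poly_Mapping.single j (Suc i)) \<subseteq> {..<N}"
        using add.prems by (auto simp: in_keys_iff lookup_minus subset_iff)
      then show "Poly_Mapping.lookup (xvar j ^ Suc i * in_vars N (?s M)) \<alpha> =
        (if Suc i \<le> Poly_Mapping.lookup \<alpha> j then
        hall (?s M) (\<Prod>l<N. hsym (Poly_Mapping.lookup (\<alpha> - Poly_Mapping.single j (Suc i)) l)) else 0)"
        unfolding xvar_power lookup_monomial_times using add.IH by presburger
    qed simp
    also have "\<dots> = hall (?s M) (\<Sum>j<N. pperp i (hsym (Poly_Mapping.lookup \<alpha> j)) *
        (\<Prod>l\<in>{..<N} - {j}. hsym (Poly_Mapping.lookup \<alpha> l)))"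
      unfolding hall_sum_right
    proof (rule sum.cong)
      fix j assume j: "j \<in> {..<N}"
      have "(\<Prod>l<N. hsym (Poly_Mapping.lookup (\<alpha> - Poly_Mapping.single j (Suc i)) l)) =
        (hsym (Poly_Mapping.lookup \<alpha> j - Suc i) :: 'a symf) * (\<Prod>l\<in>{..<N} - {j}. hsym (Poly_Mapping.lookup \<alpha> l))"
        by (subst prod.remove[of _ j]) (use j in \<open>auto simp: lookup_minus lookup_single when_def intro!: prod.cong arg_cong2[where f = times]\<close>)
      then show "(if Suc i \<le> Poly_Mapping.lookup \<alpha> j then
        hall (?s M) (\<Prod>l<N. hsym (Poly_Mapping.lookup (\<alpha> - Poly_Mapping.single j (Suc i)) l)) else 0) =
        hall (?s M) (pperp i (hsym (Poly_Mapping.lookup \<alpha> j)) * (\<Prod>l\<in>{..<N} - {j}. hsym (Poly_Mapping.lookup \<alpha> l)))"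
        by (simp add: pperp_hsym)
    qed simp
    also have "\<dots> = hall (?s (add_mset i M)) (\<Prod>l<N. hsym (Poly_Mapping.lookup \<alpha> l))"
      by (simp add: pperp_prod hall_psum_times flip: psum_times_single)
    finally show ?case .
  qed
qed (simp add: comm_ring_homD[OF in_vars_hom] lookup_add hall_add_left)

lemma lookup_in_vars_outside:
  assumes "\<not> Poly_Mapping.keys \<alpha> \<subseteq> {..<N}"
  shows "Poly_Mapping.lookup (in_vars N F) \<alpha> = 0"
proof -
  \<comment> \<open>The polynomials in the first \<open>N\<close> variables; they form a ring
    containing everything that \<open>in_vars N\<close> is built from.\<close>
  define S :: "'a xpoly set" where "S = {f. \<forall>\<alpha>. \<not> Poly_Mapping.keys \<alpha> \<subseteq> {..<N} \<longrightarrow> Poly_Mapping.lookup f \<alpha> = 0}"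
  have S_sum: "(\<Sum>i\<in>A. f i) \<in> S" if "\<And>i. i \<in> A \<Longrightarrow> f i \<in> S" for A :: "'i set" and f
    using that by (auto simp: S_def lookup_sum intro!: sum.neutral)
  have S_mult: "f * g \<in> S" if "f \<in> S" "g \<in> S" for f g
    unfolding S_def
  proof (safe, rule ccontr)
    fix \<alpha> x assume *: "x \<in> Poly_Mapping.keys \<alpha>" "\<not> x < N" "Poly_Mapping.lookup (f * g) \<alpha> \<noteq> 0"
    then have "\<alpha> \<in> Poly_Mapping.keys (f * g)" by (simp add: in_keys_iff)
    then obtain \<beta> \<gamma> where "\<alpha> = \<beta> + \<gamma>" "\<beta> \<in> Poly_Mapping.keys f" "\<gamma> \<in> Poly_Mapping.keys g"
      using keys_mult[of f g] by blast
    moreover from this have "Poly_Mapping.keys \<beta> \<subseteq> {..<N}" "Poly_Mapping.keys \<gamma> \<subseteq> {..<N}"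
      using that by (auto simp: S_def in_keys_iff)
    ultimately show False using * keys_add[of \<beta> \<gamma>] by auto
  qed
  have S_const: "const c \<in> S" for c
    by (auto simp: S_def const_def lookup_single when_def)
  have S_var: "xvar i ^ k \<in> S" if "i < N" for i k
    using that by (auto simp: S_def xvar_power lookup_single when_def split: if_splits)
  have "in_vars N (Poly_Mapping.single M c) \<in> S" for M c
  proof (induction M)
    case empty
    show ?case using S_const[of c] in_vars_const[of N c] by (simp add: const_def)
  next
    case (add i M)
    then show ?case
      unfolding psum_times_single[symmetric] comm_ring_homD(4)[OF in_vars_hom] in_vars_psum[OF zero_less_Suc]
      by (intro S_mult S_sum S_var) auto
  qed
  then have "in_vars N F \<in> S"
    by (induction F rule: poly_mapping_additive_induct)
      (auto simp: S_def comm_ring_homD[OF in_vars_hom] lookup_add)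
  then show ?thesis using assms by (simp add: S_def)
qed

text \<open>Since \<open>h_0 = 1\<close>, trailing zeros of an exponent vector do not
  matter.\<close>

lemma prod_hsym_eq_prod_list:
  assumes "length \<sigma> \<le> N"
  shows "(\<Prod>i<N. hsym (part \<sigma> i)) = prod_list (map hsym \<sigma>)"
proof -
  have "(\<Prod>i<N. hsym (part \<sigma> i)) = (\<Prod>i<length \<sigma>. hsym (part \<sigma> i))"
    by (rule prod.mono_neutral_right) (use assms in \<open>auto simp: part_def\<close>)
  also have "\<dots> = (\<Prod>i<length \<sigma>. hsym (\<sigma> ! i))"
    by (rule prod.cong) (auto simp: part_def)
  also have "\<dots> = prod_list (map hsym \<sigma>)"
    by (induction \<sigma>) (simp_all add: prod.lessThan_Suc_shift del: prod.lessThan_Suc)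
  finally show ?thesis .
qed

lemma lookup_nth_part: "Poly_Mapping.lookup (Poly_Mapping.nth \<sigma>) i = part \<sigma> i"
  by (simp add: part_def nth_default_def)

lemma lookup_in_vars_part:
  assumes "length \<sigma> \<le> N"
  shows "Poly_Mapping.lookup (in_vars N F) (Poly_Mapping.nth \<sigma>) = hall F (prod_list (map hsym \<sigma>))"
proof -
  have "Poly_Mapping.keys (Poly_Mapping.nth \<sigma>) \<subseteq> {..<N}"
    using assms by (auto simp: in_keys_iff lookup_nth_part part_def simp del: lookup_nth keys_nth split: if_splits)
  then show ?thesis
    using assms by (simp add: lookup_in_vars lookup_nth_part prod_hsym_eq_prod_list del: lookup_nth)
qed

section \<open>Monomial symmetric functions as the dual basis\<close>

definition hmon :: "nat multiset \<Rightarrow> 'k::field_char_0 symf" where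
  "hmon M = (\<Prod>i\<in>#M. hsym (Suc i))"

lemma hmon_plus: "hmon (M + L) = hmon M * hmon L"
  by (simp add: hmon_def)

lemma homog_hmon: "homog (mdeg M) (hmon M)"
proof (induction M)
  case (add i M)
  then show ?case using homog_mult[OF homog_hsym[of "Suc i"] add] by (simp add: hmon_def)
qed (simp add: hmon_def homog_one)

definition hspace :: "nat \<Rightarrow> 'k::field_char_0 symf set" where
  "hspace n = symf.span (hmon ` {M. mdeg M = n})"

lemma hspace_mult:
  assumes F: "F \<in> hspace m" and G: "G \<in> hspace n"
  shows "F * G \<in> hspace (m + n)"
proof -
  have 1: "hmon M * G \<in> hspace (m + n)" if "mdeg M = m" for M
    using G unfolding hspace_def
  proof (rule symf.span_induct)
    show "symf.subspace {G. hmon M * G \<in> symf.span (hmon ` {M. mdeg M = m + n})}"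
      by (auto simp: symf.subspace_def distrib_left smul_mult_right
          intro: symf.span_add symf.span_scale symf.span_zero)
  qed (use that in \<open>auto intro!: symf.span_base simp: hmon_plus[symmetric]\<close>)
  show ?thesis using F unfolding hspace_def[of m]
  proof (rule symf.span_induct)
    show "symf.subspace {F. F * G \<in> hspace (m + n)}"
      by (auto simp: symf.subspace_def distrib_right smul_mult_left hspace_def
          intro: symf.span_add symf.span_scale symf.span_zero)
  qed (use 1 in auto)
qed

lemma hsym_in_hspace: "hsym n \<in> hspace n"
proof (cases n)
  case 0
  have "hmon {#} \<in> hspace 0" unfolding hspace_def by (rule symf.span_base) auto
  then show ?thesis by (simp add: 0 hmon_def)
next
  case (Suc m)
  have "hmon {#m#} \<in> hspace (Suc m)" unfolding hspace_def by (rule symf.span_base) auto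
  then show ?thesis by (simp add: Suc hmon_def)
qed

text \<open>Newton's identity read backwards: its last power sum is expressed through complete
  functions and smaller power sums.\<close>

lemma psum_in_hspace: "psum (Suc n) \<in> (hspace (Suc n) :: 'k::field_char_0 symf set)"
proof (induction n rule: less_induct)
  case (less n)
  have "psum (Suc n) = of_nat (Suc n) * hsym (Suc n) - (\<Sum>k<n. psum (Suc k) * (hsym (n - k) :: 'k symf))"
    unfolding hsym_newton by simp
  moreover have "of_nat (Suc n) * hsym (Suc n) \<in> hspace (Suc n)"
    using symf.span_scale[OF hsym_in_hspace[unfolded hspace_def], of "of_nat (Suc n)" "Suc n"]
    by (simp add: hspace_def smul_def of_nat_eq_const del: of_nat_Suc)
  moreover have "psum (Suc k) * hsym (n - k) \<in> (hspace (Suc n) :: 'k symf set)" if "k < n" for k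
    using hspace_mult[OF less[OF that] hsym_in_hspace[of "n - k"]] that by simp
  ultimately show ?case
    by (auto simp: hspace_def intro!: symf.span_diff symf.span_sum)
qed

lemma single_in_hspace: "Poly_Mapping.single M 1 \<in> hspace (mdeg M)"
proof (induction M)
  case empty
  show ?case using hsym_in_hspace[of 0, where 'a = 'a] by simp
next
  case (add i M)
  then show ?case using hspace_mult[OF psum_in_hspace[of i] add]
    by (simp add: psum_times_single)
qed

lemma symf_expand: "F = (\<Sum>M\<in>Poly_Mapping.keys F. smul (Poly_Mapping.lookup F M) (Poly_Mapping.single M 1))"
proof (rule poly_mapping_eqI)
  fix L
  have "Poly_Mapping.lookup (\<Sum>M\<in>Poly_Mapping.keys F. smul (Poly_Mapping.lookup F M) (Poly_Mapping.single M 1)) L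
    = (\<Sum>M\<in>Poly_Mapping.keys F. if M = L then Poly_Mapping.lookup F L else 0)"
    unfolding lookup_sum by (rule sum.cong) (auto simp: lookup_smul lookup_single when_def)
  then show "Poly_Mapping.lookup F L = Poly_Mapping.lookup
      (\<Sum>M\<in>Poly_Mapping.keys F. smul (Poly_Mapping.lookup F M) (Poly_Mapping.single M 1)) L"
    by (simp add: in_keys_iff)
qed

text \<open>The products of complete functions span every power sum monomial, and pairing with such
  a monomial returns the coefficient times the nonzero \<open>z_coeff\<close>.\<close>

lemma hall_nondegenerate:
  assumes "\<And>M. hall F (hmon M) = 0"
  shows "F = 0"
proof (rule poly_mapping_eqI)
  fix M
  have "hall F (Poly_Mapping.single M 1) = 0"
    using single_in_hspace[of M] unfolding hspace_def
    by (rule symf.span_induct) (use assms in \<open>auto intro: subspace_hall_right\<close>)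
  then show "Poly_Mapping.lookup F M = Poly_Mapping.lookup 0 M"
    using z_coeff_pos[of M] by (simp add: hall_commute[of F] hall_single_left)
qed

text \<open>The partition with parts \<open>i + 1\<close>, for \<open>i \<in> M\<close>, and its inverse.\<close>

definition parts_of :: "nat multiset \<Rightarrow> nat list" where
  "parts_of M = rev (sorted_list_of_multiset (image_mset Suc M))"

definition mset_of :: "nat list \<Rightarrow> nat multiset" where
  "mset_of \<sigma> = image_mset (\<lambda>k. k - 1) (mset \<sigma>)"

lemma mset_parts_of: "mset (parts_of M) = image_mset Suc M"
  by (simp add: parts_of_def)

lemma is_partition_parts_of: "is_partition (parts_of M)"
proof -
  have "set (parts_of M) = set_mset (image_mset Suc M)"
    by (metis mset_parts_of set_mset_mset)
  then show ?thesis
    by (auto simp: is_partition_def parts_of_def sorted_wrt_rev)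
qed

lemma mset_of_parts_of [simp]: "mset_of (parts_of M) = M"
  by (simp add: mset_of_def mset_parts_of image_mset.compositionality comp_def)

lemma sum_list_parts_of: "sum_list (parts_of M) = mdeg M"
  by (metis mdeg_def mset_parts_of sum_mset_sum_list)

lemma image_mset_Suc_mset_of: "is_partition \<sigma> \<Longrightarrow> image_mset Suc (mset_of \<sigma>) = mset \<sigma>"
  unfolding is_partition_def mset_of_def
  by (auto simp: image_mset.compositionality comp_def intro!: image_mset_cong[of _ _ id, simplified])

lemma mdeg_mset_of: "is_partition \<sigma> \<Longrightarrow> mdeg (mset_of \<sigma>) = sum_list \<sigma>"
  unfolding mdeg_def by (simp add: image_mset_Suc_mset_of sum_mset_sum_list)

lemma parts_of_mset_of: "is_partition \<sigma> \<Longrightarrow> parts_of (mset_of \<sigma>) = \<sigma>"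
proof -
  assume \<sigma>: "is_partition \<sigma>"
  then have "sort \<sigma> = rev \<sigma>"
    by (intro properties_for_sort) (auto simp: is_partition_def sorted_wrt_rev)
  with \<sigma> show ?thesis by (simp add: parts_of_def image_mset_Suc_mset_of)
qed

lemma mset_of_inj: "is_partition \<sigma> \<Longrightarrow> is_partition \<rho> \<Longrightarrow> mset_of \<sigma> = mset_of \<rho> \<longleftrightarrow> \<sigma> = \<rho>"
  by (metis parts_of_mset_of)

lemma hmon_parts_of: "hmon M = prod_list (map hsym (parts_of M))"
proof -
  have "prod_list (map hsym (parts_of M)) = (prod_mset (image_mset hsym (mset (parts_of M))) :: 'a symf)"
    by (simp only: mset_map[symmetric] prod_mset_prod_list)
  then show ?thesis
    by (simp add: hmon_def mset_parts_of image_mset.compositionality comp_def)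
qed

lemma hmon_mset_of: "is_partition \<sigma> \<Longrightarrow> hmon (mset_of \<sigma>) = prod_list (map hsym \<sigma>)"
  by (simp add: hmon_parts_of parts_of_mset_of)

lemma partitions_of_eq_image: "partitions_of n = parts_of ` {M. mdeg M = n}"
  by (auto simp: partitions_of_def is_partition_parts_of sum_list_parts_of)
    (metis (mono_tags, lifting) image_eqI mdeg_mset_of mem_Collect_eq parts_of_mset_of)

lemma finite_mdeg: "finite {M. mdeg M = n}"
proof -
  have bnd: "size M \<le> mdeg M \<and> set_mset M \<subseteq> {..mdeg M}" for M
    by (induction M) (auto intro: le_trans)
  have "{M. mdeg M = n} \<subseteq> mset ` {xs. set xs \<subseteq> {..n} \<and> length xs \<le> n}"
  proof
    fix M assume "M \<in> {M. mdeg M = n}"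
    with bnd[of M] have "size M \<le> n" "set_mset M \<subseteq> {..n}" by auto
    moreover obtain xs where "M = mset xs" by (metis ex_mset)
    ultimately show "M \<in> mset ` {xs. set xs \<subseteq> {..n} \<and> length xs \<le> n}" by auto
  qed
  then show ?thesis by (rule finite_subset) (simp add: finite_lists_length_le)
qed

lemma finite_partitions_of: "finite (partitions_of n)"
  by (simp add: partitions_of_eq_image finite_mdeg)

lemma hall_eqI:
  assumes "\<And>\<sigma>. is_partition \<sigma> \<Longrightarrow> hall F (prod_list (map hsym \<sigma>)) = hall G (prod_list (map hsym \<sigma>))"
  shows "F = G"
proof -
  have "F - G = 0"
    by (rule hall_nondegenerate) (simp add: hall_diff_left hmon_parts_of assms is_partition_parts_of)
  then show ?thesis by simp
qed

lemma hall_homog_eqI: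
  assumes "homog n F" "homog n G"
    "\<And>\<sigma>. \<sigma> \<in> partitions_of n \<Longrightarrow> hall F (prod_list (map hsym \<sigma>)) = hall G (prod_list (map hsym \<sigma>))"
  shows "F = G"
proof (rule hall_eqI)
  fix \<sigma> assume "is_partition \<sigma>"
  then show "hall F (prod_list (map hsym \<sigma>)) = hall G (prod_list (map hsym \<sigma>))"
    using assms(3)[of \<sigma>] hall_homog_neq[OF assms(1) homog_prod_list_hsym[of \<sigma>]]
      hall_homog_neq[OF assms(2) homog_prod_list_hsym[of \<sigma>]]
    by (cases "sum_list \<sigma> = n") (auto simp: partitions_of_def)
qed

text \<open>The pairing with \<open>h_\<sigma>\<close> is a coefficient in any
  \<open>N \<ge> length \<sigma>\<close> variables, so agreement for all large \<open>N\<close>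
  suffices. Uniqueness in the definitions of \<open>mono_symf\<close> and
  \<open>hall_littlewood\<close> rests on this.\<close>

lemma in_vars_inject:
  fixes F G :: "'k::field_char_0 symf"
  assumes "\<And>N. N \<ge> N0 \<Longrightarrow> in_vars N F = in_vars N G"
  shows "F = G"
proof (rule hall_eqI)
  fix \<sigma> :: "nat list"
  show "hall F (prod_list (map hsym \<sigma>)) = hall G (prod_list (map hsym \<sigma>))"
    using assms[of "max N0 (length \<sigma>)"]
    by (simp flip: lookup_in_vars_part[of \<sigma> "max N0 (length \<sigma>)"])
qed

lemma inj_on_single_one: "inj_on (\<lambda>M. Poly_Mapping.single M (1::'k::zero_neq_one)) A"
  by (rule inj_onI) (metis keys_single one_neq_zero singleton_inject)

lemma independent_power_sums:
  "symf.independent ((\<lambda>M. Poly_Mapping.single M 1) ` A :: 'k::field_char_0 symf set)" if "finite A"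
proof (rule symf.independent_if_scalars_zero)
  fix f :: "'k symf \<Rightarrow> 'k" and x
  let ?s = "\<lambda>M. Poly_Mapping.single M (1::'k)"
  assume eq: "(\<Sum>x\<in>?s ` A. smul (f x) x) = 0" and "x \<in> ?s ` A"
  then obtain M where M: "M \<in> A" "x = ?s M" by auto
  have inj: "inj_on ?s A"
    by (rule inj_on_single_one)
  have "0 = Poly_Mapping.lookup (\<Sum>M\<in>A. smul (f (?s M)) (?s M)) M"
    using eq by (simp add: sum.reindex[OF inj])
  also have "\<dots> = (\<Sum>L\<in>A. if L = M then f (?s M) else 0)"
    unfolding lookup_sum by (rule sum.cong) (auto simp: lookup_smul lookup_single when_def)
  finally show "f x = 0" using M that by simp
qed (use that in simp)

text \<open>Counting argument: the power sum monomials of degree \<open>n\<close> are independent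
  and lie in the span of the \<open>hmon M\<close>, which are at most as many; so the latter are
  distinct and independent.\<close>

lemma hmon_basis:
  fixes n :: nat
  defines "B \<equiv> hmon ` {M. mdeg M = n} :: 'k::field_char_0 symf set"
  shows "symf.independent B" "inj_on (hmon :: _ \<Rightarrow> 'k symf) {M. mdeg M = n}"
proof -
  let ?D = "{M. mdeg M = n}"
  let ?S = "(\<lambda>M. Poly_Mapping.single M 1) ` ?D :: 'k symf set"
  have finB: "finite B" by (simp add: B_def finite_mdeg)
  obtain B' where B': "B' \<subseteq> B" "symf.independent B'" "B \<subseteq> symf.span B'"
    using symf.maximal_independent_subset by blast
  have "?S \<subseteq> hspace n"
    using single_in_hspace by fastforce
  also have "hspace n \<subseteq> symf.span B'"
    unfolding hspace_def B_def[symmetric] by (rule symf.span_minimal[OF B'(3) symf.subspace_span])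
  finally have "card ?S \<le> card B'"
    using symf.independent_span_bound[OF _ independent_power_sums[OF finite_mdeg]] finite_subset[OF B'(1) finB] by blast
  moreover have "card ?S = card ?D"
    by (rule card_image) (rule inj_on_single_one)
  moreover have "card B' \<le> card B" using B'(1) finB by (rule card_mono[rotated])
  moreover have "card B \<le> card ?D" unfolding B_def by (rule card_image_le) (rule finite_mdeg)
  ultimately have "card B' = card B" "card B = card ?D" by auto
  then show "symf.independent B" "inj_on (hmon :: _ \<Rightarrow> 'k symf) ?D"
    using B' card_subset_eq[OF finB B'(1)]
    by (simp, intro eq_card_imp_inj_on[OF finite_mdeg], simp add: B_def)
qed

text \<open>The coordinate functional of \<open>hmon M0\<close> is represented by a vector, found in
  the orthogonal basis of power sums by dividing its values by the norms.\<close>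

lemma dual_basis_exists:
  assumes M0: "mdeg M0 = n"
  shows "\<exists>F :: 'k::field_char_0 symf. homog n F \<and> (\<forall>M. hall F (hmon M) = (if M = M0 then 1 else 0))"
proof -
  let ?D = "{M. mdeg M = n}"
  let ?h = "hmon :: _ \<Rightarrow> 'k symf"
  obtain g where g: "Vector_Spaces.linear smul smul g"
      "\<forall>x\<in>?h ` ?D. g x = (if x = hmon M0 then 1 else 0 :: 'k symf)"
    using symf_pair.linear_independent_extend[OF hmon_basis(1)[of n, where 'k = 'k],
        of "\<lambda>x. if x = hmon M0 then 1 else 0"] by blast
  interpret g: Vector_Spaces.linear smul smul g by (rule g(1))
  \<comment> \<open>The extension theorem is used with \<open>symf\<close> as target space, so the
    scalar value is stored as a constant term.\<close>
  define f where "f G = Poly_Mapping.lookup (g G) {#}" for G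
  define F where "F = (\<Sum>M\<in>?D. Poly_Mapping.single M (f (Poly_Mapping.single M 1) / of_nat (z_coeff M)))"
  have F: "homog n F"
    unfolding F_def by (auto intro!: homog_sum homog_single)
  have Fs: "hall F (Poly_Mapping.single M 1) = f (Poly_Mapping.single M 1)" if "mdeg M = n" for M
  proof -
    have "hall F (Poly_Mapping.single M 1) = Poly_Mapping.lookup F M * of_nat (z_coeff M)"
      by (simp add: hall_commute[of F] hall_single_left)
    also have "Poly_Mapping.lookup F M =
      (\<Sum>L\<in>?D. if L = M then f (Poly_Mapping.single M 1) / of_nat (z_coeff M) else 0)"
      unfolding F_def lookup_sum by (rule sum.cong) (auto simp: lookup_single when_def)
    also have "\<dots> = f (Poly_Mapping.single M 1) / of_nat (z_coeff M)"
      using that finite_mdeg by simp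
    finally show ?thesis using z_coeff_pos[of M] by simp
  qed
  have FG: "hall F G = f G" if "homog n G" for G
  proof -
    have "hall F G = (\<Sum>M\<in>Poly_Mapping.keys G. Poly_Mapping.lookup G M * hall F (Poly_Mapping.single M 1))"
      by (subst symf_expand[of G]) (simp add: hall_sum_right hall_smul_right)
    also have "\<dots> = (\<Sum>M\<in>Poly_Mapping.keys G. Poly_Mapping.lookup G M * f (Poly_Mapping.single M 1))"
      using that by (intro sum.cong refl) (metis Fs homog_def in_keys_iff)
    also have "\<dots> = f G"
      using arg_cong[OF symf_expand[of G], of f, symmetric]
      by (simp add: f_def g.sum g.scale lookup_sum lookup_smul)
    finally show ?thesis .
  qed
  have "hall F (hmon M) = (if M = M0 then 1 else 0)" for M
  proof (cases "mdeg M = n")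
    case True
    then have "hmon M = (hmon M0 :: 'k symf) \<longleftrightarrow> M = M0"
      using hmon_basis(2)[of n, where 'k = 'k] M0 by (auto dest: inj_onD)
    then show ?thesis using FG[of "hmon M"] homog_hmon[of M] True g(2)
      by (auto simp: f_def)
  next
    case False
    then show ?thesis using hall_homog_neq[OF F homog_hmon[of M]] M0 by auto
  qed
  then show ?thesis using F by blast
qed

definition expo_mset :: "(nat \<Rightarrow>\<^sub>0 nat) \<Rightarrow> nat multiset" where
  "expo_mset \<alpha> = image_mset (\<lambda>i. Poly_Mapping.lookup \<alpha> i - 1) (mset_set (Poly_Mapping.keys \<alpha>))"

lemma prod_hsym_expo:
  assumes "Poly_Mapping.keys \<alpha> \<subseteq> {..<N}"
  shows "(\<Prod>i<N. hsym (Poly_Mapping.lookup \<alpha> i)) = hmon (expo_mset \<alpha>)"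
proof -
  have "(\<Prod>i<N. hsym (Poly_Mapping.lookup \<alpha> i)) = (\<Prod>i\<in>Poly_Mapping.keys \<alpha>. hsym (Poly_Mapping.lookup \<alpha> i) :: 'a symf)"
    by (rule prod.mono_neutral_right) (use assms in \<open>auto simp: in_keys_iff\<close>)
  also have "\<dots> = (\<Prod>i\<in>Poly_Mapping.keys \<alpha>. hsym (Suc (Poly_Mapping.lookup \<alpha> i - 1)))"
    by (rule prod.cong) (auto simp: in_keys_iff)
  finally show ?thesis
    by (simp add: hmon_def expo_mset_def prod_unfold_prod_mset image_mset.compositionality comp_def)
qed

lemma finite_expos:
  "finite {\<alpha>. Poly_Mapping.keys \<alpha> \<subseteq> {..<N::nat} \<and>
     image_mset (Poly_Mapping.lookup \<alpha>) (mset_set (Poly_Mapping.keys \<alpha>)) = mset (\<rho> :: nat list)}" (is "finite ?A")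
proof (rule inj_on_finite)
  show "inj_on (\<lambda>\<alpha>. map (Poly_Mapping.lookup \<alpha>) [0..<N]) ?A"
  proof (rule inj_onI)
    fix \<alpha> \<beta> assume *: "\<alpha> \<in> ?A" "\<beta> \<in> ?A" "map (Poly_Mapping.lookup \<alpha>) [0..<N] = map (Poly_Mapping.lookup \<beta>) [0..<N]"
    show "\<alpha> = \<beta>"
    proof (rule poly_mapping_eqI)
      fix i show "Poly_Mapping.lookup \<alpha> i = Poly_Mapping.lookup \<beta> i"
      proof (cases "i < N")
        case True
        then show ?thesis using *(3) by (simp add: map_eq_conv)
      next
        case False
        then have "i \<notin> Poly_Mapping.keys \<alpha>" "i \<notin> Poly_Mapping.keys \<beta>" using * by auto
        then show ?thesis by (simp add: in_keys_iff)
      qed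
    qed
  qed
  show "(\<lambda>\<alpha>. map (Poly_Mapping.lookup \<alpha>) [0..<N]) ` ?A \<subseteq> {xs. set xs \<subseteq> insert 0 (set \<rho>) \<and> length xs = N}"
  proof -
    have "Poly_Mapping.lookup \<alpha> i \<in> insert 0 (set \<rho>)"
      if *: "image_mset (Poly_Mapping.lookup \<alpha>) (mset_set (Poly_Mapping.keys \<alpha>)) = mset \<rho>" for \<alpha> i
    proof (cases "i \<in> Poly_Mapping.keys \<alpha>")
      case True
      then have "Poly_Mapping.lookup \<alpha> i \<in># image_mset (Poly_Mapping.lookup \<alpha>) (mset_set (Poly_Mapping.keys \<alpha>))"
        by simp
      then show ?thesis unfolding * by simp
    qed (simp add: in_keys_iff)
    then show ?thesis by fastforce
  qed
qed (simp add: finite_lists_length_eq)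

text \<open>The coefficient of \<open>x^\<beta>\<close> in \<open>F\<close> is the pairing with
  \<open>h_\<beta>\<close>, hence 1 exactly when the nonzero exponents are the parts of
  \<open>\<rho>\<close>.\<close>

lemma mono_symf_spec:
  assumes "is_partition \<rho>" "homog (sum_list \<rho>) (F :: 'k::field_char_0 symf)"
    and F: "\<And>M. hall F (hmon M) = (if M = mset_of \<rho> then 1 else 0)"
  shows "mono_symf \<rho> = F"
proof -
  define R where "R N = (\<Sum>\<alpha> | Poly_Mapping.keys \<alpha> \<subseteq> {..<N} \<and>
        image_mset (Poly_Mapping.lookup \<alpha>) (mset_set (Poly_Mapping.keys \<alpha>)) = mset \<rho>.
      Poly_Mapping.single \<alpha> (1 :: 'k))" for N :: nat
  have "in_vars N F = R N" for N
  proof (rule poly_mapping_eqI)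
    fix \<beta>
    let ?A = "{\<alpha>. Poly_Mapping.keys \<alpha> \<subseteq> {..<N} \<and>
        image_mset (Poly_Mapping.lookup \<alpha>) (mset_set (Poly_Mapping.keys \<alpha>)) = mset \<rho>}"
    have "Poly_Mapping.lookup (R N) \<beta> = (\<Sum>\<alpha>\<in>?A. if \<alpha> = \<beta> then 1 else 0)"
      unfolding R_def lookup_sum by (rule sum.cong) (auto simp: lookup_single when_def)
    also have "\<dots> = (if \<beta> \<in> ?A then 1 else 0)"
      by (simp add: finite_expos)
    also have "\<dots> = Poly_Mapping.lookup (in_vars N F) \<beta>"
    proof (cases "Poly_Mapping.keys \<beta> \<subseteq> {..<N}")
      case True
      have "mset_of \<rho> = expo_mset \<beta> \<longleftrightarrow> mset \<rho> = image_mset Suc (expo_mset \<beta>)"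
        unfolding image_mset_Suc_mset_of[OF assms(1), symmetric]
        using inj_eq[OF multiset.inj_map[OF inj_Suc]] by simp
      also have "image_mset Suc (expo_mset \<beta>) =
          image_mset (Poly_Mapping.lookup \<beta>) (mset_set (Poly_Mapping.keys \<beta>))"
        unfolding expo_mset_def image_mset.compositionality comp_def
        by (rule image_mset_cong) (auto simp: in_keys_iff)
      finally show ?thesis
        using True by (auto simp: lookup_in_vars prod_hsym_expo F)
    qed (auto simp: lookup_in_vars_outside)
    finally show "Poly_Mapping.lookup (in_vars N F) \<beta> = Poly_Mapping.lookup (R N) \<beta>" by simp
  qed
  then show ?thesis unfolding mono_symf_def R_def[symmetric]
    by (intro the_equality in_vars_inject[of 0]) auto
qed

lemma mono_symf_dual:
  assumes "is_partition \<rho>"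
  shows "homog (sum_list \<rho>) (mono_symf \<rho> :: 'k::field_char_0 symf)"
    "is_partition \<sigma> \<Longrightarrow> hall (mono_symf \<rho> :: 'k symf) (prod_list (map hsym \<sigma>)) = (if \<sigma> = \<rho> then 1 else 0)"
proof -
  obtain F :: "'k symf" where F: "homog (sum_list \<rho>) F" "\<And>M. hall F (hmon M) = (if M = mset_of \<rho> then 1 else 0)"
    using dual_basis_exists[OF mdeg_mset_of[OF assms], where 'k = 'k] by auto
  have eq: "mono_symf \<rho> = F" by (rule mono_symf_spec[OF assms F])
  show "homog (sum_list \<rho>) (mono_symf \<rho> :: 'k::field_char_0 symf)" using F eq by simp
  show "hall (mono_symf \<rho> :: 'k symf) (prod_list (map hsym \<sigma>)) = (if \<sigma> = \<rho> then 1 else 0)"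
    if "is_partition \<sigma>"
    using F(2)[of "mset_of \<sigma>"] that assms by (simp add: eq hmon_mset_of mset_of_inj)
qed

lemma mono_symf_eqI:
  assumes "is_partition \<rho>" "homog (sum_list \<rho>) (F :: 'k::field_char_0 symf)"
    "\<And>\<sigma>. \<sigma> \<in> partitions_of (sum_list \<rho>) \<Longrightarrow> hall F (prod_list (map hsym \<sigma>)) = (if \<sigma> = \<rho> then 1 else 0)"
  shows "mono_symf \<rho> = F"
  by (rule hall_homog_eqI[OF mono_symf_dual(1)[OF assms(1)] assms(2)])
    (use assms(1,3) mono_symf_dual(2)[OF assms(1), where 'k = 'k] in \<open>auto simp: partitions_of_def\<close>)

lemma expand_mono:
  assumes "homog n F"
  shows "F = (\<Sum>\<rho>\<in>partitions_of n. smul (hall F (prod_list (map hsym \<rho>))) (mono_symf \<rho>))"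
proof (rule hall_homog_eqI[OF assms])
  show "homog n (\<Sum>\<rho>\<in>partitions_of n. smul (hall F (prod_list (map hsym \<rho>))) (mono_symf \<rho>))"
    using mono_symf_dual(1) by (auto intro!: homog_sum homog_smul simp: partitions_of_def)
  fix \<sigma> assume \<sigma>: "\<sigma> \<in> partitions_of n"
  have "hall (\<Sum>\<rho>\<in>partitions_of n. smul (hall F (prod_list (map hsym \<rho>))) (mono_symf \<rho>)) (prod_list (map hsym \<sigma>))
    = (\<Sum>\<rho>\<in>partitions_of n. if \<rho> = \<sigma> then hall F (prod_list (map hsym \<sigma>)) else 0)"
    unfolding hall_sum_left by (rule sum.cong) (use \<sigma> in \<open>auto simp: hall_smul_left mono_symf_dual partitions_of_def\<close>)
  then show "hall F (prod_list (map hsym \<sigma>)) = hall (\<Sum>\<rho>\<in>partitions_of n. smul (hall F (prod_list (map hsym \<rho>))) (mono_symf \<rho>)) (prod_list (map hsym \<sigma>))"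
    using \<sigma> finite_partitions_of by simp
qed

lemma hall_expand:
  assumes "homog n G"
  shows "hall F G = (\<Sum>\<rho>\<in>partitions_of n. hall G (prod_list (map hsym \<rho>)) * hall F (mono_symf \<rho>))"
proof -
  have "hall F G = hall F (\<Sum>\<rho>\<in>partitions_of n. smul (hall G (prod_list (map hsym \<rho>))) (mono_symf \<rho>))"
    by (rule arg_cong[OF expand_mono[OF assms]])
  then show ?thesis by (simp add: hall_sum_right hall_smul_right)
qed

text \<open>Both sides are first tested against monomial functions, where duality applies directly;
  \<open>hall_expand\<close> transfers the equality to the test functions
  \<open>h_\<sigma>\<close>.\<close>

lemma expand_complete:
  assumes "homog n F"
  shows "F = (\<Sum>\<rho>\<in>partitions_of n. smul (hall F (mono_symf \<rho>)) (prod_list (map hsym \<rho>)))" (is "F = ?R")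
proof (rule hall_homog_eqI[OF assms])
  have R: "homog n ?R"
    using homog_prod_list_hsym by (auto intro!: homog_sum homog_smul simp: partitions_of_def)
  then show "homog n ?R" .
  have m: "hall F (mono_symf \<sigma>) = hall ?R (mono_symf \<sigma>)" if "\<sigma> \<in> partitions_of n" for \<sigma>
  proof -
    have "hall ?R (mono_symf \<sigma>) = (\<Sum>\<rho>\<in>partitions_of n. if \<rho> = \<sigma> then hall F (mono_symf \<sigma>) else 0)"
      unfolding hall_sum_left
    proof (rule sum.cong)
      fix \<rho> assume "\<rho> \<in> partitions_of n"
      then show "hall (smul (hall F (mono_symf \<rho>)) (prod_list (map hsym \<rho>))) (mono_symf \<sigma>) =
        (if \<rho> = \<sigma> then hall F (mono_symf \<sigma>) else 0)"
        using that mono_symf_dual(2)[of \<sigma> \<rho>, where 'k = 'a]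
        by (simp add: hall_smul_left hall_commute[of "prod_list _"] partitions_of_def)
    qed simp
    then show ?thesis using that finite_partitions_of by simp
  qed
  fix \<sigma> assume "\<sigma> \<in> partitions_of n"
  then have h: "homog n (prod_list (map hsym \<sigma>) :: 'a symf)"
    using homog_prod_list_hsym by (auto simp: partitions_of_def)
  show "hall F (prod_list (map hsym \<sigma>)) = hall ?R (prod_list (map hsym \<sigma>))"
    unfolding hall_expand[OF h] by (rule sum.cong) (simp_all add: m)
qed

section \<open>Rescaling the power sums\<close>

text \<open>Diagonal plethysms. Omega and the substitutions of -X, X(1-q) and X/(1-t) for X are all
  of this form; hence they commute, and they are self-adjoint for the Hall form
  (\<open>hall_scale\<close>).\<close>

definition scale :: "(nat \<Rightarrow> 'k) \<Rightarrow> 'k::comm_ring_1 symf \<Rightarrow> 'k symf" where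
  "scale c = pleth const (\<lambda>k. smul (c k) (psum k))"

lemma scale_hom: "comm_ring_hom (scale c)"
  unfolding scale_def by (rule comm_ring_hom_pleth[OF comm_ring_hom_const])

lemmas scale_simps = comm_ring_homD[OF scale_hom]

lemma lookup_scale: "Poly_Mapping.lookup (scale c F) M = Poly_Mapping.lookup F M * (\<Prod>i\<in>#M. c (Suc i))"
proof (induction F rule: poly_mapping_additive_induct)
  case (single L d)
  have "scale c (Poly_Mapping.single L d) = Poly_Mapping.single L (d * (\<Prod>i\<in>#L. c (Suc i)))"
  proof (induction L)
    case empty
    show ?case using pleth_const[OF comm_ring_hom_const, of _ d]
      by (simp add: scale_def const_def)
  next
    case (add i L)
    have "scale c (psum (Suc i)) = smul (c (Suc i)) (psum (Suc i))"
      by (simp add: scale_def pleth_psum comm_ring_hom_const)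
    then show ?case
      unfolding psum_times_single[symmetric] scale_simps add
      by (simp add: smul_mult_left psum_times_single)
        (auto intro!: poly_mapping_eqI simp: lookup_smul lookup_single when_def mult_ac)
  qed
  then show ?case by (simp add: lookup_single when_def)
qed (simp add: scale_simps lookup_add distrib_right)

lemma homog_scale: "homog n F \<Longrightarrow> homog n (scale c F)"
  by (simp add: homog_def lookup_scale)

lemma scale_smul: "scale c (smul d F) = smul d (scale c F)"
  by (rule poly_mapping_eqI) (simp add: lookup_scale lookup_smul mult_ac)

lemma scale_scale: "scale c (scale d F) = scale (\<lambda>k. c k * d k) F"
  by (rule poly_mapping_eqI) (simp add: lookup_scale prod_mset.distrib mult_ac)

lemma scale_cong: "(\<And>k. k > 0 \<Longrightarrow> c k = d k) \<Longrightarrow> scale c F = scale d F"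
  by (rule poly_mapping_eqI) (simp add: lookup_scale cong: image_mset_cong)

lemma scale_one: "scale (\<lambda>_. 1) F = F"
  by (rule poly_mapping_eqI) (simp add: lookup_scale)

lemma scale_inverse: "(\<And>k. k > 0 \<Longrightarrow> c k * d k = 1) \<Longrightarrow> scale c (scale d F) = F"
  unfolding scale_scale using scale_cong[of "\<lambda>k. c k * d k" "\<lambda>_. 1" F] by (simp add: scale_one)

lemma scale_power: "homog n F \<Longrightarrow> scale (\<lambda>k. z ^ k) F = smul (z ^ n) F"
proof (rule poly_mapping_eqI)
  fix M assume F: "homog n F"
  have "(\<Prod>i\<in>#M. z ^ Suc i) = z ^ mdeg M"
    by (induction M) (simp_all add: power_add mult_ac)
  then show "Poly_Mapping.lookup (scale (\<lambda>k. z ^ k) F) M = Poly_Mapping.lookup (smul (z ^ n) F) M"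
    using F by (cases "mdeg M = n") (simp_all add: lookup_scale lookup_smul homog_def mult_ac)
qed

lemma hall_scale: "hall (scale c F) G = hall F (scale c G)"
proof -
  have "hall (scale c F) G = (\<Sum>M\<in>Poly_Mapping.keys F. Poly_Mapping.lookup (scale c F) M * Poly_Mapping.lookup G M * of_nat (z_coeff M))"
    by (rule hall_superset) (auto simp: in_keys_iff lookup_scale)
  then show ?thesis by (simp add: hall_def lookup_scale mult_ac)
qed

lemma pleth_scale:
  "comm_ring_hom \<iota> \<Longrightarrow> pleth \<iota> a (scale c F) = pleth \<iota> (\<lambda>k. \<iota> (c k) * a k) F"
  unfolding scale_def
  by (subst pleth_compose[OF comm_ring_hom_pleth comm_ring_hom_const], assumption)
    (auto intro!: pleth_cong simp: pleth_smul pleth_psum)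

lemma linear_scale: "Vector_Spaces.linear smul smul (scale c :: 'k::field symf \<Rightarrow> 'k symf)"
  by unfold_locales (simp_all add: scale_simps scale_smul)

section \<open>Elementary symmetric functions\<close>

text \<open>This is \<open>h_n = sum_M p_M / z_M\<close>. The factors of a monomial are removed one
  by one with the adjoint of multiplication by a power sum.\<close>

lemma lookup_hsym:
  assumes "mdeg M = n"
  shows "Poly_Mapping.lookup (hsym n :: 'k::field_char_0 symf) M * of_nat (z_coeff M) = 1"
proof -
  have "hall (Poly_Mapping.single M 1) (hsym (mdeg M) :: 'k symf) = 1"
  proof (induction M)
    case (add i M)
    have "hall (psum (Suc i) * Poly_Mapping.single M 1) (hsym (mdeg (add_mset i M)) :: 'k symf) = 1"
      unfolding hall_psum_times pperp_hsym using add by simp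
    then show ?case unfolding psum_times_single .
  next
    case empty
    show ?case unfolding hall_single_left by simp
  qed
  then show ?thesis using assms by (simp add: hall_single_left)
qed

text \<open>The coefficients \<open>1 / z_M\<close> of \<open>h_n\<close> cancel the norms, so
  pairing with \<open>h_n\<close> is evaluation at one variable equal to 1.\<close>

lemma hall_hsym:
  assumes "homog n F"
  shows "hall F (hsym n) = pleth (\<lambda>c. c) (\<lambda>_. 1) F"
  unfolding hall_def pleth_def
proof (intro sum.cong refl)
  fix M assume "M \<in> Poly_Mapping.keys F"
  then have "mdeg M = n" using assms by (auto simp: homog_def in_keys_iff)
  then show "Poly_Mapping.lookup F M * Poly_Mapping.lookup (hsym n) M * of_nat (z_coeff M) =
    Poly_Mapping.lookup F M * (\<Prod>i\<in>#M. 1)"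
    by (simp add: mult.assoc lookup_hsym)
qed

text \<open>The sign by which omega acts on \<open>p_k\<close>; that \<open>scale sgnc\<close>
  agrees with the map defined through Schur functions is the content of
  \<open>omega_eq\<close>.\<close>

definition sgnc :: "nat \<Rightarrow> 'k::comm_ring_1" where
  "sgnc k = (- 1) ^ (k - 1)"

lemma sgnc_eq: "k > 0 \<Longrightarrow> sgnc k = - ((- 1) ^ k)"
  by (cases k) (simp_all add: sgnc_def)

lemma sgnc_square [simp]: "sgnc k * sgnc k = 1"
  by (simp add: sgnc_def flip: power_mult_distrib)

lemma scale_sgnc_involution: "scale sgnc (scale sgnc F) = F"
  by (rule scale_inverse) simp

text \<open>The values \<open>-((-1)^k)\<close> are the power sums of minus the alphabet consisting
  of -1, whose series is the polynomial \<open>1 + X\<close>.\<close>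

lemma pleth_sgnc_hsym: "pleth (\<lambda>c. c) sgnc (hsym r) = (if r \<le> 1 then 1 else 0)"
proof -
  have "hser (\<lambda>c. c) sgnc = 1 - fps_const (- 1) * fps_X"
    by (rule hser_eqI[OF comm_ring_hom_id newton_linear]) (simp add: sgnc_eq)
  from arg_cong[OF this, of "\<lambda>f. fps_nth f r"] show ?thesis
    by (cases r) auto
qed

lemma pleth_one_hsym: "pleth (\<lambda>c. c) (\<lambda>_. 1) (hsym r) = 1"
  using arg_cong[OF hser_geometric[OF comm_ring_hom_id, of 1], of "\<lambda>f. fps_nth f r"] by simp

lemma hall_esym:
  assumes "homog n F"
  shows "hall (scale sgnc (hsym n)) F = pleth (\<lambda>c. c) sgnc F"
  using hall_hsym[OF homog_scale[OF assms], of sgnc]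
  by (simp add: hall_commute[of _ F] hall_scale[symmetric] pleth_scale comm_ring_hom_id)

lemma partition_ones: "\<sigma> \<in> partitions_of n \<Longrightarrow> (\<forall>r\<in>set \<sigma>. r \<le> 1) \<longleftrightarrow> \<sigma> = replicate n 1"
proof
  assume \<sigma>: "\<sigma> \<in> partitions_of n" and "\<forall>r\<in>set \<sigma>. r \<le> 1"
  then have "\<forall>r\<in>set \<sigma>. r = 1" by (auto simp: partitions_of_def is_partition_def le_Suc_eq)
  then have "\<sigma> = replicate (length \<sigma>) 1" by (induction \<sigma>) auto
  moreover have "length \<sigma> = n"
    using \<sigma> arg_cong[OF calculation, of sum_list] by (simp add: partitions_of_def sum_list_replicate)
  ultimately show "\<sigma> = replicate n 1" by simp
qed auto

lemma prod_list_indicator: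
  "prod_list (map (\<lambda>r. if P r then 1 else 0) xs) = (if \<forall>r\<in>set xs. P r then 1 else 0 :: 'k::comm_ring_1)"
  by (induction xs) auto

text \<open>Paired with a product of complete functions, \<open>scale sgnc (hsym n)\<close> gives a
  product of indicators that the parts are at most 1, so only the partition with all parts equal to
  1 survives.\<close>

lemma elem_symf_eq: "elem_symf n = scale sgnc (hsym n :: 'k::field_char_0 symf)"
  unfolding elem_symf_def
proof (rule mono_symf_eqI)
  show "is_partition (replicate n 1)" by (auto simp: is_partition_def sorted_wrt_iff_nth_less)
  show "homog (sum_list (replicate n 1)) (scale sgnc (hsym n :: 'k symf))"
    by (simp add: sum_list_replicate homog_scale homog_hsym)
  fix \<sigma> assume "\<sigma> \<in> partitions_of (sum_list (replicate n 1))"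
  then have \<sigma>: "\<sigma> \<in> partitions_of n" by (simp add: sum_list_replicate)
  then have "homog n (prod_list (map hsym \<sigma>) :: 'k symf)"
    using homog_prod_list_hsym by (auto simp: partitions_of_def)
  then have "hall (scale sgnc (hsym n)) (prod_list (map hsym \<sigma>) :: 'k symf) = (if \<forall>r\<in>set \<sigma>. r \<le> 1 then 1 else 0)"
    by (simp add: hall_esym comm_ring_homD[OF comm_ring_hom_pleth[OF comm_ring_hom_id]] comp_def
        pleth_sgnc_hsym prod_list_indicator del: One_nat_def)
  then show "hall (scale sgnc (hsym n)) (prod_list (map hsym \<sigma>) :: 'k symf) = (if \<sigma> = replicate n 1 then 1 else 0)"
    unfolding partition_ones[OF \<sigma>] .
qed

text \<open>For \<open>r \<ge> 0\<close> both sides pair to 1 with every product of complete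
  functions of degree \<open>r\<close>.\<close>

lemma complete_symf_eq: "complete_symf r = (if r < 0 then 0 else hsym (nat r))"
proof -
  have "(\<Sum>\<mu>\<in>partitions_of n. mono_symf \<mu>) = (hsym n :: 'a symf)" for n
  proof (rule hall_homog_eqI)
    show "homog n (\<Sum>\<mu>\<in>partitions_of n. mono_symf \<mu> :: 'a symf)"
      using mono_symf_dual(1) by (auto intro!: homog_sum simp: partitions_of_def)
    show "homog n (hsym n)" by (rule homog_hsym)
    fix \<sigma> assume \<sigma>: "\<sigma> \<in> partitions_of n"
    have "hall (\<Sum>\<mu>\<in>partitions_of n. mono_symf \<mu>) (prod_list (map hsym \<sigma>)) =
      (\<Sum>\<mu>\<in>partitions_of n. if \<mu> = \<sigma> then 1 else 0 :: 'a)"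
      unfolding hall_sum_left
      by (rule sum.cong) (use \<sigma> in \<open>auto simp: mono_symf_dual partitions_of_def\<close>)
    also have "\<dots> = 1" using \<sigma> finite_partitions_of by simp
    also have "\<dots> = pleth (\<lambda>c. c) (\<lambda>_. 1) (prod_list (map hsym \<sigma>))"
      by (simp add: comm_ring_homD[OF comm_ring_hom_pleth[OF comm_ring_hom_id]] comp_def pleth_one_hsym
          map_replicate_const)
    also have "\<dots> = hall (hsym n) (prod_list (map hsym \<sigma>))"
      using \<sigma> homog_prod_list_hsym[of \<sigma>, where 'a = 'a]
      by (subst hall_commute, subst hall_hsym) (auto simp: partitions_of_def)
    finally show "hall (\<Sum>\<mu>\<in>partitions_of n. mono_symf \<mu>) (prod_list (map hsym \<sigma>)) =
      hall (hsym n) (prod_list (map hsym \<sigma>) :: 'a symf)" .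
  qed
  then show ?thesis by (simp add: complete_symf_def)
qed

section \<open>Dominance order and triangular families of symmetric functions\<close>

section \<open>Dominance order and conjugation\<close>

lemma sum_list_take_eq: "sum_list (take k \<sigma>) = (\<Sum>i<k. part \<sigma> i)"
proof (induction k)
  case (Suc k)
  then show ?case by (cases "k < length \<sigma>") (simp_all add: take_Suc_conv_app_nth part_def)
qed simp

lemma sum_part_eq: "length \<sigma> \<le> N \<Longrightarrow> (\<Sum>i<N. part \<sigma> i) = sum_list \<sigma>"
  by (simp flip: sum_list_take_eq)

lemma dominated_iff:
  "dominated \<mu> \<rho> \<longleftrightarrow> is_partition \<mu> \<and> is_partition \<rho> \<and> sum_list \<mu> = sum_list \<rho> \<and>
     (\<forall>k. (\<Sum>i<k. part \<mu> i) \<le> (\<Sum>i<k. part \<rho> i))"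
  by (simp add: dominated_def sum_list_take_eq)

lemma part_pos: "is_partition \<mu> \<Longrightarrow> i < length \<mu> \<Longrightarrow> part \<mu> i > 0"
  by (auto simp: is_partition_def part_def)

lemma part_inj:
  assumes "is_partition \<mu>" "is_partition \<rho>" "\<And>i. part \<mu> i = part \<rho> i"
  shows "\<mu> = \<rho>"
proof -
  have "length \<mu> = length \<rho>"
    using part_pos[OF assms(1), of "length \<rho>"] part_pos[OF assms(2), of "length \<mu>"]
      assms(3)[of "length \<rho>"] assms(3)[of "length \<mu>"]
    by (cases "length \<mu>" "length \<rho>" rule: linorder_cases) (auto simp: part_def)
  then show ?thesis
  proof (rule nth_equalityI)
    fix i assume "i < length \<mu>"
    with assms(3)[of i] \<open>length \<mu> = length \<rho>\<close> show "\<mu> ! i = \<rho> ! i" by (simp add: part_def)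
  qed
qed

lemma part_antimono: "is_partition \<mu> \<Longrightarrow> i \<le> j \<Longrightarrow> part \<mu> j \<le> part \<mu> i"
  by (cases "i = j") (auto simp: is_partition_def part_def sorted_wrt_iff_nth_less)

lemma dominated_refl: "is_partition \<mu> \<Longrightarrow> dominated \<mu> \<mu>"
  by (simp add: dominated_def)

lemma dominated_trans: "dominated \<mu> \<rho> \<Longrightarrow> dominated \<rho> \<sigma> \<Longrightarrow> dominated \<mu> \<sigma>"
  unfolding dominated_def by (metis order_trans)

lemma dominated_antisym:
  assumes "dominated \<mu> \<rho>" "dominated \<rho> \<mu>"
  shows "\<mu> = \<rho>"
proof (rule part_inj)
  have eq: "(\<Sum>i<k. part \<mu> i) = (\<Sum>i<k. part \<rho> i)" for k
    using assms by (metis dominated_iff order_antisym)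
  show "part \<mu> i = part \<rho> i" for i
    using eq[of i] eq[of "Suc i"] by simp
qed (use assms in \<open>auto simp: dominated_def\<close>)

text \<open>A numerical rank that increases strictly along dominance; it supports induction over the
  partial order and the choice of maximal partitions.\<close>

definition dom_rank :: "nat list \<Rightarrow> nat" where
  "dom_rank \<mu> = (\<Sum>k\<le>sum_list \<mu>. \<Sum>i<k. part \<mu> i)"

lemma length_le_sum_list: "is_partition \<mu> \<Longrightarrow> length \<mu> \<le> sum_list \<mu>"
  by (induction \<mu>) (auto simp: is_partition_def)

lemma dom_rank_less:
  assumes "dominated \<mu> \<rho>" "\<mu> \<noteq> \<rho>"
  shows "dom_rank \<mu> < dom_rank \<rho>"
proof -
  have le: "(\<Sum>i<k. part \<mu> i) \<le> (\<Sum>i<k. part \<rho> i)" for k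
    using assms by (simp add: dominated_iff)
  obtain k where k: "(\<Sum>i<k. part \<mu> i) \<noteq> (\<Sum>i<k. part \<rho> i)"
    using assms dominated_antisym[of \<mu> \<rho>] by (metis dominated_iff order_refl)
  \<comment> \<open>Partial sums of length beyond the size of the partition all equal that size, so
    a strict inequality must occur within the range of the rank.\<close>
  have "k \<le> sum_list \<mu>"
  proof (rule ccontr)
    assume "\<not> k \<le> sum_list \<mu>"
    then have "length \<mu> \<le> k" "length \<rho> \<le> k"
      using assms length_le_sum_list[of \<mu>] length_le_sum_list[of \<rho>] by (auto simp: dominated_def)
    then show False using k assms by (simp add: sum_part_eq dominated_def)
  qed
  moreover have "(\<Sum>i<k. part \<mu> i) < (\<Sum>i<k. part \<rho> i)" using k le[of k] by simp
  ultimately have "(\<Sum>k\<le>sum_list \<mu>. \<Sum>i<k. part \<mu> i) < (\<Sum>k\<le>sum_list \<mu>. \<Sum>i<k. part \<rho> i)"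
    using le by (intro sum_strict_mono_ex1) blast+
  then show ?thesis
    using assms by (simp add: dom_rank_def dominated_def)
qed

lemma le_part_0:
  assumes "is_partition \<mu>" "a \<in> set \<mu>"
  shows "a \<le> part \<mu> 0"
proof -
  obtain i where "i < length \<mu>" "\<mu> ! i = a" using assms(2) by (auto simp: in_set_conv_nth)
  then show ?thesis using part_antimono[OF assms(1), of 0 i] by (simp add: part_def split: if_splits)
qed

lemma part_conj: "is_partition \<mu> \<Longrightarrow> part (conj_partition \<mu>) j = length (filter (\<lambda>k. j < k) \<mu>)"
proof (cases "j < part \<mu> 0")
  case False
  assume \<mu>: "is_partition \<mu>"
  have "\<not> j < k" if "k \<in> set \<mu>" for k
    using le_part_0[OF \<mu> that] False by simp
  then show ?thesis using False by (simp add: conj_partition_def part_def filter_empty_conv)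
qed (auto simp: conj_partition_def part_def)

lemma length_conj: "length (conj_partition \<mu>) = part \<mu> 0"
  by (simp add: conj_partition_def)

text \<open>The rows longer than \<open>j\<close> form an initial segment, so their number exceeds
  \<open>i\<close> iff row \<open>i\<close> is one of them.\<close>

lemma less_part_conj_iff:
  assumes "is_partition \<mu>"
  shows "i < part (conj_partition \<mu>) j \<longleftrightarrow> j < part \<mu> i"
proof -
  let ?A = "{i. i < length \<mu> \<and> j < \<mu> ! i}"
  have part: "part (conj_partition \<mu>) j = card ?A"
    by (simp add: part_conj[OF assms] length_filter_conv_card)
  have down: "i' \<in> ?A" if "i \<in> ?A" "i' \<le> i" for i i'
    using part_antimono[OF assms that(2)] that by (auto simp: part_def)
  have fin: "finite ?A" by simp
  show ?thesis
  proof
    assume "j < part \<mu> i"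
    then have "i \<in> ?A" by (auto simp: part_def split: if_splits)
    then have "{..i} \<subseteq> ?A" using down by blast
    then have "card {..i} \<le> card ?A" by (rule card_mono[OF fin])
    then show "i < part (conj_partition \<mu>) j" by (simp add: part)
  next
    assume *: "i < part (conj_partition \<mu>) j"
    show "j < part \<mu> i"
    proof (rule ccontr)
      assume "\<not> j < part \<mu> i"
      then have "i \<notin> ?A" by (auto simp: part_def)
      then have "?A \<subseteq> {..<i}" using down[of _ i] by (auto simp: not_less[symmetric])
      then have "card ?A \<le> card {..<i}" by (rule card_mono[OF finite_lessThan])
      with * show False by (simp add: part)
    qed
  qed
qed

lemma is_partition_conj:
  assumes "is_partition \<mu>"
  shows "is_partition (conj_partition \<mu>)"
proof -
  have "sorted_wrt (\<ge>) (conj_partition \<mu>)"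
    unfolding conj_partition_def sorted_wrt_map
    by (rule sorted_wrt_mono_rel[OF _ sorted_wrt_upt])
      (auto simp: length_filter_conv_card intro!: card_mono)
  moreover have "0 < k" if k: "k \<in> set (conj_partition \<mu>)" for k
  proof -
    obtain j where j: "j < part \<mu> 0" "k = length (filter (\<lambda>k. j < k) \<mu>)"
      using k unfolding conj_partition_def by auto
    then show ?thesis using less_part_conj_iff[OF assms, of 0 j] part_conj[OF assms] by simp
  qed
  ultimately show ?thesis by (simp add: is_partition_def)
qed

lemma conj_conj:
  assumes "is_partition \<mu>"
  shows "conj_partition (conj_partition \<mu>) = \<mu>"
proof (rule part_inj)
  show "is_partition (conj_partition (conj_partition \<mu>))" "is_partition \<mu>"
    using assms is_partition_conj by auto
  fix i
  have *: "j < part (conj_partition (conj_partition \<mu>)) i \<longleftrightarrow> j < part \<mu> i" for j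
    by (simp add: less_part_conj_iff[OF assms] less_part_conj_iff[OF is_partition_conj[OF assms]])
  show "part (conj_partition (conj_partition \<mu>)) i = part \<mu> i"
    using *[of "part \<mu> i"] *[of "part (conj_partition (conj_partition \<mu>)) i"] by simp
qed

lemma sum_part_conj:
  assumes "is_partition \<mu>"
  shows "(\<Sum>j<k. part (conj_partition \<mu>) j) = sum_list (map (\<lambda>a. min a k) \<mu>)"
proof -
  have "(\<Sum>j<k. length (filter (\<lambda>a. j < a) \<nu>)) = sum_list (map (\<lambda>a. min a k) \<nu>)" for \<nu> :: "nat list"
  proof (induction \<nu>)
    case (Cons a \<nu>)
    have "(\<Sum>j<k. if j < a then 1 else 0) = min a k"
      by (induction k) auto
    moreover have "(\<Sum>j<k. length (filter (\<lambda>a. j < a) (a # \<nu>))) =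
      (\<Sum>j<k. if j < a then 1 else 0) + (\<Sum>j<k. length (filter (\<lambda>a. j < a) \<nu>))"
      unfolding sum.distrib[symmetric] by (rule sum.cong) auto
    ultimately show ?case using Cons by simp
  qed simp
  then show ?thesis by (simp add: part_conj[OF assms])
qed

lemma sum_list_map_part: "length \<mu> \<le> N \<Longrightarrow> f 0 = 0 \<Longrightarrow> sum_list (map f \<mu>) = (\<Sum>i<N. f (part \<mu> i))"
  for f :: "nat \<Rightarrow> nat"
proof -
  assume *: "length \<mu> \<le> N" "f 0 = 0"
  have "sum_list (map f \<mu>) = (\<Sum>i<length \<mu>. f (part \<mu> i))"
    by (simp add: sum_list_sum_nth atLeast0LessThan part_def)
  also have "\<dots> = (\<Sum>i<N. f (part \<mu> i))"
    by (rule sum.mono_neutral_left) (use * in \<open>auto simp: part_def\<close>)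
  finally show ?thesis .
qed

lemma sum_list_conj:
  assumes "is_partition \<mu>"
  shows "sum_list (conj_partition \<mu>) = sum_list \<mu>"
proof -
  have "sum_list (conj_partition \<mu>) = sum_list (map (\<lambda>a. min a (part \<mu> 0)) \<mu>)"
    by (simp add: sum_part_conj[OF assms] length_conj flip: sum_part_eq[of "conj_partition \<mu>" "part \<mu> 0"])
  also have "map (\<lambda>a. min a (part \<mu> 0)) \<mu> = map (\<lambda>a. a) \<mu>"
    using le_part_0[OF assms] by (intro map_cong) (auto simp: min_def)
  finally show ?thesis by simp
qed

lemma conj_partitions_of: "\<mu> \<in> partitions_of n \<Longrightarrow> conj_partition \<mu> \<in> partitions_of n"
  by (simp add: partitions_of_def is_partition_conj sum_list_conj)

text \<open>The first \<open>k\<close> columns hold the cells counted by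
  \<open>min (part \<mu> i) k\<close>. The cells outside them are counted by truncated differences,
  and that count is monotone in dominance.\<close>

lemma dominated_conj:
  assumes "dominated \<mu> \<rho>"
  shows "dominated (conj_partition \<rho>) (conj_partition \<mu>)"
proof -
  have p: "is_partition \<mu>" "is_partition \<rho>" "sum_list \<mu> = sum_list \<rho>"
    using assms by (auto simp: dominated_def)
  define N where "N = max (length \<mu>) (length \<rho>)"
  have split: "(\<Sum>i<N. min (part \<sigma> i) k) + (\<Sum>i<N. part \<sigma> i - k) = sum_list \<sigma>"
    if "length \<sigma> \<le> N" for \<sigma> k
    unfolding sum.distrib[symmetric] by (subst sum_part_eq[OF that, symmetric]) (auto intro!: sum.cong)
  have le: "(\<Sum>i<N. part \<mu> i - k) \<le> (\<Sum>i<N. part \<rho> i - k)" for k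
  proof -
    \<comment> \<open>The number of rows of \<open>\<mu>\<close> longer than \<open>k\<close>. On
      these rows the subtraction is not truncated, so the prefix sums of length \<open>l\<close> can
      be compared.\<close>
    define l where "l = part (conj_partition \<mu>) k"
    have l: "i < l \<longleftrightarrow> k < part \<mu> i" for i
      by (simp add: l_def less_part_conj_iff p)
    have lN: "l \<le> N"
      using l[of N] by (auto simp: part_def N_def split: if_splits)
    have "(\<Sum>i<N. part \<mu> i - k) = (\<Sum>i<l. part \<mu> i - k)"
      by (rule sum.mono_neutral_right) (use l lN in \<open>auto simp: not_less[symmetric]\<close>)
    also have "\<dots> + l * k = (\<Sum>i<l. (part \<mu> i - k) + k)"
      by (simp add: sum.distrib)
    also have "\<dots> = (\<Sum>i<l. part \<mu> i)" by (rule sum.cong) (use l in auto)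
    also have "\<dots> \<le> (\<Sum>i<l. part \<rho> i)" using assms by (simp add: dominated_iff)
    also have "\<dots> \<le> (\<Sum>i<l. (part \<rho> i - k) + k)" by (rule sum_mono) simp
    also have "\<dots> = (\<Sum>i<l. part \<rho> i - k) + l * k" by (simp add: sum.distrib)
    also have "(\<Sum>i<l. part \<rho> i - k) \<le> (\<Sum>i<N. part \<rho> i - k)"
      by (rule sum_mono2) (use lN in auto)
    finally show ?thesis by simp
  qed
  have "(\<Sum>i<N. min (part \<rho> i) k) \<le> (\<Sum>i<N. min (part \<mu> i) k)" for k
    using split[of \<mu> k] split[of \<rho> k] p(3) le[of k] unfolding N_def by linarith
  moreover have "sum_list (map (\<lambda>a. min a k) \<sigma>) = (\<Sum>i<N. min (part \<sigma> i) k)" if "length \<sigma> \<le> N" for \<sigma> k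
    by (rule sum_list_map_part) (use that in auto)
  ultimately show ?thesis
    by (simp add: dominated_iff is_partition_conj sum_list_conj p sum_part_conj N_def)
qed

section \<open>Triangularity of the elementary symmetric functions\<close>

lemma poly_mapping_expand: "f = (\<Sum>a\<in>Poly_Mapping.keys f. Poly_Mapping.single a (Poly_Mapping.lookup f a))"
  for f :: "'m \<Rightarrow>\<^sub>0 'k::comm_monoid_add"
proof (rule poly_mapping_eqI)
  fix k
  have "Poly_Mapping.lookup (\<Sum>a\<in>Poly_Mapping.keys f. Poly_Mapping.single a (Poly_Mapping.lookup f a)) k =
    (\<Sum>a\<in>Poly_Mapping.keys f. if a = k then Poly_Mapping.lookup f k else 0)"
    unfolding lookup_sum by (rule sum.cong) (auto simp: lookup_single when_def)
  then show "Poly_Mapping.lookup f k =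
    Poly_Mapping.lookup (\<Sum>a\<in>Poly_Mapping.keys f. Poly_Mapping.single a (Poly_Mapping.lookup f a)) k"
    by (simp add: in_keys_iff)
qed

lemma lookup_times_sum:
  fixes f g :: "'m::comm_monoid_add \<Rightarrow>\<^sub>0 'k::comm_ring_1"
  shows "Poly_Mapping.lookup (f * g) k = (\<Sum>(a, b)\<in>Poly_Mapping.keys f \<times> Poly_Mapping.keys g.
    if a + b = k then Poly_Mapping.lookup f a * Poly_Mapping.lookup g b else 0)"
proof -
  have "f * g = (\<Sum>a\<in>Poly_Mapping.keys f. Poly_Mapping.single a (Poly_Mapping.lookup f a)) *
     (\<Sum>b\<in>Poly_Mapping.keys g. Poly_Mapping.single b (Poly_Mapping.lookup g b))"
    by (simp only: poly_mapping_expand[symmetric])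
  also have "\<dots> = (\<Sum>(a, b)\<in>Poly_Mapping.keys f \<times> Poly_Mapping.keys g.
      Poly_Mapping.single (a + b) (Poly_Mapping.lookup f a * Poly_Mapping.lookup g b))"
    by (simp add: sum_product mult_single sum.cartesian_product)
  finally show ?thesis
    by (auto simp: lookup_sum lookup_single when_def case_prod_unfold intro!: sum.cong)
qed

lemma lookup_times_ge:
  fixes f g :: "'m::comm_monoid_add \<Rightarrow>\<^sub>0 'k::linordered_field"
  assumes "\<And>k. Poly_Mapping.lookup f k \<ge> 0" "\<And>k. Poly_Mapping.lookup g k \<ge> 0"
  shows "Poly_Mapping.lookup (f * g) k \<ge> 0"
    "Poly_Mapping.lookup (f * g) (a + b) \<ge> Poly_Mapping.lookup f a * Poly_Mapping.lookup g b"
proof -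
  let ?t = "\<lambda>k (a, b). if a + b = k then Poly_Mapping.lookup f a * Poly_Mapping.lookup g b else 0"
  have nn: "?t k x \<ge> 0" for k x
    using assms by (cases x) auto
  show "Poly_Mapping.lookup (f * g) k \<ge> 0"
    unfolding lookup_times_sum using nn by (auto intro!: sum_nonneg simp: case_prod_unfold assms)
  show "Poly_Mapping.lookup (f * g) (a + b) \<ge> Poly_Mapping.lookup f a * Poly_Mapping.lookup g b"
  proof (cases "a \<in> Poly_Mapping.keys f \<and> b \<in> Poly_Mapping.keys g")
    case True
    have "?t (a + b) (a, b) \<le> sum (?t (a + b)) (Poly_Mapping.keys f \<times> Poly_Mapping.keys g)"
      by (rule member_le_sum) (use True nn in \<open>auto simp: assms\<close>)
    then show ?thesis by (simp add: lookup_times_sum)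
  next
    case False
    then have "Poly_Mapping.lookup f a * Poly_Mapping.lookup g b = 0" by (simp add: in_keys_iff)
    moreover have "Poly_Mapping.lookup (f * g) (a + b) \<ge> 0"
      unfolding lookup_times_sum using nn by (auto intro!: sum_nonneg simp: case_prod_unfold assms)
    ultimately show ?thesis by linarith
  qed
qed

lemma homog_prod_hsym: "homog (\<Sum>i<N. \<alpha> i) (\<Prod>i<N. hsym (\<alpha> i))" for N :: nat
proof (induction N)
  case (Suc N)
  show ?case using homog_mult[OF Suc homog_hsym[of "\<alpha> N"]] by simp
qed (simp add: homog_one)

lemma prod_indicator:
  "finite A \<Longrightarrow> (\<Prod>i\<in>A. if P i then 1 else 0) = (if \<forall>i\<in>A. P i then 1 else 0 :: 'k::comm_ring_1)"
  by (induction A rule: finite_induct) auto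

lemma lookup_in_vars_esym:
  assumes "Poly_Mapping.keys \<alpha> \<subseteq> {..<N}"
  shows "Poly_Mapping.lookup (in_vars N (scale sgnc (hsym r) :: 'k::field_char_0 symf)) \<alpha> =
    (if (\<Sum>i<N. Poly_Mapping.lookup \<alpha> i) = r \<and> (\<forall>i<N. Poly_Mapping.lookup \<alpha> i \<le> 1) then 1 else 0)"
proof -
  let ?h = "\<Prod>i<N. hsym (Poly_Mapping.lookup \<alpha> i) :: 'k symf"
  have "hall (scale sgnc (hsym r)) ?h = pleth (\<lambda>c. c) sgnc ?h" if "(\<Sum>i<N. Poly_Mapping.lookup \<alpha> i) = r"
    by (rule hall_esym) (use that homog_prod_hsym in auto)
  moreover have "hall (scale sgnc (hsym r)) ?h = 0" if "(\<Sum>i<N. Poly_Mapping.lookup \<alpha> i) \<noteq> r"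
    by (rule hall_homog_neq[OF homog_scale[OF homog_hsym] homog_prod_hsym]) (use that in auto)
  moreover have "pleth (\<lambda>c. c) sgnc ?h = (if \<forall>i<N. Poly_Mapping.lookup \<alpha> i \<le> 1 then 1 else 0)"
    unfolding comm_ring_homD[OF comm_ring_hom_pleth[OF comm_ring_hom_id]] pleth_sgnc_hsym
    by (subst prod_indicator) auto
  ultimately show ?thesis unfolding lookup_in_vars[OF assms]
    by (cases "(\<Sum>i<N. Poly_Mapping.lookup \<alpha> i) = r") (simp_all del: One_nat_def)
qed

lemma in_vars_scale_hl_Cons:
  "in_vars N (scale sgnc (prod_list (map hsym (r # \<sigma>)))) =
    in_vars N (scale sgnc (hsym r)) * in_vars N (scale sgnc (prod_list (map hsym \<sigma>)))"
  by (simp add: scale_simps comm_ring_homD[OF in_vars_hom])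

lemma sum_lookup_add: "(\<Sum>i<k. Poly_Mapping.lookup (\<beta> + \<gamma>) i) =
  (\<Sum>i<k. Poly_Mapping.lookup \<beta> i) + (\<Sum>i<k. Poly_Mapping.lookup \<gamma> i)" for \<beta> :: "nat \<Rightarrow>\<^sub>0 nat" and k :: nat
  by (simp add: lookup_add sum.distrib)

text \<open>A monomial of \<open>e_r\<close> is squarefree of degree \<open>r\<close>, so a factor
  \<open>e_r\<close> adds at most \<open>min r k\<close> to the total exponent of the first
  \<open>k\<close> variables.\<close>

lemma esym_support:
  assumes "Poly_Mapping.lookup (in_vars N (scale sgnc (prod_list (map hsym \<sigma>)) :: 'k::field_char_0 symf)) \<alpha> \<noteq> 0"
  shows "(\<Sum>i<k. Poly_Mapping.lookup \<alpha> i) \<le> sum_list (map (\<lambda>a. min a k) \<sigma>)"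
  using assms
proof (induction \<sigma> arbitrary: \<alpha>)
  case Nil
  then have "\<alpha> = 0"
    by (simp add: scale_simps comm_ring_homD[OF in_vars_hom] lookup_one when_def split: if_splits)
  then show ?case by simp
next
  case (Cons r \<sigma>)
  let ?e = "in_vars N (scale sgnc (hsym r) :: 'k symf)"
  let ?f = "in_vars N (scale sgnc (prod_list (map hsym \<sigma>)) :: 'k symf)"
  have "\<alpha> \<in> Poly_Mapping.keys (?e * ?f)"
    using Cons.prems unfolding in_vars_scale_hl_Cons by (simp add: in_keys_iff)
  then obtain \<beta> \<gamma> where *: "\<alpha> = \<beta> + \<gamma>" "\<beta> \<in> Poly_Mapping.keys ?e" "\<gamma> \<in> Poly_Mapping.keys ?f"
    using keys_mult[of ?e ?f] by blast
  have \<beta>: "Poly_Mapping.keys \<beta> \<subseteq> {..<N}"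
    using *(2) lookup_in_vars_outside by (metis in_keys_iff)
  then have \<beta>': "(\<Sum>i<N. Poly_Mapping.lookup \<beta> i) = r" "\<forall>i<N. Poly_Mapping.lookup \<beta> i \<le> 1"
    using *(2) by (auto simp: in_keys_iff lookup_in_vars_esym split: if_splits)
  have "Poly_Mapping.lookup \<beta> i \<le> 1" for i
  proof (cases "i < N")
    case False
    then have "i \<notin> Poly_Mapping.keys \<beta>" using \<beta> by auto
    then show ?thesis by (simp add: in_keys_iff)
  qed (use \<beta>' in auto)
  then have "(\<Sum>i<k. Poly_Mapping.lookup \<beta> i) \<le> (\<Sum>i<k. 1)" by (intro sum_mono) auto
  then have 1: "(\<Sum>i<k. Poly_Mapping.lookup \<beta> i) \<le> k" by simp
  have "(\<Sum>i<k. Poly_Mapping.lookup \<beta> i) \<le> (\<Sum>i<max k N. Poly_Mapping.lookup \<beta> i)"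
    by (rule sum_mono2) auto
  also have "\<dots> = (\<Sum>i<N. Poly_Mapping.lookup \<beta> i)"
    by (rule sum.mono_neutral_right) (use \<beta> in \<open>auto simp: in_keys_iff subset_iff\<close>)
  finally have "(\<Sum>i<k. Poly_Mapping.lookup \<beta> i) \<le> min r k" using 1 \<beta>' by simp
  moreover have "(\<Sum>i<k. Poly_Mapping.lookup \<gamma> i) \<le> sum_list (map (\<lambda>a. min a k) \<sigma>)"
    using *(3) Cons.IH by (simp add: in_keys_iff)
  ultimately have "(\<Sum>i<k. Poly_Mapping.lookup \<beta> i) + (\<Sum>i<k. Poly_Mapping.lookup \<gamma> i) \<le>
    min r k + sum_list (map (\<lambda>a. min a k) \<sigma>)" by (rule add_mono)
  then show ?case unfolding *(1) sum_lookup_add by simp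
qed

lemma hall_esym_triangular:
  assumes "is_partition \<rho>" "is_partition \<sigma>"
    "hall (scale sgnc (prod_list (map hsym \<rho>)) :: 'k::field_char_0 symf) (prod_list (map hsym \<sigma>)) \<noteq> 0"
  shows "dominated \<sigma> (conj_partition \<rho>)"
proof -
  let ?F = "scale sgnc (prod_list (map hsym \<rho>)) :: 'k symf"
  have "Poly_Mapping.lookup (in_vars (length \<sigma>) ?F) (Poly_Mapping.nth \<sigma>) \<noteq> 0"
    using assms(3) by (simp add: lookup_in_vars_part)
  from esym_support[OF this] have "(\<Sum>i<k. part \<sigma> i) \<le> (\<Sum>i<k. part (conj_partition \<rho>) i)" for k
    by (simp only: lookup_nth_part sum_part_conj[OF assms(1)])
  moreover have "sum_list \<rho> = sum_list \<sigma>"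
    using assms(3) hall_homog_neq[OF homog_scale[OF homog_prod_list_hsym] homog_prod_list_hsym] by metis
  ultimately show ?thesis
    using assms by (simp add: dominated_iff is_partition_conj sum_list_conj)
qed

text \<open>The coefficients of a product of elementary symmetric functions are nonnegative, and the
  product of the monomials \<open>x\<^sub>0 \<cdots> x\<^bsub>r-1\<^esub>\<close> contributes \<open>1\<close> to the extremal one.\<close>

lemma esym_positive:
  fixes N :: nat
  assumes "\<forall>a\<in>set \<sigma>. a \<le> N"
  shows "(\<forall>\<alpha>. Poly_Mapping.lookup (in_vars N (scale sgnc (prod_list (map hsym \<sigma>)) :: 'k::linordered_field symf)) \<alpha> \<ge> 0) \<and>
    (\<exists>\<alpha>. (\<forall>j. Poly_Mapping.lookup \<alpha> j = length (filter (\<lambda>a. j < a) \<sigma>)) \<and>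
      Poly_Mapping.lookup (in_vars N (scale sgnc (prod_list (map hsym \<sigma>)) :: 'k symf)) \<alpha> \<ge> 1)"
  using assms
proof (induction \<sigma>)
  case Nil
  show ?case
    by (auto simp: scale_simps comm_ring_homD[OF in_vars_hom] lookup_one when_def intro!: exI[of _ 0])
next
  case (Cons r \<sigma>)
  let ?e = "in_vars N (scale sgnc (hsym r) :: 'k symf)"
  let ?f = "in_vars N (scale sgnc (prod_list (map hsym \<sigma>)) :: 'k symf)"
  obtain \<gamma> where \<gamma>: "\<And>j. Poly_Mapping.lookup \<gamma> j = length (filter (\<lambda>a. j < a) \<sigma>)" "Poly_Mapping.lookup ?f \<gamma> \<ge> 1"
    and f: "\<And>\<alpha>. Poly_Mapping.lookup ?f \<alpha> \<ge> 0"
    using Cons by auto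
  have e: "Poly_Mapping.lookup ?e \<alpha> \<ge> 0" for \<alpha>
    by (cases "Poly_Mapping.keys \<alpha> \<subseteq> {..<N}") (simp_all add: lookup_in_vars_esym lookup_in_vars_outside)
  define \<beta> :: "nat \<Rightarrow>\<^sub>0 nat" where "\<beta> = (\<Sum>j<r. Poly_Mapping.single j 1)"
  have \<beta>: "Poly_Mapping.lookup \<beta> j = (if j < r then 1 else 0)" for j
    by (simp add: \<beta>_def lookup_sum lookup_single when_def)
  have "Poly_Mapping.lookup ?e \<beta> = 1"
  proof (subst lookup_in_vars_esym)
    show "Poly_Mapping.keys \<beta> \<subseteq> {..<N}"
      using Cons.prems by (auto simp: in_keys_iff \<beta> split: if_splits)
    have "(\<Sum>i<N. if i < r then 1 else 0) = (\<Sum>i<r. 1::nat)"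
      by (rule sum.mono_neutral_cong_right) (use Cons.prems in auto)
    then show "(if (\<Sum>i<N. Poly_Mapping.lookup \<beta> i) = r \<and> (\<forall>i<N. Poly_Mapping.lookup \<beta> i \<le> 1) then 1 else 0) = (1::'k)"
      by (simp add: \<beta>)
  qed
  then have "1 \<le> Poly_Mapping.lookup ?e \<beta> * Poly_Mapping.lookup ?f \<gamma>" using \<gamma> by simp
  also have "\<dots> \<le> Poly_Mapping.lookup (?e * ?f) (\<beta> + \<gamma>)"
    by (rule lookup_times_ge[OF e f])
  finally have "1 \<le> Poly_Mapping.lookup (?e * ?f) (\<beta> + \<gamma>)" .
  moreover have "\<forall>j. Poly_Mapping.lookup (\<beta> + \<gamma>) j = length (filter (\<lambda>a. j < a) (r # \<sigma>))"
    by (simp add: lookup_add \<beta> \<gamma>(1))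
  ultimately show ?case
    unfolding in_vars_scale_hl_Cons using lookup_times_ge(1)[OF e f] by blast
qed

lemma hall_esym_conj:
  assumes "is_partition \<rho>"
  shows "hall (scale sgnc (prod_list (map hsym \<rho>)) :: 'k::linordered_field symf)
    (prod_list (map hsym (conj_partition \<rho>))) \<ge> 1"
proof -
  let ?N = "part \<rho> 0"
  let ?F = "scale sgnc (prod_list (map hsym \<rho>)) :: 'k symf"
  obtain \<alpha> where \<alpha>: "\<And>j. Poly_Mapping.lookup \<alpha> j = length (filter (\<lambda>a. j < a) \<rho>)"
    "Poly_Mapping.lookup (in_vars ?N ?F) \<alpha> \<ge> 1"
    using esym_positive[of \<rho> ?N, where 'k = 'k] le_part_0[OF assms] by auto
  have "\<alpha> = Poly_Mapping.nth (conj_partition \<rho>)"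
    by (rule poly_mapping_eqI) (simp only: lookup_nth_part \<alpha>(1) part_conj[OF assms])
  then show ?thesis using \<alpha>(2) by (simp add: lookup_in_vars_part length_conj)
qed

section \<open>Upper and lower triangular elements\<close>

text \<open>\<open>F\<close> lies in the span of the \<open>m\<^sub>\<sigma>\<close> with \<open>\<sigma> \<le> \<tau>\<close>, respectively of the \<open>h\<^sub>\<sigma>\<close> with \<open>\<sigma> \<ge> \<tau>\<close>.\<close>

definition lower :: "nat list \<Rightarrow> 'k::field_char_0 symf \<Rightarrow> bool" where
  "lower \<tau> F \<longleftrightarrow> homog (sum_list \<tau>) F \<and> (\<forall>\<sigma>. is_partition \<sigma> \<longrightarrow>
     hall F (prod_list (map hsym \<sigma>)) \<noteq> 0 \<longrightarrow> dominated \<sigma> \<tau>)"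

definition upper :: "nat list \<Rightarrow> 'k::field_char_0 symf \<Rightarrow> bool" where
  "upper \<tau> F \<longleftrightarrow> homog (sum_list \<tau>) F \<and> (\<forall>\<sigma>. is_partition \<sigma> \<longrightarrow>
     hall F (mono_symf \<sigma>) \<noteq> 0 \<longrightarrow> dominated \<tau> \<sigma>)"

lemma lower_smul: "lower \<tau> F \<Longrightarrow> lower \<tau> (smul c F)"
  by (auto simp: lower_def homog_smul hall_smul_left)

lemma partitions_of_iff: "\<mu> \<in> partitions_of n \<longleftrightarrow> is_partition \<mu> \<and> sum_list \<mu> = n"
  by (simp add: partitions_of_def)

lemma hall_scale_upper_expand:
  assumes "homog n F"
  shows "hall (scale c F) G = (\<Sum>\<rho>\<in>partitions_of n. hall F (mono_symf \<rho>) *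
    hall (scale c (prod_list (map hsym \<rho>))) G)"
proof -
  have "hall (scale c F) G = hall (scale c (\<Sum>\<rho>\<in>partitions_of n. smul (hall F (mono_symf \<rho>)) (prod_list (map hsym \<rho>)))) G"
    by (rule arg_cong[OF expand_complete[OF assms], of "\<lambda>F. hall (scale c F) G"])
  then show ?thesis by (simp add: scale_simps scale_smul hall_sum_left hall_smul_left)
qed

lemma sum_single_term:
  assumes "finite A" "a \<in> A" "\<And>x. x \<in> A \<Longrightarrow> x \<noteq> a \<Longrightarrow> f x = 0"
  shows "sum f A = f a"
  using sum.remove[OF assms(1,2), of f] assms(3) by (simp add: sum.neutral)

text \<open>Omega turns \<open>h_\<rho>\<close> into \<open>e_\<rho>\<close>, which is supported
  below the conjugate of \<open>\<rho>\<close>, and conjugation reverses dominance. The leading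
  coefficient is multiplied by that of \<open>e_\<tau>\<close>.\<close>

lemma lower_omega_upper:
  assumes \<tau>: "is_partition \<tau>" and F: "upper \<tau> F"
  shows "lower (conj_partition \<tau>) (scale sgnc F)"
    "hall (scale sgnc F) (prod_list (map hsym (conj_partition \<tau>))) =
      hall F (mono_symf \<tau>) * hall (scale sgnc (prod_list (map hsym \<tau>))) (prod_list (map hsym (conj_partition \<tau>)))"
proof -
  let ?n = "sum_list \<tau>"
  have h: "homog ?n F" using F by (simp add: upper_def)
  have nz: "dominated \<sigma> (conj_partition \<rho>) \<and> dominated \<tau> \<rho>"
    if "\<rho> \<in> partitions_of ?n" "is_partition \<sigma>"
      "hall F (mono_symf \<rho>) * hall (scale sgnc (prod_list (map hsym \<rho>))) (prod_list (map hsym \<sigma>)) \<noteq> 0" for \<rho> \<sigma>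
    using that F hall_esym_triangular[of \<rho> \<sigma>, where 'k = 'a] by (auto simp: upper_def partitions_of_iff)
  show "lower (conj_partition \<tau>) (scale sgnc F)"
    unfolding lower_def
  proof (intro conjI allI impI)
    show "homog (sum_list (conj_partition \<tau>)) (scale sgnc F)"
      using h \<tau> by (simp add: sum_list_conj homog_scale)
    fix \<sigma> assume \<sigma>: "is_partition \<sigma>" "hall (scale sgnc F) (prod_list (map hsym \<sigma>)) \<noteq> 0"
    then obtain \<rho> where "\<rho> \<in> partitions_of ?n"
      "hall F (mono_symf \<rho>) * hall (scale sgnc (prod_list (map hsym \<rho>))) (prod_list (map hsym \<sigma>)) \<noteq> 0"
      unfolding hall_scale_upper_expand[OF h] by (rule_tac sum.not_neutral_contains_not_neutral)
    with nz[OF _ \<sigma>(1)] show "dominated \<sigma> (conj_partition \<tau>)"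
      by (blast intro: dominated_trans dominated_conj)
  qed
  show "hall (scale sgnc F) (prod_list (map hsym (conj_partition \<tau>))) =
      hall F (mono_symf \<tau>) * hall (scale sgnc (prod_list (map hsym \<tau>))) (prod_list (map hsym (conj_partition \<tau>)))"
    unfolding hall_scale_upper_expand[OF h]
  proof (rule sum_single_term[OF finite_partitions_of])
    show "\<tau> \<in> partitions_of ?n" using \<tau> by (simp add: partitions_of_iff)
    fix \<rho> assume \<rho>: "\<rho> \<in> partitions_of ?n" "\<rho> \<noteq> \<tau>"
    show "hall F (mono_symf \<rho>) * hall (scale sgnc (prod_list (map hsym \<rho>))) (prod_list (map hsym (conj_partition \<tau>))) = 0"
    proof (rule ccontr)
      assume "\<not> ?thesis"
      from nz[OF \<rho>(1) is_partition_conj[OF \<tau>] this]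
      have "dominated (conj_partition (conj_partition \<rho>)) (conj_partition (conj_partition \<tau>))" "dominated \<tau> \<rho>"
        by (auto intro: dominated_conj)
      then have "\<rho> = \<tau>" using \<rho> \<tau> by (auto simp: conj_conj partitions_of_iff intro: dominated_antisym)
      with \<rho> show False by simp
    qed
  qed
qed

text \<open>With \<open>F\<close> expanded in monomial and \<open>G\<close> in complete functions,
  only \<open>\<rho>\<close> between \<open>\<mu>\<close> and \<open>\<tau>\<close> contribute; for
  \<open>\<tau> = \<mu>\<close> this is a single term.\<close>

lemma hall_lower_upper:
  assumes "lower \<tau> F" "upper \<mu> G"
  shows "hall F G \<noteq> 0 \<Longrightarrow> dominated \<mu> \<tau>"
    "\<tau> = \<mu> \<Longrightarrow> is_partition \<tau> \<Longrightarrow> hall F G = hall F (prod_list (map hsym \<tau>)) * hall G (mono_symf \<tau>)"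
proof -
  let ?n = "sum_list \<tau>"
  have h: "homog ?n F" using assms by (simp add: lower_def)
  have eq: "hall F G = (\<Sum>\<rho>\<in>partitions_of ?n. hall F (prod_list (map hsym \<rho>)) * hall G (mono_symf \<rho>))"
    using hall_expand[OF h, of G] by (simp add: hall_commute)
  have nz: "dominated \<rho> \<tau> \<and> dominated \<mu> \<rho>" if "\<rho> \<in> partitions_of ?n"
    "hall F (prod_list (map hsym \<rho>)) * hall G (mono_symf \<rho>) \<noteq> 0" for \<rho>
    using that assms by (auto simp: lower_def upper_def partitions_of_iff)
  show "dominated \<mu> \<tau>" if ne: "hall F G \<noteq> 0"
  proof -
    obtain \<rho> where "\<rho> \<in> partitions_of ?n" "hall F (prod_list (map hsym \<rho>)) * hall G (mono_symf \<rho>) \<noteq> 0"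
      using ne unfolding eq by (rule sum.not_neutral_contains_not_neutral)
    with nz show ?thesis by (blast intro: dominated_trans)
  qed
  show "hall F G = hall F (prod_list (map hsym \<tau>)) * hall G (mono_symf \<tau>)" if "\<tau> = \<mu>" "is_partition \<tau>"
    unfolding eq
  proof (rule sum_single_term[OF finite_partitions_of])
    show "\<tau> \<in> partitions_of ?n" using that by (simp add: partitions_of_iff)
    show "hall F (prod_list (map hsym \<rho>)) * hall G (mono_symf \<rho>) = 0"
      if "\<rho> \<in> partitions_of ?n" "\<rho> \<noteq> \<tau>" for \<rho>
      using nz[OF that(1)] that(2) \<open>\<tau> = \<mu>\<close> dominated_antisym by blast
  qed
qed

text \<open>A triangular transition matrix with nonzero diagonal is inverted by induction on
  \<open>dom_rank\<close>.\<close>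

lemma mono_in_span_lower:
  fixes F :: "nat list \<Rightarrow> 'k::field_char_0 symf"
  assumes "\<And>\<tau>. \<tau> \<in> partitions_of n \<Longrightarrow> lower \<tau> (F \<tau>)"
    "\<And>\<tau>. \<tau> \<in> partitions_of n \<Longrightarrow> hall (F \<tau>) (prod_list (map hsym \<tau>)) \<noteq> 0"
    and "\<tau> \<in> partitions_of n"
  shows "mono_symf \<tau> \<in> symf.span (F ` {\<mu>. dominated \<mu> \<tau>})"
  using assms(3)
proof (induction "dom_rank \<tau>" arbitrary: \<tau> rule: less_induct)
  case less
  note \<tau> = less.prems
  let ?c = "\<lambda>\<rho>. hall (F \<tau>) (prod_list (map hsym \<rho>))"
  let ?S = "symf.span (F ` {\<mu>. dominated \<mu> \<tau>})"
  have "homog n (F \<tau>)" using assms(1)[OF \<tau>] \<tau> by (auto simp: lower_def partitions_of_iff)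
  then have "F \<tau> = (\<Sum>\<rho>\<in>partitions_of n. smul (?c \<rho>) (mono_symf \<rho>))" by (rule expand_mono)
  also have "\<dots> = smul (?c \<tau>) (mono_symf \<tau>) + (\<Sum>\<rho>\<in>partitions_of n - {\<tau>}. smul (?c \<rho>) (mono_symf \<rho>))"
    by (rule sum.remove[OF finite_partitions_of \<tau>])
  finally have "smul (?c \<tau>) (mono_symf \<tau>) = F \<tau> - (\<Sum>\<rho>\<in>partitions_of n - {\<tau>}. smul (?c \<rho>) (mono_symf \<rho>))"
    by (simp only: eq_diff_eq)
  moreover have "F \<tau> \<in> ?S"
    using \<tau> by (intro symf.span_base) (auto simp: partitions_of_iff dominated_refl)
  moreover have "smul (?c \<rho>) (mono_symf \<rho>) \<in> ?S" if "\<rho> \<in> partitions_of n - {\<tau>}" for \<rho>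
  proof (cases "?c \<rho> = 0")
    case True
    then show ?thesis by (simp add: symf.span_zero)
  next
    case False
    then have dom: "dominated \<rho> \<tau>" using assms(1)[OF \<tau>] that by (auto simp: lower_def partitions_of_iff)
    have "mono_symf \<rho> \<in> symf.span (F ` {\<mu>. dominated \<mu> \<rho>})"
      by (rule less.hyps) (use dom_rank_less[OF dom] that in auto)
    also have "\<dots> \<subseteq> ?S"
      by (rule symf.span_mono) (use dom dominated_trans in blast)
    finally show ?thesis by (rule symf.span_scale)
  qed
  ultimately have "smul (?c \<tau>) (mono_symf \<tau>) \<in> ?S"
    by (metis (no_types, lifting) symf.span_diff symf.span_sum)
  from symf.span_scale[OF this, of "1 / ?c \<tau>"] show ?case
    using assms(2)[OF \<tau>] by (simp add: smul_smul)
qed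

lemma homog_in_span_lower:
  fixes F :: "nat list \<Rightarrow> 'k::field_char_0 symf"
  assumes "\<And>\<tau>. \<tau> \<in> partitions_of n \<Longrightarrow> lower \<tau> (F \<tau>)"
    "\<And>\<tau>. \<tau> \<in> partitions_of n \<Longrightarrow> hall (F \<tau>) (prod_list (map hsym \<tau>)) \<noteq> 0"
    and "homog n G"
  shows "G \<in> symf.span (F ` partitions_of n)"
proof -
  have "mono_symf \<tau> \<in> symf.span (F ` partitions_of n)" if "\<tau> \<in> partitions_of n" for \<tau>
  proof -
    have "F ` {\<mu>. dominated \<mu> \<tau>} \<subseteq> F ` partitions_of n"
      using that by (auto simp: dominated_def partitions_of_iff)
    then show ?thesis
      using mono_in_span_lower[OF assms(1,2) that] symf.span_mono by blast
  qed
  then have "(\<Sum>\<rho>\<in>partitions_of n. smul (hall G (prod_list (map hsym \<rho>))) (mono_symf \<rho>)) \<in> symf.span (F ` partitions_of n)"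
    by (intro symf.span_sum symf.span_scale)
  then show ?thesis using expand_mono[OF assms(3)] by (metis (no_types, lifting))
qed

lemma in_span_image_finite:
  assumes "finite A" "G \<in> symf.span (F ` A)"
  shows "\<exists>c. G = (\<Sum>a\<in>A. smul (c a) (F a :: 'k::field symf))"
  using assms(2)
proof (induction rule: symf.span_induct_alt)
  case base
  show ?case by (rule exI[of _ "\<lambda>_. 0"]) simp
next
  case (step c x y)
  then obtain a d where a: "a \<in> A" "x = F a" "y = (\<Sum>a\<in>A. smul (d a) (F a))" by auto
  have "(\<Sum>b\<in>A. smul (d b + (if b = a then c else 0)) (F b)) =
    (\<Sum>b\<in>A. smul (d b) (F b)) + (\<Sum>b\<in>A. if b = a then smul c (F a) else 0)"
    unfolding sum.distrib[symmetric] by (rule sum.cong) (auto simp: symf.scale_left_distrib)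
  also have "\<dots> = smul c x + y" using a assms(1) by (simp add: add.commute)
  finally show ?case by metis
qed

section \<open>Hall-Littlewood functions: two descriptions, duality and principal
  specialization\<close>

section \<open>Hall--Littlewood functions by vertex operators\<close>

text \<open>\<open>shiftp t F\<close> is \<open>F[X - (1 - t) u]\<close> as a polynomial in \<open>u\<close>.\<close>

definition shiftp :: "'k::field_char_0 \<Rightarrow> 'k symf \<Rightarrow> 'k symf poly" where
  "shiftp t = pleth (\<lambda>c. [:const c:]) (\<lambda>k. [:psum k:] - monom (const (1 - t ^ k)) k)"

text \<open>Jing's vertex operator: the coefficient of \<open>z^r\<close> in the product of
  \<open>sum_n h_n z^n\<close> and \<open>F[X - (1 - t)/z]\<close>, where \<open>u\<close> stands
  for \<open>1/z\<close>.\<close>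

definition bop :: "'k::field_char_0 \<Rightarrow> nat \<Rightarrow> 'k symf \<Rightarrow> 'k symf" where
  "bop t r F = (\<Sum>m\<le>degree (shiftp t F). hsym (r + m) * coeff (shiftp t F) m)"

text \<open>The functions usually written \<open>Q'\<close>, dual to the Hall-Littlewood functions
  \<open>P\<close> (\<open>HL_Qp_dual\<close>); for \<open>t = 0\<close> they are the Schur
  functions (\<open>schur_eq\<close>).\<close>

fun Qp :: "'k::field_char_0 \<Rightarrow> nat list \<Rightarrow> 'k symf" where
  "Qp t [] = 1"
| "Qp t (r # \<tau>) = bop t r (Qp t \<tau>)"

lemma comm_ring_hom_pCons: "comm_ring_hom (\<lambda>c. [:c:])"
  by (rule comm_ring_homI) (simp_all add: one_pCons)

lemma comm_ring_hom_pCons_const: "comm_ring_hom (\<lambda>c. [:const c:])"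
  by (rule comm_ring_hom_compose[OF comm_ring_hom_pCons comm_ring_hom_const])

lemma shiftp_hom: "comm_ring_hom (shiftp t)"
  unfolding shiftp_def by (rule comm_ring_hom_pleth[OF comm_ring_hom_pCons_const])

lemma shiftp_smul: "shiftp t (smul c F) = [:const c:] * shiftp t F"
  by (simp add: shiftp_def pleth_smul[OF comm_ring_hom_pCons_const])

lemma pleth_const_psum: "pleth const psum F = F"
  by (rule pleth_unique[where f = "\<lambda>x. x", OF comm_ring_hom_id _ _ comm_ring_hom_const, symmetric]) simp_all

lemma coeff_0_shiftp: "coeff (shiftp t F) 0 = F"
proof -
  have hom: "comm_ring_hom (\<lambda>p :: 'a symf poly. coeff p 0)"
    by (rule comm_ring_homI) (simp_all add: coeff_mult_0)
  have "coeff (shiftp t F) 0 = pleth const psum F"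
    unfolding shiftp_def pleth_compose[OF hom comm_ring_hom_pCons_const]
    by (rule pleth_cong) simp_all
  then show ?thesis by (simp add: pleth_const_psum)
qed

text \<open>Addition formula for \<open>h_s\<close> at the sum of \<open>X\<close> and
  \<open>-(1 - t) u\<close>; in degree \<open>i\<close> the second alphabet contributes a scalar
  times \<open>u^i\<close>.\<close>

lemma shiftp_hsym:
  "shiftp t (hsym s) = (\<Sum>i\<le>s. monom (smul (pleth (\<lambda>c. c) (\<lambda>k. - (1 - t ^ k)) (hsym i)) (hsym (s - i))) i)"
proof -
  let ?\<iota> = "\<lambda>c. [:const c:] :: 'a symf poly"
  let ?u = "monom 1 1 :: 'a symf poly"
  let ?\<kappa> = "\<lambda>i. pleth (\<lambda>c. c) (\<lambda>k. - (1 - t ^ k)) (hsym i)"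
  have a: "pleth ?\<iota> (\<lambda>k. [:psum k:]) F = [:F:]" for F :: "'a symf"
    using pleth_compose[OF comm_ring_hom_pCons comm_ring_hom_const, of psum F]
    by (simp add: pleth_const_psum)
  have b: "pleth ?\<iota> (\<lambda>k. ?u ^ k * ?\<iota> (- (1 - t ^ k))) (hsym i) = monom (const (?\<kappa> i)) i" for i
    unfolding pleth_hsym_scale[OF comm_ring_hom_pCons_const]
      pleth_compose[OF comm_ring_hom_pCons_const comm_ring_hom_id, symmetric]
    by (simp add: monom_power mult_monom flip: monom_0)
  have "shiftp t (hsym s) = pleth ?\<iota> (\<lambda>k. ?u ^ k * ?\<iota> (- (1 - t ^ k)) + [:psum k:]) (hsym s)"
    unfolding shiftp_def
    by (rule pleth_cong) (simp_all add: monom_power mult_monom comm_ring_homD[OF comm_ring_hom_const] minus_monom flip: monom_0)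
  also have "\<dots> = (\<Sum>i\<le>s. monom (const (?\<kappa> i)) i * [:hsym (s - i):])"
    by (simp only: pleth_hsym_add[OF comm_ring_hom_pCons_const] a b)
  finally show ?thesis
    by (simp add: mult_monom smul_def flip: monom_0)
qed

lemma coeff_shiftp_hsym:
  "coeff (shiftp t (hsym s)) m = (if m \<le> s then smul (pleth (\<lambda>c. c) (\<lambda>k. - (1 - t ^ k)) (hsym m)) (hsym (s - m)) else 0)"
proof -
  have "coeff (shiftp t (hsym s)) m = (\<Sum>i\<le>s. if i = m then
    smul (pleth (\<lambda>c. c) (\<lambda>k. - (1 - t ^ k)) (hsym m)) (hsym (s - m)) else 0)"
    unfolding shiftp_hsym coeff_sum by (rule sum.cong) auto
  then show ?thesis by simp
qed

text \<open>\<open>shiftp\<close> is multiplicative and takes \<open>u^i\<close> out of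
  \<open>h_s\<close> at the cost of lowering its index by \<open>i\<close>; extracting
  \<open>u^m\<close> thus lowers the indices by \<open>m\<close> in total.\<close>

lemma coeff_shiftp_prod:
  "coeff (shiftp t (prod_list (map hsym \<beta>))) m \<in> symf.span
     ((\<lambda>\<gamma>. prod_list (map hsym \<gamma>)) ` {\<gamma>. list_all2 (\<le>) \<gamma> \<beta> \<and> sum_list \<gamma> + m = sum_list \<beta>})"
proof (induction \<beta> arbitrary: m)
  case Nil
  show ?case
    by (cases m) (auto simp: comm_ring_homD[OF shiftp_hom] intro!: symf.span_base symf.span_zero)
next
  case (Cons s \<beta>)
  let ?g = "\<lambda>\<gamma>. prod_list (map hsym \<gamma>) :: 'a symf"
  let ?D = "\<lambda>\<beta> m. {\<gamma>. list_all2 (\<le>) \<gamma> \<beta> \<and> sum_list \<gamma> + m = sum_list \<beta>}"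
  have "hsym (s - i) * G \<in> symf.span (?g ` ?D (s # \<beta>) m)"
    if "i \<le> s" "i \<le> m" "G \<in> symf.span (?g ` ?D \<beta> (m - i))" for i G
    using that(3)
  proof (rule symf.span_induct)
    show "symf.subspace {G. hsym (s - i) * G \<in> symf.span (?g ` ?D (s # \<beta>) m)}"
      by (auto simp: symf.subspace_def distrib_left smul_mult_right
          intro: symf.span_add symf.span_scale symf.span_zero)
    fix G assume "G \<in> ?g ` ?D \<beta> (m - i)"
    then obtain \<gamma> where \<gamma>: "\<gamma> \<in> ?D \<beta> (m - i)" "G = ?g \<gamma>" by auto
    then have "(s - i) # \<gamma> \<in> ?D (s # \<beta>) m" using that(1,2) by auto
    then have "?g ((s - i) # \<gamma>) \<in> symf.span (?g ` ?D (s # \<beta>) m)" by (intro symf.span_base imageI)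
    then show "hsym (s - i) * G \<in> symf.span (?g ` ?D (s # \<beta>) m)" by (simp add: \<gamma>)
  qed
  then have "coeff (shiftp t (hsym s)) i * coeff (shiftp t (?g \<beta>)) (m - i) \<in> symf.span (?g ` ?D (s # \<beta>) m)"
    if "i \<le> m" for i
    using that Cons.IH[of "m - i"]
    by (auto simp: coeff_shiftp_hsym smul_mult_left intro!: symf.span_scale symf.span_zero)
  then show ?case
    unfolding list.map prod_list.Cons comm_ring_homD(4)[OF shiftp_hom] coeff_mult
    by (intro symf.span_sum) simp
qed

lemma bop_superset:
  assumes "degree (shiftp t F) \<le> N"
  shows "bop t r F = (\<Sum>m\<le>N. hsym (r + m) * coeff (shiftp t F) m)"
  unfolding bop_def by (rule sum.mono_neutral_left) (use assms in \<open>auto simp: coeff_eq_0 not_le\<close>)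

lemma bop_add: "bop t r (F + G) = bop t r F + bop t r G"
proof -
  let ?N = "max (degree (shiftp t F)) (degree (shiftp t G))"
  have "degree (shiftp t (F + G)) \<le> ?N"
    by (simp add: comm_ring_homD[OF shiftp_hom] degree_add_le_max)
  then show ?thesis
    by (simp add: bop_superset[of _ _ ?N] comm_ring_homD[OF shiftp_hom] distrib_left sum.distrib)
qed

lemma bop_smul: "bop t r (smul c F) = smul c (bop t r F)"
proof -
  have "degree (shiftp t (smul c F)) \<le> degree (shiftp t F)"
    by (simp add: shiftp_smul degree_smult_le)
  then show ?thesis
    by (simp add: bop_superset[of _ _ "degree (shiftp t F)"] shiftp_smul symf.scale_sum_right
        smul_mult_right smul_def[symmetric])
qed

text \<open>Dominance for compositions: weight has moved to earlier positions. Sortedness is not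
  imposed, because \<open>bop\<close> produces unsorted index lists.\<close>

definition raised :: "nat list \<Rightarrow> nat list set" where
  "raised \<tau> = {\<beta>. length \<beta> = length \<tau> \<and> sum_list \<beta> = sum_list \<tau> \<and>
     (\<forall>k. sum_list (take k \<tau>) \<le> sum_list (take k \<beta>))}"

abbreviation raised_span :: "nat list \<Rightarrow> 'k::field_char_0 symf set" where
  "raised_span \<tau> \<equiv> symf.span ((\<lambda>\<beta>. prod_list (map hsym \<beta>)) ` (raised \<tau> - {\<tau>}))"

lemma list_all2_le_sum_list: "list_all2 (\<le>) \<gamma> \<beta> \<Longrightarrow> sum_list \<gamma> \<le> sum_list (\<beta> :: nat list)"
  by (induction rule: list_all2_induct) auto

lemma raised_Cons:
  assumes "\<beta> \<in> raised \<tau>" "list_all2 (\<le>) \<gamma> \<beta>" "sum_list \<gamma> + m = sum_list \<beta>"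
  shows "(r + m) # \<gamma> \<in> raised (r # \<tau>)"
proof -
  have "sum_list (take k \<beta>) \<le> m + sum_list (take k \<gamma>)" for k
  proof -
    have "sum_list (drop k \<gamma>) \<le> sum_list (drop k \<beta>)"
      by (rule list_all2_le_sum_list) (simp add: assms list_all2_dropI)
    moreover have "sum_list (take k xs) + sum_list (drop k xs) = sum_list xs" for xs :: "nat list"
      by (metis append_take_drop_id sum_list_append)
    from this[of \<beta>] this[of \<gamma>] calculation show ?thesis using assms(3) by linarith
  qed
  moreover have "sum_list (take k \<tau>) \<le> sum_list (take k \<beta>)" for k
    using assms by (simp add: raised_def)
  ultimately have "sum_list (take k \<tau>) \<le> m + sum_list (take k \<gamma>)" for k
    using le_trans by blast
  then show ?thesis
    using assms by (auto simp: raised_def take_Cons' dest: list_all2_lengthD)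
qed

text \<open>The \<open>u^0\<close> term is \<open>h_r\<close> times the old product; every later
  term moves weight from the old entries to the new first entry.\<close>

lemma bop_prod:
  assumes "\<beta> \<in> raised \<tau>"
  shows "bop t r (prod_list (map hsym \<beta>)) - prod_list (map hsym (r # \<beta>)) \<in> raised_span (r # \<tau>)"
proof -
  let ?g = "\<lambda>\<gamma>. prod_list (map hsym \<gamma>) :: 'a symf"
  let ?c = "coeff (shiftp t (?g \<beta>))"
  let ?d = "degree (shiftp t (?g \<beta>))"
  have "bop t r (?g \<beta>) = hsym r * ?g \<beta> + (\<Sum>m\<in>{1..?d}. hsym (r + m) * ?c m)"
    unfolding bop_def by (subst atMost_atLeast0, subst sum.atLeast_Suc_atMost) (simp_all add: coeff_0_shiftp)
  moreover have "hsym (r + m) * G \<in> raised_span (r # \<tau>)"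
    if m: "m > 0" and G: "G \<in> symf.span (?g ` {\<gamma>. list_all2 (\<le>) \<gamma> \<beta> \<and> sum_list \<gamma> + m = sum_list \<beta>})" for m G
    using G
  proof (rule symf.span_induct)
    show "symf.subspace {G. hsym (r + m) * G \<in> raised_span (r # \<tau>)}"
      by (auto simp: symf.subspace_def distrib_left smul_mult_right
          intro: symf.span_add symf.span_scale symf.span_zero)
    fix G assume "G \<in> ?g ` {\<gamma>. list_all2 (\<le>) \<gamma> \<beta> \<and> sum_list \<gamma> + m = sum_list \<beta>}"
    then obtain \<gamma> where \<gamma>: "list_all2 (\<le>) \<gamma> \<beta>" "sum_list \<gamma> + m = sum_list \<beta>" "G = ?g \<gamma>" by auto
    then have "(r + m) # \<gamma> \<in> raised (r # \<tau>) - {r # \<tau>}"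
      using raised_Cons[OF assms] m by auto
    then have "?g ((r + m) # \<gamma>) \<in> raised_span (r # \<tau>)" by (intro symf.span_base imageI)
    then show "hsym (r + m) * G \<in> raised_span (r # \<tau>)" by (simp add: \<gamma>)
  qed
  ultimately show ?thesis
    using coeff_shiftp_prod[of t \<beta>] by (auto intro!: symf.span_sum)
qed

lemma Qp_raised: "Qp t \<tau> - prod_list (map hsym \<tau>) \<in> raised_span \<tau>"
proof (induction \<tau>)
  case Nil
  show ?case by (simp add: symf.span_zero)
next
  case (Cons r \<tau>)
  let ?g = "\<lambda>\<gamma>. prod_list (map hsym \<gamma>) :: 'a symf"
  have "bop t r G \<in> raised_span (r # \<tau>)" if "G \<in> raised_span \<tau>" for G
    using that
  proof (rule symf.span_induct)
    show "symf.subspace {G. bop t r G \<in> raised_span (r # \<tau>)}"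
      using bop_smul[of t r 0 0]
      by (auto simp: symf.subspace_def bop_add bop_smul
          intro: symf.span_add symf.span_scale symf.span_zero)
    fix G assume "G \<in> ?g ` (raised \<tau> - {\<tau>})"
    then obtain \<beta> where \<beta>: "\<beta> \<in> raised \<tau>" "\<beta> \<noteq> \<tau>" "G = ?g \<beta>" by auto
    have "r # \<beta> \<in> raised (r # \<tau>)"
      using raised_Cons[OF \<beta>(1), of \<beta> 0 r] by (simp add: list_all2_refl)
    then have "?g (r # \<beta>) \<in> raised_span (r # \<tau>)"
      using \<beta>(2) by (intro symf.span_base imageI) auto
    from symf.span_add[OF bop_prod[OF \<beta>(1), of t r] this] show "bop t r G \<in> raised_span (r # \<tau>)"
      by (simp add: \<beta>)
  qed
  from symf.span_add[OF bop_prod[of \<tau> \<tau> t r] this[OF Cons]]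
  have "bop t r (?g \<tau>) - ?g (r # \<tau>) + bop t r (Qp t \<tau> - ?g \<tau>) \<in> raised_span (r # \<tau>)"
    by (simp add: raised_def)
  moreover have "bop t r (Qp t \<tau>) = bop t r (?g \<tau>) + bop t r (Qp t \<tau> - ?g \<tau>)"
    by (simp flip: bop_add)
  ultimately show ?case by (simp add: algebra_simps)
qed

text \<open>Counting by layers: among the first \<open>k\<close> entries, those above
  \<open>j\<close> number at most the minimum of \<open>k\<close> and the number of all entries
  above \<open>j\<close>. For the sorted list every one of these bounds is attained.\<close>

lemma sum_list_take_le_sorted:
  assumes "is_partition \<sigma>" "mset (filter (\<lambda>a. 0 < a) \<beta>) = mset \<sigma>"
  shows "sum_list (take k \<beta>) \<le> sum_list (take k \<sigma>)"
proof -
  define L where "L = part \<sigma> 0"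
  have sum_filter: "sum_list xs = (\<Sum>j<L. length (filter (\<lambda>a. j < a) xs))" if "\<forall>a\<in>set xs. a \<le> L" for xs
    using that
  proof (induction xs)
    case (Cons a xs)
    have "(\<Sum>j<L. if j < a then 1 else 0) = (\<Sum>j<a. 1::nat)"
      by (rule sum.mono_neutral_cong_right) (use Cons.prems in auto)
    moreover have "(\<Sum>j<L. length (filter (\<lambda>b. j < b) (a # xs))) =
      (\<Sum>j<L. if j < a then 1 else 0) + (\<Sum>j<L. length (filter (\<lambda>b. j < b) xs))"
      unfolding sum.distrib[symmetric] by (rule sum.cong) auto
    ultimately show ?case using Cons by simp
  qed simp
  have \<beta>: "a \<le> L" if "a \<in> set \<beta>" for a
  proof (cases "a = 0")
    case False
    then have "a \<in># mset (filter (\<lambda>a. 0 < a) \<beta>)" using that by simp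
    then show ?thesis unfolding assms(2) L_def using le_part_0[OF assms(1)] by simp
  qed simp
  have len: "length (filter (\<lambda>a. j < a) \<beta>) = part (conj_partition \<sigma>) j" for j
  proof -
    have "mset (filter (\<lambda>a. j < a) \<beta>) = filter_mset (\<lambda>a. j < a) (mset (filter (\<lambda>a. 0 < a) \<beta>))"
      by (auto simp: filter_filter_mset intro!: filter_mset_cong)
    also have "\<dots> = mset (filter (\<lambda>a. j < a) \<sigma>)" by (unfold assms(2)) simp
    finally show ?thesis by (metis part_conj[OF assms(1)] size_mset)
  qed
  have "sum_list (take k \<beta>) = (\<Sum>j<L. length (filter (\<lambda>a. j < a) (take k \<beta>)))"
    using \<beta> by (intro sum_filter) (meson in_set_takeD)
  also have "\<dots> \<le> (\<Sum>j<L. min (part (conj_partition \<sigma>) j) k)"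
  proof (rule sum_mono)
    fix j
    have "length (filter (\<lambda>a. j < a) (take k \<beta>)) \<le> length (filter (\<lambda>a. j < a) (take k \<beta> @ drop k \<beta>))"
      by (simp only: filter_append length_append le_add1)
    moreover have "length (filter (\<lambda>a. j < a) (take k \<beta>)) \<le> k"
      by (rule le_trans[OF length_filter_le]) simp
    ultimately show "length (filter (\<lambda>a. j < a) (take k \<beta>)) \<le> min (part (conj_partition \<sigma>) j) k"
      by (simp add: len)
  qed
  also have "\<dots> = sum_list (map (\<lambda>a. min a k) (conj_partition \<sigma>))"
    by (rule sum_list_map_part[symmetric]) (simp_all add: length_conj L_def)
  also have "\<dots> = sum_list (take k \<sigma>)"
    using sum_part_conj[OF is_partition_conj[OF assms(1)], of k]
    by (simp add: conj_conj[OF assms(1)] sum_list_take_eq)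
  finally show ?thesis .
qed

lemma prod_list_map_filter_pos:
  "prod_list (map hsym (filter (\<lambda>a. 0 < a) \<beta>)) = prod_list (map hsym \<beta>)"
  by (induction \<beta>) auto

lemma hall_prod_mono:
  assumes "is_partition \<sigma>"
  shows "hall (prod_list (map hsym \<beta>)) (mono_symf \<sigma>) =
    (if mset (filter (\<lambda>a. 0 < a) \<beta>) = mset \<sigma> then 1 else 0 :: 'k::field_char_0)"
proof -
  define \<rho> where "\<rho> = parts_of (image_mset (\<lambda>k. k - 1) (mset (filter (\<lambda>a. 0 < a) \<beta>)))"
  have "mset \<rho> = image_mset (\<lambda>k. Suc (k - 1)) (mset (filter (\<lambda>a. 0 < a) \<beta>))"
    by (simp add: \<rho>_def mset_parts_of image_mset.compositionality comp_def)
  also have "\<dots> = image_mset id (mset (filter (\<lambda>a. 0 < a) \<beta>))"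
    by (rule image_mset_cong) auto
  finally have \<rho>: "mset \<rho> = mset (filter (\<lambda>a. 0 < a) \<beta>)" by simp
  have "prod_list (map hsym \<rho>) = (prod_mset (image_mset hsym (mset \<rho>)) :: 'k symf)"
    by (simp only: mset_map[symmetric] prod_mset_prod_list)
  also have "\<dots> = prod_list (map hsym (filter (\<lambda>a. 0 < a) \<beta>))"
    unfolding \<rho> by (simp only: mset_map[symmetric] prod_mset_prod_list)
  finally have "prod_list (map hsym \<beta>) = (prod_list (map hsym \<rho>) :: 'k symf)"
    by (simp add: prod_list_map_filter_pos)
  moreover have "is_partition \<rho>" by (simp add: \<rho>_def is_partition_parts_of)
  moreover from this have "\<rho> = \<sigma> \<longleftrightarrow> mset \<rho> = mset \<sigma>"
    using assms by (metis mset_of_def parts_of_mset_of)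
  ultimately show ?thesis
    using mono_symf_dual(2)[OF assms, of \<rho>, where 'k = 'k] \<rho> by (simp add: hall_commute)
qed

text \<open>Sorting can only increase prefix sums, so raising followed by sorting moves up in
  dominance. If nothing changes in the end, all prefix sums, and hence the list, were
  unchanged.\<close>

lemma raised_dominated:
  assumes \<tau>: "is_partition \<tau>" and \<sigma>: "is_partition \<sigma>" and \<beta>: "\<beta> \<in> raised \<tau>"
    and eq: "mset (filter (\<lambda>a. 0 < a) \<beta>) = mset \<sigma>"
  shows "dominated \<tau> \<sigma>" "\<sigma> = \<tau> \<Longrightarrow> \<beta> = \<tau>"
proof -
  have le: "sum_list (take k \<tau>) \<le> sum_list (take k \<beta>)" "sum_list (take k \<beta>) \<le> sum_list (take k \<sigma>)" for k
    using \<beta> sum_list_take_le_sorted[OF \<sigma> eq] by (auto simp: raised_def)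
  have "sum_list \<sigma> = sum_list (filter (\<lambda>a. 0 < a) \<beta>)"
    by (metis eq sum_mset_sum_list)
  also have "\<dots> = sum_list \<beta>" by (induction \<beta>) auto
  also have "\<dots> = sum_list \<tau>" using \<beta> by (simp add: raised_def)
  finally show "dominated \<tau> \<sigma>"
    using \<tau> \<sigma> le_trans[OF le] by (simp add: dominated_def)
  show "\<beta> = \<tau>" if "\<sigma> = \<tau>"
  proof (rule nth_equalityI)
    show "length \<beta> = length \<tau>" using \<beta> by (simp add: raised_def)
    fix i assume "i < length \<beta>"
    moreover have "sum_list (take k \<beta>) = sum_list (take k \<tau>)" for k
      using le[of k] that by simp
    from this[of i] this[of "Suc i"] show "\<beta> ! i = \<tau> ! i"
      using \<open>i < length \<beta>\<close> \<open>length \<beta> = length \<tau>\<close> by (simp add: take_Suc_conv_app_nth)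
  qed
qed

lemma homog_raised_span:
  assumes "F \<in> raised_span \<tau>"
  shows "homog (sum_list \<tau>) F"
  using assms
proof (rule symf.span_induct)
  show "symf.subspace {F :: 'a symf. homog (sum_list \<tau>) F}" by (rule subspace_homog)
  fix F :: "'a symf" assume "F \<in> (\<lambda>\<beta>. prod_list (map hsym \<beta>)) ` (raised \<tau> - {\<tau>})"
  then obtain \<beta> where "\<beta> \<in> raised \<tau>" "F = prod_list (map hsym \<beta>)" by auto
  then show "homog (sum_list \<tau>) F" using homog_prod_list_hsym[of \<beta>] by (auto simp: raised_def)
qed

lemma homog_Qp: "homog (sum_list \<tau>) (Qp t \<tau>)"
  using homog_add[OF homog_raised_span[OF Qp_raised[of t \<tau>]] homog_prod_list_hsym[of \<tau>]] by simp

lemma Qp_upper: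
  assumes \<tau>: "is_partition \<tau>"
  shows "upper \<tau> (Qp t \<tau>)" "hall (Qp t \<tau>) (mono_symf \<tau>) = 1"
proof -
  let ?g = "\<lambda>\<gamma>. prod_list (map hsym \<gamma>) :: 'a symf"
  define R where "R = Qp t \<tau> - ?g \<tau>"
  have R: "hall R (mono_symf \<sigma>) = 0" if \<sigma>: "is_partition \<sigma>" and "\<sigma> = \<tau> \<or> \<not> dominated \<tau> \<sigma>" for \<sigma>
    using Qp_raised[of t \<tau>, folded R_def]
  proof (rule symf.span_induct)
    show "symf.subspace {F. hall F (mono_symf \<sigma>) = 0}"
      by (auto simp: symf.subspace_def hall_add_left hall_smul_left)
    fix F assume "F \<in> ?g ` (raised \<tau> - {\<tau>})"
    then obtain \<beta> where "\<beta> \<in> raised \<tau>" "\<beta> \<noteq> \<tau>" "F = ?g \<beta>" by auto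
    then show "hall F (mono_symf \<sigma>) = 0"
      using raised_dominated[OF \<tau> \<sigma>] that by (auto simp: hall_prod_mono[OF \<sigma>])
  qed
  have filter: "filter (\<lambda>a. 0 < a) \<tau> = \<tau>"
    using \<tau> by (simp add: is_partition_def)
  have Q: "hall (Qp t \<tau>) (mono_symf \<sigma>) = hall R (mono_symf \<sigma>) + (if mset \<tau> = mset \<sigma> then 1 else 0)"
    if "is_partition \<sigma>" for \<sigma>
    using hall_prod_mono[OF that, of \<tau>, where 'k = 'a] by (simp add: R_def hall_diff_left filter)
  show "hall (Qp t \<tau>) (mono_symf \<tau>) = 1" using Q[OF \<tau>] R[OF \<tau>] by simp
  show "upper \<tau> (Qp t \<tau>)"
    unfolding upper_def
  proof (intro conjI allI impI)
    fix \<sigma> assume \<sigma>: "is_partition \<sigma>" "hall (Qp t \<tau>) (mono_symf \<sigma>) \<noteq> 0"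
    show "dominated \<tau> \<sigma>"
    proof (rule ccontr)
      assume not: "\<not> dominated \<tau> \<sigma>"
      then have "\<sigma> \<noteq> \<tau>" using dominated_refl[OF \<tau>] by auto
      then have "mset \<tau> \<noteq> mset \<sigma>" using \<sigma> \<tau> by (metis mset_of_def parts_of_mset_of)
      then show False using Q[OF \<sigma>(1)] R[OF \<sigma>(1)] not \<sigma>(2) by simp
    qed
  qed (rule homog_Qp)
qed

section \<open>Hall--Littlewood functions as symmetrized sums\<close>

definition hl_weight :: "'e::field \<Rightarrow> (nat \<Rightarrow> 'e) \<Rightarrow> nat set \<Rightarrow> nat \<Rightarrow> 'e" where
  "hl_weight T x A i = (\<Prod>j\<in>A - {i}. (x i - T * x j) / (x i - x j))"

text \<open>The symmetrized Hall-Littlewood sum in recursive form: \<open>i\<close> is the variable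
  that receives the first exponent, and variables left over when the list ends contribute nothing.
  One step corresponds to one application of \<open>bop\<close>.\<close>

fun hl_sum :: "'e::field \<Rightarrow> (nat \<Rightarrow> 'e) \<Rightarrow> nat list \<Rightarrow> nat set \<Rightarrow> 'e" where
  "hl_sum T x [] A = 1"
| "hl_sum T x (r # \<tau>) A = (\<Sum>i\<in>A. x i ^ r * hl_weight T x A i * hl_sum T x \<tau> (A - {i}))"

lemma prod_linear_poly:
  fixes b :: "nat \<Rightarrow> 'e::field"
  assumes "finite A"
  shows "degree (\<Prod>j\<in>A. [:1, b j:]) \<le> card A" "coeff (\<Prod>j\<in>A. [:1, b j:]) (card A) = (\<Prod>j\<in>A. b j)"
proof -
  have "degree (\<Prod>j\<in>A. [:1, b j:]) \<le> card A \<and> coeff (\<Prod>j\<in>A. [:1, b j:]) (card A) = (\<Prod>j\<in>A. b j)"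
    using assms
  proof (induction A rule: finite_induct)
    case (insert a A)
    let ?P = "\<Prod>j\<in>A. [:1, b j:]"
    have "degree ([:1, b a:] * ?P) \<le> degree [:1, b a:] + degree ?P" by (rule degree_mult_le)
    also have "\<dots> \<le> 1 + card A" using insert by (intro add_mono) auto
    finally have "degree ([:1, b a:] * ?P) \<le> Suc (card A)" by simp
    moreover have "coeff ?P (Suc (card A)) = 0"
      using insert by (intro coeff_eq_0) auto
    ultimately show ?case using insert by simp
  qed simp
  then show "degree (\<Prod>j\<in>A. [:1, b j:]) \<le> card A" "coeff (\<Prod>j\<in>A. [:1, b j:]) (card A) = (\<Prod>j\<in>A. b j)"
    by auto
qed

text \<open>Partial fractions of \<open>prod_j (1 - T x_j u) / (1 - x_j u)\<close> with denominators
  cleared. The difference of the two sides has degree below \<open>card A\<close>, because the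
  leading coefficients cancel, and it vanishes at the \<open>card A\<close> points
  \<open>1 / x_i\<close>.\<close>

lemma partial_fractions_poly:
  fixes x :: "nat \<Rightarrow> 'e::field"
  assumes A: "finite A" and x: "inj_on x A" "\<And>i. i \<in> A \<Longrightarrow> x i \<noteq> 0"
  shows "(\<Prod>j\<in>A. [:1, - (T * x j):]) = Polynomial.smult (T ^ card A) (\<Prod>j\<in>A. [:1, - x j:]) +
    Polynomial.smult (1 - T) (\<Sum>i\<in>A. Polynomial.smult (hl_weight T x A i) (\<Prod>j\<in>A - {i}. [:1, - x j:]))"
    (is "?L = ?R1 + ?R2")
proof (cases "A = {}")
  case False
  define p where "p = ?L - (?R1 + ?R2)"
  have deg2: "degree (\<Prod>j\<in>A - {i}. [:1, - x j:]) < card A" if "i \<in> A" for i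
  proof -
    have "card (A - {i}) < card A" using A that by (rule card_Diff1_less)
    then show ?thesis using prod_linear_poly(1)[of "A - {i}" "\<lambda>j. - x j"] A by simp
  qed
  have degR2: "degree ?R2 < card A"
  proof (rule le_less_trans[OF degree_smult_le], rule degree_sum_less)
    fix i assume "i \<in> A"
    then show "degree (Polynomial.smult (hl_weight T x A i) (\<Prod>j\<in>A - {i}. [:1, - x j:])) < card A"
      by (rule le_less_trans[OF degree_smult_le deg2])
  qed (use A False in \<open>simp add: card_gt_0_iff\<close>)
  have "degree ?L \<le> card A" "degree ?R1 \<le> card A"
    by (rule prod_linear_poly(1)[OF A], rule le_trans[OF degree_smult_le prod_linear_poly(1)[OF A]])
  then have "degree p \<le> card A"
    unfolding p_def using degR2 by (intro degree_diff_le degree_add_le) simp_all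
  moreover have "coeff p (card A) = 0"
  proof -
    have "(\<Prod>j\<in>A. - (T * x j)) = T ^ card A * (\<Prod>j\<in>A. - x j)"
      using A by (induction A rule: finite_induct) (simp_all add: mult_ac)
    then show ?thesis using coeff_eq_0[OF degR2] by (simp add: p_def prod_linear_poly(2)[OF A])
  qed
  ultimately have deg: "p = 0 \<or> degree p < card A"
    by (rule eq_zero_or_degree_less)
  have roots: "poly p (1 / x i) = 0" if i: "i \<in> A" for i
  proof -
    have split: "(\<Prod>j\<in>A. f j) = f i * (\<Prod>j\<in>A - {i}. f j)" for f :: "nat \<Rightarrow> 'e"
      by (rule prod.remove[OF A i])
    have "poly ?L (1 / x i) = (1 - T) * (\<Prod>j\<in>A - {i}. 1 - T * x j / x i)"
      by (simp add: poly_prod split x i)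
    also have "(\<Prod>j\<in>A - {i}. 1 - T * x j / x i) = hl_weight T x A i * (\<Prod>j\<in>A - {i}. 1 - x j / x i)"
      unfolding hl_weight_def prod.distrib[symmetric]
    proof (rule prod.cong)
      fix j assume j: "j \<in> A - {i}"
      then have "x i - x j \<noteq> 0" "x i \<noteq> 0" using x i inj_on_eq_iff[OF x(1), of i j] by simp_all
      then show "1 - T * x j / x i = (x i - T * x j) / (x i - x j) * (1 - x j / x i)"
        by (simp add: field_simps)
    qed simp
    also have "hl_weight T x A i * (\<Prod>j\<in>A - {i}. 1 - x j / x i) =
      poly (\<Sum>i\<in>A. Polynomial.smult (hl_weight T x A i) (\<Prod>j\<in>A - {i}. [:1, - x j:])) (1 / x i)"
    proof -
      have "(\<Sum>l\<in>A. hl_weight T x A l * (\<Prod>j\<in>A - {l}. 1 - x j / x i)) =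
        hl_weight T x A i * (\<Prod>j\<in>A - {i}. 1 - x j / x i)"
      proof (rule sum_single_term[OF A i])
        fix l assume l: "l \<in> A" "l \<noteq> i"
        then have "(\<Prod>j\<in>A - {l}. 1 - x j / x i) = 0"
          using i x A by (intro prod_zero bexI[of _ i]) simp_all
        then show "hl_weight T x A l * (\<Prod>j\<in>A - {l}. 1 - x j / x i) = 0" by simp
      qed
      then show ?thesis by (simp add: poly_sum poly_prod)
    qed
    finally show ?thesis
      using x i by (simp add: p_def poly_prod split)
  qed
  have "p = 0"
  proof (rule ccontr)
    assume p: "p \<noteq> 0"
    have "inj_on (\<lambda>i. 1 / x i) A"
      using inj_on_eq_iff[OF x(1)] x(2) by (intro inj_onI) simp
    then have "card A = card ((\<lambda>i. 1 / x i) ` A)" by (simp add: card_image)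
    also have "\<dots> \<le> card {y. poly p y = 0}"
      by (rule card_mono) (use roots p poly_roots_finite in auto)
    also have "\<dots> \<le> degree p" by (rule card_poly_roots_bound[OF p])
    finally show False using deg p by simp
  qed
  then show ?thesis by (simp add: p_def)
qed simp

text \<open>Used with independent variables to identify the Hall-Littlewood functions, and with the
  powers of \<open>t\<close> for the principal specialization.\<close>

locale hl_evaluation =
  fixes \<iota> :: "'k::field_char_0 \<Rightarrow> 'e::field" and x :: "nat \<Rightarrow> 'e" and t :: 'k
  assumes hom: "comm_ring_hom \<iota>" and inj_x: "inj x" and x_nonzero: "\<And>i. x i \<noteq> 0"
begin

abbreviation "T \<equiv> \<iota> t"

text \<open>Evaluation at \<open>1 - t\<close> times the alphabet of the variables in
  \<open>A\<close>; the factor \<open>1 - t\<close> converts \<open>Q'\<close> into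
  \<open>Q\<close>.\<close>

definition evq :: "nat set \<Rightarrow> 'k symf \<Rightarrow> 'e" where
  "evq A = pleth \<iota> (\<lambda>k. (1 - T ^ k) * (\<Sum>i\<in>A. x i ^ k))"

lemma evq_hom: "comm_ring_hom (evq A)"
  unfolding evq_def by (rule comm_ring_hom_pleth[OF hom])

lemma geometric_cancel: "Abs_fps (\<lambda>n. z ^ n) * (1 - fps_const z * fps_X) = (1 :: 'e fps)"
proof (rule fps_ext)
  fix n
  have "Abs_fps (\<lambda>n. z ^ n) * (1 - fps_const z * fps_X) =
    Abs_fps (\<lambda>n. z ^ n) - fps_const z * Abs_fps (\<lambda>n. z ^ n) * fps_X"
    by (simp add: right_diff_distrib mult_ac)
  then show "fps_nth (Abs_fps (\<lambda>n. z ^ n) * (1 - fps_const z * fps_X)) n = fps_nth (1 :: 'e fps) n"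
    by (cases n) simp_all
qed

text \<open>The generating function of these values is the product treated in
  \<open>partial_fractions_poly\<close>; the constant of that expansion shows only for
  \<open>s = 0\<close>.\<close>

lemma evq_hsym:
  assumes A: "finite A"
  shows "evq A (hsym s) = (if s = 0 then T ^ card A else 0) + (1 - T) * (\<Sum>i\<in>A. hl_weight T x A i * x i ^ s)"
proof -
  let ?w = "hl_weight T x A"
  let ?D = "\<lambda>A. \<Prod>j\<in>A. 1 - fps_const (x j) * fps_X"
  let ?g = "\<lambda>i. Abs_fps (\<lambda>n. x i ^ n)"
  have lin: "fps_of_poly [:1, - a:] = 1 - fps_const a * fps_X" for a :: 'e
    by (simp add: fps_of_poly_pCons fps_const_neg[symmetric] del: fps_const_neg)
  have "hser \<iota> (\<lambda>k. (1 - T ^ k) * (\<Sum>i\<in>A. x i ^ k)) = hser \<iota> (\<lambda>k. \<Sum>i\<in>A. x i ^ k + - ((T * x i) ^ k))"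
    by (rule arg_cong[where f = "hser \<iota>"]) (simp add: fun_eq_iff algebra_simps sum_distrib_left sum_subtractf power_mult_distrib)
  also have "\<dots> = (\<Prod>i\<in>A. ?g i * (1 - fps_const (T * x i) * fps_X))"
    unfolding hser_sum[OF hom] hser_add[OF hom] hser_geometric[OF hom] hser_linear[OF hom] ..
  finally have gser: "hser \<iota> (\<lambda>k. (1 - T ^ k) * (\<Sum>i\<in>A. x i ^ k)) = (\<Prod>i\<in>A. ?g i * (1 - fps_const (T * x i) * fps_X))" .
  have "hser \<iota> (\<lambda>k. (1 - T ^ k) * (\<Sum>i\<in>A. x i ^ k)) * ?D A =
      (\<Prod>i\<in>A. (?g i * (1 - fps_const (x i) * fps_X)) * (1 - fps_const (T * x i) * fps_X))"
    unfolding gser prod.distrib by (simp only: mult_ac)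
  also have "\<dots> = fps_of_poly (\<Prod>j\<in>A. [:1, - (T * x j):])"
    by (simp add: geometric_cancel fps_of_poly_prod lin)
  also have "\<dots> = fps_const (T ^ card A) * ?D A + fps_const (1 - T) * (\<Sum>i\<in>A. fps_const (?w i) * ?D (A - {i}))"
    by (subst partial_fractions_poly[OF A inj_on_subset[OF inj_x]])
      (simp_all add: x_nonzero fps_of_poly_prod lin fps_of_poly_add fps_of_poly_smult fps_of_poly_sum)
  also have "(\<Sum>i\<in>A. fps_const (?w i) * ?D (A - {i})) = (\<Sum>i\<in>A. fps_const (?w i) * ?g i) * ?D A"
    unfolding sum_distrib_right
  proof (rule sum.cong)
    fix i assume "i \<in> A"
    then have "?D A = (1 - fps_const (x i) * fps_X) * ?D (A - {i})"
      by (rule prod.remove[OF A])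
    then have "?g i * ?D A = (?g i * (1 - fps_const (x i) * fps_X)) * ?D (A - {i})"
      by (simp only: mult_ac)
    then show "fps_const (?w i) * ?D (A - {i}) = fps_const (?w i) * ?g i * ?D A"
      by (simp only: geometric_cancel mult_1_left mult.assoc)
  qed simp
  finally have "hser \<iota> (\<lambda>k. (1 - T ^ k) * (\<Sum>i\<in>A. x i ^ k)) * ?D A =
    (fps_const (T ^ card A) + fps_const (1 - T) * (\<Sum>i\<in>A. fps_const (?w i) * ?g i)) * ?D A"
    by (simp only: distrib_right mult.assoc)
  moreover have "?D A \<noteq> 0"
  proof -
    have "(1 - fps_const (x j) * fps_X) \<noteq> 0" for j
      using geometric_cancel[of "x j"] by auto
    then show ?thesis using A by simp
  qed
  ultimately have "hser \<iota> (\<lambda>k. (1 - T ^ k) * (\<Sum>i\<in>A. x i ^ k)) =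
    fps_const (T ^ card A) + fps_const (1 - T) * (\<Sum>i\<in>A. fps_const (?w i) * ?g i)"
    by simp
  from arg_cong[OF this, of "\<lambda>f. fps_nth f s"] show ?thesis
    by (simp add: evq_def fps_sum_nth)
qed

text \<open>Setting \<open>u = x i\<close> in \<open>F[X - (1 - t) u]\<close> cancels the variable
  \<open>x i\<close> from the alphabet.\<close>

lemma evq_remove:
  assumes A: "finite A" and i: "i \<in> A"
  shows "(\<Sum>m\<le>degree (shiftp t F). evq A (coeff (shiftp t F) m) * x i ^ m) = evq (A - {i}) F"
proof -
  interpret e: comm_ring_hom "evq A" by (rule evq_hom)
  interpret m: map_poly_comm_ring_hom "evq A" ..
  have eval: "poly (map_poly (evq A) p) y = (\<Sum>m\<le>degree p. evq A (coeff p m) * y ^ m)" for p y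
  proof -
    have "poly (map_poly (evq A) p) y = (\<Sum>m\<le>degree (map_poly (evq A) p). coeff (map_poly (evq A) p) m * y ^ m)"
      by (rule poly_altdef)
    also have "\<dots> = (\<Sum>m\<le>degree p. coeff (map_poly (evq A) p) m * y ^ m)"
    proof (rule sum.mono_neutral_left)
      show "\<forall>m\<in>{..degree p} - {..degree (map_poly (evq A) p)}. coeff (map_poly (evq A) p) m * y ^ m = 0"
        using coeff_eq_0[of "map_poly (evq A) p"] by (simp only: not_le[symmetric] Diff_iff atMost_iff) simp
    qed (use degree_map_poly_le[of "evq A" p] in auto)
    finally show ?thesis by (simp add: coeff_map_poly)
  qed
  have const: "poly (map_poly (evq A) [:c:]) (x i) = evq A c" for c
    unfolding eval by simp
  have hom': "comm_ring_hom (\<lambda>p. poly (map_poly (evq A) p) (x i))"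
    by (rule comm_ring_homI) (simp_all add: m.hom_add m.hom_mult)
  have "poly (map_poly (evq A) (shiftp t F)) (x i) = evq (A - {i}) F"
    unfolding shiftp_def pleth_compose[OF hom' comm_ring_hom_pCons_const] evq_def[of "A - {i}"]
  proof (rule pleth_cong)
    show "poly (map_poly (evq A) [:const c:]) (x i) = \<iota> c" for c
      unfolding const by (simp add: evq_def hom)
    fix k :: nat assume k: "k > 0"
    have "poly (map_poly (evq A) ([:psum k:] - monom (const (1 - t ^ k)) k)) (x i) =
      evq A (psum k) - evq A (const (1 - t ^ k)) * x i ^ k"
      by (simp add: m.hom_minus map_poly_monom poly_monom const)
    also have "\<dots> = (1 - T ^ k) * (\<Sum>j\<in>A. x j ^ k) - (1 - T ^ k) * x i ^ k"
      using k by (simp add: evq_def hom pleth_psum comm_ring_homD[OF hom])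
    also have "\<dots> = (1 - T ^ k) * (\<Sum>j\<in>A - {i}. x j ^ k)"
      using sum.remove[OF A i, of "\<lambda>j. x j ^ k"] by (simp add: algebra_simps)
    finally show "poly (map_poly (evq A) ([:psum k:] - monom (const (1 - t ^ k)) k)) (x i) =
      (1 - T ^ k) * (\<Sum>j\<in>A - {i}. x j ^ k)" .
  qed
  then show ?thesis unfolding eval .
qed

text \<open>By partial fractions \<open>h_{r+m}\<close> contributes \<open>x_i^r x_i^m\<close>, and
  the sum over \<open>m\<close> evaluates the shifted function at \<open>u = x i\<close>. Since
  \<open>r > 0\<close>, the extra constant in \<open>evq_hsym\<close> stays out.\<close>

lemma evq_bop:
  assumes A: "finite A" and r: "r > 0"
  shows "evq A (bop t r F) = (1 - T) * (\<Sum>i\<in>A. x i ^ r * hl_weight T x A i * evq (A - {i}) F)"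
proof -
  let ?c = "\<lambda>m. evq A (coeff (shiftp t F) m)"
  have "evq A (bop t r F) = (\<Sum>m\<le>degree (shiftp t F). ((1 - T) * (\<Sum>i\<in>A. hl_weight T x A i * x i ^ (r + m))) * ?c m)"
    using r by (simp add: bop_def comm_ring_homD[OF evq_hom] evq_hsym[OF A])
  also have "\<dots> = (1 - T) * (\<Sum>m\<le>degree (shiftp t F). \<Sum>i\<in>A. x i ^ r * hl_weight T x A i * (?c m * x i ^ m))"
    by (simp add: sum_distrib_left sum_distrib_right power_add mult_ac)
  also have "(\<Sum>m\<le>degree (shiftp t F). \<Sum>i\<in>A. x i ^ r * hl_weight T x A i * (?c m * x i ^ m)) =
    (\<Sum>i\<in>A. x i ^ r * hl_weight T x A i * evq (A - {i}) F)"
    by (subst sum.swap) (simp add: sum_distrib_left[symmetric] evq_remove[OF A])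
  finally show ?thesis .
qed

lemma evq_Qp:
  assumes "finite A" "\<forall>r\<in>set \<tau>. r > 0"
  shows "evq A (Qp t \<tau>) = (1 - T) ^ length \<tau> * hl_sum T x \<tau> A"
  using assms
proof (induction \<tau> arbitrary: A)
  case Nil
  show ?case by (simp add: comm_ring_homD[OF evq_hom])
next
  case (Cons r \<tau>)
  then show ?case
    by (simp add: evq_bop sum_distrib_left mult_ac)
qed

lemma evq_scale: "evq A F = pleth \<iota> (\<lambda>k. \<Sum>i\<in>A. x i ^ k) (scale (\<lambda>k. 1 - t ^ k) F)"
  by (simp add: evq_def pleth_scale hom comm_ring_homD[OF hom])

text \<open>The case \<open>s = 0\<close> of \<open>evq_hsym\<close>, where the left side is
  1.\<close>

lemma sum_hl_weight:
  assumes "finite A" "T \<noteq> 1"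
  shows "(\<Sum>i\<in>A. hl_weight T x A i) = (1 - T ^ card A) / (1 - T)"
  using evq_hsym[OF assms(1), of 0] assms(2) by (simp add: comm_ring_homD[OF evq_hom] field_simps)

lemma hl_sum_zeros:
  assumes "finite A" "card A = m" "T \<noteq> 1"
  shows "hl_sum T x (replicate m 0) A = hl_v T m"
  using assms(1,2)
proof (induction m arbitrary: A)
  case 0
  then show ?case by (simp add: hl_v_def)
next
  case (Suc m)
  have "hl_sum T x (replicate (Suc m) 0) A = (\<Sum>i\<in>A. hl_weight T x A i * hl_v T m)"
    using Suc by (auto intro!: sum.cong simp: card_Diff_singleton)
  also have "\<dots> = (1 - T ^ Suc m) / (1 - T) * hl_v T m"
    unfolding sum_distrib_right[symmetric] sum_hl_weight[OF Suc.prems(1) assms(3)] Suc.prems(2) ..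
  finally show ?case by (simp add: hl_v_def mult_ac)
qed

lemma hl_sum_append_zeros:
  assumes "finite A" "card A = length \<tau> + m" "T \<noteq> 1"
  shows "hl_sum T x (\<tau> @ replicate m 0) A = hl_sum T x \<tau> A * hl_v T m"
  using assms(1,2)
proof (induction \<tau> arbitrary: A)
  case Nil
  then show ?case using hl_sum_zeros[OF _ _ assms(3)] by simp
next
  case (Cons r \<tau>)
  then show ?case
    by (simp add: sum_distrib_right mult.assoc card_Diff_singleton)
qed

text \<open>A list of full length uses every variable once, so raising all exponents by 1 multiplies
  each term by the product of all variables.\<close>

lemma hl_sum_map_Suc:
  assumes "finite A" "card A = length \<tau>"
  shows "hl_sum T x (map Suc \<tau>) A = (\<Prod>i\<in>A. x i) * hl_sum T x \<tau> A"
  using assms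
proof (induction \<tau> arbitrary: A)
  case Nil
  then show ?case by simp
next
  case (Cons r \<tau>)
  have "hl_sum T x (map Suc (r # \<tau>)) A =
    (\<Sum>i\<in>A. x i ^ Suc r * hl_weight T x A i * ((\<Prod>j\<in>A - {i}. x j) * hl_sum T x \<tau> (A - {i})))"
    using Cons by (auto intro!: sum.cong simp: card_Diff_singleton)
  also have "\<dots> = (\<Sum>i\<in>A. (\<Prod>j\<in>A. x j) * (x i ^ r * hl_weight T x A i * hl_sum T x \<tau> (A - {i})))"
  proof (rule sum.cong)
    fix i assume "i \<in> A"
    from prod.remove[OF Cons.prems(1) this, of x]
    show "x i ^ Suc r * hl_weight T x A i * ((\<Prod>j\<in>A - {i}. x j) * hl_sum T x \<tau> (A - {i})) =
      (\<Prod>j\<in>A. x j) * (x i ^ r * hl_weight T x A i * hl_sum T x \<tau> (A - {i}))"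
      by (simp add: mult_ac)
  qed simp
  finally show ?case by (simp add: sum_distrib_left)
qed

end

section \<open>Antisymmetrization\<close>

definition pairs :: "nat \<Rightarrow> (nat \<times> nat) set" where
  "pairs N = {(i, j). i < j \<and> j < N}"

definition vander :: "nat \<Rightarrow> (nat \<Rightarrow> 'e::comm_ring_1) \<Rightarrow> 'e" where
  "vander N x = (\<Prod>(i, j)\<in>pairs N. x i - x j)"

lemma finite_pairs: "finite (pairs N)"
  by (rule finite_subset[of _ "{..<N} \<times> {..<N}"]) (auto simp: pairs_def)

lemma prod_pairs: "(\<Prod>(i, j)\<in>pairs N. f i j) = (\<Prod>i<N. \<Prod>j\<in>{Suc i..<N}. f i j)"
proof -
  have "pairs N = Sigma {..<N} (\<lambda>i. {Suc i..<N})" by (auto simp: pairs_def)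
  then show ?thesis by (simp add: prod.Sigma)
qed

lemma inversions_transpose:
  assumes "a < b" "b < N"
  shows "{(i, j) \<in> pairs N. \<not> transpose a b i < transpose a b j} =
    insert (a, b) ((\<lambda>k. (a, k)) ` {a<..<b} \<union> (\<lambda>k. (k, b)) ` {a<..<b})"
  using assms by (auto simp: pairs_def transpose_def image_iff split: if_splits)

text \<open>The transposition reverses the pair \<open>(a, b)\<close> itself and, for each
  \<open>k\<close> strictly between, the pairs \<open>(a, k)\<close> and \<open>(k, b)\<close>: an
  odd number, whence the sign.\<close>

lemma vander_transpose:
  assumes "a < N" "b < N" "a \<noteq> b"
  shows "vander N (x \<circ> transpose a b) = - vander N (x :: nat \<Rightarrow> 'e::comm_ring_1)"
proof -
  have *: "vander N (x \<circ> transpose a b) = - vander N x" if ab: "a < b" "b < N" for a b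
  proof -
    let ?s = "transpose a b"
    \<comment> \<open>Sorting the image of a pair gives an involution of \<open>pairs N\<close>, so
      apart from signs the factors are merely rearranged.\<close>
    let ?\<phi> = "\<lambda>(i, j). (min (?s i) (?s j), max (?s i) (?s j))"
    let ?I = "{(i, j) \<in> pairs N. \<not> ?s i < ?s j}"
    have bnd: "?s i < N" if "i < N" for i
      using that ab by (auto simp: transpose_def)
    have ne: "?s i \<noteq> ?s j" if "i \<noteq> j" for i j
      using that by (auto simp: transpose_def)
    have "vander N (x \<circ> ?s) = (\<Prod>p\<in>pairs N. (if p \<in> ?I then - 1 else 1) * (x (fst (?\<phi> p)) - x (snd (?\<phi> p))))"
      unfolding vander_def
    proof (rule prod.cong)
      fix p assume "p \<in> pairs N"
      then show "(case p of (i, j) \<Rightarrow> (x \<circ> ?s) i - (x \<circ> ?s) j) =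
        (if p \<in> ?I then - 1 else 1) * (x (fst (?\<phi> p)) - x (snd (?\<phi> p)))"
        using ne[of "fst p" "snd p"] by (cases p) (auto simp: pairs_def min_def max_def)
    qed simp
    also have "\<dots> = (\<Prod>p\<in>pairs N. if p \<in> ?I then - 1 else 1) * (\<Prod>p\<in>pairs N. x (fst (?\<phi> p)) - x (snd (?\<phi> p)))"
      by (rule prod.distrib)
    also have "(\<Prod>p\<in>pairs N. x (fst (?\<phi> p)) - x (snd (?\<phi> p))) = (\<Prod>p\<in>pairs N. x (fst p) - x (snd p))"
    proof -
      have "?\<phi> (?\<phi> p) = p \<and> ?\<phi> p \<in> pairs N" if p: "p \<in> pairs N" for p
      proof -
        obtain i j where ij: "p = (i, j)" "i < j" "j < N" using p by (auto simp: pairs_def)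
        have "?\<phi> (?\<phi> p) = p" using ij ne[of i j] by (auto simp: min_def max_def)
        moreover have "?\<phi> p \<in> pairs N" using ij ne[of i j] bnd[of i] bnd[of j] by (auto simp: pairs_def)
        ultimately show ?thesis by blast
      qed
      then show ?thesis by (intro prod.reindex_bij_witness[of _ ?\<phi> ?\<phi>]) blast+
    qed
    also have "(\<Prod>p\<in>pairs N. if p \<in> ?I then - 1 else 1) = (- 1 :: 'e) ^ card ?I"
    proof -
      have "(\<Prod>p\<in>pairs N. if p \<in> ?I then - 1 else 1) = (\<Prod>p\<in>?I. - 1 :: 'e)"
        by (rule prod.mono_neutral_cong_right) (auto simp: finite_pairs)
      then show ?thesis by simp
    qed
    also have "card ?I = Suc (2 * card {a<..<b})"
      unfolding inversions_transpose[OF ab]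
    proof (subst card_insert_disjoint)
      have "card ((\<lambda>k. (a, k)) ` {a<..<b} \<union> (\<lambda>k. (k, b)) ` {a<..<b}) =
        card ((\<lambda>k. (a, k)) ` {a<..<b}) + card ((\<lambda>k. (k, b)) ` {a<..<b})"
        by (rule card_Un_disjoint) auto
      also have "\<dots> = 2 * card {a<..<b}"
        by (subst (1 2) card_image) (auto simp: inj_on_def)
      finally show "Suc (card ((\<lambda>k. (a, k)) ` {a<..<b} \<union> (\<lambda>k. (k, b)) ` {a<..<b})) = Suc (2 * card {a<..<b})"
        by simp
    qed auto
    finally show ?thesis by (simp add: vander_def case_prod_unfold)
  qed
  show ?thesis
    using assms *[of a b] *[of b a] by (cases "a < b") (auto simp: transpose_commute)
qed

lemma vander_permute:
  assumes "w permutes {..<N}"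
  shows "vander N (x \<circ> w) = of_int (sign w) * vander N (x :: nat \<Rightarrow> 'e::comm_ring_1)"
  using assms finite_lessThan[of N]
proof (induction w arbitrary: x rule: permutes_induct)
  case id
  show ?case by simp
next
  case (swap a b p)
  have "sign (transpose a b \<circ> p) = - sign p"
  proof -
    have "permutation p" using swap.hyps unfolding permutation_permutes by blast
    then show ?thesis using swap.hyps by (simp add: sign_compose permutation_swap_id sign_swap_id)
  qed
  moreover have "vander N (x \<circ> transpose a b) = - vander N x"
    by (rule vander_transpose) (use swap.hyps in auto)
  moreover have "vander N (x \<circ> (transpose a b \<circ> p)) = of_int (sign p) * vander N (x \<circ> transpose a b)"
    unfolding comp_assoc[symmetric] by (rule swap.IH)
  ultimately show ?case by (simp only:) simp
qed

text \<open>The summand of \<open>hl_sum\<close> for one ordering of the variables, given as the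
  list in which they take up the exponents.\<close>

fun list_term :: "'e::field \<Rightarrow> (nat \<Rightarrow> 'e) \<Rightarrow> nat list \<Rightarrow> nat list \<Rightarrow> 'e" where
  "list_term T x (r # \<alpha>) (i # l) =
     x i ^ r * (\<Prod>j\<in>set l. (x i - T * x j) / (x i - x j)) * list_term T x \<alpha> l"
| "list_term T x _ _ = 1"

lemma hl_sum_permutations:
  assumes "finite A" "length \<alpha> = card A"
  shows "hl_sum T x \<alpha> A = (\<Sum>l\<in>permutations_of_set A. list_term T x \<alpha> l)"
  using assms
proof (induction \<alpha> arbitrary: A)
  case Nil
  then have "A = {}" by simp
  then show ?case by simp
next
  case (Cons r \<alpha>)
  have "A \<noteq> {}" using Cons.prems(2) by (intro notI) simp
  have "(\<Sum>l\<in>permutations_of_set A. list_term T x (r # \<alpha>) l) =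
    (\<Sum>l\<in>(\<Union>i\<in>A. (#) i ` permutations_of_set (A - {i})). list_term T x (r # \<alpha>) l)"
    unfolding permutations_of_set_nonempty[OF \<open>A \<noteq> {}\<close>] by (rule refl)
  also have "\<dots> = (\<Sum>i\<in>A. \<Sum>l\<in>(#) i ` permutations_of_set (A - {i}). list_term T x (r # \<alpha>) l)"
  proof (rule sum.UNION_disjoint)
    show "finite A" by fact
    show "\<forall>i\<in>A. finite ((#) i ` permutations_of_set (A - {i}))"
      using Cons.prems(1) by (intro ballI finite_imageI) simp
    show "\<forall>i\<in>A. \<forall>j\<in>A. i \<noteq> j \<longrightarrow>
      (#) i ` permutations_of_set (A - {i}) \<inter> (#) j ` permutations_of_set (A - {j}) = {}"
      by blast
  qed
  also have "\<dots> = (\<Sum>i\<in>A. \<Sum>l\<in>permutations_of_set (A - {i}). list_term T x (r # \<alpha>) (i # l))"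
    by (rule sum.cong[OF refl], subst sum.reindex, rule inj_onI, simp, simp only: comp_def)
  also have "\<dots> = (\<Sum>i\<in>A. x i ^ r * hl_weight T x A i * hl_sum T x \<alpha> (A - {i}))"
  proof (rule sum.cong)
    fix i assume i: "i \<in> A"
    have "(\<Sum>l\<in>permutations_of_set (A - {i}). list_term T x (r # \<alpha>) (i # l)) =
      (\<Sum>l\<in>permutations_of_set (A - {i}). x i ^ r * hl_weight T x A i * list_term T x \<alpha> l)"
    proof (rule sum.cong)
      fix l assume "l \<in> permutations_of_set (A - {i})"
      then have "set l = A - {i}" by (rule permutations_of_setD)
      then show "list_term T x (r # \<alpha>) (i # l) = x i ^ r * hl_weight T x A i * list_term T x \<alpha> l"
        by (simp add: hl_weight_def)
    qed simp
    also have "\<dots> = x i ^ r * hl_weight T x A i * hl_sum T x \<alpha> (A - {i})"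
    proof -
      have "hl_sum T x \<alpha> (A - {i}) = (\<Sum>l\<in>permutations_of_set (A - {i}). list_term T x \<alpha> l)"
        by (rule Cons.IH) (use Cons.prems i in \<open>auto simp: card_Diff_singleton\<close>)
      then show ?thesis by (simp only: sum_distrib_left)
    qed
    finally show "(\<Sum>l\<in>permutations_of_set (A - {i}). list_term T x (r # \<alpha>) (i # l)) =
      x i ^ r * hl_weight T x A i * hl_sum T x \<alpha> (A - {i})" .
  qed simp
  finally show ?case by simp
qed

lemma list_term_eq:
  assumes "length \<alpha> = length l" "distinct l"
  shows "list_term T x \<alpha> l = (\<Prod>i<length l. x (l ! i) ^ (\<alpha> ! i)) *
    (\<Prod>i<length l. \<Prod>j\<in>{Suc i..<length l}. (x (l ! i) - T * x (l ! j)) / (x (l ! i) - x (l ! j)))"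
  using assms
proof (induction \<alpha> l rule: list_induct2)
  case Nil
  then show ?case by simp
next
  case (Cons r \<alpha> i l)
  let ?g = "\<lambda>i j. (x i - T * x j) / (x i - x j)"
  have "(\<Prod>j\<in>set l. ?g i j) = (\<Prod>j<length l. ?g i (l ! j))"
    using Cons.prems by (intro prod.reindex_bij_betw[symmetric] bij_betw_nth) auto
  also have "\<dots> = (\<Prod>j\<in>{Suc 0..<Suc (length l)}. ?g i ((i # l) ! j))"
    unfolding prod.shift_bounds_Suc_ivl by (simp add: atLeast0LessThan)
  finally have 1: "(\<Prod>j\<in>set l. ?g i j) = (\<Prod>j\<in>{Suc 0..<length (i # l)}. ?g i ((i # l) ! j))" by simp
  have 2: "(\<Prod>k<length (i # l). \<Prod>j\<in>{Suc k..<length (i # l)}. ?g ((i # l) ! k) ((i # l) ! j)) =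
    (\<Prod>j\<in>{Suc 0..<length (i # l)}. ?g i ((i # l) ! j)) *
    (\<Prod>k<length l. \<Prod>j\<in>{Suc k..<length l}. ?g (l ! k) (l ! j))"
    unfolding list.size(4) add_Suc_right add_0_right prod.lessThan_Suc_shift prod.shift_bounds_Suc_ivl by simp
  have 3: "(\<Prod>k<length (i # l). x ((i # l) ! k) ^ ((r # \<alpha>) ! k)) = x i ^ r * (\<Prod>k<length l. x (l ! k) ^ (\<alpha> ! k))"
    unfolding list.size(4) add_Suc_right add_0_right prod.lessThan_Suc_shift by simp
  show ?case
    unfolding 2 3 list_term.simps 1 using Cons by (simp add: mult_ac)
qed

lemma bij_betw_permutes_lists:
  "bij_betw (\<lambda>w. map w [0..<N]) {w. w permutes {..<N}} (permutations_of_set {..<N})"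
proof (rule bij_betwI')
  fix w v assume *: "w \<in> {w. w permutes {..<N}}" "v \<in> {w. w permutes {..<N}}"
  show "map w [0..<N] = map v [0..<N] \<longleftrightarrow> w = v"
  proof
    assume eq: "map w [0..<N] = map v [0..<N]"
    show "w = v"
    proof
      fix i show "w i = v i"
      proof (cases "i < N")
        case True
        then show ?thesis using arg_cong[OF eq, of "\<lambda>l. l ! i"] by simp
      next
        case False
        then show ?thesis using * permutes_not_in[of w "{..<N}" i] permutes_not_in[of v "{..<N}" i] by simp
      qed
    qed
  qed simp
next
  fix w assume "w \<in> {w. w permutes {..<N}}"
  then have w: "w permutes {..<N}" by simp
  have "w ` {..<N} = {..<N}" "inj_on w {..<N}" by (rule permutes_image[OF w], rule permutes_inj_on[OF w])
  then show "map w [0..<N] \<in> permutations_of_set {..<N}"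
    unfolding permutations_of_set_def by (simp add: distinct_map atLeast0LessThan)
next
  fix l assume l: "l \<in> permutations_of_set {..<N}"
  then have set: "set l = {..<N}" and dist: "distinct l" by (auto simp: permutations_of_set_def)
  then have len: "length l = N" using distinct_card[OF dist] by simp
  define w where "w i = (if i < N then l ! i else i)" for i
  have "bij_betw w {..<N} {..<N}"
  proof (subst bij_betw_cong[of _ _ "(!) l"])
    show "bij_betw ((!) l) {..<N} {..<N}"
      by (rule bij_betw_nth[OF dist]) (simp_all only: len set)
  qed (simp add: w_def)
  then have "w permutes {..<N}" by (rule bij_imp_permutes) (simp add: w_def)
  moreover have "map w [0..<N] = l"
    by (rule nth_equalityI) (auto simp: len w_def)
  ultimately show "\<exists>w\<in>{w. w permutes {..<N}}. l = map w [0..<N]" by blast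
qed

text \<open>The denominators in the summand of \<open>w\<close> multiply up to the Vandermonde
  product of the permuted variables, which is the fixed one up to \<open>sign w\<close>. This
  produces the cleared form used in \<open>hall_littlewood\<close>.\<close>

lemma antisymmetrization:
  fixes x :: "nat \<Rightarrow> 'e::field"
  assumes x: "inj x" and \<tau>: "length \<tau> \<le> N"
  shows "(\<Sum>w | w permutes {..<N}. of_int (sign w) * (\<Prod>i<N. x (w i) ^ part \<tau> i) *
      (\<Prod>(i, j)\<in>pairs N. x (w i) - T * x (w j))) =
    vander N x * hl_sum T x (\<tau> @ replicate (N - length \<tau>) 0) {..<N}"
proof -
  let ?\<alpha> = "\<tau> @ replicate (N - length \<tau>) 0"
  have V: "vander N x \<noteq> 0"
    unfolding vander_def prod_zero_iff[OF finite_pairs] using x by (auto simp: pairs_def inj_eq)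
  have summand: "of_int (sign w) * (\<Prod>i<N. x (w i) ^ part \<tau> i) * (\<Prod>(i, j)\<in>pairs N. x (w i) - T * x (w j)) =
    vander N x * list_term T x ?\<alpha> (map w [0..<N])" if w: "w permutes {..<N}" for w
  proof -
    have dist: "distinct (map w [0..<N])"
      using w by (simp add: distinct_map permutes_inj_on)
    have part: "(\<Prod>i<N. x (map w [0..<N] ! i) ^ (?\<alpha> ! i)) = (\<Prod>i<N. x (w i) ^ part \<tau> i)"
      by (rule prod.cong) (auto simp: part_def nth_append)
    have "list_term T x ?\<alpha> (map w [0..<N]) = (\<Prod>i<N. x (w i) ^ part \<tau> i) *
      (\<Prod>(i, j)\<in>pairs N. (x (w i) - T * x (w j)) / (x (w i) - x (w j)))"
    proof (subst list_term_eq[OF _ dist])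
      show "length ?\<alpha> = length (map w [0..<N])" using \<tau> by simp
      have "(\<Prod>i<N. \<Prod>j\<in>{Suc i..<N}. (x (map w [0..<N] ! i) - T * x (map w [0..<N] ! j)) /
          (x (map w [0..<N] ! i) - x (map w [0..<N] ! j))) =
        (\<Prod>i<N. \<Prod>j\<in>{Suc i..<N}. (x (w i) - T * x (w j)) / (x (w i) - x (w j)))"
        by (intro prod.cong refl) simp
      then show "(\<Prod>i<length (map w [0..<N]). x (map w [0..<N] ! i) ^ (?\<alpha> ! i)) *
        (\<Prod>i<length (map w [0..<N]). \<Prod>j\<in>{Suc i..<length (map w [0..<N])}.
          (x (map w [0..<N] ! i) - T * x (map w [0..<N] ! j)) / (x (map w [0..<N] ! i) - x (map w [0..<N] ! j))) =
        (\<Prod>i<N. x (w i) ^ part \<tau> i) * (\<Prod>(i, j)\<in>pairs N. (x (w i) - T * x (w j)) / (x (w i) - x (w j)))"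
        by (simp only: prod_pairs part length_map length_upt diff_zero)
    qed
    also have "(\<Prod>(i, j)\<in>pairs N. (x (w i) - T * x (w j)) / (x (w i) - x (w j))) =
      (\<Prod>(i, j)\<in>pairs N. x (w i) - T * x (w j)) / vander N (x \<circ> w)"
      by (simp add: vander_def case_prod_unfold prod_dividef)
    also have "vander N (x \<circ> w) = of_int (sign w) * vander N x" by (rule vander_permute[OF w])
    finally have "list_term T x ?\<alpha> (map w [0..<N]) = (\<Prod>i<N. x (w i) ^ part \<tau> i) *
      ((\<Prod>(i, j)\<in>pairs N. x (w i) - T * x (w j)) / (of_int (sign w) * vander N x))" .
    moreover have "sign w = 1 \<or> sign w = - 1" by (simp add: sign_def)
    ultimately show ?thesis using V by (elim disjE) simp_all
  qed
  have "(\<Sum>w | w permutes {..<N}. of_int (sign w) * (\<Prod>i<N. x (w i) ^ part \<tau> i) *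
      (\<Prod>(i, j)\<in>pairs N. x (w i) - T * x (w j))) =
    (\<Sum>w | w permutes {..<N}. vander N x * list_term T x ?\<alpha> (map w [0..<N]))"
    by (rule sum.cong) (simp_all add: summand)
  also have "\<dots> = vander N x * (\<Sum>l\<in>permutations_of_set {..<N}. list_term T x ?\<alpha> l)"
    unfolding sum_distrib_left by (rule sum.reindex_bij_betw[OF bij_betw_permutes_lists])
  also have "(\<Sum>l\<in>permutations_of_set {..<N}. list_term T x ?\<alpha> l) = hl_sum T x ?\<alpha> {..<N}"
    by (rule hl_sum_permutations[symmetric]) (use \<tau> in auto)
  finally show ?thesis .
qed

section \<open>Identification of the Hall--Littlewood functions\<close>

lemma comm_ring_hom_inverse:
  fixes f :: "'a::field \<Rightarrow> 'b::field"
  assumes "comm_ring_hom f"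
  shows "f (inverse a) = inverse (f a)"
proof (cases "a = 0")
  case False
  then have "f a * f (inverse a) = 1"
    by (simp add: comm_ring_homD(2,4)[OF assms, symmetric] flip: comm_ring_homD(4)[OF assms])
  then show ?thesis by (simp add: inverse_unique)
qed (simp add: comm_ring_homD[OF assms])

lemma comm_ring_hom_divide:
  fixes f :: "'a::field \<Rightarrow> 'b::field"
  assumes "comm_ring_hom f"
  shows "f (a / b) = f a / f b"
  by (simp add: divide_inverse comm_ring_homD[OF assms] comm_ring_hom_inverse[OF assms])

lemma to_fract_hom: "comm_ring_hom to_fract"
  by (rule comm_ring_homI) simp_all

lemma const_eq_iff: "const a = const b \<longleftrightarrow> a = b"
  unfolding const_def by (metis lookup_single_eq)

lemma const_eq_0_iff: "const c = 0 \<longleftrightarrow> c = 0"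
  using const_eq_iff[of c 0] by simp

lemma xvar_eq_iff: "xvar i = (xvar j :: 'k::field_char_0 xpoly) \<longleftrightarrow> i = j"
proof
  assume "xvar i = (xvar j :: 'k xpoly)"
  then have "Poly_Mapping.keys (xvar i :: 'k xpoly) = Poly_Mapping.keys (xvar j :: 'k xpoly)" by simp
  then have "Poly_Mapping.single i (1::nat) = Poly_Mapping.single j 1" by (simp add: xvar_def)
  then have "Poly_Mapping.keys (Poly_Mapping.single i (1::nat)) = Poly_Mapping.keys (Poly_Mapping.single j (1::nat))" by simp
  then show "i = j" by simp
qed simp

lemma xvar_nonzero: "xvar i \<noteq> (0 :: 'k::field_char_0 xpoly)"
proof
  assume "xvar i = (0 :: 'k xpoly)"
  then have "Poly_Mapping.keys (xvar i :: 'k xpoly) = {}" by simp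
  then show False by (simp add: xvar_def)
qed

text \<open>Not a root of unity, so that no normalizing factor \<open>hl_v\<close> or
  \<open>hl_b\<close> vanishes. The value 0 qualifies and leads to the Schur functions.\<close>

definition nonroot :: "'k::field \<Rightarrow> bool" where
  "nonroot t \<longleftrightarrow> (\<forall>k>0. t ^ k \<noteq> 1)"

lemma nonrootD: "nonroot t \<Longrightarrow> k > 0 \<Longrightarrow> t ^ k \<noteq> 1"
  by (simp add: nonroot_def)

lemma nonroot_neq_1: "nonroot t \<Longrightarrow> t \<noteq> 1"
  using nonrootD[of t 1] by simp

lemma hl_v_nonzero: "nonroot t \<Longrightarrow> hl_v t m \<noteq> 0"
  unfolding hl_v_def using nonrootD[of t] nonroot_neq_1[of t] by (simp add: prod_zero_iff)

abbreviation frc :: "'k::field_char_0 \<Rightarrow> 'k xpoly fract" where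
  "frc c \<equiv> to_fract (const c)"

abbreviation frx :: "nat \<Rightarrow> 'k::field_char_0 xpoly fract" where
  "frx i \<equiv> to_fract (xvar i)"

lemma frc_hom: "comm_ring_hom frc"
  by (rule comm_ring_hom_compose[OF to_fract_hom comm_ring_hom_const])

interpretation frx: hl_evaluation frc frx t for t :: "'k::field_char_0"
  by (rule hl_evaluation.intro[OF frc_hom]) (auto intro!: injI simp: xvar_eq_iff xvar_nonzero)

lemma pleth_frx: "pleth frc (\<lambda>k. \<Sum>i<N. frx i ^ k) F = to_fract (in_vars N F)"
  unfolding in_vars_def pleth_compose[OF to_fract_hom comm_ring_hom_const]
  by (rule pleth_cong) (simp_all add: comm_ring_homD[OF to_fract_hom])

lemma hl_v_hom:
  assumes "comm_ring_hom (f :: 'a::field \<Rightarrow> 'b::field)"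
  shows "f (hl_v t m) = hl_v (f t) m"
  by (simp add: hl_v_def comm_ring_homD[OF assms] comm_ring_hom_divide[OF assms])

text \<open>Macdonald's \<open>Q_\<tau>(x; t)\<close>, obtained as
  \<open>Q'[X (1 - t)]\<close>.\<close>

definition Qhl :: "'k::field_char_0 \<Rightarrow> nat list \<Rightarrow> 'k symf" where
  "Qhl t \<tau> = scale (\<lambda>k. 1 - t ^ k) (Qp t \<tau>)"

definition hl_mult :: "'k::field \<Rightarrow> nat list \<Rightarrow> 'k" where
  "hl_mult t \<tau> = (\<Prod>k\<in>set \<tau>. hl_v t (count (mset \<tau>) k))"

text \<open>Macdonald's \<open>b_\<tau>(t)\<close>: a factor \<open>(1 - t) ... (1 - t^m)\<close>
  for each part size of multiplicity \<open>m\<close>. Dividing \<open>Q\<close> by it gives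
  \<open>P\<close>.\<close>

definition hl_b :: "'k::field \<Rightarrow> nat list \<Rightarrow> 'k" where
  "hl_b t \<tau> = (1 - t) ^ length \<tau> * hl_mult t \<tau>"

definition HL :: "'k::field_char_0 \<Rightarrow> nat list \<Rightarrow> 'k symf" where
  "HL t \<tau> = smul (1 / hl_b t \<tau>) (Qhl t \<tau>)"

lemma hl_b_nonzero: "nonroot t \<Longrightarrow> hl_b t \<tau> \<noteq> 0"
  using nonroot_neq_1[of t] hl_v_nonzero[of t] by (simp add: hl_b_def hl_mult_def prod_zero_iff)

lemma to_fract_Qhl:
  assumes "\<forall>r\<in>set \<tau>. r > 0"
  shows "to_fract (in_vars N (Qhl t \<tau>)) = frc ((1 - t) ^ length \<tau>) * hl_sum (frc t) frx \<tau> {..<N}"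
proof -
  have "to_fract (in_vars N (Qhl t \<tau>)) = frx.evq t {..<N} (Qp t \<tau>)"
    unfolding frx.evq_scale Qhl_def[symmetric] pleth_frx ..
  also have "\<dots> = (1 - frc t) ^ length \<tau> * hl_sum (frc t) frx \<tau> {..<N}"
    by (rule frx.evq_Qp) (use assms in auto)
  finally show ?thesis by (simp add: comm_ring_homD[OF frc_hom])
qed

lemma frc_neq_1: "t \<noteq> 1 \<Longrightarrow> frc t \<noteq> 1"
  by (metis const_eq_iff const_one to_fract_1 to_fract_eq_iff)

lemma HL_antisymmetrization:
  fixes t :: "'k::field_char_0"
  assumes t: "nonroot t" and \<tau>: "is_partition \<tau>" and N: "length \<tau> \<le> N"
  shows "const (hl_v_part t N \<tau>) * vander N xvar * in_vars N (HL t \<tau>) =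
     (\<Sum>w | w permutes {..<N}. of_int (sign w) * (\<Prod>i<N. xvar (w i) ^ part \<tau> i) *
        (\<Prod>(i, j)\<in>pairs N. xvar (w i) - const t * xvar (w j)))" (is "?L = ?R")
proof -
  note f = comm_ring_homD[OF to_fract_hom]
  have pos: "\<forall>r\<in>set \<tau>. r > 0" using \<tau> by (simp add: is_partition_def)
  have V: "to_fract (vander N xvar) = vander N (frx :: nat \<Rightarrow> 'k xpoly fract)"
    by (simp add: vander_def f case_prod_unfold)
  have "to_fract ?R = (\<Sum>w | w permutes {..<N}. of_int (sign w) * (\<Prod>i<N. frx (w i) ^ part \<tau> i) *
        (\<Prod>(i, j)\<in>pairs N. frx (w i) - frc t * frx (w j)))"
    by (simp only: f case_prod_unfold)
  also have "\<dots> = vander N frx * hl_sum (frc t) frx (\<tau> @ replicate (N - length \<tau>) 0) {..<N}"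
    by (rule antisymmetrization[OF frx.inj_x N])
  also have "hl_sum (frc t) frx (\<tau> @ replicate (N - length \<tau>) 0) {..<N} =
      hl_sum (frc t) frx \<tau> {..<N} * hl_v (frc t) (N - length \<tau>)"
    by (rule frx.hl_sum_append_zeros) (use N frc_neq_1[OF nonroot_neq_1[OF t]] in auto)
  finally have R: "to_fract ?R = vander N frx * (hl_sum (frc t) frx \<tau> {..<N} * hl_v (frc t) (N - length \<tau>))" .
  \<comment> \<open>The normalization cancels up to the factor belonging to the trailing zeros,
    which is exactly what padding the exponent list produces.\<close>
  have "hl_v_part t N \<tau> * (1 / hl_b t \<tau>) * (1 - t) ^ length \<tau> = hl_v t (N - length \<tau>)"
    using hl_b_nonzero[OF t, of \<tau>] by (simp add: hl_v_part_def hl_b_def hl_mult_def)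
  from arg_cong[OF this, of frc]
  have c: "frc (hl_v_part t N \<tau>) * frc (1 / hl_b t \<tau>) * frc ((1 - t) ^ length \<tau>) = hl_v (frc t) (N - length \<tau>)"
    by (simp only: comm_ring_homD(4)[OF frc_hom] hl_v_hom[OF frc_hom])
  have "to_fract ?L = frc (hl_v_part t N \<tau>) * vander N frx * (frc (1 / hl_b t \<tau>) * to_fract (in_vars N (Qhl t \<tau>)))"
    by (simp only: f V HL_def in_vars_smul)
  also have "\<dots> = (frc (hl_v_part t N \<tau>) * frc (1 / hl_b t \<tau>) * frc ((1 - t) ^ length \<tau>)) *
      (vander N frx * hl_sum (frc t) frx \<tau> {..<N})"
    unfolding to_fract_Qhl[OF pos] by (simp only: mult_ac)
  also have "\<dots> = to_fract ?R"
    unfolding c R by (simp only: mult_ac)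
  finally show ?thesis by (simp only: to_fract_eq_iff)
qed

lemma vander_xvar_nonzero: "vander N (xvar :: nat \<Rightarrow> 'k::field_char_0 xpoly) \<noteq> 0"
  unfolding vander_def prod_zero_iff[OF finite_pairs] by (auto simp: pairs_def xvar_eq_iff)

text \<open>Existence is the preceding identity; uniqueness is cancellation of a nonzero polynomial
  factor in every sufficiently large number of variables.\<close>

lemma hall_littlewood_eq:
  fixes t :: "'k::field_char_0"
  assumes t: "nonroot t" and \<tau>: "is_partition \<tau>"
  shows "hall_littlewood t \<tau> = HL t \<tau>"
proof -
  define R where "R N = (\<Sum>w | w permutes {..<N}. of_int (sign w) * (\<Prod>i<N. xvar (w i) ^ part \<tau> i) *
        (\<Prod>(i, j)\<in>pairs N. xvar (w i) - const t * xvar (w j)))" for N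
  have "hall_littlewood t \<tau> = (THE F. \<forall>N\<ge>length \<tau>. const (hl_v_part t N \<tau>) * vander N xvar * in_vars N F = R N)"
    by (simp only: hall_littlewood_def vander_def pairs_def R_def)
  also have "\<dots> = HL t \<tau>"
  proof (rule the_equality)
    show HL: "\<forall>N\<ge>length \<tau>. const (hl_v_part t N \<tau>) * vander N xvar * in_vars N (HL t \<tau>) = R N"
      using HL_antisymmetrization[OF t \<tau>] by (simp add: R_def)
    fix F assume F: "\<forall>N\<ge>length \<tau>. const (hl_v_part t N \<tau>) * vander N xvar * in_vars N F = R N"
    show "F = HL t \<tau>"
    proof (rule in_vars_inject[of "length \<tau>"])
      fix N assume N: "length \<tau> \<le> N"
      have "hl_v_part t N \<tau> \<noteq> 0"
        using hl_v_nonzero[OF t] by (simp add: hl_v_part_def prod_zero_iff)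
      then have "const (hl_v_part t N \<tau>) \<noteq> (0 :: 'k xpoly)"
        by (simp add: const_eq_0_iff)
      then have "const (hl_v_part t N \<tau>) * vander N xvar \<noteq> (0 :: 'k xpoly)"
        using vander_xvar_nonzero by simp
      moreover have "const (hl_v_part t N \<tau>) * vander N xvar * in_vars N F =
        const (hl_v_part t N \<tau>) * vander N xvar * in_vars N (HL t \<tau>)"
        using F HL N by simp
      ultimately show "in_vars N F = in_vars N (HL t \<tau>)" by simp
    qed
  qed
  finally show ?thesis .
qed

section \<open>Dominance triangularity of Hall--Littlewood functions\<close>

text \<open>Multiplying the first \<open>k\<close> variables by \<open>u\<close> turns the total degree in these variables into a
  degree of polynomials over an integral domain, which is additive on products.\<close>

definition grade :: "nat \<Rightarrow> 'k::field_char_0 xpoly \<Rightarrow> 'k xpoly poly" where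
  "grade k = pm_eval (\<lambda>c. [:const c:]) (\<lambda>\<alpha>. monom (Poly_Mapping.single \<alpha> 1) (\<Sum>i<k. Poly_Mapping.lookup \<alpha> i))"

lemma grade_hom: "comm_ring_hom (grade k)"
  unfolding grade_def
  by (rule comm_ring_hom_pm_eval[OF comm_ring_hom_compose[OF comm_ring_hom_pCons comm_ring_hom_const]])
    (simp_all add: mult_monom mult_single lookup_add sum.distrib)

lemma grade_single: "grade k (Poly_Mapping.single \<alpha> c) = monom (Poly_Mapping.single \<alpha> c) (\<Sum>i<k. Poly_Mapping.lookup \<alpha> i)"
  unfolding grade_def
  by (subst pm_eval_single) (simp_all add: smult_monom const_def mult_single)

lemma lookup_coeff_grade:
  "Poly_Mapping.lookup (coeff (grade k f) d) \<alpha> =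
    (if (\<Sum>i<k. Poly_Mapping.lookup \<alpha> i) = d then Poly_Mapping.lookup f \<alpha> else 0)"
proof (induction f rule: poly_mapping_additive_induct)
  case (single \<beta> c)
  show ?case by (auto simp: grade_single lookup_single when_def)
qed (simp add: comm_ring_homD[OF grade_hom] lookup_add)

lemma le_degree_grade:
  assumes "Poly_Mapping.lookup f \<alpha> \<noteq> 0"
  shows "(\<Sum>i<k. Poly_Mapping.lookup \<alpha> i) \<le> degree (grade k f)"
proof (rule le_degree)
  show "coeff (grade k f) (\<Sum>i<k. Poly_Mapping.lookup \<alpha> i) \<noteq> 0"
    using lookup_coeff_grade[of k f "\<Sum>i<k. Poly_Mapping.lookup \<alpha> i" \<alpha>] assms by auto
qed

lemma grade_xvar: "grade k (xvar i) = monom (xvar i) (if i < k then 1 else 0)"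
  by (simp add: xvar_def grade_single lookup_single when_def)

lemma degree_grade_diff:
  assumes "a \<noteq> b"
  shows "grade k (xvar a) - grade k (xvar b) \<noteq> (0 :: 'k::field_char_0 xpoly poly)"
    "degree (grade k (xvar a) - grade k (xvar b) :: 'k xpoly poly) = (if a < k \<or> b < k then 1 else 0)"
proof -
  have ne: "xvar a - xvar b \<noteq> (0 :: 'k xpoly)" using assms by (simp add: xvar_eq_iff)
  have "grade k (xvar a) - grade k (xvar b) = (if a < k then (if b < k then [:0, xvar a - xvar b:] else [:- xvar b, xvar a:])
      else (if b < k then [:xvar a, - xvar b:] else [:xvar a - xvar b:]) :: 'k xpoly poly)"
    by (simp add: grade_xvar monom_0 monom_Suc)
  then show "grade k (xvar a) - grade k (xvar b) \<noteq> (0 :: 'k xpoly poly)"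
    "degree (grade k (xvar a) - grade k (xvar b) :: 'k xpoly poly) = (if a < k \<or> b < k then 1 else 0)"
    using ne xvar_nonzero[where 'k = 'k] by auto
qed

lemma degree_grade_vander:
  assumes "inj w"
  shows "grade k (vander N (xvar \<circ> w)) \<noteq> (0 :: 'k::field_char_0 xpoly poly)"
    "degree (grade k (vander N (xvar \<circ> w) :: 'k xpoly)) = (\<Sum>(i, j)\<in>pairs N. if w i < k \<or> w j < k then 1 else 0)"
proof -
  have eq: "grade k (vander N (xvar \<circ> w)) = (\<Prod>(i, j)\<in>pairs N. grade k (xvar (w i)) - grade k (xvar (w j)) :: 'k xpoly poly)"
    by (simp add: vander_def comm_ring_homD[OF grade_hom] case_prod_unfold)
  have ne: "w i \<noteq> w j" if "(i, j) \<in> pairs N" for i j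
    using that assms by (auto simp: pairs_def inj_eq)
  have nz: "(\<lambda>(i, j). grade k (xvar (w i)) - grade k (xvar (w j)) :: 'k xpoly poly) p \<noteq> 0" if "p \<in> pairs N" for p
    using that ne degree_grade_diff(1)[where 'k = 'k] by (cases p) auto
  show "grade k (vander N (xvar \<circ> w)) \<noteq> (0 :: 'k xpoly poly)"
    unfolding eq prod_zero_iff[OF finite_pairs] using nz by blast
  have "degree (grade k (vander N (xvar \<circ> w) :: 'k xpoly)) =
    (\<Sum>p\<in>pairs N. degree ((\<lambda>(i, j). grade k (xvar (w i)) - grade k (xvar (w j)) :: 'k xpoly poly) p))"
    unfolding eq by (rule degree_prod_eq_sum_degree) (use nz in blast)
  also have "\<dots> = (\<Sum>(i, j)\<in>pairs N. if w i < k \<or> w j < k then 1 else 0)"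
    by (rule sum.cong) (use ne degree_grade_diff(2)[where 'k = 'k] in \<open>auto split: prod.split\<close>)
  finally show "degree (grade k (vander N (xvar \<circ> w) :: 'k xpoly)) = (\<Sum>(i, j)\<in>pairs N. if w i < k \<or> w j < k then 1 else 0)" .
qed

text \<open>Exchange argument: the indices of \<open>B\<close> beyond the first \<open>k\<close> are
  at most as many as the ones missing from \<open>B\<close> among the first \<open>k\<close>, and
  they carry parts that are no larger.\<close>

lemma sum_part_le_prefix:
  assumes \<tau>: "is_partition \<tau>" and B: "finite B" "card B \<le> k"
  shows "(\<Sum>i\<in>B. part \<tau> i) \<le> (\<Sum>i<k. part \<tau> i)"
proof -
  let ?K = "{..<k}"
  have "card (B - ?K) + card (B \<inter> ?K) \<le> card (?K - B) + card (?K \<inter> B)"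
    using B card_Int_Diff[OF B(1), of ?K] card_Int_Diff[of ?K B] by simp
  then have c: "card (B - ?K) \<le> card (?K - B)" by (simp add: Int_commute)
  have "(\<Sum>i\<in>B - ?K. part \<tau> i) \<le> (\<Sum>i\<in>B - ?K. part \<tau> k)"
    by (rule sum_mono) (simp add: part_antimono[OF \<tau>])
  also have "\<dots> \<le> (\<Sum>i\<in>?K - B. part \<tau> k)" using c by simp
  also have "\<dots> \<le> (\<Sum>i\<in>?K - B. part \<tau> i)"
    by (rule sum_mono) (simp add: part_antimono[OF \<tau>])
  finally have "(\<Sum>i\<in>B - ?K. part \<tau> i) + (\<Sum>i\<in>B \<inter> ?K. part \<tau> i) \<le> (\<Sum>i\<in>?K - B. part \<tau> i) + (\<Sum>i\<in>?K \<inter> B. part \<tau> i)"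
    by (simp add: Int_commute)
  then show ?thesis
    using sum.Int_Diff[OF B(1), of "part \<tau>" ?K] sum.Int_Diff[of ?K "part \<tau>" B] by simp
qed

lemma degree_prod_le: "finite A \<Longrightarrow> (\<And>a. a \<in> A \<Longrightarrow> degree (f a) \<le> g a) \<Longrightarrow> degree (\<Prod>a\<in>A. f a) \<le> (\<Sum>a\<in>A. g a)"
  for f :: "'i \<Rightarrow> 'b::comm_ring_1 poly"
proof (induction A rule: finite_induct)
  case (insert a A)
  then show ?case using degree_mult_le[of "f a" "prod f A"] by (simp add: add_mono order_trans)
qed simp

text \<open>In each summand \<open>x_a - t x_b\<close> has degree in \<open>u\<close> at most that
  of \<open>x_a - x_b\<close>, so the summand exceeds the degree of the Vandermonde product only
  through its monomial, by at most a prefix sum of \<open>\<tau>\<close>. Degrees add over a domain,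
  so dividing by the Vandermonde product leaves this bound.\<close>

lemma degree_HL:
  fixes t :: "'k::field_char_0"
  assumes t: "nonroot t" and \<tau>: "is_partition \<tau>" and N: "length \<tau> \<le> N" and nz: "in_vars N (HL t \<tau>) \<noteq> 0"
  shows "degree (grade k (in_vars N (HL t \<tau>))) \<le> (\<Sum>i<k. part \<tau> i)"
proof -
  note g = comm_ring_homD[OF grade_hom]
  let ?V = "vander N (xvar :: nat \<Rightarrow> 'k xpoly)"
  let ?D = "degree (grade k ?V)"
  define F where "F w = of_int (sign w) * (\<Prod>i<N. xvar (w i) ^ part \<tau> i) *
        (\<Prod>(i, j)\<in>pairs N. xvar (w i) - const t * (xvar (w j) :: 'k xpoly))" for w
  have bound: "degree (grade k (F w)) \<le> (\<Sum>i<k. part \<tau> i) + ?D" if w: "w permutes {..<N}" for w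
  proof -
    have x: "degree (grade k (xvar i :: 'k xpoly)) \<le> (if i < k then 1 else 0)" for i
      by (simp add: grade_xvar degree_monom_le[THEN order_trans])
    have c: "grade k (const t) = [:const t:]"
      by (simp add: const_def grade_single monom_0)
    have 1: "degree (grade k (\<Prod>i<N. xvar (w i) ^ part \<tau> i :: 'k xpoly)) \<le> (\<Sum>i<N. if w i < k then part \<tau> i else 0)"
      unfolding g
    proof (rule degree_prod_le)
      fix i
      have "degree (grade k (xvar (w i) :: 'k xpoly) ^ part \<tau> i) \<le> degree (grade k (xvar (w i) :: 'k xpoly)) * part \<tau> i"
        by (rule degree_power_le)
      also have "\<dots> \<le> (if w i < k then 1 else 0) * part \<tau> i" by (rule mult_right_mono[OF x]) simp
      finally show "degree (grade k (xvar (w i) :: 'k xpoly) ^ part \<tau> i) \<le> (if w i < k then part \<tau> i else 0)"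
        by (simp split: if_splits)
    qed simp
    have "(\<Sum>i<N. if w i < k then part \<tau> i else 0) = (\<Sum>i\<in>{i. i < N \<and> w i < k}. part \<tau> i)"
      by (rule sum.mono_neutral_cong_right) auto
    also have "\<dots> \<le> (\<Sum>i<k. part \<tau> i)"
    proof (rule sum_part_le_prefix[OF \<tau>])
      have "card {i. i < N \<and> w i < k} = card (w ` {i. i < N \<and> w i < k})"
        by (rule card_image[symmetric]) (rule inj_on_subset[OF permutes_inj[OF w]], simp)
      also have "\<dots> \<le> card {..<k}" by (rule card_mono) auto
      finally show "card {i. i < N \<and> w i < k} \<le> k" by simp
    qed simp
    finally have 1: "degree (grade k (\<Prod>i<N. xvar (w i) ^ part \<tau> i :: 'k xpoly)) \<le> (\<Sum>i<k. part \<tau> i)"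
      using 1 by (rule order_trans[rotated])
    have fac: "degree (grade k (xvar a :: 'k xpoly) - [:const t:] * grade k (xvar b)) \<le> (if a < k \<or> b < k then 1 else 0)" for a b
    proof (rule degree_diff_le)
      show "degree (grade k (xvar a :: 'k xpoly)) \<le> (if a < k \<or> b < k then 1 else 0)"
        using x[of a] by (auto split: if_splits)
      have "degree ([:const t:] * grade k (xvar b) :: 'k xpoly poly) \<le> degree (grade k (xvar b :: 'k xpoly))"
        by (simp add: degree_smult_le)
      then show "degree ([:const t:] * grade k (xvar b) :: 'k xpoly poly) \<le> (if a < k \<or> b < k then 1 else 0)"
        using x[of b] by (auto split: if_splits)
    qed
    have "degree (grade k (\<Prod>(i, j)\<in>pairs N. xvar (w i) - const t * (xvar (w j) :: 'k xpoly))) \<le>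
      (\<Sum>p\<in>pairs N. (\<lambda>(i, j). if w i < k \<or> w j < k then 1 else 0) p)"
      unfolding g by (rule degree_prod_le[OF finite_pairs]) (simp only: case_prod_unfold g c fac)
    also have "\<dots> = degree (grade k (vander N (xvar \<circ> w) :: 'k xpoly))"
      by (rule degree_grade_vander(2)[OF permutes_inj[OF w], symmetric])
    also have "\<dots> = ?D"
    proof -
      have "sign w = 1 \<or> sign w = - 1" by (simp add: sign_def)
      then show ?thesis unfolding vander_permute[OF w] by (elim disjE) (simp_all add: g)
    qed
    finally have 2: "degree (grade k (\<Prod>(i, j)\<in>pairs N. xvar (w i) - const t * (xvar (w j) :: 'k xpoly))) \<le> ?D" .
    have s: "degree (grade k (of_int (sign w) :: 'k xpoly)) = 0" by (simp add: g)
    show ?thesis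
      unfolding F_def g(4)
      using degree_mult_le[of "grade k (of_int (sign w) :: 'k xpoly) * grade k (\<Prod>i<N. xvar (w i) ^ part \<tau> i)"
          "grade k (\<Prod>(i, j)\<in>pairs N. xvar (w i) - const t * xvar (w j))"]
        degree_mult_le[of "grade k (of_int (sign w) :: 'k xpoly)" "grade k (\<Prod>i<N. xvar (w i) ^ part \<tau> i)"] 1 2 s
      by linarith
  qed
  have c0: "hl_v_part t N \<tau> \<noteq> 0"
    using hl_v_nonzero[OF t] by (simp add: hl_v_part_def prod_zero_iff)
  have gc: "grade k (const (hl_v_part t N \<tau>) :: 'k xpoly) = [:const (hl_v_part t N \<tau>):]"
    by (simp add: const_def grade_single monom_0)
  have c1: "grade k (const (hl_v_part t N \<tau>) :: 'k xpoly) \<noteq> 0"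
    using c0 by (simp add: gc const_eq_0_iff)
  have V0: "grade k ?V \<noteq> 0" using degree_grade_vander(1)[of id k N] by simp
  have P0: "grade k (in_vars N (HL t \<tau>)) \<noteq> 0"
  proof -
    obtain \<alpha> where "\<alpha> \<in> Poly_Mapping.keys (in_vars N (HL t \<tau>))" using nz by (meson all_not_in_conv keys_eq_empty)
    then show ?thesis
      using lookup_coeff_grade[of k "in_vars N (HL t \<tau>)" "\<Sum>i<k. Poly_Mapping.lookup \<alpha> i" \<alpha>] by (auto simp: in_keys_iff)
  qed
  have "?D + degree (grade k (in_vars N (HL t \<tau>))) =
    degree (grade k (const (hl_v_part t N \<tau>)) * grade k ?V * grade k (in_vars N (HL t \<tau>)))"
    using c1 V0 P0 by (simp add: degree_mult_eq gc)
  also have "\<dots> = degree (grade k (\<Sum>w | w permutes {..<N}. F w))"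
    unfolding g(4)[symmetric] HL_antisymmetrization[OF t \<tau> N] F_def ..
  also have "\<dots> \<le> (\<Sum>i<k. part \<tau> i) + ?D"
    unfolding g(10) by (rule degree_sum_le) (use bound in \<open>auto simp: finite_permutations\<close>)
  finally show ?thesis by simp
qed

lemma homog_HL: "homog (sum_list \<tau>) (HL t \<tau>)"
  unfolding HL_def Qhl_def by (intro homog_smul homog_scale homog_Qp)

lemma HL_lower:
  assumes t: "nonroot t" and \<tau>: "is_partition \<tau>"
  shows "lower \<tau> (HL t \<tau>)"
  unfolding lower_def
proof (intro conjI allI impI homog_HL)
  fix \<sigma> assume \<sigma>: "is_partition \<sigma>" and nz: "hall (HL t \<tau>) (prod_list (map hsym \<sigma>)) \<noteq> 0"
  define N where "N = max (length \<tau>) (length \<sigma>)"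
  have l: "Poly_Mapping.lookup (in_vars N (HL t \<tau>)) (Poly_Mapping.nth \<sigma>) \<noteq> 0"
    using nz by (simp add: lookup_in_vars_part N_def)
  then have "in_vars N (HL t \<tau>) \<noteq> 0" by (intro notI) simp
  from degree_HL[OF t \<tau> _ this] le_degree_grade[OF l]
  have "(\<Sum>i<k. part \<sigma> i) \<le> (\<Sum>i<k. part \<tau> i)" for k
    unfolding lookup_nth_part N_def by (meson max.cobounded1 order_trans)
  moreover have "sum_list \<sigma> = sum_list \<tau>"
    using hall_homog_neq[OF homog_HL homog_prod_list_hsym] nz by metis
  ultimately show "dominated \<sigma> \<tau>" using \<tau> \<sigma> by (simp add: dominated_iff)
qed

section \<open>Normalization and duality\<close>

lemma hl_mult_superset:
  assumes "finite S" "set \<tau> \<subseteq> S"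
  shows "hl_mult t \<tau> = (\<Prod>k\<in>S. hl_v t (count (mset \<tau>) k))"
  unfolding hl_mult_def
proof (rule prod.mono_neutral_left)
  show "\<forall>k\<in>S - set \<tau>. hl_v t (count (mset \<tau>) k) = 1"
    by (auto simp: hl_v_def count_mset_0_iff)
qed (use assms in auto)

lemma hl_mult_map_Suc:
  assumes "\<forall>r\<in>set \<tau>. r > 0"
  shows "hl_mult t (map Suc (\<tau> @ replicate m 0)) = hl_v t m * hl_mult t \<tau>"
proof -
  let ?\<rho> = "map Suc (\<tau> @ replicate m 0)"
  let ?S = "insert 0 (set \<tau>)"
  have count: "count (mset ?\<rho>) (Suc k) = count (mset \<tau>) k + (if k = 0 then m else 0)" for k
  proof -
    have "count (image_mset Suc M) (Suc k) = count M k" for M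
      by (induction M) auto
    from this[of "mset (\<tau> @ replicate m 0)"] show ?thesis by simp
  qed
  have "0 \<notin> set \<tau>" using assms by auto
  have "hl_mult t ?\<rho> = (\<Prod>k\<in>Suc ` ?S. hl_v t (count (mset ?\<rho>) k))"
    by (rule hl_mult_superset) auto
  also have "\<dots> = (\<Prod>k\<in>?S. hl_v t (count (mset ?\<rho>) (Suc k)))"
    by (simp only: prod.reindex[OF inj_Suc[THEN inj_on_subset, OF subset_UNIV]] comp_def)
  also have "\<dots> = hl_v t (count (mset ?\<rho>) (Suc 0)) * (\<Prod>k\<in>set \<tau>. hl_v t (count (mset ?\<rho>) (Suc k)))"
    using \<open>0 \<notin> set \<tau>\<close> by simp
  also have "(\<Prod>k\<in>set \<tau>. hl_v t (count (mset ?\<rho>) (Suc k))) = hl_mult t \<tau>"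
    unfolding hl_mult_def
  proof (rule prod.cong)
    fix k assume "k \<in> set \<tau>"
    then have "k \<noteq> 0" using assms by auto
    then show "hl_v t (count (mset ?\<rho>) (Suc k)) = hl_v t (count (mset \<tau>) k)" unfolding count by simp
  qed simp
  also have "count (mset ?\<rho>) (Suc 0) = m"
    using \<open>0 \<notin> set \<tau>\<close> unfolding count by (simp add: count_mset_0_iff)
  finally show ?thesis .
qed

text \<open>Removal of the first column; \<open>m\<close> is the number of parts equal to 1, kept as
  zeros.\<close>

lemma partition_shift:
  assumes "is_partition \<tau>"
  obtains \<rho> m where "is_partition \<rho>" "\<tau> = map Suc (\<rho> @ replicate m 0)"
proof -
  define \<rho> where "\<rho> = filter (\<lambda>a. 0 < a) (map (\<lambda>a. a - 1) \<tau>)"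
  define \<zeta> where "\<zeta> = filter (\<lambda>a. \<not> 0 < a) (map (\<lambda>a. a - 1) \<tau>)"
  have sorted: "sorted_wrt (\<ge>) (map (\<lambda>a. a - 1) \<tau>)"
    using assms unfolding is_partition_def sorted_wrt_map
    by (auto intro: sorted_wrt_mono_rel[rotated] diff_le_mono)
  have split: "xs = filter (\<lambda>a. 0 < a) xs @ filter (\<lambda>a. \<not> 0 < a) xs" if "sorted_wrt (\<ge>) xs" for xs :: "nat list"
    using that
  proof (induction xs)
    case (Cons a xs)
    show ?case
    proof (cases "a = 0")
      case True
      then have "\<forall>b\<in>set xs. b = 0" using Cons.prems by auto
      then have "filter (\<lambda>a. 0 < a) xs = []" "filter (\<lambda>a. \<not> 0 < a) xs = xs"
        by (auto simp: filter_empty_conv filter_id_conv)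
      then show ?thesis using True by simp
    qed (use Cons in auto)
  qed simp
  have \<zeta>: "\<zeta> = replicate (length \<zeta>) 0"
    by (rule replicate_length_same[symmetric]) (auto simp: \<zeta>_def)
  have "map (\<lambda>a. a - 1) \<tau> = \<rho> @ replicate (length \<zeta>) 0"
    using split[OF sorted] \<zeta> unfolding \<rho>_def \<zeta>_def by simp
  moreover have "map Suc (map (\<lambda>a. a - 1) \<tau>) = \<tau>"
    using assms by (simp add: is_partition_def comp_def map_idI)
  ultimately have "\<tau> = map Suc (\<rho> @ replicate (length \<zeta>) 0)" by metis
  moreover have "is_partition \<rho>"
    unfolding is_partition_def \<rho>_def using sorted by (auto intro: sorted_wrt_filter)
  ultimately show ?thesis using that by blast
qed

lemma lookup_monomial_shift:
  "Poly_Mapping.lookup (Poly_Mapping.single \<beta> 1 * f) (\<beta> + \<gamma>) = Poly_Mapping.lookup (f :: 'k::comm_ring_1 xpoly) \<gamma>"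
  by (induction f rule: poly_mapping_additive_induct)
    (auto simp: mult_single lookup_single when_def distrib_left lookup_add)

lemma prod_xvar: "(\<Prod>i<N. xvar i) = Poly_Mapping.single (\<Sum>i<N. Poly_Mapping.single i 1) (1::'k::comm_ring_1)" for N :: nat
  by (induction N) (simp_all add: xvar_def mult_single)

text \<open>In exactly \<open>length \<tau>\<close> variables the product of all variables splits
  off. The parts equal to 1 become trailing zeros and account for the scalar.\<close>

lemma in_vars_Qhl_shift:
  fixes t :: "'k::field_char_0"
  assumes t: "t \<noteq> 1" and \<rho>: "is_partition \<rho>" and \<tau>: "\<tau> = map Suc (\<rho> @ replicate m 0)"
  shows "in_vars (length \<tau>) (Qhl t \<tau>) =
    const ((1 - t) ^ m * hl_v t m) * ((\<Prod>i<length \<tau>. xvar i) * in_vars (length \<tau>) (Qhl t \<rho>))"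
proof -
  let ?A = "{..<length \<tau>}"
  have len: "length \<tau> = length \<rho> + m" by (simp add: \<tau>)
  have "to_fract (in_vars (length \<tau>) (Qhl t \<tau>)) = frc ((1 - t) ^ length \<tau>) * hl_sum (frc t) frx \<tau> ?A"
    by (rule to_fract_Qhl) (auto simp: \<tau>)
  also have "hl_sum (frc t) frx \<tau> ?A = (\<Prod>i\<in>?A. frx i) * hl_sum (frc t) frx (\<rho> @ replicate m 0) ?A"
    using frx.hl_sum_map_Suc[of ?A "\<rho> @ replicate m 0" t] by (simp add: \<tau>)
  also have "hl_sum (frc t) frx (\<rho> @ replicate m 0) ?A = hl_sum (frc t) frx \<rho> ?A * hl_v (frc t) m"
    by (rule frx.hl_sum_append_zeros) (use len frc_neq_1[OF t] in auto)
  also have "frc ((1 - t) ^ length \<tau>) * ((\<Prod>i\<in>?A. frx i) * (hl_sum (frc t) frx \<rho> ?A * hl_v (frc t) m)) =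
    frc ((1 - t) ^ m * hl_v t m) * ((\<Prod>i\<in>?A. frx i) * (frc ((1 - t) ^ length \<rho>) * hl_sum (frc t) frx \<rho> ?A))"
    unfolding len power_add comm_ring_homD(4)[OF frc_hom] hl_v_hom[OF frc_hom, symmetric] by (simp only: mult_ac)
  also have "frc ((1 - t) ^ length \<rho>) * hl_sum (frc t) frx \<rho> ?A = to_fract (in_vars (length \<tau>) (Qhl t \<rho>))"
    by (rule to_fract_Qhl[symmetric]) (use \<rho> in \<open>simp add: is_partition_def\<close>)
  also have "(\<Prod>i\<in>?A. frx i) = to_fract (\<Prod>i\<in>?A. xvar i)"
    by (simp only: comm_ring_homD[OF to_fract_hom])
  finally show ?thesis by (simp only: to_fract_mult[symmetric] to_fract_eq_iff)
qed

text \<open>Induction on the size by removal of the first column: the coefficient of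
  \<open>x^\<tau>\<close> becomes that of \<open>x^\<rho>\<close>, and the scalars multiply up to
  \<open>hl_b\<close>.\<close>

lemma hall_Qhl_diag:
  fixes t :: "'k::field_char_0"
  assumes t: "t \<noteq> 1" and "is_partition \<tau>"
  shows "hall (Qhl t \<tau>) (prod_list (map hsym \<tau>)) = hl_b t \<tau>"
  using assms(2)
proof (induction "sum_list \<tau>" arbitrary: \<tau> rule: less_induct)
  case less
  show ?case
  proof (cases "\<tau> = []")
    case True
    have "hall 1 (1 :: 'k symf) = 1" using lookup_hsym[of "{#}" 0, where 'k = 'k] hall_single_left[of "{#}" 1 "1 :: 'k symf"] by simp
    then show ?thesis using True by (simp add: Qhl_def scale_simps hl_b_def hl_mult_def)
  next
    case False
    obtain \<rho> m where \<rho>: "is_partition \<rho>" "\<tau> = map Suc (\<rho> @ replicate m 0)"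
      using partition_shift[OF less.prems] by blast
    have len: "length \<tau> = length \<rho> + m" by (simp add: \<rho>(2))
    have "sum_list \<tau> = sum_list \<rho> + length \<tau>"
      unfolding \<rho>(2) by (simp add: sum_list_Suc sum_list_replicate)
    then have IH: "hall (Qhl t \<rho>) (prod_list (map hsym \<rho>)) = hl_b t \<rho>"
      using False by (intro less.hyps \<rho>(1)) simp
    have nth: "Poly_Mapping.nth \<tau> = (\<Sum>i<length \<tau>. Poly_Mapping.single i 1) + Poly_Mapping.nth \<rho>"
    proof (rule poly_mapping_eqI)
      fix i
      have "(\<Sum>j<length \<tau>. Poly_Mapping.lookup (Poly_Mapping.single j 1) i) = (if i < length \<tau> then 1 else 0 :: nat)"
        by (simp add: lookup_single when_def)
      then show "Poly_Mapping.lookup (Poly_Mapping.nth \<tau>) i =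
        Poly_Mapping.lookup ((\<Sum>i<length \<tau>. Poly_Mapping.single i 1) + Poly_Mapping.nth \<rho>) i"
        unfolding lookup_add lookup_sum lookup_nth_part
        using len by (auto simp: part_def \<rho>(2) nth_append simp del: lookup_nth)
    qed
    have "hall (Qhl t \<tau>) (prod_list (map hsym \<tau>)) = Poly_Mapping.lookup (in_vars (length \<tau>) (Qhl t \<tau>)) (Poly_Mapping.nth \<tau>)"
      by (simp add: lookup_in_vars_part)
    also have "\<dots> = (1 - t) ^ m * hl_v t m * Poly_Mapping.lookup (in_vars (length \<tau>) (Qhl t \<rho>)) (Poly_Mapping.nth \<rho>)"
      unfolding in_vars_Qhl_shift[OF t \<rho>] lookup_const_times prod_xvar nth lookup_monomial_shift ..
    also have "\<dots> = (1 - t) ^ m * hl_v t m * hl_b t \<rho>"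
      by (simp add: lookup_in_vars_part len IH)
    also have "\<dots> = hl_b t \<tau>"
    proof -
      have "hl_mult t \<tau> = hl_v t m * hl_mult t \<rho>"
        unfolding \<rho>(2) by (rule hl_mult_map_Suc) (use \<rho>(1) in \<open>simp add: is_partition_def\<close>)
      then show ?thesis by (simp add: hl_b_def len power_add)
    qed
    finally show ?thesis .
  qed
qed

lemma hall_HL_diag:
  assumes "nonroot t" "is_partition \<tau>"
  shows "hall (HL t \<tau>) (prod_list (map hsym \<tau>)) = 1"
  using hall_Qhl_diag[OF nonroot_neq_1[OF assms(1)] assms(2)] hl_b_nonzero[OF assms(1)]
  by (simp add: HL_def hall_smul_left)

text \<open>Off the diagonal, the pairing of \<open>Q_\<tau> = Q'_\<tau>[X (1 - t)]\<close> with
  \<open>Q'_\<mu>\<close> is symmetric in \<open>\<tau>\<close> and \<open>\<mu>\<close>, because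
  \<open>scale\<close> is self-adjoint. If it were nonzero, triangularity would make the two
  partitions dominate each other.\<close>

lemma HL_Qp_dual:
  fixes t :: "'k::field_char_0"
  assumes t: "nonroot t" and \<tau>: "is_partition \<tau>" and \<mu>: "is_partition \<mu>"
  shows "hall (HL t \<tau>) (Qp t \<mu>) = (if \<mu> = \<tau> then 1 else 0)"
proof (cases "\<mu> = \<tau>")
  case True
  then show ?thesis
    using hall_lower_upper(2)[OF HL_lower[OF t \<tau>] Qp_upper(1)[OF \<tau>]] \<tau> hall_HL_diag[OF t \<tau>] Qp_upper(2)[OF \<tau>, of t]
    by simp
next
  case False
  have sym: "hl_b t \<tau> * hall (HL t \<tau>) (Qp t \<mu>) = hl_b t \<mu> * hall (HL t \<mu>) (Qp t \<tau>)"
    using hl_b_nonzero[OF t] hall_scale[of "\<lambda>k. 1 - t ^ k" "Qp t \<tau>" "Qp t \<mu>"]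
    by (simp add: HL_def Qhl_def hall_smul_left hall_commute[of "Qp t \<tau>"])
  show ?thesis
  proof (rule ccontr)
    assume "\<not> ?thesis"
    then have nz: "hall (HL t \<tau>) (Qp t \<mu>) \<noteq> 0" using False by simp
    then have "hall (HL t \<mu>) (Qp t \<tau>) \<noteq> 0" using sym hl_b_nonzero[OF t] by auto
    then have "dominated \<tau> \<mu>" by (rule hall_lower_upper(1)[OF HL_lower[OF t \<mu>] Qp_upper(1)[OF \<tau>]])
    moreover have "dominated \<mu> \<tau>" by (rule hall_lower_upper(1)[OF HL_lower[OF t \<tau>] Qp_upper(1)[OF \<mu>] nz])
    ultimately show False using False dominated_antisym by blast
  qed
qed

lemma expand_HL:
  fixes t :: "'k::field_char_0"
  assumes t: "nonroot t" and G: "homog n G"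
  shows "G = (\<Sum>\<tau>\<in>partitions_of n. smul (hall G (Qp t \<tau>)) (HL t \<tau>))"
proof -
  have "G \<in> symf.span (HL t ` partitions_of n)"
    by (rule homog_in_span_lower[OF _ _ G])
      (simp_all add: partitions_of_iff HL_lower[OF t] hall_HL_diag[OF t])
  then obtain c where c: "G = (\<Sum>\<tau>\<in>partitions_of n. smul (c \<tau>) (HL t \<tau>))"
    using in_span_image_finite[OF finite_partitions_of] by blast
  have "hall G (Qp t \<mu>) = c \<mu>" if \<mu>: "\<mu> \<in> partitions_of n" for \<mu>
  proof -
    have "hall G (Qp t \<mu>) = (\<Sum>\<tau>\<in>partitions_of n. if \<tau> = \<mu> then c \<mu> else 0)"
      unfolding c hall_sum_left hall_smul_left
      by (rule sum.cong) (use \<mu> in \<open>auto simp: HL_Qp_dual[OF t] partitions_of_iff\<close>)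
    then show ?thesis using \<mu> finite_partitions_of by simp
  qed
  then show ?thesis using c by simp
qed

section \<open>Principal specialization\<close>

lemma power_inj_nonroot:
  assumes "nonroot t" "t \<noteq> 0" "t ^ i = t ^ j"
  shows "i = j"
proof -
  have *: "i = j" if "i \<le> j" "t ^ i = t ^ j" for i j
  proof (rule ccontr)
    assume "i \<noteq> j"
    have "t ^ j = t ^ i * t ^ (j - i)" using that(1) by (simp flip: power_add)
    then have "t ^ (j - i) = 1" using that assms(2) by simp
    then show False using nonrootD[OF assms(1), of "j - i"] \<open>i \<noteq> j\<close> that by simp
  qed
  show ?thesis using *[of i j] *[of j i] assms(3) by (cases "i \<le> j") auto
qed

text \<open>The product telescopes: the new variable \<open>t^(a+d+1)\<close> replaces the numerator
  \<open>1 - t^(d+1)\<close> by \<open>1 - t^(d+2)\<close>.\<close>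

lemma hl_weight_powers:
  fixes t :: "'k::field"
  assumes t: "nonroot t" "t \<noteq> 0" and aN: "a < N"
  shows "hl_weight t (\<lambda>i. t ^ i) {a..<N} a = (1 - t ^ (N - a)) / (1 - t)"
proof -
  have "hl_weight t (\<lambda>i. t ^ i) {a..<a + Suc d} a = (1 - t ^ Suc d) / (1 - t)" for d
  proof (induction d)
    case 0
    show ?case using nonroot_neq_1[OF t(1)] by (simp add: hl_weight_def)
  next
    case (Suc d)
    have "{a..<a + Suc (Suc d)} - {a} = insert (a + Suc d) ({a..<a + Suc d} - {a})" by auto
    then have "hl_weight t (\<lambda>i. t ^ i) {a..<a + Suc (Suc d)} a =
      (t ^ a - t * t ^ (a + Suc d)) / (t ^ a - t ^ (a + Suc d)) * hl_weight t (\<lambda>i. t ^ i) {a..<a + Suc d} a"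
      by (simp add: hl_weight_def)
    also have "\<dots> = (t ^ a * (1 - t ^ Suc (Suc d))) / (t ^ a * (1 - t ^ Suc d)) * ((1 - t ^ Suc d) / (1 - t))"
      unfolding Suc by (simp add: algebra_simps power_add)
    also have "\<dots> = (1 - t ^ Suc (Suc d)) / (1 - t)"
      using t nonrootD[OF t(1), of "Suc d"] by (simp del: power_Suc)
    finally show ?case .
  qed
  from this[of "N - a - 1"] show ?thesis using aN by (simp del: power_Suc add: Suc_diff_Suc)
qed

text \<open>The factor \<open>x_i - t x_{i-1}\<close> kills the weight of every index of the
  interval but the smallest, so a single ordering of the variables survives.\<close>

lemma hl_sum_powers:
  fixes t :: "'k::field"
  assumes t: "nonroot t" "t \<noteq> 0" and "length \<tau> \<le> N - a"
  shows "hl_sum t (\<lambda>i. t ^ i) \<tau> {a..<N} =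
    t ^ (\<Sum>j<length \<tau>. (a + j) * \<tau> ! j) * (\<Prod>j<length \<tau>. (1 - t ^ (N - a - j)) / (1 - t))"
  using assms(3)
proof (induction \<tau> arbitrary: a)
  case (Cons r \<tau>)
  have aN: "a < N" using Cons.prems by simp
  have "hl_sum t (\<lambda>i. t ^ i) (r # \<tau>) {a..<N} =
    (t ^ a) ^ r * hl_weight t (\<lambda>i. t ^ i) {a..<N} a * hl_sum t (\<lambda>i. t ^ i) \<tau> ({a..<N} - {a})"
    unfolding hl_sum.simps
  proof (rule sum_single_term)
    fix i assume i: "i \<in> {a..<N}" "i \<noteq> a"
    then have "i - 1 \<in> {a..<N} - {i}" "t ^ i - t * t ^ (i - 1) = 0"
      by (auto simp flip: power_Suc)
    then have "hl_weight t (\<lambda>i. t ^ i) {a..<N} i = 0"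
      unfolding hl_weight_def by (intro prod_zero bexI[of _ "i - 1"]) auto
    then show "(t ^ i) ^ r * hl_weight t (\<lambda>i. t ^ i) {a..<N} i * hl_sum t (\<lambda>i. t ^ i) \<tau> ({a..<N} - {i}) = 0" by simp
  qed (use aN in auto)
  also have "{a..<N} - {a} = {Suc a..<N}" by auto
  also have "hl_sum t (\<lambda>i. t ^ i) \<tau> {Suc a..<N} =
    t ^ (\<Sum>j<length \<tau>. (Suc a + j) * \<tau> ! j) * (\<Prod>j<length \<tau>. (1 - t ^ (N - Suc a - j)) / (1 - t))"
    by (rule Cons.IH) (use Cons.prems in auto)
  also have "(t ^ a) ^ r * hl_weight t (\<lambda>i. t ^ i) {a..<N} a * \<dots> =
    t ^ (a * r + (\<Sum>j<length \<tau>. (Suc a + j) * \<tau> ! j)) *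
    ((1 - t ^ (N - a)) / (1 - t) * (\<Prod>j<length \<tau>. (1 - t ^ (N - Suc a - j)) / (1 - t)))"
    unfolding hl_weight_powers[OF t aN] power_add power_mult by (simp only: mult_ac)
  also have "a * r + (\<Sum>j<length \<tau>. (Suc a + j) * \<tau> ! j) = (\<Sum>j<length (r # \<tau>). (a + j) * (r # \<tau>) ! j)"
    unfolding list.size(4) add_Suc_right add_0_right sum.lessThan_Suc_shift by simp
  also have "(1 - t ^ (N - a)) / (1 - t) * (\<Prod>j<length \<tau>. (1 - t ^ (N - Suc a - j)) / (1 - t)) =
    (\<Prod>j<length (r # \<tau>). (1 - t ^ (N - a - j)) / (1 - t))"
    unfolding list.size(4) add_Suc_right add_0_right prod.lessThan_Suc_shift by simp
  finally show ?case .
qed simp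

text \<open>The alphabet \<open>1 - t^N\<close> is \<open>1 - t\<close> times
  \<open>1 + t + ... + t^(N-1)\<close>.\<close>

lemma principal_specialization_power:
  fixes t :: "'k::field_char_0"
  assumes t: "nonroot t" "t \<noteq> 0" and \<tau>: "is_partition \<tau>" and N: "length \<tau> \<le> N"
  shows "pleth (\<lambda>c. c) (\<lambda>k. 1 - (t ^ N) ^ k) (Qp t \<tau>) = t ^ n_stat \<tau> * (\<Prod>j<length \<tau>. 1 - t ^ (N - j))"
proof -
  interpret hl_evaluation "\<lambda>c. c" "\<lambda>i. t ^ i" t
    by (rule hl_evaluation.intro[OF comm_ring_hom_id]) (use t power_inj_nonroot in \<open>auto intro!: injI\<close>)
  have "(1 - t ^ k) * (\<Sum>i<N. (t ^ i) ^ k) = 1 - (t ^ N) ^ k" for k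
    using one_diff_power_eq[of "t ^ k" N] by (simp add: mult.commute flip: power_mult)
  then have "pleth (\<lambda>c. c) (\<lambda>k. 1 - (t ^ N) ^ k) (Qp t \<tau>) = evq {..<N} (Qp t \<tau>)"
    by (simp only: evq_def)
  also have "\<dots> = (1 - t) ^ length \<tau> * hl_sum t (\<lambda>i. t ^ i) \<tau> {..<N}"
    by (rule evq_Qp) (use \<tau> in \<open>auto simp: is_partition_def\<close>)
  also have "hl_sum t (\<lambda>i. t ^ i) \<tau> {..<N} = t ^ n_stat \<tau> * (\<Prod>j<length \<tau>. (1 - t ^ (N - j)) / (1 - t))"
    using hl_sum_powers[OF t, of \<tau> N 0] N by (simp add: n_stat_def atLeast0LessThan)
  also have "(\<Prod>j<length \<tau>. (1 - t ^ (N - j)) / (1 - t)) = (\<Prod>j<length \<tau>. 1 - t ^ (N - j)) / (1 - t) ^ length \<tau>"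
    by (simp add: prod_dividef)
  finally show ?thesis using nonroot_neq_1[OF t(1)] by simp
qed

text \<open>Both sides are polynomials in \<open>y\<close> which agree at \<open>y = t\<^sup>N\<close> for all large \<open>N\<close>.\<close>

lemma principal_specialization:
  fixes t :: "'k::field_char_0"
  assumes t: "nonroot t" "t \<noteq> 0" and \<tau>: "is_partition \<tau>"
  shows "pleth (\<lambda>c. c) (\<lambda>k. 1 - y ^ k) (Qp t \<tau>) = t ^ n_stat \<tau> * (\<Prod>j<length \<tau>. 1 - inverse t ^ j * y)"
proof -
  define p where "p = pleth (\<lambda>c. [:c:]) (\<lambda>k. 1 - monom 1 k) (Qp t \<tau>)"
  define r where "r = [:t ^ n_stat \<tau>:] * (\<Prod>j<length \<tau>. [:1, - (inverse t ^ j):])"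
  have hom: "comm_ring_hom (\<lambda>p. poly p y)" for y :: 'k
    by (rule comm_ring_homI) simp_all
  have p: "poly p y = pleth (\<lambda>c. c) (\<lambda>k. 1 - y ^ k) (Qp t \<tau>)" for y
    unfolding p_def pleth_compose[OF hom comm_ring_hom_pCons] by (rule pleth_cong) (simp_all add: poly_monom)
  have r: "poly r y = t ^ n_stat \<tau> * (\<Prod>j<length \<tau>. 1 - inverse t ^ j * y)" for y
    by (simp add: r_def poly_prod mult.commute)
  have eq: "poly (p - r) (t ^ N) = 0" if N: "length \<tau> \<le> N" for N
  proof -
    have "(\<Prod>j<length \<tau>. 1 - t ^ (N - j)) = (\<Prod>j<length \<tau>. 1 - inverse t ^ j * t ^ N)"
    proof (rule prod.cong)
      fix j assume "j \<in> {..<length \<tau>}"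
      then have "j \<le> N" using N by simp
      then have "t ^ N = t ^ j * t ^ (N - j)" by (simp flip: power_add)
      then show "1 - t ^ (N - j) = 1 - inverse t ^ j * t ^ N" using t(2) by (simp add: field_simps)
    qed simp
    then show ?thesis using principal_specialization_power[OF t \<tau> N] by (simp add: p r)
  qed
  have "p - r = 0"
  proof (rule ccontr)
    assume "p - r \<noteq> 0"
    then have "finite {y. poly (p - r) y = 0}" by (rule poly_roots_finite)
    then have "finite ((\<lambda>N. t ^ N) ` {length \<tau>..})"
      by (rule finite_subset[rotated]) (use eq in auto)
    then have "finite {length \<tau>..}"
      by (rule finite_imageD) (use power_inj_nonroot[OF t] in \<open>auto intro!: inj_onI\<close>)
    then show False by (simp add: infinite_Ici)
  qed
  then show ?thesis using p r by simp
qed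

text \<open>The coefficient of \<open>P_\<tau>\<close> is the pairing with \<open>Q'_\<tau>\<close>.
  Pairing with \<open>h_n[X (1 - 1/t)]\<close> is evaluation at the alphabet \<open>1 - 1/t\<close>,
  that is, the principal specialization at \<open>y = 1/t\<close>.\<close>

theorem complete_HL_expansion:
  fixes t :: "'k::field_char_0"
  assumes t: "nonroot t" "t \<noteq> 0"
  shows "scale (\<lambda>k. 1 - inverse t ^ k) (hsym n) =
    (\<Sum>\<tau>\<in>partitions_of n. smul (t ^ n_stat \<tau> * (\<Prod>j = 1..length \<tau>. 1 - inverse t ^ j)) (HL t \<tau>))"
proof -
  let ?c = "\<lambda>k. 1 - inverse t ^ k"
  have "hall (scale ?c (hsym n)) (Qp t \<tau>) = t ^ n_stat \<tau> * (\<Prod>j = 1..length \<tau>. 1 - inverse t ^ j)"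
    if \<tau>: "\<tau> \<in> partitions_of n" for \<tau>
  proof -
    have "homog n (scale ?c (Qp t \<tau>))"
      using homog_scale[OF homog_Qp[of \<tau> t]] \<tau> by (simp add: partitions_of_iff)
    from hall_hsym[OF this] have "hall (scale ?c (hsym n)) (Qp t \<tau>) = pleth (\<lambda>c. c) ?c (Qp t \<tau>)"
      by (simp add: hall_commute[of "hsym n"] hall_scale pleth_scale comm_ring_hom_id)
    also have "\<dots> = t ^ n_stat \<tau> * (\<Prod>j<length \<tau>. 1 - inverse t ^ j * inverse t)"
      by (rule principal_specialization[OF t]) (use \<tau> in \<open>simp add: partitions_of_iff\<close>)
    also have "(\<Prod>j<length \<tau>. 1 - inverse t ^ j * inverse t) = (\<Prod>j = 1..length \<tau>. 1 - inverse t ^ j)"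
      by (rule prod.reindex_bij_witness[of _ "\<lambda>j. j - 1" Suc]) (auto simp: mult.commute)
    finally show ?thesis .
  qed
  then show ?thesis
    using expand_HL[OF t(1) homog_scale[OF homog_hsym], of ?c n] by (simp cong: sum.cong)
qed

section \<open>Schur functions as the case t = 0, and omega in power sums\<close>

section \<open>Schur functions\<close>

definition jt_mat :: "nat \<Rightarrow> nat list \<Rightarrow> 'k::field_char_0 symf mat" where
  "jt_mat N \<tau> = mat N N (\<lambda>(i, j). complete_symf (int (part \<tau> i) - int i + int j))"

text \<open>Padding by a zero part appends the row \<open>(0, ..., 0, 1)\<close>, since complete
  functions of negative index vanish and \<open>h_0 = 1\<close>.\<close>

lemma det_jt_mat:
  assumes "length \<tau> \<le> N"
  shows "det (jt_mat N \<tau>) = (schur \<tau> :: 'k::field_char_0 symf)"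
  using assms
proof (induction N rule: dec_induct)
  case base
  have "jt_mat (length \<tau>) \<tau> = (mat (length \<tau>) (length \<tau>) (\<lambda>(i, j). complete_symf (int (\<tau> ! i) - int i + int j)) :: 'k symf mat)"
    by (rule eq_matI) (auto simp: jt_mat_def part_def)
  then show ?case by (simp add: schur_def)
next
  case (step N)
  let ?A = "jt_mat (Suc N) \<tau> :: 'k symf mat"
  have A: "?A \<in> carrier_mat (Suc N) (Suc N)" by (simp add: jt_mat_def)
  have row: "?A $$ (N, j) = (if j = N then 1 else 0)" if "j < Suc N" for j
    using that step.hyps by (auto simp: jt_mat_def part_def complete_symf_eq)
  have del: "mat_delete ?A N N = jt_mat N \<tau>"
    by (rule eq_matI) (auto simp: mat_delete_def jt_mat_def)
  have "det ?A = (\<Sum>j<Suc N. ?A $$ (N, j) * cofactor ?A N j)"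
    by (rule laplace_expansion_row[OF A]) simp
  also have "\<dots> = (\<Sum>j<Suc N. if j = N then cofactor ?A N N else 0)"
    by (rule sum.cong) (use row in auto)
  also have "\<dots> = cofactor ?A N N" by simp
  also have "\<dots> = det (jt_mat N \<tau>)"
    by (simp add: cofactor_def del)
  finally show ?case using step.IH by simp
qed

lemma prod_linear_fps_nth:
  fixes x :: "'i \<Rightarrow> 'r::comm_ring_1"
  assumes "finite B"
  shows "card B < v \<Longrightarrow> fps_nth (\<Prod>l\<in>B. 1 - fps_const (x l) * fps_X) v = 0"
  using assms
proof (induction B arbitrary: v rule: finite_induct)
  case (insert b B)
  let ?P = "\<Prod>l\<in>B. 1 - fps_const (x l) * fps_X"
  obtain u where v: "v = Suc u" "card B < u" using insert by (cases v) auto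
  have "(\<Prod>l\<in>insert b B. 1 - fps_const (x l) * fps_X) = ?P - fps_const (x b) * (fps_X * ?P)"
    using insert by (simp add: algebra_simps)
  then show ?case using insert.IH[of u] insert.IH[of v] v by simp
qed simp

text \<open>On minus an alphabet \<open>h_v\<close> becomes, up to sign, \<open>e_v\<close>, which
  vanishes on fewer than \<open>v\<close> variables.\<close>

lemma pleth_hsym_negative:
  fixes \<iota> :: "'k::field_char_0 \<Rightarrow> 'r::comm_ring_1"
  assumes "comm_ring_hom \<iota>" "finite B" "card B < v"
  shows "pleth \<iota> (\<lambda>k. \<Sum>l\<in>B. - (x l ^ k)) (hsym v) = 0"
  using arg_cong[OF hser_sum[OF assms(1), of "\<lambda>l k. - (x l ^ k)" B], of "\<lambda>f. fps_nth f v"]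
    prod_linear_fps_nth[OF assms(2,3), of x]
  by (simp add: hser_linear[OF assms(1)])

text \<open>\<open>g v\<close> is \<open>h_v\<close> at minus all variables except
  \<open>x_j\<close>. Adding the full alphabet leaves \<open>x_j\<close> alone, and
  \<open>h_s\<close> of one variable is its power; reversing the column index makes the sum a
  convolution.\<close>

lemma bialternant_entry:
  assumes j: "j < N" and i: "i < N" and "length \<tau> \<le> N"
  defines "g v \<equiv> pleth const (\<lambda>k. \<Sum>l\<in>{..<N} - {j}. - (xvar l ^ k)) (hsym v) :: 'k::field_char_0 xpoly"
  shows "(\<Sum>k<N. in_vars N (complete_symf (int (part \<tau> i) - int i + int k)) * g (N - Suc k)) =
    xvar j ^ (part \<tau> i + (N - Suc i))"
proof -
  let ?s = "part \<tau> i + (N - Suc i)"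
  let ?h = "\<lambda>r. in_vars N (hsym r) :: 'k xpoly"
  have "(\<Sum>k<N. in_vars N (complete_symf (int (part \<tau> i) - int i + int k)) * g (N - Suc k)) =
    (\<Sum>k<N. in_vars N (complete_symf (int (part \<tau> i) - int i + int (N - Suc k))) * g (N - Suc (N - Suc k)))"
    by (rule sum.nat_diff_reindex[symmetric])
  also have "\<dots> = (\<Sum>v<N. if v \<le> ?s then g v * ?h (?s - v) else 0)"
  proof (rule sum.cong)
    fix v assume v: "v \<in> {..<N}"
    have eq: "int (part \<tau> i) - int i + int (N - Suc v) = int ?s - int v"
      using v i by (simp add: of_nat_diff)
    have "in_vars N (complete_symf (int ?s - int v)) = (if v \<le> ?s then ?h (?s - v) else 0)"
    proof (cases "v \<le> ?s")
      case True
      then have "int ?s - int v = int (?s - v)" by (simp only: of_nat_diff)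
      then show ?thesis using True by (simp add: complete_symf_eq del: of_nat_add of_nat_diff)
    next
      case False
      then have "int ?s - int v < 0" by simp
      then show ?thesis using False by (simp add: complete_symf_eq comm_ring_homD[OF in_vars_hom] del: of_nat_add)
    qed
    moreover have "N - Suc (N - Suc v) = v" using v by auto
    ultimately show "in_vars N (complete_symf (int (part \<tau> i) - int i + int (N - Suc v))) * g (N - Suc (N - Suc v)) =
      (if v \<le> ?s then g v * ?h (?s - v) else 0)"
      unfolding eq by (simp add: mult.commute)
  qed simp
  also have "\<dots> = (\<Sum>v\<le>?s. g v * ?h (?s - v))"
  proof -
    \<comment> \<open>Only \<open>N - 1\<close> variables are subtracted, so restricting the
      convolution to \<open>v < N\<close> loses nothing.\<close>
    have g0: "g v = 0" if "v \<ge> N" for v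
      unfolding g_def by (rule pleth_hsym_negative[OF comm_ring_hom_const]) (use that j in auto)
    have "(\<Sum>v\<le>?s. g v * ?h (?s - v)) = (\<Sum>v\<in>{..?s} \<inter> {..<N}. g v * ?h (?s - v))"
    proof (rule sum.mono_neutral_right)
      show "\<forall>v\<in>{..?s} - {..?s} \<inter> {..<N}. g v * ?h (?s - v) = 0"
      proof
        fix v assume "v \<in> {..?s} - {..?s} \<inter> {..<N}"
        then have "g v = 0" by (intro g0) auto
        then show "g v * ?h (?s - v) = 0" by simp
      qed
    qed auto
    also have "\<dots> = (\<Sum>v<N. if v \<le> ?s then g v * ?h (?s - v) else 0)"
      by (rule sum.mono_neutral_cong_left) auto
    finally show ?thesis by simp
  qed
  also have "\<dots> = pleth const (\<lambda>k. (\<Sum>l\<in>{..<N} - {j}. - (xvar l ^ k)) + (\<Sum>l<N. xvar l ^ k)) (hsym ?s)"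
    unfolding g_def in_vars_def by (rule pleth_hsym_add[OF comm_ring_hom_const, symmetric])
  also have "\<dots> = pleth const (\<lambda>k. xvar j ^ k) (hsym ?s)"
  proof (rule pleth_cong)
    fix k
    show "(\<Sum>l\<in>{..<N} - {j}. - (xvar l ^ k)) + (\<Sum>l<N. xvar l ^ k) = (xvar j ^ k :: 'k xpoly)"
      using sum.remove[of "{..<N}" j "\<lambda>l. xvar l ^ k :: 'k xpoly"] j by (simp add: sum_negf)
  qed simp
  also have "\<dots> = xvar j ^ ?s"
    using arg_cong[OF hser_geometric[OF comm_ring_hom_const, of "xvar j :: 'k xpoly"], of "\<lambda>f. fps_nth f ?s"] by simp
  finally show ?thesis .
qed

definition alternant :: "nat \<Rightarrow> nat list \<Rightarrow> 'k::field_char_0 xpoly mat" where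
  "alternant N \<tau> = mat N N (\<lambda>(i, j). xvar j ^ (part \<tau> i + (N - Suc i)))"

text \<open>The alternant is the Jacobi-Trudi matrix times a matrix \<open>M\<close> that does not
  depend on the partition; the empty partition identifies \<open>det M\<close>.\<close>

lemma det_alternant:
  assumes N: "length \<tau> \<le> N"
  shows "det (alternant N \<tau>) = in_vars N (schur \<tau>) * det (alternant N [] :: 'k::field_char_0 xpoly mat)"
proof -
  define M where "M = mat N N (\<lambda>(k, j). pleth const (\<lambda>r. \<Sum>l\<in>{..<N} - {j}. - (xvar l ^ r)) (hsym (N - Suc k)) :: 'k xpoly)"
  interpret iv: comm_ring_hom "in_vars N :: 'k symf \<Rightarrow> 'k xpoly" by (rule in_vars_hom)
  have M: "M \<in> carrier_mat N N" by (simp add: M_def)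
  have *: "det (alternant N \<sigma> :: 'k xpoly mat) = in_vars N (schur \<sigma>) * det M" if \<sigma>: "length \<sigma> \<le> N" for \<sigma>
  proof -
    let ?H = "map_mat (in_vars N) (jt_mat N \<sigma> :: 'k symf mat)"
    have H: "?H \<in> carrier_mat N N" by (simp add: jt_mat_def)
    have "alternant N \<sigma> = ?H * M"
    proof (rule eq_matI)
      fix i j assume "i < dim_row (?H * M)" "j < dim_col (?H * M)"
      then have ij: "i < N" "j < N" using H M by auto
      have "(?H * M) $$ (i, j) = (\<Sum>k<N. in_vars N (complete_symf (int (part \<sigma> i) - int i + int k)) *
        pleth const (\<lambda>r. \<Sum>l\<in>{..<N} - {j}. - (xvar l ^ r)) (hsym (N - Suc k)))"
        using ij H M by (simp add: scalar_prod_def jt_mat_def M_def atLeast0LessThan)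
      also have "\<dots> = xvar j ^ (part \<sigma> i + (N - Suc i))"
        by (rule bialternant_entry[OF ij(2,1) \<sigma>])
      finally show "alternant N \<sigma> $$ (i, j) = (?H * M) $$ (i, j)"
        using ij by (simp add: alternant_def)
    qed (use H M in \<open>auto simp: alternant_def\<close>)
    then show ?thesis using det_mult[OF H M] by (simp add: det_jt_mat[OF \<sigma>])
  qed
  have "schur [] = (1 :: 'k symf)" by (simp add: schur_def)
  then show ?thesis using *[OF N] *[of "[]"] by (simp add: comm_ring_homD[OF in_vars_hom])
qed

lemma nonroot_0: "nonroot 0"
  by (simp add: nonroot_def zero_power)

lemma hl_v_0: "hl_v 0 m = 1"
  unfolding hl_v_def by (rule prod.neutral) auto

lemma HL_0: "HL 0 \<tau> = Qp 0 \<tau>"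
proof -
  have "scale (\<lambda>k. 1 - 0 ^ k) (Qp 0 \<tau>) = scale (\<lambda>_. 1) (Qp 0 \<tau> :: 'a symf)"
    by (rule scale_cong) simp
  then show ?thesis by (simp add: HL_def Qhl_def hl_b_def hl_mult_def hl_v_0 scale_one)
qed

text \<open>At \<open>t = 0\<close> a pair \<open>(i, j)\<close> contributes just the variable of
  \<open>w i\<close>, altogether \<open>N - 1 - i\<close> times, so the antisymmetrized sum is the
  Leibniz expansion of a determinant.\<close>

lemma vander_HL_0:
  assumes "is_partition \<tau>" "length \<tau> \<le> N"
  shows "vander N xvar * in_vars N (HL 0 \<tau>) = det (alternant N \<tau> :: 'k::field_char_0 xpoly mat)"
proof -
  have "vander N xvar * in_vars N (HL 0 \<tau>) = (\<Sum>w | w permutes {..<N}. of_int (sign w) * (\<Prod>i<N. xvar (w i) ^ part \<tau> i) *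
        (\<Prod>(i, j)\<in>pairs N. xvar (w i) - const 0 * (xvar (w j) :: 'k xpoly)))"
    using HL_antisymmetrization[OF nonroot_0 assms, where 'k = 'k] by (simp add: hl_v_part_def hl_v_0)
  also have "\<dots> = (\<Sum>w | w permutes {0..<N}. of_int (sign w) * (\<Prod>i = 0..<N. alternant N \<tau> $$ (i, w i)))"
    unfolding atLeast0LessThan
  proof (rule sum.cong)
    fix w assume "w \<in> {w. w permutes {..<N}}"
    then have w: "w permutes {..<N}" by simp
    have "(\<Prod>(i, j)\<in>pairs N. xvar (w i) - const 0 * (xvar (w j) :: 'k xpoly)) = (\<Prod>i<N. xvar (w i) ^ (N - Suc i))"
      by (simp add: prod_pairs)
    then have "(\<Prod>i<N. xvar (w i) ^ part \<tau> i) * (\<Prod>(i, j)\<in>pairs N. xvar (w i) - const 0 * (xvar (w j) :: 'k xpoly)) =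
      (\<Prod>i<N. xvar (w i) ^ (part \<tau> i + (N - Suc i)))"
      by (simp only: power_add prod.distrib)
    also have "\<dots> = (\<Prod>i<N. alternant N \<tau> $$ (i, w i))"
    proof (rule prod.cong)
      fix i assume "i \<in> {..<N}"
      moreover from this have "w i < N" using permutes_in_image[OF w, of i] by simp
      ultimately show "xvar (w i) ^ (part \<tau> i + (N - Suc i)) = (alternant N \<tau> :: 'k xpoly mat) $$ (i, w i)"
        by (simp add: alternant_def)
    qed simp
    finally show "of_int (sign w) * (\<Prod>i<N. xvar (w i) ^ part \<tau> i) *
      (\<Prod>(i, j)\<in>pairs N. xvar (w i) - const 0 * (xvar (w j) :: 'k xpoly)) =
      of_int (sign w) * (\<Prod>i<N. alternant N \<tau> $$ (i, w i))"
      by (simp only: mult.assoc)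
  qed simp
  also have "\<dots> = det (alternant N \<tau>)"
    by (subst det_def'[of _ N]) (simp_all add: alternant_def)
  finally show ?thesis .
qed

lemma schur_eq:
  assumes \<tau>: "is_partition \<tau>"
  shows "schur \<tau> = (Qp 0 \<tau> :: 'k::field_char_0 symf)"
proof (rule in_vars_inject[of "length \<tau>"])
  fix N assume N: "length \<tau> \<le> N"
  have "is_partition []" by (simp add: is_partition_def)
  from vander_HL_0[OF this, of N, where 'k = 'k]
  have V: "det (alternant N [] :: 'k xpoly mat) = vander N xvar"
    by (simp add: HL_0 comm_ring_homD[OF in_vars_hom])
  have "vander N xvar * in_vars N (Qp 0 \<tau>) = vander N xvar * (in_vars N (schur \<tau>) :: 'k xpoly)"
    using vander_HL_0[OF \<tau> N, where 'k = 'k] det_alternant[OF N, where 'k = 'k] unfolding V HL_0 by (simp add: mult.commute)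
  then show "in_vars N (schur \<tau>) = in_vars N (Qp 0 \<tau> :: 'k symf)"
    using vander_xvar_nonzero[of N, where 'k = 'k] by simp
qed

section \<open>The involution omega\<close>

lemma span_UNIV_if_homog:
  fixes B :: "'k::field_char_0 symf set"
  assumes "\<And>n G. homog n G \<Longrightarrow> G \<in> symf.span B"
  shows "symf.span B = UNIV"
proof -
  have "F \<in> symf.span B" for F
  proof -
    have "(\<Sum>M\<in>Poly_Mapping.keys F. smul (Poly_Mapping.lookup F M) (Poly_Mapping.single M 1)) \<in> symf.span B"
      by (intro symf.span_sum symf.span_scale assms[OF homog_single[OF refl]])
    then show ?thesis unfolding symf_expand[of F, symmetric] .
  qed
  then show ?thesis by blast
qed

text \<open>The element \<open>\<omega> s\<^bsub>\<mu>'\<^esub>\<close> has norm \<open>1\<close>, and it is \<open>a s\<^sub>\<mu> +\<close> (other Schur functions) with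
  \<open>a \<ge> 1\<close>; as the Schur functions are orthonormal, it equals \<open>s\<^sub>\<mu>\<close>.\<close>

lemma scale_sgnc_schur:
  assumes \<rho>: "is_partition \<rho>"
  shows "scale sgnc (schur \<rho>) = (schur (conj_partition \<rho>) :: 'k::linordered_field symf)"
proof -
  let ?\<mu> = "conj_partition \<rho>"
  let ?n = "sum_list \<rho>"
  let ?S = "\<lambda>\<tau>. Qp 0 \<tau> :: 'k symf"
  have \<mu>: "is_partition ?\<mu>" "?\<mu> \<in> partitions_of ?n"
    using \<rho> by (auto simp: is_partition_conj partitions_of_iff sum_list_conj)
  define T where "T = scale sgnc (?S \<rho>)"
  define a where "a \<tau> = hall T (?S \<tau>)" for \<tau>
  have orth: "hall (?S \<tau>) (?S \<sigma>) = (if \<sigma> = \<tau> then 1 else 0)" if "is_partition \<tau>" "is_partition \<sigma>" for \<tau> \<sigma>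
    using HL_Qp_dual[OF nonroot_0 that, where 'k = 'k] by (simp add: HL_0)
  have hT: "homog ?n T" unfolding T_def by (intro homog_scale homog_Qp)
  have T: "T = (\<Sum>\<tau>\<in>partitions_of ?n. smul (a \<tau>) (?S \<tau>))"
    unfolding a_def by (rule expand_HL[OF nonroot_0 hT, unfolded HL_0])
  have "hall T T = hall (?S \<rho>) (?S \<rho>)"
    unfolding T_def hall_scale scale_sgnc_involution ..
  also have "\<dots> = 1" by (simp add: orth \<rho>)
  finally have norm: "hall T T = 1" .
  have "hall T T = (\<Sum>\<tau>\<in>partitions_of ?n. a \<tau> * hall T (?S \<tau>))"
    by (rule trans[OF arg_cong[OF T, of "hall T"]]) (simp only: hall_sum_right hall_smul_right)
  then have sum1: "(\<Sum>\<tau>\<in>partitions_of ?n. a \<tau> * a \<tau>) = 1"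
    using norm by (simp add: a_def)
  have lowT: "lower ?\<mu> T" "hall T (prod_list (map hsym ?\<mu>)) \<ge> 1"
    using lower_omega_upper[OF \<rho> Qp_upper(1)[OF \<rho>, of "0::'k"]] Qp_upper(2)[OF \<rho>, of "0::'k"] hall_esym_conj[OF \<rho>, where 'k = 'k]
    by (simp_all add: T_def)
  have a1: "a ?\<mu> \<ge> 1"
    unfolding a_def hall_lower_upper(2)[OF lowT(1) Qp_upper(1)[OF \<mu>(1)] refl \<mu>(1)]
    using lowT(2) Qp_upper(2)[OF \<mu>(1), of "0::'k"] by simp
  have split: "a ?\<mu> * a ?\<mu> + (\<Sum>\<tau>\<in>partitions_of ?n - {?\<mu>}. a \<tau> * a \<tau>) = 1"
    using sum1 sum.remove[OF finite_partitions_of \<mu>(2), of "\<lambda>\<tau>. a \<tau> * a \<tau>"] by simp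
  have nonneg: "(\<Sum>\<tau>\<in>partitions_of ?n - {?\<mu>}. a \<tau> * a \<tau>) \<ge> 0" by (rule sum_nonneg) simp
  have ge: "a ?\<mu> * a ?\<mu> \<ge> a ?\<mu>" using a1 mult_left_mono[OF a1, of "a ?\<mu>"] by simp
  then have "a ?\<mu> = 1" using split nonneg a1 by linarith
  then have "(\<Sum>\<tau>\<in>partitions_of ?n - {?\<mu>}. a \<tau> * a \<tau>) = 0" using split by simp
  then have "a \<tau> * a \<tau> = 0" if "\<tau> \<in> partitions_of ?n - {?\<mu>}" for \<tau>
    using sum_nonneg_eq_0_iff[of "partitions_of ?n - {?\<mu>}" "\<lambda>\<tau>. a \<tau> * a \<tau>"] finite_partitions_of that by simp
  then have "T = smul (a ?\<mu>) (?S ?\<mu>)"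
    unfolding T by (intro sum_single_term[OF finite_partitions_of \<mu>(2)]) simp
  then show ?thesis using \<open>a ?\<mu> = 1\<close> \<mu>(1) \<rho> by (simp add: T_def schur_eq)
qed

text \<open>The scalars are ordered because \<open>scale_sgnc_schur\<close> compares sums of
  squares. Uniqueness holds since the Schur functions span, by \<open>expand_HL\<close> at
  \<open>t = 0\<close>.\<close>

lemma omega_eq: "omega = (scale sgnc :: 'k::linordered_field symf \<Rightarrow> _)"
  unfolding omega_def
proof (rule the_equality)
  show "Vector_Spaces.linear smul smul (scale sgnc :: 'k symf \<Rightarrow> 'k symf) \<and>
    (\<forall>\<rho>. is_partition \<rho> \<longrightarrow> scale sgnc (schur \<rho>) = (schur (conj_partition \<rho>) :: 'k symf))"
    using linear_scale scale_sgnc_schur by blast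
  fix f :: "'k symf \<Rightarrow> 'k symf"
  assume f: "Vector_Spaces.linear smul smul f \<and> (\<forall>\<rho>. is_partition \<rho> \<longrightarrow> f (schur \<rho>) = schur (conj_partition \<rho>))"
  let ?B = "schur ` {\<rho>. is_partition \<rho>} :: 'k symf set"
  have "symf.span ?B = UNIV"
  proof (rule span_UNIV_if_homog)
    fix n and G :: "'k symf" assume G: "homog n G"
    have "G = (\<Sum>\<tau>\<in>partitions_of n. smul (hall G (Qp 0 \<tau>)) (Qp 0 \<tau>))"
      by (rule expand_HL[OF nonroot_0 G, unfolded HL_0])
    also have "\<dots> = (\<Sum>\<tau>\<in>partitions_of n. smul (hall G (Qp 0 \<tau>)) (schur \<tau>))"
      by (rule sum.cong) (simp_all add: schur_eq partitions_of_iff)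
    finally have "G = (\<Sum>\<tau>\<in>partitions_of n. smul (hall G (Qp 0 \<tau>)) (schur \<tau>))" .
    moreover have "\<dots> \<in> symf.span ?B"
      by (intro symf.span_sum symf.span_scale symf.span_base) (auto simp: partitions_of_iff)
    ultimately show "G \<in> symf.span ?B" by (rule ssubst[where P = "\<lambda>x. x \<in> symf.span ?B"])
  qed
  then have span: "F \<in> symf.span ?B" for F by simp
  show "f = scale sgnc"
  proof
    fix F
    show "f F = scale sgnc F"
    proof (rule symf_pair.linear_eq_on_span[OF _ linear_scale _ span])
      show "Vector_Spaces.linear smul smul f" using f by blast
      fix x assume "x \<in> ?B"
      then obtain \<rho> where "is_partition \<rho>" "x = schur \<rho>" by blast
      then show "f x = scale sgnc x" using f scale_sgnc_schur by metis
    qed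
  qed
qed

section \<open>Macdonald polynomials near t = 0\<close>

section \<open>Reduction at t = 0\<close>

text \<open>\<open>rdx x y\<close>: the rational function \<open>x\<close> is regular at \<open>t = 0\<close>, with value \<open>y\<close>.\<close>

definition rdx :: "Qqt \<Rightarrow> Qq \<Rightarrow> bool" where
  "rdx x y \<longleftrightarrow> (\<exists>a b. poly b 0 \<noteq> 0 \<and> x = Fract a b \<and> y = poly a 0 / poly b 0)"

lemma rdxI: "poly b 0 \<noteq> 0 \<Longrightarrow> rdx (Fract a b) (poly a 0 / poly b 0)"
  by (auto simp: rdx_def)

lemma rdx_unique:
  assumes "rdx x y" "rdx x y'"
  shows "y = y'"
proof -
  obtain a b a' b' where *: "poly b 0 \<noteq> 0" "x = Fract a b" "y = poly a 0 / poly b 0"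
    "poly b' 0 \<noteq> 0" "x = Fract a' b'" "y' = poly a' 0 / poly b' 0"
    using assms unfolding rdx_def by blast
  then have "b \<noteq> 0" "b' \<noteq> 0" by auto
  then have "a * b' = a' * b" using * eq_fract(1)[of b b' a a'] by simp
  from arg_cong[OF this, of "\<lambda>p. poly p 0"] have "poly a 0 * poly b' 0 = poly a' 0 * poly b 0" by simp
  then show ?thesis using * by (simp add: frac_eq_eq)
qed

lemma at_t0_eq: "rdx x y \<Longrightarrow> at_t0 x = y"
  unfolding at_t0_def rdx_def[symmetric] using rdx_unique by (intro the_equality) auto

lemma rdx_add: "rdx x y \<Longrightarrow> rdx x' y' \<Longrightarrow> rdx (x + x') (y + y')"
proof -
  assume "rdx x y" "rdx x' y'"
  then obtain a b a' b' where *: "poly b 0 \<noteq> 0" "x = Fract a b" "y = poly a 0 / poly b 0"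
    "poly b' 0 \<noteq> 0" "x' = Fract a' b'" "y' = poly a' 0 / poly b' 0"
    unfolding rdx_def by blast
  then have "b \<noteq> 0" "b' \<noteq> 0" by auto
  then have "x + x' = Fract (a * b' + a' * b) (b * b')" using * by simp
  moreover have "y + y' = poly (a * b' + a' * b) 0 / poly (b * b') 0" using * by (simp add: add_frac_eq)
  moreover have "poly (b * b') 0 \<noteq> 0" using * by simp
  ultimately show ?thesis unfolding rdx_def by blast
qed

lemma rdx_mult: "rdx x y \<Longrightarrow> rdx x' y' \<Longrightarrow> rdx (x * x') (y * y')"
proof -
  assume "rdx x y" "rdx x' y'"
  then obtain a b a' b' where *: "poly b 0 \<noteq> 0" "x = Fract a b" "y = poly a 0 / poly b 0"
    "poly b' 0 \<noteq> 0" "x' = Fract a' b'" "y' = poly a' 0 / poly b' 0"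
    unfolding rdx_def by blast
  then have "x * x' = Fract (a * a') (b * b')" by simp
  moreover have "y * y' = poly (a * a') 0 / poly (b * b') 0" using * by simp
  moreover have "poly (b * b') 0 \<noteq> 0" using * by simp
  ultimately show ?thesis unfolding rdx_def by blast
qed

lemma rdx_inverse: "rdx x y \<Longrightarrow> y \<noteq> 0 \<Longrightarrow> rdx (inverse x) (inverse y)"
proof -
  assume "rdx x y" "y \<noteq> 0"
  then obtain a b where *: "poly b 0 \<noteq> 0" "x = Fract a b" "y = poly a 0 / poly b 0" "poly a 0 \<noteq> 0"
    unfolding rdx_def by auto
  then have "inverse x = Fract b a" "inverse y = poly b 0 / poly a 0" by simp_all
  then show ?thesis unfolding rdx_def using * by blast
qed

lemma rdx_divide: "rdx x y \<Longrightarrow> rdx x' y' \<Longrightarrow> y' \<noteq> 0 \<Longrightarrow> rdx (x / x') (y / y')"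
  unfolding divide_inverse by (intro rdx_mult rdx_inverse)

definition emb :: "Qq \<Rightarrow> Qqt" where
  "emb c = Fract [:c:] 1"

lemma emb_hom: "comm_ring_hom emb"
  using comm_ring_hom_compose[OF to_fract_hom comm_ring_hom_pCons]
  by (simp add: emb_def[abs_def] to_fract_def)

lemma rdx_emb: "rdx (emb c) c"
  using rdxI[of 1 "[:c:]"] by (simp add: emb_def)

lemma rdx_0: "rdx 0 0" and rdx_1: "rdx 1 1"
  using rdx_emb[of 0] rdx_emb[of 1] by (simp_all add: comm_ring_homD[OF emb_hom])

lemma rdx_uminus: "rdx x y \<Longrightarrow> rdx (- x) (- y)"
  using rdx_mult[OF rdx_emb[of "- 1"], of x y] by (simp add: comm_ring_homD[OF emb_hom])

lemma rdx_diff: "rdx x y \<Longrightarrow> rdx x' y' \<Longrightarrow> rdx (x - x') (y - y')"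
  using rdx_add[of x y "- x'" "- y'"] rdx_uminus by simp

lemma rdx_sum: "(\<And>i. i \<in> A \<Longrightarrow> rdx (f i) (g i)) \<Longrightarrow> rdx (\<Sum>i\<in>A. f i) (\<Sum>i\<in>A. g i)"
  by (induction A rule: infinite_finite_induct) (auto intro: rdx_add rdx_0)

lemma rdx_power: "rdx x y \<Longrightarrow> rdx (x ^ n) (y ^ n)"
  by (induction n) (auto intro: rdx_mult rdx_1)

lemma rdx_prod_mset: "(\<And>i. i \<in># M \<Longrightarrow> rdx (f i) (g i)) \<Longrightarrow> rdx (\<Prod>i\<in>#M. f i) (\<Prod>i\<in>#M. g i)"
  by (induction M) (auto intro: rdx_mult rdx_1)

lemma rdx_nonzero: "rdx x y \<Longrightarrow> y \<noteq> 0 \<Longrightarrow> x \<noteq> 0"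
  using rdx_unique[OF rdx_0] by auto

lemma rdx_of_nat: "rdx (of_nat n) (of_nat n)"
  by (induction n) (auto intro: rdx_add rdx_0 rdx_1)

lemma q2_eq: "q2 = emb q1"
  by (simp add: q2_def emb_def)

lemma rdx_q2: "rdx q2 q1"
  by (simp add: q2_eq rdx_emb)

lemma rdx_t2: "rdx t2 0"
  using rdxI[of 1 "[:0, 1:]"] by (simp add: t2_def)

lemma q1_power_neq_1: "k > 0 \<Longrightarrow> q1 ^ k \<noteq> 1"
proof
  assume k: "k > 0" and "q1 ^ k = 1"
  have "q1 ^ k = to_fract ([:0, 1:] ^ k)"
    by (simp add: q1_def to_fract_def[symmetric] comm_ring_homD[OF to_fract_hom])
  with \<open>q1 ^ k = 1\<close> have "[:0, 1:] ^ k = (1 :: rat poly)"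
    by (metis to_fract_1 to_fract_eq_iff)
  then have "poly ([:0, 1:] ^ k) 0 = (1 :: rat)" by simp
  then show False using k by (simp add: zero_power)
qed

lemma q1_nonzero: "q1 \<noteq> 0"
  unfolding q1_def to_fract_def[symmetric] by simp

abbreviation (input) tq :: Qq where "tq \<equiv> inverse q1"

lemma nonroot_tq: "nonroot tq"
  using q1_power_neq_1 by (auto simp: nonroot_def power_inverse)

lemma tq_nonzero: "tq \<noteq> 0"
  using q1_nonzero by simp

lemma t2_nonzero: "t2 \<noteq> 0"
  unfolding t2_def to_fract_def[symmetric] by simp

lemma q2_nonzero: "q2 \<noteq> 0"
  using rdx_nonzero[OF rdx_q2 q1_nonzero] .

lemma rdx_one_minus_t2: "k > 0 \<Longrightarrow> rdx (1 - t2 ^ k) 1"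
  using rdx_diff[OF rdx_1 rdx_power[OF rdx_t2, of k]] by (simp add: zero_power)

lemma one_minus_t2_nonzero: "k > 0 \<Longrightarrow> 1 - t2 ^ k \<noteq> 0"
  using rdx_nonzero[OF rdx_one_minus_t2] by simp

text \<open>Regularity of all coefficients in the power sums; linear combinations,
  \<open>scale\<close> and the Hall form then specialize termwise.\<close>

definition red :: "Qqt symf \<Rightarrow> Qq symf \<Rightarrow> bool" where
  "red F G \<longleftrightarrow> (\<forall>M. rdx (Poly_Mapping.lookup F M) (Poly_Mapping.lookup G M))"

lemma red_add: "red F G \<Longrightarrow> red F' G' \<Longrightarrow> red (F + F') (G + G')"
  by (simp add: red_def lookup_add rdx_add)

lemma red_smul: "rdx c d \<Longrightarrow> red F G \<Longrightarrow> red (smul c F) (smul d G)"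
  by (simp add: red_def lookup_smul rdx_mult)

lemma red_sum: "(\<And>i. i \<in> A \<Longrightarrow> red (F i) (G i)) \<Longrightarrow> red (\<Sum>i\<in>A. F i) (\<Sum>i\<in>A. G i)"
  by (simp add: red_def lookup_sum rdx_sum)

lemma red_scale: "(\<And>k. k > 0 \<Longrightarrow> rdx (c k) (d k)) \<Longrightarrow> red F G \<Longrightarrow> red (scale c F) (scale d G)"
  by (simp add: red_def lookup_scale rdx_mult rdx_prod_mset)

lemma rdx_hall:
  assumes "red F G" "red F' G'"
  shows "rdx (hall F F') (hall G G')"
proof -
  let ?S = "Poly_Mapping.keys F \<union> Poly_Mapping.keys G"
  have "hall F F' = (\<Sum>M\<in>?S. Poly_Mapping.lookup F M * Poly_Mapping.lookup F' M * of_nat (z_coeff M))"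
    "hall G G' = (\<Sum>M\<in>?S. Poly_Mapping.lookup G M * Poly_Mapping.lookup G' M * of_nat (z_coeff M))"
    by (rule hall_superset; simp)+
  then show ?thesis
    using assms by (auto simp: red_def intro!: rdx_sum rdx_mult rdx_of_nat)
qed

lemma symf_at_t0_eq:
  assumes "red F G"
  shows "symf_at_t0 F = G"
proof (rule poly_mapping_eqI)
  fix M
  have "Poly_Mapping.lookup (symf_at_t0 F) M = (at_t0 (Poly_Mapping.lookup F M) when Poly_Mapping.lookup F M \<noteq> 0)"
    unfolding symf_at_t0_def by transfer simp
  moreover have "at_t0 (Poly_Mapping.lookup F M) = Poly_Mapping.lookup G M"
    using assms by (intro at_t0_eq) (simp add: red_def)
  \<comment> \<open>\<open>Poly_Mapping.map\<close> acts on nonzero coefficients only, so the value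
    at 0 is checked separately.\<close>
  moreover have "at_t0 0 = 0" by (rule at_t0_eq[OF rdx_0])
  ultimately show "Poly_Mapping.lookup (symf_at_t0 F) M = Poly_Mapping.lookup G M"
    by (cases "Poly_Mapping.lookup F M = 0") simp_all
qed

text \<open>Extension of scalars from \<open>Qq\<close> to \<open>Qqt\<close>. As a plethysm it is a
  ring homomorphism at once; on coefficients it is \<open>emb\<close>
  (\<open>lookup_semb\<close>).\<close>

definition semb :: "Qq symf \<Rightarrow> Qqt symf" where
  "semb = pleth (\<lambda>c. const (emb c)) psum"

lemma comm_ring_hom_const_emb: "comm_ring_hom (\<lambda>c. const (emb c))"
  by (rule comm_ring_hom_compose[OF comm_ring_hom_const emb_hom])

lemma semb_hom: "comm_ring_hom semb"
  unfolding semb_def by (rule comm_ring_hom_pleth[OF comm_ring_hom_const_emb])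

lemma lookup_semb: "Poly_Mapping.lookup (semb F) M = emb (Poly_Mapping.lookup F M)"
proof (induction F rule: poly_mapping_additive_induct)
  case (single L c)
  have "semb (Poly_Mapping.single L c) = Poly_Mapping.single L (emb c)"
    unfolding semb_def pleth_conv_pm_eval
    by (subst pm_eval_single) (simp_all add: single_multiset_eq comm_ring_homD[OF emb_hom])
  then show ?case by (simp add: lookup_single when_def comm_ring_homD[OF emb_hom])
qed (simp add: comm_ring_homD[OF semb_hom] comm_ring_homD[OF emb_hom] lookup_add)

lemma red_semb: "red (semb F) F"
  by (simp add: red_def lookup_semb rdx_emb)

lemma homog_semb: "homog n F \<Longrightarrow> homog n (semb F)"
  by (simp add: homog_def lookup_semb comm_ring_homD[OF emb_hom])

lemma semb_smul: "semb (smul c F) = smul (emb c) (semb F)"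
  by (rule poly_mapping_eqI) (simp add: lookup_semb lookup_smul comm_ring_homD[OF emb_hom])

lemma semb_scale: "semb (scale c F) = scale (\<lambda>k. emb (c k)) (semb F)"
  by (rule poly_mapping_eqI)
    (simp add: lookup_semb lookup_scale comm_ring_homD[OF emb_hom] image_mset.compositionality comp_def)

lemma hall_semb: "hall (semb F) (semb G) = emb (hall F G)"
proof -
  have "hall (semb F) (semb G) = (\<Sum>M\<in>Poly_Mapping.keys F. Poly_Mapping.lookup (semb F) M *
    Poly_Mapping.lookup (semb G) M * of_nat (z_coeff M))"
    by (rule hall_superset) (auto simp: in_keys_iff lookup_semb comm_ring_homD[OF emb_hom])
  then show ?thesis
    by (simp add: hall_def lookup_semb comm_ring_homD[OF emb_hom])
qed

lemma semb_psum: "k > 0 \<Longrightarrow> semb (psum k) = psum k"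
  by (simp add: semb_def pleth_psum comm_ring_hom_const_emb)

lemma semb_hsym: "semb (hsym n) = hsym n"
proof (induction n rule: less_induct)
  case (less n)
  show ?case
  proof (cases "n = 0")
    case False
    have "semb (hsym n) = smul (emb (1 / of_nat n)) (\<Sum>k<n. semb (psum (Suc k)) * semb (hsym (n - Suc k)))"
      using False by (subst hsym.simps) (simp add: semb_smul comm_ring_homD[OF semb_hom])
    also have "\<dots> = smul (1 / of_nat n) (\<Sum>k<n. psum (Suc k) * hsym (n - Suc k))"
    proof -
      have "(\<Sum>k<n. semb (psum (Suc k)) * semb (hsym (n - Suc k))) = (\<Sum>k<n. psum (Suc k) * hsym (n - Suc k))"
        by (rule sum.cong) (simp_all add: semb_psum less)
      then show ?thesis by (simp add: comm_ring_hom_divide[OF emb_hom] comm_ring_homD[OF emb_hom])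
    qed
    also have "\<dots> = hsym n" using False by (subst (2) hsym.simps) simp
    finally show ?thesis .
  qed (simp add: comm_ring_homD[OF semb_hom])
qed

lemma semb_hl: "semb (prod_list (map hsym \<sigma>)) = prod_list (map hsym \<sigma>)"
  by (simp add: comm_ring_homD[OF semb_hom] comp_def semb_hsym)

lemma semb_elem: "semb (elem_symf n) = elem_symf n"
proof -
  have "emb (sgnc k) = sgnc k" for k
    by (simp add: sgnc_def comm_ring_homD[OF emb_hom])
  then show ?thesis by (simp add: elem_symf_eq semb_scale semb_hsym)
qed

lemma semb_schur: "semb (schur \<nu>) = schur \<nu>"
proof -
  interpret comm_ring_hom semb by (rule semb_hom)
  let ?H = "\<lambda>\<nu>. mat (length \<nu>) (length \<nu>) (\<lambda>(i, j). complete_symf (int (\<nu> ! i) - int i + int j))"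
  have "map_mat semb (?H \<nu>) = (?H \<nu> :: Qqt symf mat)"
    by (rule eq_matI) (auto simp: complete_symf_eq semb_hsym comm_ring_homD[OF semb_hom])
  then show ?thesis unfolding schur_def using hom_det[of "?H \<nu>"] by simp
qed

lemma lower_semb:
  assumes "lower \<mu> F"
  shows "lower \<mu> (semb F)"
proof -
  have "hall (semb F) (prod_list (map hsym \<sigma>)) = emb (hall F (prod_list (map hsym \<sigma>)))" for \<sigma>
    using hall_semb[of F "prod_list (map hsym \<sigma>)"] by (simp add: semb_hl)
  then show ?thesis
    using assms by (auto simp: lower_def homog_semb comm_ring_homD[OF emb_hom])
qed

section \<open>The q-Whittaker functions\<close>

text \<open>The coefficient of \<open>m_\<mu>\<close> by which \<open>W\<close> is normalized; only
  its nonvanishing is established, its value being absorbed in \<open>conj_W_coeff\<close>.\<close>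

definition W_coeff :: "nat list \<Rightarrow> Qq" where
  "W_coeff \<mu> = hall (scale sgnc (Qp tq (conj_partition \<mu>))) (prod_list (map hsym \<mu>))"

definition W :: "nat list \<Rightarrow> Qq symf" where
  "W \<mu> = smul (1 / W_coeff \<mu>) (scale sgnc (Qp tq (conj_partition \<mu>)))"

abbreviation w0 :: "nat \<Rightarrow> Qq" where "w0 k \<equiv> 1 - tq ^ k"

text \<open>By triangularity it is the leading coefficient of a product of elementary functions,
  which positivity in the ordered field \<open>Qq\<close> bounds below by 1.\<close>

lemma W_coeff_nonzero:
  assumes "is_partition \<mu>"
  shows "W_coeff \<mu> \<noteq> 0"
proof -
  let ?c = "conj_partition \<mu>"
  have "W_coeff \<mu> = hall (scale sgnc (prod_list (map hsym ?c))) (prod_list (map hsym \<mu>))"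
    using lower_omega_upper(2)[OF is_partition_conj[OF assms] Qp_upper(1)[OF is_partition_conj[OF assms], of tq]]
      Qp_upper(2)[OF is_partition_conj[OF assms], of tq]
    by (simp add: W_coeff_def conj_conj[OF assms])
  also have "\<dots> \<ge> 1"
    using hall_esym_conj[OF is_partition_conj[OF assms]] by (simp add: conj_conj[OF assms])
  finally show ?thesis by auto
qed

lemma W_lower:
  assumes "is_partition \<mu>"
  shows "lower \<mu> (W \<mu>)" "hall (W \<mu>) (prod_list (map hsym \<mu>)) = 1"
  using lower_omega_upper(1)[OF is_partition_conj[OF assms] Qp_upper(1)[OF is_partition_conj[OF assms], of tq]]
    W_coeff_nonzero[OF assms]
  by (simp_all add: W_def conj_conj[OF assms] lower_smul hall_smul_left W_coeff_def[symmetric])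

text \<open>The two signs of omega cancel, and the weight \<open>w0\<close> turns one
  \<open>Q'\<close> into \<open>Q\<close> at parameter \<open>1/q\<close>; what remains is the
  duality of \<open>P\<close> and \<open>Q'\<close> for the conjugate partitions.\<close>

lemma W_orth:
  assumes "is_partition \<mu>" "is_partition \<sigma>"
  shows "hall (scale w0 (W \<mu>)) (W \<sigma>) = 0 \<longleftrightarrow> \<mu> \<noteq> \<sigma>"
proof -
  let ?Q = "\<lambda>\<mu>. Qp tq (conj_partition \<mu>)"
  have "hall (scale w0 (scale sgnc (?Q \<mu>))) (scale sgnc (?Q \<sigma>)) = hall (scale w0 (?Q \<mu>)) (?Q \<sigma>)"
    unfolding hall_scale[of sgnc, symmetric] scale_scale
    by (rule arg_cong2[where f = hall], rule scale_cong) (simp_all add: mult.assoc mult.left_commute)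
  also have "\<dots> = hl_b tq (conj_partition \<mu>) * hall (HL tq (conj_partition \<mu>)) (?Q \<sigma>)"
    using hl_b_nonzero[OF nonroot_tq] by (simp add: HL_def Qhl_def hall_smul_left)
  also have "\<dots> = (if \<mu> = \<sigma> then hl_b tq (conj_partition \<mu>) else 0)"
    using assms conj_conj[of \<mu>] conj_conj[of \<sigma>]
    by (auto simp: HL_Qp_dual[OF nonroot_tq is_partition_conj is_partition_conj])
  finally show ?thesis
    using W_coeff_nonzero[OF assms(1)] W_coeff_nonzero[OF assms(2)] hl_b_nonzero[OF nonroot_tq]
    by (simp add: W_def scale_smul hall_smul_left hall_smul_right)
qed

section \<open>Macdonald polynomials near t = 0\<close>

text \<open>From \<open>(1 - q^k) / (1 - t^-k) = (q t)^k (1 - q^-k) / (1 - t^k)\<close>. The weight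
  on the left vanishes at \<open>t = 0\<close>, while \<open>wL\<close> tends to \<open>w0\<close>,
  for which the \<open>W\<close> are orthogonal.\<close>

definition wL :: "nat \<Rightarrow> Qqt" where
  "wL k = (1 - inverse q2 ^ k) / (1 - t2 ^ k)"

definition BL :: "Qqt symf \<Rightarrow> Qqt symf \<Rightarrow> Qqt" where
  "BL F G = hall (scale wL F) G"

lemma rdx_wL: "k > 0 \<Longrightarrow> rdx (wL k) (w0 k)"
proof -
  assume k: "k > 0"
  have "rdx (1 - inverse q2 ^ k) (w0 k)"
    by (intro rdx_diff rdx_1 rdx_power rdx_inverse rdx_q2 q1_nonzero)
  from rdx_divide[OF this rdx_one_minus_t2[OF k]] show ?thesis by (simp add: wL_def)
qed

lemma rdx_BL: "red F G \<Longrightarrow> red F' G' \<Longrightarrow> rdx (BL F F') (hall (scale w0 G) G')"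
  unfolding BL_def by (intro rdx_hall red_scale rdx_wL)

lemma BL_commute: "BL F G = BL G F"
  unfolding BL_def by (subst hall_scale) (rule hall_commute)

lemma BL_linear:
  "BL (F + F') G = BL F G + BL F' G" "BL F (G + G') = BL F G + BL F G'"
  "BL (smul c F) G = c * BL F G" "BL F (smul c G) = c * BL F G"
  "BL (\<Sum>i\<in>A. f i) G = (\<Sum>i\<in>A. BL (f i) G)" "BL F (\<Sum>i\<in>A. f i) = (\<Sum>i\<in>A. BL F (f i))"
  "BL (F - F') G = BL F G - BL F' G"
  by (simp_all add: BL_def scale_simps scale_smul hall_add_left hall_add_right hall_smul_left hall_smul_right
      hall_sum_left hall_sum_right hall_diff_left)

lemma qt_form_eq:
  assumes "homog n F"
  shows "qt_form q2 (inverse t2) F G = (q2 * t2) ^ n * BL F G"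
proof -
  let ?c = "\<lambda>k. (1 - q2 ^ k) / (1 - inverse t2 ^ k)"
  have "qt_form q2 (inverse t2) F G = hall (scale ?c F) G"
  proof -
    have "hall (scale ?c F) G = (\<Sum>M\<in>Poly_Mapping.keys F. Poly_Mapping.lookup (scale ?c F) M * Poly_Mapping.lookup G M * of_nat (z_coeff M))"
      by (rule hall_superset) (auto simp: in_keys_iff lookup_scale)
    then show ?thesis by (simp only: qt_form_def lookup_scale mult_ac)
  qed
  also have "scale ?c F = scale (\<lambda>k. (q2 * t2) ^ k) (scale wL F)"
    unfolding scale_scale
  proof (rule scale_cong)
    fix k :: nat assume k: "k > 0"
    have nz: "1 - t2 ^ k \<noteq> 0" "t2 ^ k \<noteq> 0" "q2 ^ k \<noteq> 0"
      using one_minus_t2_nonzero[OF k] t2_nonzero q2_nonzero by simp_all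
    then have "1 - inverse t2 ^ k \<noteq> 0" by (simp add: power_inverse field_simps)
    then show "?c k = (q2 * t2) ^ k * wL k"
      using nz by (simp add: wL_def power_inverse power_mult_distrib field_simps)
  qed
  also have "\<dots> = smul ((q2 * t2) ^ n) (scale wL F)"
    by (rule scale_power[OF homog_scale[OF assms]])
  finally show ?thesis by (simp add: hall_smul_left BL_def)
qed

text \<open>Gram--Schmidt orthogonalization starting from a family that is orthogonal at \<open>t = 0\<close>: the
  corrections vanish at \<open>t = 0\<close>.\<close>

lemma orthogonalize:
  assumes "finite J" "\<And>\<sigma>. \<sigma> \<in> J \<Longrightarrow> is_partition \<sigma>"
    and "red v v0" "\<And>\<sigma>. \<sigma> \<in> J \<Longrightarrow> hall (scale w0 v0) (W \<sigma>) = 0"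
  shows "\<exists>c. (\<forall>\<sigma>\<in>J. rdx (c \<sigma>) 0) \<and>
    (\<forall>\<sigma>\<in>J. BL (v + (\<Sum>\<rho>\<in>J. smul (c \<rho>) (semb (W \<rho>)))) (semb (W \<sigma>)) = 0)"
  using assms
proof (induction J arbitrary: v v0 rule: finite_induct)
  case empty
  show ?case by simp
next
  case (insert \<tau> J)
  let ?w = "\<lambda>\<rho>. semb (W \<rho>)"
  have part: "is_partition \<tau>" "\<And>\<sigma>. \<sigma> \<in> J \<Longrightarrow> is_partition \<sigma>" using insert.prems(1) by auto
  obtain c where c: "\<forall>\<sigma>\<in>J. rdx (c \<sigma>) 0" "\<forall>\<sigma>\<in>J. BL (v + (\<Sum>\<rho>\<in>J. smul (c \<rho>) (?w \<rho>))) (?w \<sigma>) = 0"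
    using insert.IH[OF part(2) insert.prems(2)] insert.prems(3) by blast
  have "hall (scale w0 (W \<tau>)) (W \<sigma>) = 0" if "\<sigma> \<in> J" for \<sigma>
    using W_orth[OF part(1) part(2)[OF that]] that insert.hyps by auto
  then obtain d where d: "\<forall>\<sigma>\<in>J. rdx (d \<sigma>) 0" "\<forall>\<sigma>\<in>J. BL (?w \<tau> + (\<Sum>\<rho>\<in>J. smul (d \<rho>) (?w \<rho>))) (?w \<sigma>) = 0"
    using insert.IH[OF part(2) red_semb[of "W \<tau>"]] by blast
  \<comment> \<open>\<open>p\<close> and \<open>r\<close> are \<open>v\<close> and the new vector,
    each made orthogonal to \<open>J\<close>; subtracting the projection of \<open>p\<close> on
    \<open>r\<close> handles \<open>\<tau>\<close> as well. At \<open>t = 0\<close> the numerator of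
    the projection factor vanishes and the denominator does not.\<close>
  define p where "p = v + (\<Sum>\<rho>\<in>J. smul (c \<rho>) (?w \<rho>))"
  define r where "r = ?w \<tau> + (\<Sum>\<rho>\<in>J. smul (d \<rho>) (?w \<rho>))"
  have small: "red (u + (\<Sum>\<rho>\<in>J. smul (e \<rho>) (?w \<rho>))) u0" if "red u u0" "\<forall>\<sigma>\<in>J. rdx (e \<sigma>) 0" for u u0 e
  proof -
    have "red (\<Sum>\<rho>\<in>J. smul (e \<rho>) (?w \<rho>)) (\<Sum>\<rho>\<in>J. smul 0 (W \<rho>))"
      using that by (intro red_sum red_smul red_semb) auto
    from red_add[OF that(1) this] show ?thesis by simp
  qed
  have "red p v0" "red r (W \<tau>)"
    unfolding p_def r_def using small insert.prems(2) c d red_semb by blast+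
  then have "rdx (BL p (?w \<tau>)) 0" "rdx (BL r (?w \<tau>)) (hall (scale w0 (W \<tau>)) (W \<tau>))"
    using rdx_BL[OF _ red_semb[of "W \<tau>"]] insert.prems(3)[of \<tau>] by force+
  moreover have "hall (scale w0 (W \<tau>)) (W \<tau>) \<noteq> 0" using W_orth[OF part(1) part(1)] by simp
  ultimately have k: "rdx (BL p (?w \<tau>) / BL r (?w \<tau>)) 0" and rnz: "BL r (?w \<tau>) \<noteq> 0"
    using rdx_divide[of "BL p (?w \<tau>)" 0] rdx_nonzero by force+
  define k where "k = BL p (?w \<tau>) / BL r (?w \<tau>)"
  define c' where "c' \<sigma> = (if \<sigma> = \<tau> then - k else c \<sigma> - k * d \<sigma>)" for \<sigma>
  have "(\<Sum>\<rho>\<in>J. smul (c' \<rho>) (?w \<rho>)) = (\<Sum>\<rho>\<in>J. smul (c \<rho>) (?w \<rho>) - smul k (smul (d \<rho>) (?w \<rho>)))"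
    using insert.hyps by (intro sum.cong) (auto simp: c'_def smul_smul symf.scale_left_diff_distrib)
  then have eq: "v + (\<Sum>\<rho>\<in>insert \<tau> J. smul (c' \<rho>) (?w \<rho>)) = p - smul k r"
    using insert.hyps
    by (simp add: p_def r_def sum_subtractf symf.scale_right_distrib symf.scale_sum_right c'_def algebra_simps)
  have "rdx (c' \<sigma>) 0" if "\<sigma> \<in> insert \<tau> J" for \<sigma>
  proof (cases "\<sigma> = \<tau>")
    case True
    then show ?thesis using rdx_uminus[OF k] by (simp add: c'_def k_def)
  next
    case False
    then have "rdx (c \<sigma> - k * d \<sigma>) (0 - 0 * 0)"
      using that c d k unfolding k_def[symmetric] by (intro rdx_diff rdx_mult) auto
    then show ?thesis using False by (simp add: c'_def)
  qed
  moreover have "BL (p - smul k r) (?w \<sigma>) = 0" if "\<sigma> \<in> insert \<tau> J" for \<sigma>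
  proof (cases "\<sigma> = \<tau>")
    case True
    then show ?thesis using rnz by (simp add: BL_linear k_def)
  next
    case False
    then show ?thesis using that c(2) d(2) by (simp add: BL_linear p_def r_def)
  qed
  ultimately show ?case unfolding eq[symmetric] by blast
qed

text \<open>Pairing with the component of \<open>W_\<tau>\<close> orthogonal to the other vectors
  isolates the coefficient \<open>a \<tau>\<close>; the pairing of this component with
  \<open>W_\<tau>\<close> is nonzero because it is so at \<open>t = 0\<close>.\<close>

lemma BL_nondegenerate:
  assumes "finite J" "\<And>\<sigma>. \<sigma> \<in> J \<Longrightarrow> is_partition \<sigma>"
    and "\<And>\<sigma>. \<sigma> \<in> J \<Longrightarrow> BL (\<Sum>\<rho>\<in>J. smul (a \<rho>) (semb (W \<rho>))) (semb (W \<sigma>)) = 0"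
  shows "(\<Sum>\<rho>\<in>J. smul (a \<rho>) (semb (W \<rho>))) = 0"
  using assms
proof (induction J rule: finite_induct)
  case empty
  show ?case by simp
next
  case (insert \<tau> J)
  let ?w = "\<lambda>\<rho>. semb (W \<rho>)"
  have part: "is_partition \<tau>" "\<And>\<sigma>. \<sigma> \<in> J \<Longrightarrow> is_partition \<sigma>" using insert.prems(1) by auto
  have "hall (scale w0 (W \<tau>)) (W \<sigma>) = 0" if "\<sigma> \<in> J" for \<sigma>
    using W_orth[OF part(1) part(2)[OF that]] that insert.hyps by auto
  then obtain d where d: "\<forall>\<sigma>\<in>J. rdx (d \<sigma>) 0" "\<forall>\<sigma>\<in>J. BL (?w \<tau> + (\<Sum>\<rho>\<in>J. smul (d \<rho>) (?w \<rho>))) (?w \<sigma>) = 0"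
    using orthogonalize[OF insert.hyps(1) part(2) red_semb[of "W \<tau>"]] by blast
  define r where "r = ?w \<tau> + (\<Sum>\<rho>\<in>J. smul (d \<rho>) (?w \<rho>))"
  define D where "D = (\<Sum>\<rho>\<in>J. smul (a \<rho>) (?w \<rho>))"
  have D: "(\<Sum>\<rho>\<in>insert \<tau> J. smul (a \<rho>) (?w \<rho>)) = smul (a \<tau>) (?w \<tau>) + D"
    using insert.hyps by (simp add: D_def)
  have "red (\<Sum>\<rho>\<in>J. smul (d \<rho>) (?w \<rho>)) (\<Sum>\<rho>\<in>J. smul 0 (W \<rho>))"
    using d by (intro red_sum red_smul red_semb) auto
  from red_add[OF red_semb[of "W \<tau>"] this] have "red r (W \<tau>)" by (simp add: r_def)
  from rdx_nonzero[OF rdx_BL[OF this red_semb[of "W \<tau>"]]] have rnz: "BL r (?w \<tau>) \<noteq> 0"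
    using W_orth[OF part(1) part(1)] by simp
  have "BL (smul (a \<tau>) (?w \<tau>) + D) r = 0"
    unfolding r_def BL_linear(2,4,6) D[symmetric] using insert.prems(2) by simp
  moreover have "BL D r = 0"
    unfolding D_def BL_linear(5,3)
  proof (rule sum.neutral, rule ballI)
    fix \<sigma> assume "\<sigma> \<in> J"
    then have "BL r (?w \<sigma>) = 0" using d(2) by (simp add: r_def)
    then show "a \<sigma> * BL (?w \<sigma>) r = 0" by (simp add: BL_commute[of "?w \<sigma>" r])
  qed
  ultimately have "a \<tau> = 0" using rnz by (simp add: BL_linear BL_commute[of _ r])
  then have eq: "(\<Sum>\<rho>\<in>insert \<tau> J. smul (a \<rho>) (?w \<rho>)) = D" using D by simp
  have "D = 0"
    unfolding D_def by (rule insert.IH[OF part(2)]) (use insert.prems(2) eq D_def in auto)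
  then show ?case using eq by simp
qed

lemma finite_strictly_below: "finite (strictly_below \<mu>)"
  by (rule finite_subset[OF _ finite_partitions_of[of "sum_list \<mu>"]])
    (auto simp: strictly_below_def dominated_def partitions_of_iff)

lemma lower_mono_span:
  assumes "is_partition \<mu>" "lower \<mu> F"
  shows "F - smul (hall F (prod_list (map hsym \<mu>))) (mono_symf \<mu>) \<in> symf.span (mono_symf ` strictly_below \<mu>)"
proof -
  let ?n = "sum_list \<mu>"
  let ?c = "\<lambda>\<sigma>. hall F (prod_list (map hsym \<sigma>))"
  have "F = (\<Sum>\<sigma>\<in>partitions_of ?n. smul (?c \<sigma>) (mono_symf \<sigma>))"
    by (rule expand_mono) (use assms in \<open>simp add: lower_def\<close>)
  also have "\<dots> = smul (?c \<mu>) (mono_symf \<mu>) + (\<Sum>\<sigma>\<in>partitions_of ?n - {\<mu>}. smul (?c \<sigma>) (mono_symf \<sigma>))"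
    by (rule sum.remove[OF finite_partitions_of]) (use assms in \<open>simp add: partitions_of_iff\<close>)
  finally have "F - smul (?c \<mu>) (mono_symf \<mu>) = (\<Sum>\<sigma>\<in>partitions_of ?n - {\<mu>}. smul (?c \<sigma>) (mono_symf \<sigma>))"
    by (simp only: diff_eq_eq add.commute)
  also have "\<dots> \<in> symf.span (mono_symf ` strictly_below \<mu>)"
  proof (rule symf.span_sum)
    fix \<sigma> assume \<sigma>: "\<sigma> \<in> partitions_of ?n - {\<mu>}"
    show "smul (?c \<sigma>) (mono_symf \<sigma>) \<in> symf.span (mono_symf ` strictly_below \<mu>)"
    proof (cases "?c \<sigma> = 0")
      case False
      then have "\<sigma> \<in> strictly_below \<mu>" using \<sigma> assms by (auto simp: lower_def strictly_below_def partitions_of_iff)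
      then show ?thesis by (intro symf.span_scale symf.span_base imageI)
    qed (simp add: symf.span_zero)
  qed
  finally show ?thesis .
qed

lemma lower_add: "lower \<mu> F \<Longrightarrow> lower \<mu> G \<Longrightarrow> lower \<mu> (F + G)"
proof -
  assume F: "lower \<mu> F" and G: "lower \<mu> G"
  have "hall F (prod_list (map hsym \<sigma>)) \<noteq> 0 \<or> hall G (prod_list (map hsym \<sigma>)) \<noteq> 0"
    if "hall (F + G) (prod_list (map hsym \<sigma>)) \<noteq> 0" for \<sigma>
    using that by (auto simp: hall_add_left)
  then show ?thesis using F G unfolding lower_def by (blast intro: homog_add)
qed

lemma lower_sum: "(\<And>i. i \<in> A \<Longrightarrow> lower \<mu> (F i)) \<Longrightarrow> lower \<mu> (\<Sum>i\<in>A. F i)"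
proof (induction A rule: infinite_finite_induct)
  case (insert a A)
  then show ?case by (simp add: lower_add)
qed (simp_all add: lower_def)

lemma lower_trans: "lower \<sigma> F \<Longrightarrow> dominated \<sigma> \<mu> \<Longrightarrow> lower \<mu> F"
  unfolding lower_def using dominated_trans by (metis dominated_def)

lemma W_semb_lower:
  assumes "is_partition \<mu>"
  shows "lower \<mu> (semb (W \<mu>))" "hall (semb (W \<mu>)) (prod_list (map hsym \<mu>)) = 1"
proof -
  show "lower \<mu> (semb (W \<mu>))" by (rule lower_semb[OF W_lower(1)[OF assms]])
  have "hall (semb (W \<mu>)) (semb (prod_list (map hsym \<mu>))) = 1"
    unfolding hall_semb W_lower(2)[OF assms] by (rule comm_ring_homD(2)[OF emb_hom])
  then show "hall (semb (W \<mu>)) (prod_list (map hsym \<mu>)) = 1" by (simp add: semb_hl)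
qed

lemma strictly_belowD:
  assumes "\<sigma> \<in> strictly_below \<mu>"
  shows "is_partition \<sigma>" "dominated \<sigma> \<mu>" "\<sigma> \<noteq> \<mu>" "sum_list \<sigma> = sum_list \<mu>"
  using assms by (auto simp: strictly_below_def dominated_def)

text \<open>Together with \<open>W_in_span_mono\<close> this lets orthogonality to the lower
  monomial functions be tested on the lower \<open>W\<close>.\<close>

lemma mono_in_span_W:
  assumes "\<sigma> \<in> strictly_below \<mu>"
  shows "mono_symf \<sigma> \<in> symf.span ((\<lambda>\<rho>. semb (W \<rho>)) ` strictly_below \<mu>)"
proof -
  have "mono_symf \<sigma> \<in> symf.span ((\<lambda>\<rho>. semb (W \<rho>)) ` {\<kappa>. dominated \<kappa> \<sigma>})"
    by (rule mono_in_span_lower[of "sum_list \<sigma>"])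
      (use strictly_belowD[OF assms] in \<open>auto simp: partitions_of_iff W_semb_lower\<close>)
  also have "\<dots> \<subseteq> symf.span ((\<lambda>\<rho>. semb (W \<rho>)) ` strictly_below \<mu>)"
  proof (rule symf.span_mono, rule image_mono, rule subsetI)
    fix \<kappa> assume "\<kappa> \<in> {\<kappa>. dominated \<kappa> \<sigma>}"
    then show "\<kappa> \<in> strictly_below \<mu>"
      using strictly_belowD[OF assms] dominated_trans dominated_antisym unfolding strictly_below_def by blast
  qed
  finally show ?thesis .
qed

lemma W_in_span_mono:
  assumes "\<sigma> \<in> strictly_below \<mu>"
  shows "semb (W \<sigma>) \<in> symf.span (mono_symf ` strictly_below \<mu>)"
proof -
  have "semb (W \<sigma>) - mono_symf \<sigma> \<in> symf.span (mono_symf ` strictly_below \<sigma>)"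
    using lower_mono_span[OF strictly_belowD(1)[OF assms] W_semb_lower(1)[OF strictly_belowD(1)[OF assms]]]
    by (simp add: W_semb_lower(2)[OF strictly_belowD(1)[OF assms]])
  moreover have "strictly_below \<sigma> \<subseteq> strictly_below \<mu>"
    using strictly_belowD[OF assms] dominated_trans dominated_antisym unfolding strictly_below_def by blast
  ultimately have "semb (W \<sigma>) - mono_symf \<sigma> \<in> symf.span (mono_symf ` strictly_below \<mu>)"
    using symf.span_mono[OF image_mono] by blast
  from symf.span_add[OF this symf.span_base[OF imageI[OF assms]]] show ?thesis by simp
qed

lemma BL_span_zero:
  assumes "G \<in> symf.span S" "\<And>x. x \<in> S \<Longrightarrow> BL F x = 0"
  shows "BL F G = 0"
  using assms(1)
proof (rule symf.span_induct)
  show "symf.subspace {G. BL F G = 0}"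
    by (auto simp: symf.subspace_def BL_linear) (simp add: BL_def)
qed (rule assms(2))

text \<open>Existence comes from orthogonalizing \<open>W_\<mu>\<close> against the lower
  \<open>W\<close>. For uniqueness, the difference of two candidates lies in the span of the lower
  functions and is orthogonal to it, hence is 0 by \<open>BL_nondegenerate\<close>.\<close>

lemma macdonald_P_expansion:
  assumes \<mu>: "is_partition \<mu>"
  shows "\<exists>c. (\<forall>\<sigma>\<in>strictly_below \<mu>. rdx (c \<sigma>) 0) \<and>
      macdonald_P q2 (inverse t2) \<mu> = semb (W \<mu>) + (\<Sum>\<sigma>\<in>strictly_below \<mu>. smul (c \<sigma>) (semb (W \<sigma>)))"
    "lower \<mu> (macdonald_P q2 (inverse t2) \<mu>)"
    "hall (macdonald_P q2 (inverse t2) \<mu>) (prod_list (map hsym \<mu>)) = 1"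
proof -
  let ?J = "strictly_below \<mu>"
  let ?n = "sum_list \<mu>"
  have orth: "hall (scale w0 (W \<mu>)) (W \<sigma>) = 0" if "\<sigma> \<in> ?J" for \<sigma>
    using W_orth[OF \<mu> strictly_belowD(1)[OF that]] strictly_belowD(3)[OF that] by auto
  have "\<exists>c. (\<forall>\<sigma>\<in>?J. rdx (c \<sigma>) 0) \<and>
    (\<forall>\<sigma>\<in>?J. BL (semb (W \<mu>) + (\<Sum>\<rho>\<in>?J. smul (c \<rho>) (semb (W \<rho>)))) (semb (W \<sigma>)) = 0)"
    by (rule orthogonalize[OF finite_strictly_below _ red_semb]) (auto simp: strictly_belowD(1) orth)
  then obtain c where c: "\<forall>\<sigma>\<in>?J. rdx (c \<sigma>) 0"
    "\<forall>\<sigma>\<in>?J. BL (semb (W \<mu>) + (\<Sum>\<rho>\<in>?J. smul (c \<rho>) (semb (W \<rho>)))) (semb (W \<sigma>)) = 0"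
    by blast
  define P where "P = semb (W \<mu>) + (\<Sum>\<rho>\<in>?J. smul (c \<rho>) (semb (W \<rho>)))"
  have PW: "BL P (semb (W \<sigma>)) = 0" if "\<sigma> \<in> ?J" for \<sigma>
    using c(2) that by (simp add: P_def)
  have low: "lower \<mu> P"
    unfolding P_def
    by (intro lower_add lower_sum lower_smul W_semb_lower(1)[OF \<mu>])
      (use strictly_belowD W_semb_lower(1) lower_trans in blast)
  have "hall (semb (W \<sigma>)) (prod_list (map hsym \<mu>)) = 0" if "\<sigma> \<in> ?J" for \<sigma>
    using W_semb_lower(1)[OF strictly_belowD(1)[OF that]] \<mu> strictly_belowD[OF that] dominated_antisym
    unfolding lower_def by blast
  then have one: "hall P (prod_list (map hsym \<mu>)) = 1"
    by (simp add: P_def hall_add_left hall_sum_left hall_smul_left W_semb_lower(2)[OF \<mu>])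
  have Ph: "homog ?n P" using low by (simp add: lower_def)
  have Pspan: "P - mono_symf \<mu> \<in> symf.span (mono_symf ` ?J)"
    using lower_mono_span[OF \<mu> low] by (simp add: one)
  have "macdonald_P q2 (inverse t2) \<mu> = P"
    unfolding macdonald_P_def
  proof (rule the_equality, intro conjI ballI)
    show "P - mono_symf \<mu> \<in> symf.span (mono_symf ` ?J)" by (rule Pspan)
    fix \<sigma> assume "\<sigma> \<in> ?J"
    then have "BL P (mono_symf \<sigma>) = 0"
      using BL_span_zero[OF mono_in_span_W] PW by blast
    then show "qt_form q2 (inverse t2) P (mono_symf \<sigma>) = 0" by (simp add: qt_form_eq[OF Ph])
  next
    fix F assume F: "F - mono_symf \<mu> \<in> symf.span (mono_symf ` ?J) \<and>
      (\<forall>\<sigma>\<in>?J. qt_form q2 (inverse t2) F (mono_symf \<sigma>) = 0)"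
    have "homog ?n (F - mono_symf \<mu>)"
      using conjunct1[OF F]
    proof (rule symf.span_induct)
      show "symf.subspace {G :: Qqt symf. homog ?n G}" by (rule subspace_homog)
      fix x :: "Qqt symf" assume "x \<in> mono_symf ` ?J"
      then obtain \<sigma> where "\<sigma> \<in> ?J" "x = mono_symf \<sigma>" by blast
      then show "homog ?n x" using mono_symf_dual(1)[OF strictly_belowD(1)] strictly_belowD(4) by metis
    qed
    from homog_add[OF this mono_symf_dual(1)[OF \<mu>]] have Fh: "homog ?n F" by simp
    have FB: "BL F x = 0" if "x \<in> mono_symf ` ?J" for x
      using that conjunct2[OF F] by (auto simp: qt_form_eq[OF Fh] q2_nonzero t2_nonzero)
    have "F - P = (F - mono_symf \<mu>) - (P - mono_symf \<mu>)" by simp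
    also have "\<dots> \<in> symf.span (mono_symf ` ?J)"
      using conjunct1[OF F] Pspan by (rule symf.span_diff)
    also have "\<dots> \<subseteq> symf.span ((\<lambda>\<rho>. semb (W \<rho>)) ` ?J)"
      by (rule symf.span_minimal) (use mono_in_span_W in auto)
    finally obtain a where a: "F - P = (\<Sum>\<rho>\<in>?J. smul (a \<rho>) (semb (W \<rho>)))"
      using in_span_image_finite[OF finite_strictly_below] by blast
    have "BL (F - P) (semb (W \<sigma>)) = 0" if "\<sigma> \<in> ?J" for \<sigma>
      unfolding BL_linear using PW[OF that] BL_span_zero[OF W_in_span_mono[OF that] FB] by simp
    then have "F - P = 0"
      unfolding a by (intro BL_nondegenerate[OF finite_strictly_below strictly_belowD(1)])
    then show "F = P" by simp
  qed
  then show "\<exists>c. (\<forall>\<sigma>\<in>strictly_below \<mu>. rdx (c \<sigma>) 0) \<and>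
      macdonald_P q2 (inverse t2) \<mu> = semb (W \<mu>) + (\<Sum>\<sigma>\<in>strictly_below \<mu>. smul (c \<sigma>) (semb (W \<sigma>)))"
    "lower \<mu> (macdonald_P q2 (inverse t2) \<mu>)"
    "hall (macdonald_P q2 (inverse t2) \<mu>) (prod_list (map hsym \<mu>)) = 1"
    using c(1) low one P_def by auto
qed

abbreviation PL :: "nat list \<Rightarrow> Qqt symf" where
  "PL \<equiv> macdonald_P q2 (inverse t2)"

lemma red_PL:
  assumes "is_partition \<mu>"
  shows "red (PL \<mu>) (W \<mu>)"
proof -
  obtain c where c: "\<forall>\<sigma>\<in>strictly_below \<mu>. rdx (c \<sigma>) 0"
    "PL \<mu> = semb (W \<mu>) + (\<Sum>\<sigma>\<in>strictly_below \<mu>. smul (c \<sigma>) (semb (W \<sigma>)))"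
    using macdonald_P_expansion(1)[OF assms] by blast
  have "red (\<Sum>\<sigma>\<in>strictly_below \<mu>. smul (c \<sigma>) (semb (W \<sigma>))) (\<Sum>\<sigma>\<in>strictly_below \<mu>. smul 0 (W \<sigma>))"
    using c by (intro red_sum red_smul red_semb) auto
  from red_add[OF red_semb[of "W \<mu>"] this] show ?thesis by (simp add: c(2))
qed

text \<open>The matrix expressing \<open>P\<close> through \<open>W\<close> is unitriangular and the
  identity at \<open>t = 0\<close>. Solving it recursively along \<open>dom_rank\<close> shows that
  the inverse is also regular with the identity as its value.\<close>

lemma W_in_PL:
  assumes "\<mu> \<in> partitions_of n"
  shows "\<exists>u. (\<forall>\<sigma>\<in>partitions_of n. rdx (u \<sigma>) (if \<sigma> = \<mu> then 1 else 0)) \<and>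
    semb (W \<mu>) = (\<Sum>\<sigma>\<in>partitions_of n. smul (u \<sigma>) (PL \<sigma>))"
  using assms
proof (induction "dom_rank \<mu>" arbitrary: \<mu> rule: less_induct)
  case less
  let ?J = "strictly_below \<mu>"
  have \<mu>: "is_partition \<mu>" "sum_list \<mu> = n" using less.prems by (auto simp: partitions_of_iff)
  obtain c where c: "\<forall>\<sigma>\<in>?J. rdx (c \<sigma>) 0"
    "PL \<mu> = semb (W \<mu>) + (\<Sum>\<sigma>\<in>?J. smul (c \<sigma>) (semb (W \<sigma>)))"
    using macdonald_P_expansion(1)[OF \<mu>(1)] by blast
  have "\<forall>\<sigma>\<in>?J. \<exists>u. (\<forall>\<tau>\<in>partitions_of n. rdx (u \<tau>) (if \<tau> = \<sigma> then 1 else 0)) \<and>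
    semb (W \<sigma>) = (\<Sum>\<tau>\<in>partitions_of n. smul (u \<tau>) (PL \<tau>))"
  proof
    fix \<sigma> assume \<sigma>: "\<sigma> \<in> ?J"
    show "\<exists>u. (\<forall>\<tau>\<in>partitions_of n. rdx (u \<tau>) (if \<tau> = \<sigma> then 1 else 0)) \<and>
      semb (W \<sigma>) = (\<Sum>\<tau>\<in>partitions_of n. smul (u \<tau>) (PL \<tau>))"
      by (rule less.hyps) (use strictly_belowD[OF \<sigma>] dom_rank_less \<mu> in \<open>auto simp: partitions_of_iff\<close>)
  qed
  then obtain u where u: "\<And>\<sigma> \<tau>. \<sigma> \<in> ?J \<Longrightarrow> \<tau> \<in> partitions_of n \<Longrightarrow> rdx (u \<sigma> \<tau>) (if \<tau> = \<sigma> then 1 else 0)"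
    "\<And>\<sigma>. \<sigma> \<in> ?J \<Longrightarrow> semb (W \<sigma>) = (\<Sum>\<tau>\<in>partitions_of n. smul (u \<sigma> \<tau>) (PL \<tau>))"
    by (auto dest!: bchoice)
  define v where "v \<tau> = (if \<tau> = \<mu> then 1 else 0) - (\<Sum>\<sigma>\<in>?J. c \<sigma> * u \<sigma> \<tau>)" for \<tau>
  have "rdx (v \<tau>) (if \<tau> = \<mu> then 1 else 0)" if "\<tau> \<in> partitions_of n" for \<tau>
  proof -
    have "rdx (\<Sum>\<sigma>\<in>?J. c \<sigma> * u \<sigma> \<tau>) (\<Sum>\<sigma>\<in>?J. 0 * (if \<tau> = \<sigma> then 1 else 0))"
      using c(1) u(1) that by (intro rdx_sum rdx_mult) auto
    then have "rdx (\<Sum>\<sigma>\<in>?J. c \<sigma> * u \<sigma> \<tau>) 0" by simp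
    moreover have "rdx (if \<tau> = \<mu> then 1 else 0) (if \<tau> = \<mu> then 1 else 0)" by (simp add: rdx_0 rdx_1)
    ultimately show ?thesis unfolding v_def using rdx_diff by fastforce
  qed
  moreover have "semb (W \<mu>) = (\<Sum>\<tau>\<in>partitions_of n. smul (v \<tau>) (PL \<tau>))"
  proof -
    have "(\<Sum>\<tau>\<in>partitions_of n. smul (\<Sum>\<sigma>\<in>?J. c \<sigma> * u \<sigma> \<tau>) (PL \<tau>)) =
      (\<Sum>\<tau>\<in>partitions_of n. \<Sum>\<sigma>\<in>?J. smul (c \<sigma>) (smul (u \<sigma> \<tau>) (PL \<tau>)))"
      by (simp only: symf.scale_sum_left smul_smul)
    also have "\<dots> = (\<Sum>\<sigma>\<in>?J. \<Sum>\<tau>\<in>partitions_of n. smul (c \<sigma>) (smul (u \<sigma> \<tau>) (PL \<tau>)))"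
      by (rule sum.swap)
    also have "\<dots> = (\<Sum>\<sigma>\<in>?J. smul (c \<sigma>) (semb (W \<sigma>)))"
      by (rule sum.cong) (simp_all only: symf.scale_sum_right[symmetric] u(2))
    finally have 1: "(\<Sum>\<tau>\<in>partitions_of n. smul (\<Sum>\<sigma>\<in>?J. c \<sigma> * u \<sigma> \<tau>) (PL \<tau>)) = (\<Sum>\<sigma>\<in>?J. smul (c \<sigma>) (semb (W \<sigma>)))" .
    have "(\<Sum>\<tau>\<in>partitions_of n. smul (if \<tau> = \<mu> then 1 else 0) (PL \<tau>)) = smul (if \<mu> = \<mu> then 1 else 0) (PL \<mu>)"
      by (rule sum_single_term[OF finite_partitions_of less.prems]) simp
    then have "(\<Sum>\<tau>\<in>partitions_of n. smul (v \<tau>) (PL \<tau>)) = PL \<mu> - (\<Sum>\<sigma>\<in>?J. smul (c \<sigma>) (semb (W \<sigma>)))"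
      by (simp add: v_def symf.scale_left_diff_distrib sum_subtractf 1)
    then show ?thesis by (simp add: c(2))
  qed
  ultimately show ?case by blast
qed

section \<open>Eigenvalues of the delta operators and the expansion of e_n\<close>

section \<open>The delta operators\<close>

text \<open>\<open>X / (1 - 1/t)\<close> equals \<open>t\<close> times \<open>-X / (1 - t)\<close>,
  and the factor \<open>t\<close> acts in degree \<open>n\<close> as the scalar \<open>t^n\<close>.
  What is left is regular at \<open>t = 0\<close>.\<close>

definition cU :: "nat \<Rightarrow> Qqt" where "cU k = - 1 / (1 - t2 ^ k)"

definition cU' :: "nat \<Rightarrow> Qqt" where "cU' k = - (1 - t2 ^ k)"

definition UL :: "nat list \<Rightarrow> Qqt symf" where
  "UL \<mu> = scale cU (PL \<mu>)"

lemma scale_cU_inverse: "scale cU' (scale cU F) = F" "scale cU (scale cU' F) = F"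
  using one_minus_t2_nonzero by (auto intro!: scale_inverse simp: cU_def cU'_def divide_simps)

lemma finite_cells: "finite (cells \<mu>)"
proof -
  have "cells \<mu> = Sigma {..<length \<mu>} (\<lambda>i. {..<\<mu> ! i})" by (auto simp: cells_def)
  then show ?thesis by simp
qed

lemma modified_macdonald_eq:
  assumes "is_partition \<mu>"
  shows "\<exists>\<kappa>. \<kappa> \<noteq> 0 \<and> modified_macdonald q2 t2 \<mu> = smul \<kappa> (UL \<mu>)"
proof -
  let ?n = "sum_list \<mu>"
  define J where "J = (\<Prod>c\<in>cells \<mu>. 1 - q2 ^ arm \<mu> c * inverse t2 ^ Suc (leg \<mu> c))"
  \<comment> \<open>Vanishing would mean \<open>q^a = t^(l+1)\<close>, which fails at
    \<open>t = 0\<close>.\<close>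
  have "1 - q2 ^ a * inverse t2 ^ Suc l \<noteq> 0" for a l
  proof
    assume "1 - q2 ^ a * inverse t2 ^ Suc l = 0"
    then have "q2 ^ a = t2 ^ Suc l" using t2_nonzero by (simp add: power_inverse field_simps del: power_Suc)
    then have "rdx (q2 ^ a) (0 ^ Suc l)" using rdx_power[OF rdx_t2, of "Suc l"] by simp
    from rdx_unique[OF rdx_power[OF rdx_q2, of a] this] show False using q1_nonzero by simp
  qed
  then have J: "J \<noteq> 0" by (simp add: J_def prod_zero_iff[OF finite_cells] del: power_Suc)
  have h: "homog ?n (UL \<mu>)"
    unfolding UL_def using macdonald_P_expansion(2)[OF assms] by (intro homog_scale) (simp add: lower_def)
  have "scale (\<lambda>k. 1 / (1 - inverse t2 ^ k)) (PL \<mu>) = scale (\<lambda>k. t2 ^ k) (UL \<mu>)"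
    unfolding UL_def scale_scale
  proof (rule scale_cong)
    fix k :: nat assume k: "k > 0"
    have nz: "1 - t2 ^ k \<noteq> 0" "t2 ^ k \<noteq> 0" using one_minus_t2_nonzero[OF k] t2_nonzero by simp_all
    then have "1 - inverse t2 ^ k \<noteq> 0" by (simp add: power_inverse field_simps)
    then show "1 / (1 - inverse t2 ^ k) = t2 ^ k * cU k"
      using nz by (simp add: cU_def power_inverse field_simps)
  qed
  also have "\<dots> = smul (t2 ^ ?n) (UL \<mu>)" by (rule scale_power[OF h])
  finally have "modified_macdonald q2 t2 \<mu> = smul (t2 ^ n_stat \<mu> * J * t2 ^ ?n) (UL \<mu>)"
    by (simp add: modified_macdonald_def macdonald_J_def J_def[symmetric] scale_def[symmetric] scale_smul smul_smul mult.assoc del: power_Suc)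
  moreover have "t2 ^ n_stat \<mu> * J * t2 ^ ?n \<noteq> 0" using J t2_nonzero by simp
  ultimately show ?thesis by blast
qed

lemma PL_support:
  assumes "is_partition \<mu>" "is_partition \<sigma>" "hall (PL \<sigma>) (prod_list (map hsym \<mu>)) \<noteq> 0"
  shows "dominated \<mu> \<sigma>"
  using macdonald_P_expansion(2)[OF assms(2)] assms by (simp add: lower_def)

lemma UL_inj:
  assumes "is_partition \<mu>" "is_partition \<sigma>" "UL \<mu> = UL \<sigma>"
  shows "\<mu> = \<sigma>"
proof -
  have "PL \<mu> = PL \<sigma>"
    using arg_cong[OF assms(3), of "scale cU'"] by (simp only: UL_def scale_cU_inverse)
  then show ?thesis
    using PL_support[OF assms(1,2)] PL_support[OF assms(2,1)] macdonald_P_expansion(3)[OF assms(1)]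
      macdonald_P_expansion(3)[OF assms(2)] dominated_antisym by simp
qed

text \<open>Among the partitions with nonzero coefficient one of maximal \<open>dom_rank\<close> is
  chosen. Pairing with its \<open>h_\<mu>\<close> sees no other term, since the partition of such a
  term would dominate it.\<close>

lemma UL_independent: "symf.independent (UL ` {\<mu>. is_partition \<mu>})"
  unfolding symf.dependent_explicit
proof (rule notI, elim exE conjE bexE)
  fix T u x assume T: "finite T" "T \<subseteq> UL ` {\<mu>. is_partition \<mu>}" and eq: "(\<Sum>v\<in>T. smul (u v) v) = 0"
    and x: "x \<in> T" "u x \<noteq> 0"
  define I where "I = {\<mu>. is_partition \<mu> \<and> UL \<mu> \<in> T}"
  have injI: "inj_on UL I" using UL_inj by (auto simp: I_def intro!: inj_onI)
  have TI: "T = UL ` I" using T(2) by (auto simp: I_def)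
  then have finI: "finite I" using T(1) injI finite_imageD by blast
  define I' where "I' = {\<mu> \<in> I. u (UL \<mu>) \<noteq> 0}"
  have I': "finite I'" "I' \<noteq> {}" using finI x TI by (auto simp: I'_def)
  have "Max (dom_rank ` I') \<in> dom_rank ` I'" using I' by (intro Max_in) auto
  then obtain \<mu> where "\<mu> \<in> I'" and max: "dom_rank \<mu> = Max (dom_rank ` I')" by force
  have \<mu>: "\<mu> \<in> I'" "\<And>\<sigma>. \<sigma> \<in> I' \<Longrightarrow> dom_rank \<sigma> \<le> dom_rank \<mu>"
    using \<open>\<mu> \<in> I'\<close> I'(1) by (auto simp: max)
  have p: "is_partition \<mu>" using \<mu>(1) by (simp add: I'_def I_def)
  have "(\<Sum>\<sigma>\<in>I. smul (u (UL \<sigma>)) (UL \<sigma>)) = 0"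
    using eq unfolding TI sum.reindex[OF injI] by (simp add: comp_def)
  from arg_cong[OF this, of "scale cU'"] have "(\<Sum>\<sigma>\<in>I. smul (u (UL \<sigma>)) (PL \<sigma>)) = 0"
    by (simp add: scale_simps scale_smul scale_cU_inverse UL_def)
  from arg_cong[OF this, of "\<lambda>F. hall F (prod_list (map hsym \<mu>))"]
  have "(\<Sum>\<sigma>\<in>I. u (UL \<sigma>) * hall (PL \<sigma>) (prod_list (map hsym \<mu>))) = 0"
    by (simp add: hall_sum_left hall_smul_left)
  moreover have "(\<Sum>\<sigma>\<in>I. u (UL \<sigma>) * hall (PL \<sigma>) (prod_list (map hsym \<mu>))) =
    u (UL \<mu>) * hall (PL \<mu>) (prod_list (map hsym \<mu>))"
  proof (rule sum_single_term[OF finI])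
    show "\<mu> \<in> I" using \<mu>(1) by (simp add: I'_def)
    fix \<sigma> assume \<sigma>: "\<sigma> \<in> I" "\<sigma> \<noteq> \<mu>"
    show "u (UL \<sigma>) * hall (PL \<sigma>) (prod_list (map hsym \<mu>)) = 0"
    proof (rule ccontr)
      assume nz: "\<not> ?thesis"
      then have "dominated \<mu> \<sigma>" using PL_support[OF p, of \<sigma>] \<sigma> by (auto simp: I_def)
      moreover have "\<sigma> \<in> I'" using nz \<sigma> by (auto simp: I'_def)
      ultimately show False using dom_rank_less[of \<mu> \<sigma>] \<sigma>(2) \<mu>(2)[of \<sigma>] by auto
    qed
  qed
  ultimately show False
    using \<mu>(1) macdonald_P_expansion(3)[OF p] by (simp add: I'_def)
qed

lemma UL_span: "symf.span (UL ` {\<mu>. is_partition \<mu>}) = UNIV"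
proof (rule span_UNIV_if_homog)
  fix n and G :: "Qqt symf" assume "homog n G"
  then have "scale cU' G \<in> symf.span (PL ` partitions_of n)"
    by (intro homog_in_span_lower homog_scale)
      (auto simp: partitions_of_iff macdonald_P_expansion(2,3))
  then obtain c where "scale cU' G = (\<Sum>\<mu>\<in>partitions_of n. smul (c \<mu>) (PL \<mu>))"
    using in_span_image_finite[OF finite_partitions_of] by blast
  from arg_cong[OF this, of "scale cU"] have "G = (\<Sum>\<mu>\<in>partitions_of n. smul (c \<mu>) (UL \<mu>))"
    by (simp add: scale_cU_inverse scale_simps scale_smul UL_def)
  moreover have "\<dots> \<in> symf.span (UL ` {\<mu>. is_partition \<mu>})"
    by (intro symf.span_sum symf.span_scale symf.span_base) (auto simp: partitions_of_iff)
  ultimately show "G \<in> symf.span (UL ` {\<mu>. is_partition \<mu>})" by simp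
qed

text \<open>Eigenvectors may be rescaled, so the specification can be read with \<open>UL\<close> in
  place of the modified Macdonald polynomials; as this family is a basis, the operator exists and is
  unique.\<close>

lemma Delta'_eigen:
  fixes F :: "Qqt symf"
  defines "e \<equiv> \<lambda>\<mu>. pleth (\<lambda>c. c) (\<lambda>k. B_psum \<mu> k - 1) F"
  shows "Vector_Spaces.linear smul smul (Delta' F)"
    "is_partition \<mu> \<Longrightarrow> Delta' F (UL \<mu>) = smul (e \<mu>) (UL \<mu>)"
proof -
  let ?spec = "\<lambda>D. Vector_Spaces.linear smul smul D \<and> (\<forall>\<mu>. is_partition \<mu> \<longrightarrow>
    D (modified_macdonald q2 t2 \<mu>) = smul (e \<mu>) (modified_macdonald q2 t2 \<mu>))"
  let ?spec' = "\<lambda>D. Vector_Spaces.linear smul smul D \<and> (\<forall>\<mu>. is_partition \<mu> \<longrightarrow> D (UL \<mu>) = smul (e \<mu>) (UL \<mu>))"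
  have spec: "?spec D \<longleftrightarrow> ?spec' D" for D
  proof (rule conj_cong[OF refl])
    assume lin: "Vector_Spaces.linear smul smul D"
    interpret D: Vector_Spaces.linear smul smul D by (rule lin)
    have "D (modified_macdonald q2 t2 \<mu>) = smul (e \<mu>) (modified_macdonald q2 t2 \<mu>) \<longleftrightarrow> D (UL \<mu>) = smul (e \<mu>) (UL \<mu>)"
      if \<mu>: "is_partition \<mu>" for \<mu>
    proof -
      obtain \<kappa> where \<kappa>: "\<kappa> \<noteq> 0" "modified_macdonald q2 t2 \<mu> = smul \<kappa> (UL \<mu>)"
        using modified_macdonald_eq[OF \<mu>] by blast
      have "smul (e \<mu>) (smul \<kappa> (UL \<mu>)) = smul \<kappa> (smul (e \<mu>) (UL \<mu>))" by (simp only: smul_smul mult.commute)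
      then show ?thesis unfolding \<kappa>(2) D.scale using \<kappa>(1) by (simp only: symf.scale_cancel_left) simp
    qed
    then show "(\<forall>\<mu>. is_partition \<mu> \<longrightarrow> D (modified_macdonald q2 t2 \<mu>) = smul (e \<mu>) (modified_macdonald q2 t2 \<mu>)) \<longleftrightarrow>
      (\<forall>\<mu>. is_partition \<mu> \<longrightarrow> D (UL \<mu>) = smul (e \<mu>) (UL \<mu>))" by blast
  qed
  obtain D where D: "Vector_Spaces.linear smul smul D"
    "\<forall>x\<in>UL ` {\<mu>. is_partition \<mu>}. D x = smul (e (inv_into {\<mu>. is_partition \<mu>} UL x)) x"
    using symf_pair.linear_independent_extend[OF UL_independent,
        of "\<lambda>x. smul (e (inv_into {\<mu>. is_partition \<mu>} UL x)) x"] by blast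
  have "inj_on UL {\<mu>. is_partition \<mu>}" using UL_inj by (auto intro!: inj_onI)
  then have D': "?spec' D" using D by (simp add: inv_into_f_f)
  have uniq: "E = D" if E: "?spec' E" for E
  proof
    fix G
    have G: "G \<in> symf.span (UL ` {\<mu>. is_partition \<mu>})" by (simp add: UL_span)
    show "E G = D G"
    proof (rule symf_pair.linear_eq_on_span[OF _ _ _ G])
      show "Vector_Spaces.linear smul smul E" "Vector_Spaces.linear smul smul D" using E D' by blast+
      fix x assume "x \<in> UL ` {\<mu>. is_partition \<mu>}"
      then obtain \<sigma> where \<sigma>: "is_partition \<sigma>" "x = UL \<sigma>" by blast
      then show "E x = D x" using E D' by simp
    qed
  qed
  have "Delta' F = (THE D. ?spec D)" by (simp only: Delta'_def e_def)
  also have "\<dots> = D"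
    unfolding spec using D' uniq by (rule the_equality)
  finally show "Vector_Spaces.linear smul smul (Delta' F)"
    "is_partition \<mu> \<Longrightarrow> Delta' F (UL \<mu>) = smul (e \<mu>) (UL \<mu>)"
    using D' by simp_all
qed

text \<open>Triangularity makes the family a basis; orthogonality for a scaled Hall form then gives
  the coefficients as quotients. Applied over \<open>Qq\<close> and over \<open>Qqt\<close>.\<close>

lemma orthogonal_expansion:
  fixes F :: "nat list \<Rightarrow> 'k::field_char_0 symf"
  assumes low: "\<And>\<mu>. \<mu> \<in> partitions_of n \<Longrightarrow> lower \<mu> (F \<mu>)"
    and diag: "\<And>\<mu>. \<mu> \<in> partitions_of n \<Longrightarrow> hall (F \<mu>) (prod_list (map hsym \<mu>)) \<noteq> 0"
    and orth: "\<And>\<mu> \<sigma>. \<mu> \<in> partitions_of n \<Longrightarrow> \<sigma> \<in> partitions_of n \<Longrightarrow>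
      hall (scale c (F \<mu>)) (F \<sigma>) = 0 \<longleftrightarrow> \<mu> \<noteq> \<sigma>"
    and G: "homog n G"
  shows "G = (\<Sum>\<mu>\<in>partitions_of n. smul (hall (scale c G) (F \<mu>) / hall (scale c (F \<mu>)) (F \<mu>)) (F \<mu>))"
proof -
  obtain d where d: "G = (\<Sum>\<mu>\<in>partitions_of n. smul (d \<mu>) (F \<mu>))"
    using in_span_image_finite[OF finite_partitions_of homog_in_span_lower[OF low diag G]] by blast
  have "hall (scale c G) (F \<sigma>) / hall (scale c (F \<sigma>)) (F \<sigma>) = d \<sigma>" if \<sigma>: "\<sigma> \<in> partitions_of n" for \<sigma>
  proof -
    have "hall (scale c G) (F \<sigma>) = (\<Sum>\<mu>\<in>partitions_of n. d \<mu> * hall (scale c (F \<mu>)) (F \<sigma>))"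
      by (simp add: d scale_simps scale_smul hall_sum_left hall_smul_left)
    also have "\<dots> = d \<sigma> * hall (scale c (F \<sigma>)) (F \<sigma>)"
      by (rule sum_single_term[OF finite_partitions_of \<sigma>]) (simp add: orth[OF _ \<sigma>])
    finally show ?thesis using orth[OF \<sigma> \<sigma>] by simp
  qed
  then show ?thesis by (subst d) (simp cong: sum.cong)
qed

lemma rdx_pleth:
  assumes "\<And>k. k > 0 \<Longrightarrow> rdx (a k) (b k)"
  shows "rdx (pleth (\<lambda>c. c) a (semb F)) (pleth (\<lambda>c. c) b F)"
proof -
  have "pleth (\<lambda>c. c) a (semb F) = pleth emb a F"
    unfolding semb_def pleth_compose[OF comm_ring_hom_pleth[OF comm_ring_hom_id] comm_ring_hom_const_emb]
    by (rule pleth_cong) (simp_all add: comm_ring_hom_id pleth_psum)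
  then show ?thesis
    unfolding pleth_def using assms by (auto intro!: rdx_sum rdx_mult rdx_emb rdx_prod_mset)
qed

text \<open>At \<open>t = 0\<close> the cells above the bottom row contribute 0; for
  \<open>k = 0\<close> they would contribute 1 each.\<close>

lemma rdx_B_psum:
  assumes k: "k > 0"
  shows "rdx (B_psum \<mu> k) (\<Sum>j<part \<mu> 0. (q1 ^ j) ^ k)"
proof -
  have "rdx (B_psum \<mu> k) (\<Sum>(i, j)\<in>cells \<mu>. (q1 ^ j * 0 ^ i) ^ k)"
    unfolding B_psum_def case_prod_unfold by (intro rdx_sum rdx_power rdx_mult rdx_q2 rdx_t2)
  also have "(\<Sum>(i, j)\<in>cells \<mu>. (q1 ^ j * 0 ^ i) ^ k) = (\<Sum>p\<in>(\<lambda>j. (0 :: nat, j)) ` {..<part \<mu> 0}. (q1 ^ snd p) ^ k)"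
    by (rule sum.mono_neutral_cong_right[OF finite_cells])
      (use k in \<open>auto simp: cells_def part_def zero_power power_0_left image_iff split: if_splits\<close>)
  also have "\<dots> = (\<Sum>j<part \<mu> 0. (q1 ^ j) ^ k)"
    by (subst sum.reindex) (auto simp: inj_on_def)
  finally show ?thesis .
qed

text \<open>Removing the term \<open>j = 0\<close> leaves \<open>q\<close> times the bracket of
  length \<open>m - 1\<close>, and homogeneity turns the factor \<open>q\<close> into
  \<open>q^d\<close>.\<close>

lemma eigenvalue_at_t0:
  assumes F: "homog d F" and m: "m > 0"
  shows "pleth (\<lambda>c. c) (\<lambda>k. (\<Sum>j<m. (q1 ^ j) ^ k) - 1) F = q1 ^ d * at_q_bracket (m - 1) F"
proof -
  let ?a = "\<lambda>k. (1 - (q1 ^ k) ^ (m - 1)) / (1 - q1 ^ k)"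
  have "pleth (\<lambda>c. c) (\<lambda>k. (\<Sum>j<m. (q1 ^ j) ^ k) - 1) F = pleth (\<lambda>c. c) (\<lambda>k. q1 ^ k * ?a k) F"
  proof (rule pleth_cong)
    fix k :: nat assume k: "k > 0"
    obtain r where r: "m = Suc r" using m by (cases m) auto
    have "(\<Sum>j<m. (q1 ^ j) ^ k) - 1 = (\<Sum>j<r. (q1 ^ Suc j) ^ k)"
      unfolding r sum.lessThan_Suc_shift by simp
    also have "\<dots> = q1 ^ k * (\<Sum>j<r. (q1 ^ k) ^ j)"
      by (simp add: sum_distrib_left power_mult_distrib mult.commute flip: power_mult)
    also have "(\<Sum>j<r. (q1 ^ k) ^ j) = ?a k"
      using one_diff_power_eq[of "q1 ^ k" r] q1_power_neq_1[OF k] by (simp add: r)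
    finally show "(\<Sum>j<m. (q1 ^ j) ^ k) - 1 = q1 ^ k * ?a k" .
  qed simp
  also have "\<dots> = pleth (\<lambda>c. c) ?a (scale (\<lambda>k. q1 ^ k) F)"
    by (simp add: pleth_scale comm_ring_hom_id)
  also have "\<dots> = q1 ^ d * at_q_bracket (m - 1) F"
    by (simp add: scale_power[OF F] pleth_smul comm_ring_hom_id at_q_bracket_def)
  finally show ?thesis .
qed

text \<open>The coefficient of \<open>W_\<mu>\<close> in \<open>e_n[-X]\<close>; see
  \<open>elem_W\<close>.\<close>

definition elem_coeff :: "nat \<Rightarrow> nat list \<Rightarrow> Qq" where
  "elem_coeff n \<mu> = hall (scale w0 (scale (\<lambda>_. - 1) (elem_symf n))) (W \<mu>) / hall (scale w0 (W \<mu>)) (W \<mu>)"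

lemma homog_elem: "homog n (elem_symf n)"
  by (simp add: elem_symf_eq homog_scale homog_hsym)

lemma elem_W: "scale (\<lambda>_. - 1) (elem_symf n) = (\<Sum>\<mu>\<in>partitions_of n. smul (elem_coeff n \<mu>) (W \<mu>))"
  unfolding elem_coeff_def
  by (rule orthogonal_expansion)
    (auto simp: partitions_of_iff W_lower W_orth intro: homog_scale homog_elem)

lemma rdx_cU: "k > 0 \<Longrightarrow> rdx (cU k) (- 1)" and rdx_cU': "k > 0 \<Longrightarrow> rdx (cU' k) (- 1)"
  using rdx_divide[OF rdx_uminus[OF rdx_1] rdx_one_minus_t2, of k] rdx_uminus[OF rdx_one_minus_t2, of k]
  by (simp_all add: cU_def cU'_def)

text \<open>The coefficients themselves have to be controlled at \<open>t = 0\<close>, not just the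
  functions. The transformed \<open>e_n\<close> is expanded in the \<open>semb (W \<mu>)\<close>,
  orthogonal for the constant weight \<open>w0\<close>, and rewritten in the \<open>PL\<close> by
  the matrix of \<open>W_in_PL\<close>.\<close>

lemma elem_UL:
  "\<exists>c. (\<forall>\<mu>\<in>partitions_of n. rdx (c \<mu>) (elem_coeff n \<mu>)) \<and>
    elem_symf n = (\<Sum>\<mu>\<in>partitions_of n. smul (c \<mu>) (UL \<mu>))"
proof -
  let ?w = "\<lambda>\<mu>. semb (W \<mu>)"
  let ?we = "\<lambda>k. emb (w0 k)"
  define v where "v = scale cU' (elem_symf n)"
  define b where "b \<mu> = hall (scale ?we v) (?w \<mu>) / hall (scale ?we (?w \<mu>)) (?w \<mu>)" for \<mu>
  have orth: "hall (scale ?we (?w \<mu>)) (?w \<sigma>) = emb (hall (scale w0 (W \<mu>)) (W \<sigma>))" for \<mu> \<sigma>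
    by (simp only: semb_scale[symmetric] hall_semb)
  have emb0: "emb x = 0 \<longleftrightarrow> x = 0" for x
    using rdx_unique[OF rdx_emb[of x]] rdx_0 by (auto simp: comm_ring_homD[OF emb_hom])
  have v: "v = (\<Sum>\<mu>\<in>partitions_of n. smul (b \<mu>) (?w \<mu>))"
    unfolding b_def
    by (rule orthogonal_expansion)
      (auto simp: partitions_of_iff W_semb_lower orth emb0 W_orth v_def intro: homog_scale homog_elem)
  have red_v: "red v (scale (\<lambda>_. - 1) (elem_symf n))"
    unfolding v_def semb_elem[symmetric, of n] by (intro red_scale rdx_cU' red_semb)
  have rb: "rdx (b \<mu>) (elem_coeff n \<mu>)" if "\<mu> \<in> partitions_of n" for \<mu>
    unfolding b_def elem_coeff_def
  proof (rule rdx_divide)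
    show "rdx (hall (scale ?we v) (?w \<mu>)) (hall (scale w0 (scale (\<lambda>_. - 1) (elem_symf n))) (W \<mu>))"
      by (intro rdx_hall red_scale rdx_emb red_v red_semb)
    show "rdx (hall (scale ?we (?w \<mu>)) (?w \<mu>)) (hall (scale w0 (W \<mu>)) (W \<mu>))"
      by (intro rdx_hall red_scale rdx_emb red_semb)
    show "hall (scale w0 (W \<mu>)) (W \<mu>) \<noteq> 0" using that W_orth by (simp add: partitions_of_iff)
  qed
  have "\<forall>\<mu>\<in>partitions_of n. \<exists>u. (\<forall>\<sigma>\<in>partitions_of n. rdx (u \<sigma>) (if \<sigma> = \<mu> then 1 else 0)) \<and>
    ?w \<mu> = (\<Sum>\<sigma>\<in>partitions_of n. smul (u \<sigma>) (PL \<sigma>))"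
    using W_in_PL by blast
  then obtain u where u: "\<And>\<mu> \<sigma>. \<mu> \<in> partitions_of n \<Longrightarrow> \<sigma> \<in> partitions_of n \<Longrightarrow> rdx (u \<mu> \<sigma>) (if \<sigma> = \<mu> then 1 else 0)"
    "\<And>\<mu>. \<mu> \<in> partitions_of n \<Longrightarrow> ?w \<mu> = (\<Sum>\<sigma>\<in>partitions_of n. smul (u \<mu> \<sigma>) (PL \<sigma>))"
    by (auto dest!: bchoice)
  define c where "c \<sigma> = (\<Sum>\<mu>\<in>partitions_of n. b \<mu> * u \<mu> \<sigma>)" for \<sigma>
  have rc: "rdx (c \<sigma>) (elem_coeff n \<sigma>)" if \<sigma>: "\<sigma> \<in> partitions_of n" for \<sigma>
  proof -
    have "rdx (c \<sigma>) (\<Sum>\<mu>\<in>partitions_of n. elem_coeff n \<mu> * (if \<sigma> = \<mu> then 1 else 0))"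
      unfolding c_def by (intro rdx_sum rdx_mult rb u(1) \<sigma>)
    also have "(\<Sum>\<mu>\<in>partitions_of n. elem_coeff n \<mu> * (if \<sigma> = \<mu> then 1 else 0)) =
      elem_coeff n \<sigma> * (if \<sigma> = \<sigma> then 1 else 0)"
      by (rule sum_single_term[OF finite_partitions_of \<sigma>]) simp
    finally show ?thesis by simp
  qed
  have "v = (\<Sum>\<mu>\<in>partitions_of n. smul (b \<mu>) (\<Sum>\<sigma>\<in>partitions_of n. smul (u \<mu> \<sigma>) (PL \<sigma>)))"
    unfolding v by (rule sum.cong) (simp_all only: u(2))
  also have "\<dots> = (\<Sum>\<mu>\<in>partitions_of n. \<Sum>\<sigma>\<in>partitions_of n. smul (b \<mu> * u \<mu> \<sigma>) (PL \<sigma>))"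
    by (simp only: symf.scale_sum_right smul_smul)
  also have "\<dots> = (\<Sum>\<sigma>\<in>partitions_of n. \<Sum>\<mu>\<in>partitions_of n. smul (b \<mu> * u \<mu> \<sigma>) (PL \<sigma>))"
    by (rule sum.swap)
  also have "\<dots> = (\<Sum>\<sigma>\<in>partitions_of n. smul (c \<sigma>) (PL \<sigma>))"
    by (simp only: c_def symf.scale_sum_left)
  finally have "scale cU v = scale cU (\<Sum>\<sigma>\<in>partitions_of n. smul (c \<sigma>) (PL \<sigma>))" by simp
  then have "elem_symf n = (\<Sum>\<sigma>\<in>partitions_of n. smul (c \<sigma>) (UL \<sigma>))"
    by (simp only: v_def scale_cU_inverse UL_def scale_simps scale_smul)
  then show ?thesis using rc by blast
qed

text \<open>In the eigenvector expansion of \<open>e_n\<close> the coefficient, the eigenvalue and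
  the eigenvector are each regular at \<open>t = 0\<close>, so they specialize separately.\<close>

lemma Delta'_elem_at_t0:
  assumes "\<And>\<mu>. \<mu> \<in> partitions_of n \<Longrightarrow> rdx (pleth (\<lambda>c. c) (\<lambda>k. B_psum \<mu> k - 1) F) (e \<mu>)"
  shows "symf_at_t0 (Delta' F (elem_symf n)) =
    (\<Sum>\<mu>\<in>partitions_of n. smul (elem_coeff n \<mu> * e \<mu>) (scale (\<lambda>_. - 1) (W \<mu>)))"
proof (rule symf_at_t0_eq)
  obtain c where c: "\<And>\<mu>. \<mu> \<in> partitions_of n \<Longrightarrow> rdx (c \<mu>) (elem_coeff n \<mu>)"
    "elem_symf n = (\<Sum>\<mu>\<in>partitions_of n. smul (c \<mu>) (UL \<mu>))"
    using elem_UL by blast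
  interpret D: Vector_Spaces.linear smul smul "Delta' F" by (rule Delta'_eigen(1))
  let ?e = "\<lambda>\<mu>. pleth (\<lambda>c. c) (\<lambda>k. B_psum \<mu> k - 1) F"
  have "Delta' F (elem_symf n) = (\<Sum>\<mu>\<in>partitions_of n. smul (c \<mu>) (Delta' F (UL \<mu>)))"
    unfolding c(2) D.sum D.scale ..
  also have "\<dots> = (\<Sum>\<mu>\<in>partitions_of n. smul (c \<mu> * ?e \<mu>) (UL \<mu>))"
    by (rule sum.cong) (simp_all add: Delta'_eigen(2) partitions_of_iff smul_smul)
  finally show "red (Delta' F (elem_symf n))
    (\<Sum>\<mu>\<in>partitions_of n. smul (elem_coeff n \<mu> * e \<mu>) (scale (\<lambda>_. - 1) (W \<mu>)))"
    using c(1) assms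
    by (auto simp: UL_def partitions_of_iff intro!: red_sum red_smul rdx_mult red_scale rdx_cU red_PL)
qed

text \<open>The factor between the transform of \<open>W\<close> at the conjugate partition and
  \<open>P_\<tau>[X; 1/q]\<close>; see \<open>scale_W\<close>.\<close>

definition conj_W_coeff :: "nat \<Rightarrow> nat list \<Rightarrow> Qq" where
  "conj_W_coeff n \<tau> = q1 ^ n * hl_b tq \<tau> / W_coeff (conj_partition \<tau>)"

lemma scale_W:
  assumes \<tau>: "\<tau> \<in> partitions_of n"
  shows "scale (\<lambda>k. 1 - q1 ^ k) (scale sgnc (scale (\<lambda>_. - 1) (W (conj_partition \<tau>)))) =
    smul (conj_W_coeff n \<tau>) (HL tq \<tau>)"
proof -
  have p: "is_partition \<tau>" using \<tau> by (simp add: partitions_of_iff)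
  have "scale (\<lambda>k. 1 - q1 ^ k) (scale sgnc (scale (\<lambda>_. - 1) (scale sgnc (Qp tq \<tau>)))) =
    scale (\<lambda>k. q1 ^ k) (Qhl tq \<tau>)"
    unfolding Qhl_def scale_scale
  proof (rule scale_cong)
    fix k :: nat
    \<comment> \<open>The two \<open>sgnc\<close> cancel, and
      \<open>-(1 - q^k) = q^k (1 - q^-k)\<close>: the sign of \<open>-X\<close> trades
      \<open>1 - q\<close> for \<open>1 - 1/q\<close>, as in \<open>Qhl tq\<close>.\<close>
    have "(1 - q1 ^ k) * (sgnc k * (- 1 * sgnc k)) = - (1 - q1 ^ k) * (sgnc k * sgnc k)"
      by (simp only: mult_ac mult_minus_left mult_minus_right mult_1_left)
    also have "\<dots> = q1 ^ k * (1 - tq ^ k)"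
      using q1_nonzero by (simp add: power_inverse field_simps)
    finally show "(1 - q1 ^ k) * (sgnc k * (- 1 * sgnc k)) = q1 ^ k * (1 - tq ^ k)" .
  qed
  also have "\<dots> = smul (q1 ^ n) (Qhl tq \<tau>)"
    by (rule scale_power) (use homog_Qp[of \<tau> tq] \<tau> in \<open>simp add: Qhl_def homog_scale partitions_of_iff\<close>)
  also have "\<dots> = smul (q1 ^ n * hl_b tq \<tau>) (HL tq \<tau>)"
    using hl_b_nonzero[OF nonroot_tq, of \<tau>] by (simp add: HL_def smul_smul)
  finally show ?thesis
    by (simp add: W_def scale_smul smul_smul conj_conj[OF p] conj_W_coeff_def)
qed

lemma sum_conj: "(\<Sum>\<mu>\<in>partitions_of n. f \<mu>) = (\<Sum>\<tau>\<in>partitions_of n. f (conj_partition \<tau>))"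
  by (rule sum.reindex_bij_witness[of _ conj_partition conj_partition])
    (auto simp: conj_partitions_of conj_conj partitions_of_iff is_partition_conj sum_list_conj)

text \<open>Neither factor is computed alone. The transform takes the expansion of
  \<open>e_n[-X]\<close> to one of \<open>h_n[X (1 - q)]\<close> in the \<open>HL tq \<tau>\<close>;
  \<open>complete_HL_expansion\<close> gives another, and pairing with \<open>Q'_\<sigma>\<close>
  compares coefficients.\<close>

lemma elem_coeff_eq:
  assumes \<sigma>: "\<sigma> \<in> partitions_of n"
  shows "elem_coeff n (conj_partition \<sigma>) * conj_W_coeff n \<sigma> = inverse (q1 ^ n_stat \<sigma>) * q_pochhammer (length \<sigma>)"
proof -
  let ?\<Theta> = "\<lambda>F. scale (\<lambda>k. 1 - q1 ^ k) (scale sgnc (scale (\<lambda>_. - 1 :: Qq) F))"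
  let ?x = "\<lambda>\<tau>. elem_coeff n (conj_partition \<tau>) * conj_W_coeff n \<tau>"
  let ?y = "\<lambda>\<tau>. inverse (q1 ^ n_stat \<tau>) * q_pochhammer (length \<tau>)"
  have pair: "hall (\<Sum>\<tau>\<in>partitions_of n. smul (z \<tau>) (HL tq \<tau>)) (Qp tq \<sigma>) = z \<sigma>" for z
  proof -
    have "hall (\<Sum>\<tau>\<in>partitions_of n. smul (z \<tau>) (HL tq \<tau>)) (Qp tq \<sigma>) = z \<sigma> * hall (HL tq \<sigma>) (Qp tq \<sigma>)"
      unfolding hall_sum_left hall_smul_left
      by (rule sum_single_term[OF finite_partitions_of \<sigma>])
        (use \<sigma> in \<open>simp add: HL_Qp_dual[OF nonroot_tq] partitions_of_iff\<close>)
    then show ?thesis using \<sigma> by (simp add: HL_Qp_dual[OF nonroot_tq] partitions_of_iff)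
  qed
  have "?\<Theta> (\<Sum>\<mu>\<in>partitions_of n. smul (elem_coeff n \<mu>) (W \<mu>)) =
    (\<Sum>\<tau>\<in>partitions_of n. smul (elem_coeff n (conj_partition \<tau>)) (?\<Theta> (W (conj_partition \<tau>))))"
    by (subst sum_conj) (simp only: scale_simps scale_smul)
  also have "\<dots> = (\<Sum>\<tau>\<in>partitions_of n. smul (?x \<tau>) (HL tq \<tau>))"
    by (rule sum.cong) (simp_all only: scale_W smul_smul)
  finally have 1: "?\<Theta> (scale (\<lambda>_. - 1) (elem_symf n)) = (\<Sum>\<tau>\<in>partitions_of n. smul (?x \<tau>) (HL tq \<tau>))"
    unfolding elem_W .
  have "?\<Theta> (scale (\<lambda>_. - 1) (elem_symf n)) = scale (\<lambda>k. 1 - q1 ^ k) (hsym n)"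
    unfolding elem_symf_eq scale_scale by (rule scale_cong) simp
  also have "\<dots> = (\<Sum>\<tau>\<in>partitions_of n. smul (?y \<tau>) (HL tq \<tau>))"
    using complete_HL_expansion[OF nonroot_tq tq_nonzero, of n]
    by (simp add: q_pochhammer_def power_inverse)
  finally have "(\<Sum>\<tau>\<in>partitions_of n. smul (?x \<tau>) (HL tq \<tau>)) = (\<Sum>\<tau>\<in>partitions_of n. smul (?y \<tau>) (HL tq \<tau>))"
    unfolding 1 .
  from arg_cong[OF this, of "\<lambda>F. hall F (Qp tq \<sigma>)"] show ?thesis unfolding pair .
qed

theorem theorem4p1:
  fixes \<nu> :: "nat list" and n :: nat
  assumes "is_partition \<nu>" and "0 < n"
  shows "X_times_1_minus_q (omega (symf_at_t0 (Delta' (schur \<nu>) (elem_symf n)))) =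
    smul (q1 ^ sum_list \<nu>)
      (\<Sum>\<mu>\<in>partitions_of n.
        smul (at_q_bracket (length \<mu> - 1) (schur \<nu>) * inverse (q1 ^ n_stat \<mu>) * q_pochhammer (length \<mu>))
          (hall_littlewood (inverse q1) \<mu>))"
proof -
  define e where "e \<mu> = pleth (\<lambda>c. c) (\<lambda>k. (\<Sum>j<part \<mu> 0. (q1 ^ j) ^ k) - 1) (schur \<nu> :: Qq symf)" for \<mu>
  have homog: "homog (sum_list \<nu>) (schur \<nu> :: Qq symf)"
    by (simp add: schur_eq assms(1) homog_Qp)
  have e: "e (conj_partition \<tau>) = q1 ^ sum_list \<nu> * at_q_bracket (length \<tau> - 1) (schur \<nu>)"
    if \<tau>: "\<tau> \<in> partitions_of n" for \<tau>
  proof -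
    \<comment> \<open>The bottom row of the conjugate has as many cells as \<open>\<tau>\<close> has
      parts.\<close>
    have "part (conj_partition \<tau>) 0 = length (filter (\<lambda>k. 0 < k) \<tau>)"
      using \<tau> by (simp add: part_conj partitions_of_iff)
    also have "filter (\<lambda>k. 0 < k) \<tau> = \<tau>" using \<tau> by (simp add: partitions_of_iff is_partition_def)
    finally have "part (conj_partition \<tau>) 0 = length \<tau>" .
    \<comment> \<open>As \<open>n > 0\<close> there is at least one part, so the subtraction in
      \<open>length \<tau> - 1\<close> is not truncated.\<close>
    moreover have "length \<tau> > 0" using \<tau> assms(2) by (auto simp: partitions_of_iff)
    ultimately show ?thesis unfolding e_def by (simp add: eigenvalue_at_t0[OF homog])
  qed
  have "rdx (pleth (\<lambda>c. c) (\<lambda>k. B_psum \<mu> k - 1) (schur \<nu>)) (e \<mu>)" for \<mu>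
    unfolding e_def semb_schur[symmetric] by (intro rdx_pleth rdx_diff rdx_B_psum rdx_1)
  then have "symf_at_t0 (Delta' (schur \<nu>) (elem_symf n)) =
    (\<Sum>\<mu>\<in>partitions_of n. smul (elem_coeff n \<mu> * e \<mu>) (scale (\<lambda>_. - 1) (W \<mu>)))"
    by (rule Delta'_elem_at_t0)
  then have "X_times_1_minus_q (omega (symf_at_t0 (Delta' (schur \<nu>) (elem_symf n)))) =
    scale (\<lambda>k. 1 - q1 ^ k) (scale sgnc
      (\<Sum>\<mu>\<in>partitions_of n. smul (elem_coeff n \<mu> * e \<mu>) (scale (\<lambda>_. - 1) (W \<mu>))))"
    by (simp only: omega_eq X_times_1_minus_q_def scale_def)
  also have "\<dots> = (\<Sum>\<tau>\<in>partitions_of n. smul (elem_coeff n (conj_partition \<tau>) * e (conj_partition \<tau>))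
      (scale (\<lambda>k. 1 - q1 ^ k) (scale sgnc (scale (\<lambda>_. - 1) (W (conj_partition \<tau>))))))"
    by (subst sum_conj) (simp only: scale_simps scale_smul)
  also have "\<dots> = (\<Sum>\<tau>\<in>partitions_of n. smul (q1 ^ sum_list \<nu>)
      (smul (at_q_bracket (length \<tau> - 1) (schur \<nu>) * inverse (q1 ^ n_stat \<tau>) * q_pochhammer (length \<tau>))
        (hall_littlewood (inverse q1) \<tau>)))"
  proof (rule sum.cong)
    fix \<tau> assume \<tau>: "\<tau> \<in> partitions_of n"
    let ?c = "elem_coeff n (conj_partition \<tau>)"
    have HL: "hall_littlewood (inverse q1) \<tau> = HL tq \<tau>"
      by (rule hall_littlewood_eq[OF nonroot_tq]) (use \<tau> in \<open>simp add: partitions_of_iff\<close>)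
    have "?c * e (conj_partition \<tau>) * conj_W_coeff n \<tau> = e (conj_partition \<tau>) * (?c * conj_W_coeff n \<tau>)"
      by (simp only: mult_ac)
    also have "\<dots> = q1 ^ sum_list \<nu> * (at_q_bracket (length \<tau> - 1) (schur \<nu>) *
        inverse (q1 ^ n_stat \<tau>) * q_pochhammer (length \<tau>))"
      unfolding elem_coeff_eq[OF \<tau>] e[OF \<tau>] by (simp only: mult_ac)
    finally show "smul (?c * e (conj_partition \<tau>))
        (scale (\<lambda>k. 1 - q1 ^ k) (scale sgnc (scale (\<lambda>_. - 1) (W (conj_partition \<tau>))))) =
      smul (q1 ^ sum_list \<nu>)
        (smul (at_q_bracket (length \<tau> - 1) (schur \<nu>) * inverse (q1 ^ n_stat \<tau>) * q_pochhammer (length \<tau>))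
          (hall_littlewood (inverse q1) \<tau>))"
      unfolding scale_W[OF \<tau>] HL smul_smul by (simp only:)
  qed simp
  also have "\<dots> = smul (q1 ^ sum_list \<nu>)
      (\<Sum>\<mu>\<in>partitions_of n.
        smul (at_q_bracket (length \<mu> - 1) (schur \<nu>) * inverse (q1 ^ n_stat \<mu>) * q_pochhammer (length \<mu>))
          (hall_littlewood (inverse q1) \<mu>))"
    by (simp only: symf.scale_sum_right)
  finally show ?thesis .
qed

end
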